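(* Let $r \ge 2$ be an integer and let $\varepsilon > 0$. Then there exist a constant $\gamma > 0$ and a function $\omega$ with $\omega(n) \to \infty$ as $n \to \infty$ such that the following holds for all sufficiently small $\delta > 0$. For every $n$, if $m \ge (1+\varepsilon)m_r$, then \[ |\mathcal{F}_{n,m}^*(K_{r+1}; \delta, \gamma, \Pi)| \le \frac{1}{\omega(n)} \binom{e(\Pi)}{m} \quad \text{for every } \Pi \in \mathcal{P}_{n,r}(\gamma). \]
   Context: All graphs have vertex set $[n]=\{1,\dots,n\}$. $\mathcal{F}_{n,m}(K_{r+1})$ is the family of all $K_{r+1}$-free graphs on $[n]$ with exactly $m$ edges. For $\gamma>0$, $\mathcal{P}_{n,r}(\gamma)$ is the family of partitions $\Pi=\{V_1,\dots,V_r\}$ of $[n]$ into $r$ parts with $(\frac1r-\gamma)n \le |V_i| \le (\frac1r+\gamma)n$ for all $i$; a partition $\Pi$ is identified with the complete $r$-partite graph on $[n]$ with parts $V_1,\dots,V_r$, and $e(\Pi)$ is its number of edges. For a graph $G$ and a partition $\Pi=\{V_1,\dots,V_r\}$ of $[n]$ consider the conditions (A) $\sum_{i=1}^r e_G(V_i) \le \delta m$, where $e_G(V_i)$ is the number of edges of $G$ inside $V_i$; (B) $\deg_G(v,V_i) \le \min_{j \ne i} \deg_G(v,V_j)$ for all $i\in[r]$ and all $v \in V_i$, where $\deg_G(v,A)$ is the number of neighbours of $v$ in $A$. $\mathcal{F}_{n,m}(K_{r+1};\delta,\gamma)$ is the set of $G \in \mathcal{F}_{n,m}(K_{r+1})$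 such that (A) holds for some partition $\Pi \in \mathcal{P}_{n,r}(\gamma)$ and for no $r$-part partition $\Pi \notin \mathcal{P}_{n,r}(\gamma)$. For $\Pi \in \mathcal{P}_{n,r}(\gamma)$, $\mathcal{F}^*_{n,m}(K_{r+1};\delta,\gamma,\Pi)$ is the set of $G \in \mathcal{F}_{n,m}(K_{r+1};\delta,\gamma)$ such that $(G,\Pi)$ satisfy (A) and (B) and $\sum_{i=1}^r e_G(V_i) > 0$. Finally, \[ m_r = \theta_r n^{2-\frac{2}{r+2}} (\log n)^{\frac{1}{\binom{r+1}{2}-1}}, \quad \theta_r = \frac{r-1}{2r}\left[ r\left(\frac{2r+2}{r+2}\right)^{\frac{1}{r-1}}\right]^{\frac{2}{r+2}}, \] with $\log$ the natural logarithm. *)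

theory Defs
  imports Complex_Main
begin

definition graphs_on :: "nat \<Rightarrow> nat set set set" where
  "graphs_on n = {G. \<forall>e\<in>G. e \<subseteq> {1..n} \<and> card e = 2}"

definition clique_free :: "nat \<Rightarrow> nat \<Rightarrow> nat set set \<Rightarrow> bool" where
  "clique_free n k G \<longleftrightarrow>
     \<not> (\<exists>S. S \<subseteq> {1..n} \<and> card S = k \<and>
            (\<forall>u\<in>S. \<forall>v\<in>S. u \<noteq> v \<longrightarrow> {u, v} \<in> G))"

definition Kfree_graphs :: "nat \<Rightarrow> nat \<Rightarrow> nat \<Rightarrow> nat set set set" where
  "Kfree_graphs n m r = {G \<in> graphs_on n. card G = m \<and> clique_free n (r + 1) G}"

definition r_partitions :: "nat \<Rightarrow> nat \<Rightarrow> nat set set set" where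
  "r_partitions n r = {P. card P = r \<and> (\<forall>V\<in>P. V \<noteq> {}) \<and> \<Union>P = {1..n} \<and>
      (\<forall>V\<in>P. \<forall>W\<in>P. V \<noteq> W \<longrightarrow> V \<inter> W = {})}"

definition balanced_partitions :: "nat \<Rightarrow> nat \<Rightarrow> real \<Rightarrow> nat set set set" where
  "balanced_partitions n r \<gamma> = {P \<in> r_partitions n r.
      \<forall>V\<in>P. (1 / real r - \<gamma>) * real n \<le> real (card V) \<and>
             real (card V) \<le> (1 / real r + \<gamma>) * real n}"

definition partition_graph :: "nat set set \<Rightarrow> nat set set" where
  "partition_graph P = {e. e \<subseteq> \<Union>P \<and> card e = 2 \<and> (\<forall>V\<in>P. \<not> e \<subseteq> V)}"

definition e_part :: "nat set set \<Rightarrow> nat" where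
  "e_part P = card (partition_graph P)"

definition e_inside :: "nat set set \<Rightarrow> nat set \<Rightarrow> nat" where
  "e_inside G A = card {e\<in>G. e \<subseteq> A}"

definition deg_in :: "nat set set \<Rightarrow> nat \<Rightarrow> nat set \<Rightarrow> nat" where
  "deg_in G v A = card {u\<in>A. {v, u} \<in> G}"

definition condA :: "real \<Rightarrow> nat \<Rightarrow> nat set set \<Rightarrow> nat set set \<Rightarrow> bool" where
  "condA \<delta> m G P \<longleftrightarrow> real (\<Sum>V\<in>P. e_inside G V) \<le> \<delta> * real m"

definition condB :: "nat set set \<Rightarrow> nat set set \<Rightarrow> bool" where
  "condB G P \<longleftrightarrow> (\<forall>V\<in>P. \<forall>v\<in>V. \<forall>W\<in>P. W \<noteq> V \<longrightarrow> deg_in G v V \<le> deg_in G v W)"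

definition F_delta_gamma :: "nat \<Rightarrow> nat \<Rightarrow> nat \<Rightarrow> real \<Rightarrow> real \<Rightarrow> nat set set set" where
  "F_delta_gamma n m r \<delta> \<gamma> = {G \<in> Kfree_graphs n m r.
      (\<exists>P\<in>balanced_partitions n r \<gamma>. condA \<delta> m G P) \<and>
      (\<forall>P\<in>r_partitions n r. P \<notin> balanced_partitions n r \<gamma> \<longrightarrow> \<not> condA \<delta> m G P)}"

definition F_star :: "nat \<Rightarrow> nat \<Rightarrow> nat \<Rightarrow> real \<Rightarrow> real \<Rightarrow> nat set set \<Rightarrow> nat set set set" where
  "F_star n m r \<delta> \<gamma> P = {G \<in> F_delta_gamma n m r \<delta> \<gamma>.
      condA \<delta> m G P \<and> condB G P \<and> (\<Sum>V\<in>P. e_inside G V) > 0}"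

definition theta :: "nat \<Rightarrow> real" where
  "theta r = (real r - 1) / (2 * real r) *
     (real r * ((2 * real r + 2) / (real r + 2)) powr (1 / (real r - 1))) powr (2 / (real r + 2))"

definition m_r :: "nat \<Rightarrow> nat \<Rightarrow> real" where
  "m_r r n = theta r * real n powr (2 - 2 / (real r + 2)) *
     ln (real n) powr (1 / (real ((r + 1) choose 2) - 1))"

end

theory Submission
  imports Defs "HOL-Library.FuncSet" "HOL-Library.Disjoint_Sets" "HOL-Real_Asymp.Real_Asymp"
begin

text \<open>
  Every graph \<open>G\<close> in question splits into its nonempty set \<open>T\<close> of edges inside the parts and its
  crossing edges, and by the absence of a clique no set of crossing pairs completing an edge of \<open>T\<close>
  to a clique lies in \<open>G\<close>. A uniform set of crossing pairs satisfies such a decreasing event no more often, up to a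
  constant factor, than a binomial set of slightly smaller density \<open>p\<close>, so Janson's inequality bounds
  the number of crossing parts for a given \<open>T\<close>. This must beat the number of choices of \<open>T\<close>, weighted
  by the loss of about \<open>p\<close> per inner edge in the choice of the crossing edges.

  Peel \<open>T\<close> into stars in order of decreasing degree. Let \<open>M\<close> be about the expected number of cliques
  completing one inner edge. For an edge in a star of degree \<open>b \<le> d\<close>, where \<open>d\<close> is about \<open>\<beta> p n\<close>, the
  Janson family is thinned to an expected \<open>min M (sqrt (p n / b))\<close> cliques: then the
  correlations are negligible, yet the star still costs \<open>exp (- b min M (sqrt (p n / b)))\<close>. The choice
  of \<open>m_r\<close> makes \<open>n^2 p exp (- M)\<close> a negative power of \<open>n\<close>, so these stars contribute little.

  At a vertex of higher degree, condition (B) provides a box of \<open>d\<close> neighbours in every part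
  spanning no transversal clique. For several such vertices a family of transversals is chosen
  greedily so that no set of \<open>j\<close> vertices is in too many of them; this fails only for the
  few boxes in which the saturated sets are dense, so Janson's inequality gives a factor
  \<open>exp (- K p n)\<close> per vertex for any prescribed constant \<open>K\<close>.

  When \<open>m\<close> is very close to the number of all crossing pairs, each inner edge instead
  forces linearly many missing crossing pairs, and a direct count suffices.
\<close>

section \<open>Random subsets and Janson's inequality\<close>

text \<open>The constant in \<open>m_r\<close> comes from one equation. In a balanced partition an
  inner edge is completed to a clique by (n/r)^(r-1) p^k expected sets, k = binom(r+1,2) - 1, and
  near the threshold n^2 p is n^(2 - 2/(r+2)) up to logarithms; equating the first quantity with (2
  - 2/(r+2)) log n and solving for p gives \<theta>_r. The square root is forced from two sides.
  Janson's inequality tolerates only a small multiple of p n expected cliques at a vertex, and b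
  edges with sqrt (p n / b) each contribute just sqrt (p n b); yet the entropy of a star, about log
  (p n / b) per edge, is still smaller than sqrt (p n / b) when p n / b is large. The events for low
  and high stars are decreasing and share crossing pairs, so their probabilities cannot be
  multiplied. The minimum of the two bounds is replaced by a weighted geometric mean: weight 1 -
  \<epsilon>1 for the low stars, whose constant is tight, and \<epsilon>1 for the high ones, whose K
  is as large as desired. The dense range is separate because the price m / (e(\<Pi>) - m) of an
  inner edge is unbounded there.\<close>

definition rweight :: "'a set \<Rightarrow> ('a \<Rightarrow> real) \<Rightarrow> 'a set \<Rightarrow> real" where
  "rweight \<Omega> p R = (\<Prod>x\<in>R. p x) * (\<Prod>x\<in>\<Omega> - R. 1 - p x)"

text \<open>Each element has its own density \<open>p x\<close>. Constant densities describe the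
  random crossing edges; variable ones describe the random choice of a subfamily of events in
  \<open>janson_thinned\<close>.\<close>

definition rprob :: "'a set \<Rightarrow> ('a \<Rightarrow> real) \<Rightarrow> ('a set \<Rightarrow> bool) \<Rightarrow> real" where
  "rprob \<Omega> p Q = (\<Sum>R\<in>Pow \<Omega>. if Q R then rweight \<Omega> p R else 0)"

lemma sum_Pow_insert:
  assumes "finite A" "x \<notin> A"
  shows "(\<Sum>R\<in>Pow (insert x A). f R) = (\<Sum>R\<in>Pow A. f (insert x R)) + (\<Sum>R\<in>Pow A. f R :: real)"
proof -
  have inj: "inj_on (insert x) (Pow A)"
    using assms(2) unfolding inj_on_def by (metis Pow_iff insert_ident subsetD)
  have "(\<Sum>R\<in>Pow (insert x A). f R) = (\<Sum>R\<in>Pow A. f R) + (\<Sum>R\<in>insert x ` Pow A. f R)"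
    unfolding Pow_insert using assms by (intro sum.union_disjoint) auto
  also have "(\<Sum>R\<in>insert x ` Pow A. f R) = (\<Sum>R\<in>Pow A. f (insert x R))"
    using sum.reindex[OF inj, of f] by simp
  finally show ?thesis by simp
qed

lemma rprob_insert:
  assumes "finite \<Omega>" "x \<notin> \<Omega>"
  shows "rprob (insert x \<Omega>) p Q = p x * rprob \<Omega> p (\<lambda>R. Q (insert x R)) + (1 - p x) * rprob \<Omega> p Q"
proof -
  have a: "rweight (insert x \<Omega>) p (insert x R) = p x * rweight \<Omega> p R" if "R \<in> Pow \<Omega>" for R
  proof -
    have "insert x \<Omega> - insert x R = \<Omega> - R" "x \<notin> R" "finite R"
      using that assms finite_subset by auto
    then show ?thesis by (simp add: rweight_def)
  qed
  have b: "rweight (insert x \<Omega>) p R = (1 - p x) * rweight \<Omega> p R" if "R \<in> Pow \<Omega>" for R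
  proof -
    have "insert x \<Omega> - R = insert x (\<Omega> - R)" "x \<notin> \<Omega> - R" "finite (\<Omega> - R)"
      using that assms by auto
    then show ?thesis by (simp add: rweight_def)
  qed
  show ?thesis unfolding rprob_def sum_Pow_insert[OF assms] sum_distrib_left
    using a b by (intro arg_cong2[of _ _ _ _ "(+)"] sum.cong) auto
qed

lemma rprob_empty: "rprob {} p Q = (if Q {} then 1 else 0)"
  by (simp add: rprob_def rweight_def)

lemma rweight_nonneg:
  assumes "\<forall>x\<in>\<Omega>. 0 \<le> p x \<and> p x \<le> 1" "R \<subseteq> \<Omega>"
  shows "0 \<le> rweight \<Omega> p R"
  unfolding rweight_def using assms by (intro mult_nonneg_nonneg prod_nonneg) auto

lemma rprob_mono:
  assumes "\<forall>x\<in>\<Omega>. 0 \<le> p x \<and> p x \<le> 1" "\<And>R. R \<subseteq> \<Omega> \<Longrightarrow> Q R \<Longrightarrow> Q' R"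
  shows "rprob \<Omega> p Q \<le> rprob \<Omega> p Q'"
  unfolding rprob_def using assms rweight_nonneg[OF assms(1)] by (intro sum_mono) auto

lemma rprob_nonneg:
  assumes "\<forall>x\<in>\<Omega>. 0 \<le> p x \<and> p x \<le> 1"
  shows "0 \<le> rprob \<Omega> p Q"
  unfolding rprob_def using rweight_nonneg[OF assms] by (intro sum_nonneg) auto

lemma rprob_cong:
  assumes "\<And>R. R \<subseteq> \<Omega> \<Longrightarrow> Q R = Q' R"
  shows "rprob \<Omega> p Q = rprob \<Omega> p Q'"
  unfolding rprob_def using assms by (intro sum.cong) auto

lemma rprob_True: "finite \<Omega> \<Longrightarrow> rprob \<Omega> p (\<lambda>R. True) = 1"
  by (induction \<Omega> rule: finite_induct) (simp_all add: rprob_empty rprob_insert)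

lemma rprob_split:
  "rprob \<Omega> p Q = rprob \<Omega> p (\<lambda>R. Q R \<and> A R) + rprob \<Omega> p (\<lambda>R. Q R \<and> \<not> A R)"
  unfolding rprob_def sum.distrib[symmetric] by (intro sum.cong) auto

text \<open>Forcing \<open>B\<close> into the random set costs its probability and leaves the law of
  the other elements undisturbed. This is the conditioning behind Janson's inequality.\<close>

lemma rprob_superset:
  assumes "finite \<Omega>" "B \<subseteq> \<Omega>"
  shows "rprob \<Omega> p (\<lambda>R. B \<subseteq> R \<and> Q R) = (\<Prod>x\<in>B. p x) * rprob \<Omega> p (\<lambda>R. Q (R \<union> B))"
  using assms
proof (induction \<Omega> arbitrary: B Q rule: finite_induct)
  case empty
  then show ?case by (simp add: rprob_empty)
next
  case (insert x \<Omega>)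
  show ?case
  proof (cases "x \<in> B")
    case True
    define B' where "B' = B - {x}"
    have B: "B = insert x B'" "x \<notin> B'" "B' \<subseteq> \<Omega>" "finite B'"
      using True insert by (auto simp: B'_def intro: finite_subset)
    have "rprob (insert x \<Omega>) p (\<lambda>R. B \<subseteq> R \<and> Q R)
        = p x * rprob \<Omega> p (\<lambda>R. B' \<subseteq> R \<and> Q (insert x R)) + (1 - p x) * rprob \<Omega> p (\<lambda>R. False)"
      unfolding rprob_insert[OF insert(1,2)] using B insert(2)
      by (intro arg_cong2[of _ _ _ _ "(+)"] arg_cong2[of _ _ _ _ "(*)"] rprob_cong) auto
    also have "\<dots> = p x * ((\<Prod>x\<in>B'. p x) * rprob \<Omega> p (\<lambda>R. Q (insert x (R \<union> B'))))"
      using insert(3)[OF B(3), of "\<lambda>R. Q (insert x R)"] by (simp add: rprob_def)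
    also have "\<dots> = (\<Prod>x\<in>B. p x) * rprob \<Omega> p (\<lambda>R. Q (R \<union> B))"
      using B by simp
    also have "rprob \<Omega> p (\<lambda>R. Q (R \<union> B)) = rprob (insert x \<Omega>) p (\<lambda>R. Q (R \<union> B))"
      unfolding rprob_insert[OF insert(1,2)] using B by (simp add: algebra_simps)
    finally show ?thesis .
  next
    case False
    then have "B \<subseteq> \<Omega>" using insert by auto
    note IH = insert(3)[OF this]
    have "(\<lambda>R. B \<subseteq> insert x R \<and> Q (insert x R)) = (\<lambda>R. B \<subseteq> R \<and> Q (insert x R))"
      using False by auto
    then show ?thesis unfolding rprob_insert[OF insert(1,2)] using IH[of Q] IH[of "\<lambda>R. Q (insert x R)"]
      by (simp add: algebra_simps)
  qed
qed

lemma rprob_superset_True: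
  assumes "finite \<Omega>" "B \<subseteq> \<Omega>"
  shows "rprob \<Omega> p (\<lambda>R. B \<subseteq> R) = (\<Prod>x\<in>B. p x)"
  using rprob_superset[OF assms, of p "\<lambda>_. True"] by (simp add: rprob_True assms)

text \<open>Elements that are added to the random set anyway need not be sampled. When some crossing
  edges are prescribed, this leads back from the remaining pairs to the full set of crossing
  pairs.\<close>

lemma rprob_union_irrelevant:
  assumes "finite \<Omega>" "F \<subseteq> \<Omega>"
  shows "rprob \<Omega> p (\<lambda>R. Q (R \<union> F)) = rprob (\<Omega> - F) p (\<lambda>R. Q (R \<union> F))"
proof -
  have "finite F" using assms finite_subset by auto
  then show ?thesis using assms
  proof (induction F arbitrary: Q rule: finite_induct)
    case empty
    then show ?case by simp
  next
    case (insert x F)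
    have e: "\<Omega> - F = insert x (\<Omega> - insert x F)" "x \<notin> \<Omega> - insert x F" "finite (\<Omega> - insert x F)"
      using insert by auto
    have "rprob \<Omega> p (\<lambda>R. Q (R \<union> insert x F)) = rprob \<Omega> p (\<lambda>R. (\<lambda>S. Q (insert x S)) (R \<union> F))"
      by simp
    also have "\<dots> = rprob (\<Omega> - F) p (\<lambda>R. Q (insert x (R \<union> F)))"
      using insert.IH[of "\<lambda>S. Q (insert x S)"] insert.prems by simp
    also have "\<dots> = rprob (\<Omega> - insert x F) p (\<lambda>R. Q (R \<union> insert x F))"
      by (subst e(1), subst rprob_insert[OF e(3,2)]) (simp add: algebra_simps del: Diff_insert Diff_insert0 insert_Diff_single)
    finally show ?case .
  qed
qed

lemma rprob_sum_card:
  assumes "finite \<Omega>"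
  shows "(\<Sum>R\<in>Pow \<Omega>. rweight \<Omega> p R * (\<Sum>x\<in>R. g x)) = (\<Sum>x\<in>\<Omega>. g x * p x)"
proof -
  have "(\<Sum>R\<in>Pow \<Omega>. rweight \<Omega> p R * (\<Sum>x\<in>R. g x))
      = (\<Sum>R\<in>Pow \<Omega>. \<Sum>x\<in>\<Omega>. if x \<in> R then rweight \<Omega> p R * g x else 0)"
  proof (intro sum.cong refl)
    fix R assume "R \<in> Pow \<Omega>"
    then have "\<Omega> \<inter> R = R" by auto
    then have "(\<Sum>x\<in>\<Omega>. if x \<in> R then rweight \<Omega> p R * g x else 0) = (\<Sum>x\<in>R. rweight \<Omega> p R * g x)"
      using assms by (simp add: sum.inter_restrict[symmetric])
    then show "rweight \<Omega> p R * (\<Sum>x\<in>R. g x) = (\<Sum>x\<in>\<Omega>. if x \<in> R then rweight \<Omega> p R * g x else 0)"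
      by (simp add: sum_distrib_left)
  qed
  also have "\<dots> = (\<Sum>x\<in>\<Omega>. \<Sum>R\<in>Pow \<Omega>. if x \<in> R then rweight \<Omega> p R * g x else 0)"
    by (rule sum.swap)
  also have "\<dots> = (\<Sum>x\<in>\<Omega>. g x * rprob \<Omega> p (\<lambda>R. {x} \<subseteq> R))"
    unfolding rprob_def sum_distrib_left by (intro sum.cong refl) auto
  also have "\<dots> = (\<Sum>x\<in>\<Omega>. g x * p x)"
    using assms by (intro sum.cong refl) (subst rprob_superset_True, auto)
  finally show ?thesis .
qed

text \<open>Together with \<open>rprob_sum_card\<close> this gives the expectations of the two terms
  in Janson's exponent when the family of events is itself chosen at random.\<close>

lemma rprob_sum_pairs:
  assumes "finite \<Omega>"
  shows "(\<Sum>R\<in>Pow \<Omega>. rweight \<Omega> p R * (\<Sum>x\<in>R. \<Sum>y\<in>R - {x}. g x y))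
       = (\<Sum>x\<in>\<Omega>. \<Sum>y\<in>\<Omega> - {x}. g x y * p x * p y)"
proof -
  have "(\<Sum>R\<in>Pow \<Omega>. rweight \<Omega> p R * (\<Sum>x\<in>R. \<Sum>y\<in>R - {x}. g x y))
      = (\<Sum>R\<in>Pow \<Omega>. \<Sum>x\<in>\<Omega>. \<Sum>y\<in>\<Omega> - {x}. if {x, y} \<subseteq> R then rweight \<Omega> p R * g x y else 0)"
  proof (intro sum.cong refl)
    fix R assume "R \<in> Pow \<Omega>"
    then have R: "R \<subseteq> \<Omega>" by auto
    have "(\<Sum>x\<in>\<Omega>. \<Sum>y\<in>\<Omega> - {x}. if {x, y} \<subseteq> R then rweight \<Omega> p R * g x y else 0)
        = (\<Sum>x\<in>R. \<Sum>y\<in>R - {x}. if {x, y} \<subseteq> R then rweight \<Omega> p R * g x y else 0)"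
    proof (rule sum.mono_neutral_cong_right)
      show "finite \<Omega>" "R \<subseteq> \<Omega>" using assms R by auto
      show "\<forall>i\<in>\<Omega> - R. (\<Sum>y\<in>\<Omega> - {i}. if {i, y} \<subseteq> R then rweight \<Omega> p R * g i y else 0) = 0"
        by (auto intro!: sum.neutral)
      fix x assume "x \<in> R"
      show "(\<Sum>y\<in>\<Omega> - {x}. if {x, y} \<subseteq> R then rweight \<Omega> p R * g x y else 0) =
         (\<Sum>y\<in>R - {x}. if {x, y} \<subseteq> R then rweight \<Omega> p R * g x y else 0)"
        using assms R by (intro sum.mono_neutral_right) auto
    qed
    then show "rweight \<Omega> p R * (\<Sum>x\<in>R. \<Sum>y\<in>R - {x}. g x y)
      = (\<Sum>x\<in>\<Omega>. \<Sum>y\<in>\<Omega> - {x}. if {x, y} \<subseteq> R then rweight \<Omega> p R * g x y else 0)"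
      by (simp add: sum_distrib_left)
  qed
  also have "\<dots> = (\<Sum>x\<in>\<Omega>. \<Sum>R\<in>Pow \<Omega>. \<Sum>y\<in>\<Omega> - {x}. if {x, y} \<subseteq> R then rweight \<Omega> p R * g x y else 0)"
    by (rule sum.swap)
  also have "\<dots> = (\<Sum>x\<in>\<Omega>. \<Sum>y\<in>\<Omega> - {x}. \<Sum>R\<in>Pow \<Omega>. if {x, y} \<subseteq> R then rweight \<Omega> p R * g x y else 0)"
    by (intro sum.cong refl sum.swap)
  also have "\<dots> = (\<Sum>x\<in>\<Omega>. \<Sum>y\<in>\<Omega> - {x}. g x y * rprob \<Omega> p (\<lambda>R. {x, y} \<subseteq> R))"
    unfolding rprob_def sum_distrib_left by (intro sum.cong refl) auto
  also have "\<dots> = (\<Sum>x\<in>\<Omega>. \<Sum>y\<in>\<Omega> - {x}. g x y * p x * p y)"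
    using assms by (intro sum.cong refl) (subst rprob_superset_True, auto)
  finally show ?thesis .
qed

lemma rprob_union_bound:
  assumes "\<forall>x\<in>\<Omega>. 0 \<le> p x \<and> p x \<le> 1" "finite J"
    and "\<And>R. R \<subseteq> \<Omega> \<Longrightarrow> Q R \<Longrightarrow> Q0 R \<or> (\<exists>j\<in>J. Q1 j R)"
  shows "rprob \<Omega> p Q \<le> rprob \<Omega> p Q0 + (\<Sum>j\<in>J. rprob \<Omega> p (Q1 j))"
proof -
  have "(\<Sum>j\<in>J. rprob \<Omega> p (Q1 j)) = (\<Sum>R\<in>Pow \<Omega>. \<Sum>j\<in>J. if Q1 j R then rweight \<Omega> p R else 0)"
    unfolding rprob_def by (rule sum.swap)
  moreover have "(if Q R then rweight \<Omega> p R else 0) \<le> (if Q0 R then rweight \<Omega> p R else 0)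
      + (\<Sum>j\<in>J. if Q1 j R then rweight \<Omega> p R else 0)" if R: "R \<in> Pow \<Omega>" for R
  proof -
    have nn: "0 \<le> rweight \<Omega> p R" using rweight_nonneg[OF assms(1)] R by auto
    have nn': "0 \<le> (\<Sum>j\<in>J. if Q1 j R then rweight \<Omega> p R else 0)" using nn by (intro sum_nonneg) auto
    show ?thesis
    proof (cases "Q R \<and> \<not> Q0 R")
      case True
      then obtain j where "j \<in> J" "Q1 j R" using assms(3) R by blast
      then have "rweight \<Omega> p R \<le> (\<Sum>j\<in>J. if Q1 j R then rweight \<Omega> p R else 0)"
        using member_le_sum[of j J "\<lambda>j. if Q1 j R then rweight \<Omega> p R else 0"] nn assms(2) by auto
      then show ?thesis using nn by auto
    next
      case False
      then show ?thesis using nn nn' by auto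
    qed
  qed
  ultimately show ?thesis
    unfolding rprob_def by (simp only: sum.distrib[symmetric]) (rule sum_mono, simp only:)
qed

text \<open>The inductive step of the Boppana--Spencer proof of Janson's inequality: the event at \<open>i\<close> is
  independent of the events disjoint from it, and Harris' inequality is only needed against an
  event of the form \<open>B \<subseteq> R\<close>.\<close>

lemma janson_step:
  assumes "finite \<Omega>" "\<forall>x\<in>\<Omega>. 0 \<le> p x \<and> p x \<le> 1" "finite I" "\<forall>j\<in>insert i I. B j \<subseteq> \<Omega>"
  shows "rprob \<Omega> p (\<lambda>R. \<forall>j\<in>insert i I. \<not> B j \<subseteq> R)
    \<le> exp (- (\<Prod>x\<in>B i. p x) + (\<Sum>j | j \<in> I \<and> B i \<inter> B j \<noteq> {}. \<Prod>x\<in>B i \<union> B j. p x))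
       * rprob \<Omega> p (\<lambda>R. \<forall>j\<in>I. \<not> B j \<subseteq> R)"
proof -
  define J where "J = {j \<in> I. B i \<inter> B j \<noteq> {}}"
  define d where "d = (\<Prod>x\<in>B i. p x) - (\<Sum>j\<in>J. \<Prod>x\<in>B i \<union> B j. p x)"
  define A where "A = (\<lambda>R. \<forall>j\<in>I. \<not> B j \<subseteq> R)"
  define E where "E = (\<lambda>R. \<forall>j\<in>I - J. \<not> B j \<subseteq> R)"
  note p = assms(2)
  have finJ: "finite J" using assms(3) by (simp add: J_def)
  \<comment> \<open>An event outside \<open>J\<close> uses no element of \<open>B i\<close>, so
    adding \<open>B i\<close> cannot create it.\<close>
  have Ei: "E (R \<union> B i) = E R" for R
    unfolding E_def J_def by blast
  have 1: "rprob \<Omega> p (\<lambda>R. B i \<subseteq> R \<and> E R) = (\<Prod>x\<in>B i. p x) * rprob \<Omega> p E"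
    using rprob_superset[of \<Omega> "B i" p E] assms Ei by simp
  have 2: "rprob \<Omega> p (\<lambda>R. B i \<union> B j \<subseteq> R \<and> E R) \<le> (\<Prod>x\<in>B i \<union> B j. p x) * rprob \<Omega> p E" if "j \<in> J" for j
  proof -
    have sub: "B i \<union> B j \<subseteq> \<Omega>" using assms(4) that J_def by auto
    have "rprob \<Omega> p (\<lambda>R. E (R \<union> (B i \<union> B j))) \<le> rprob \<Omega> p E"
      by (rule rprob_mono[OF p]) (auto simp: E_def)
    moreover have "0 \<le> (\<Prod>x\<in>B i \<union> B j. p x)" using sub p by (intro prod_nonneg) auto
    ultimately show ?thesis
      using rprob_superset[OF assms(1) sub, of p E] by (simp add: mult_left_mono)
  qed
  \<comment> \<open>If \<open>B i\<close> occurs and no event outside \<open>J\<close> does, then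
    either no event of \<open>I\<close> occurs at all or one in \<open>J\<close> does.\<close>
  have "rprob \<Omega> p (\<lambda>R. B i \<subseteq> R \<and> E R) \<le> rprob \<Omega> p (\<lambda>R. A R \<and> B i \<subseteq> R)
      + (\<Sum>j\<in>J. rprob \<Omega> p (\<lambda>R. B i \<union> B j \<subseteq> R \<and> E R))"
    by (rule rprob_union_bound[OF p finJ]) (auto simp: A_def E_def)
  also have "(\<Sum>j\<in>J. rprob \<Omega> p (\<lambda>R. B i \<union> B j \<subseteq> R \<and> E R))
      \<le> (\<Sum>j\<in>J. (\<Prod>x\<in>B i \<union> B j. p x) * rprob \<Omega> p E)"
    using 2 by (rule sum_mono)
  finally have 3: "d * rprob \<Omega> p E \<le> rprob \<Omega> p (\<lambda>R. A R \<and> B i \<subseteq> R)"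
    unfolding 1 d_def by (simp add: algebra_simps sum_distrib_left sum_distrib_right)
  have EA: "rprob \<Omega> p A \<le> rprob \<Omega> p E" by (rule rprob_mono[OF p]) (auto simp: A_def E_def)
  \<comment> \<open>\<open>d\<close> is negative when the correlations dominate; the inequality is
    trivial in that case.\<close>
  have 4: "d * rprob \<Omega> p A \<le> rprob \<Omega> p (\<lambda>R. A R \<and> B i \<subseteq> R)"
  proof (cases "d \<ge> 0")
    case True
    then show ?thesis using mult_left_mono[OF EA True] 3 by linarith
  next
    case False
    then have "d * rprob \<Omega> p A \<le> 0" using rprob_nonneg[OF p, of A] by (simp add: mult_nonpos_nonneg)
    then show ?thesis using rprob_nonneg[OF p, of "\<lambda>R. A R \<and> B i \<subseteq> R"] by linarith
  qed
  have "rprob \<Omega> p (\<lambda>R. \<forall>j\<in>insert i I. \<not> B j \<subseteq> R) = rprob \<Omega> p (\<lambda>R. A R \<and> \<not> B i \<subseteq> R)"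
    by (rule rprob_cong) (auto simp: A_def)
  also have "\<dots> \<le> (1 - d) * rprob \<Omega> p A"
    using rprob_split[of \<Omega> p A "\<lambda>R. B i \<subseteq> R"] 4 by (simp add: algebra_simps)
  also have "\<dots> \<le> exp (- d) * rprob \<Omega> p A"
    using rprob_nonneg[OF p, of A] exp_ge_add_one_self[of "- d"] by (intro mult_right_mono) auto
  finally show ?thesis unfolding A_def d_def J_def by simp
qed

text \<open>Adding the events one at a time, \<open>janson_step\<close> charges each dependent pair
  once, at the member that is added later; the double sum runs over ordered pairs and is therefore
  halved.\<close>

lemma janson:
  assumes "finite \<Omega>" "\<forall>x\<in>\<Omega>. 0 \<le> p x \<and> p x \<le> 1" "finite I" "\<forall>j\<in>I. B j \<subseteq> \<Omega>"
  shows "rprob \<Omega> p (\<lambda>R. \<forall>j\<in>I. \<not> B j \<subseteq> R)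
    \<le> exp (- (\<Sum>i\<in>I. \<Prod>x\<in>B i. p x)
           + (\<Sum>i\<in>I. \<Sum>j\<in>I - {i}. if B i \<inter> B j \<noteq> {} then \<Prod>x\<in>B i \<union> B j. p x else 0) / 2)"
  using assms(3,4)
proof (induction I rule: finite_induct)
  case empty
  then show ?case by (simp add: rprob_True assms)
next
  case (insert i I)
  let ?g = "\<lambda>i j. if B i \<inter> B j \<noteq> {} then \<Prod>x\<in>B i \<union> B j. p x else 0"
  have sym: "?g a b = ?g b a" for a b by (simp add: Un_commute Int_commute)
  have s1: "(\<Sum>j | j \<in> I \<and> B i \<inter> B j \<noteq> {}. \<Prod>x\<in>B i \<union> B j. p x) = (\<Sum>j\<in>I. ?g i j)"
    using insert(1) by (subst sum.inter_filter) auto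
  have s2: "(\<Sum>a\<in>I. \<Sum>j\<in>insert i I - {a}. ?g a j) = (\<Sum>a\<in>I. \<Sum>j\<in>I - {a}. ?g a j) + (\<Sum>a\<in>I. ?g a i)"
  proof -
    have "(\<Sum>j\<in>insert i I - {a}. ?g a j) = ?g a i + (\<Sum>j\<in>I - {a}. ?g a j)" if "a \<in> I" for a
    proof -
      have "insert i I - {a} = insert i (I - {a})" "i \<notin> I - {a}" "finite (I - {a})" using that insert by auto
      then show ?thesis by (metis (no_types, lifting) sum.insert)
    qed
    then have "(\<Sum>a\<in>I. \<Sum>j\<in>insert i I - {a}. ?g a j) = (\<Sum>a\<in>I. ?g a i + (\<Sum>j\<in>I - {a}. ?g a j))"
      by (intro sum.cong) auto
    then show ?thesis by (simp only: sum.distrib add.commute)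
  qed
  have s3: "(\<Sum>a\<in>insert i I. \<Sum>j\<in>insert i I - {a}. ?g a j)
      = (\<Sum>a\<in>I. \<Sum>j\<in>I - {a}. ?g a j) + 2 * (\<Sum>j\<in>I. ?g i j)"
  proof -
    have "insert i I - {i} = I" using insert by auto
    then have "(\<Sum>a\<in>insert i I. \<Sum>j\<in>insert i I - {a}. ?g a j)
        = (\<Sum>j\<in>I. ?g i j) + (\<Sum>a\<in>I. \<Sum>j\<in>insert i I - {a}. ?g a j)"
      using insert(1,2) by (subst sum.insert) auto
    moreover have "(\<Sum>a\<in>I. ?g a i) = (\<Sum>a\<in>I. ?g i a)" by (intro sum.cong refl sym)
    ultimately show ?thesis unfolding s2 by linarith
  qed
  have "rprob \<Omega> p (\<lambda>R. \<forall>j\<in>insert i I. \<not> B j \<subseteq> R)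
     \<le> exp (- (\<Prod>x\<in>B i. p x) + (\<Sum>j\<in>I. ?g i j)) * rprob \<Omega> p (\<lambda>R. \<forall>j\<in>I. \<not> B j \<subseteq> R)"
    using janson_step[OF assms(1,2) insert(1) insert(4)] unfolding s1 .
  also have "\<dots> \<le> exp (- (\<Prod>x\<in>B i. p x) + (\<Sum>j\<in>I. ?g i j)) *
      exp (- (\<Sum>i\<in>I. \<Prod>x\<in>B i. p x) + (\<Sum>i\<in>I. \<Sum>j\<in>I - {i}. ?g i j) / 2)"
    using insert by (intro mult_left_mono) auto
  finally show ?case unfolding exp_add[symmetric] s3 using insert(1,2)
    by (simp add: algebra_simps add_divide_distrib)
qed

text \<open>Some subfamily of \<open>I\<close> does at least as well as a random one that keeps \<open>i\<close> with
  probability \<open>q i\<close>.\<close>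

lemma janson_thinned:
  assumes "finite \<Omega>" "0 \<le> p" "p \<le> 1" "finite I" "\<forall>j\<in>I. B j \<subseteq> \<Omega>"
    and q: "\<forall>i\<in>I. 0 \<le> q i \<and> q i \<le> 1"
    and loc: "\<And>i. i \<in> I \<Longrightarrow> (\<Sum>j\<in>I - {i}. if B i \<inter> B j \<noteq> {} then q j * p ^ card (B j - B i) else 0) \<le> 2 * c"
  shows "rprob \<Omega> (\<lambda>_. p) (\<lambda>R. \<forall>j\<in>I. \<not> B j \<subseteq> R) \<le> exp (- ((1 - c) * (\<Sum>i\<in>I. q i * p ^ card (B i))))"
proof -
  let ?P = "\<lambda>_. p"
  let ?g = "\<lambda>i j. if B i \<inter> B j \<noteq> {} then p ^ card (B i \<union> B j) else 0"
  let ?\<mu> = "\<lambda>I'. \<Sum>i\<in>I'. p ^ card (B i)"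
  let ?\<Delta> = "\<lambda>I'. \<Sum>i\<in>I'. \<Sum>j\<in>I' - {i}. ?g i j"
  let ?S = "\<Sum>i\<in>I. q i * p ^ card (B i)"
  \<comment> \<open>\<open>loc\<close> bounds, for a single event, the expected weight of the kept
    events correlated with it; weighting by \<open>q i * p ^ card (B i)\<close> and summing over
    \<open>i\<close> bounds the whole second-order term.\<close>
  have D: "(\<Sum>i\<in>I. \<Sum>j\<in>I - {i}. ?g i j * q i * q j) \<le> 2 * c * ?S"
  proof -
    have "(\<Sum>j\<in>I - {i}. ?g i j * q i * q j) \<le> 2 * c * (q i * p ^ card (B i))" if i: "i \<in> I" for i
    proof -
      have "?g i j * q i * q j = q i * p ^ card (B i) * (if B i \<inter> B j \<noteq> {} then q j * p ^ card (B j - B i) else 0)"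
        if "j \<in> I - {i}" for j
      proof -
        have "finite (B i)" "finite (B j)" using assms that i by (meson Diff_iff finite_subset)+
        then have "card (B i \<union> B j) = card (B i) + card (B j - B i)"
          by (subst card_Un_disjoint[symmetric]) auto
        then show ?thesis by (simp add: power_add)
      qed
      then have "(\<Sum>j\<in>I - {i}. ?g i j * q i * q j) = q i * p ^ card (B i)
          * (\<Sum>j\<in>I - {i}. if B i \<inter> B j \<noteq> {} then q j * p ^ card (B j - B i) else 0)"
        unfolding sum_distrib_left by (intro sum.cong) auto
      also have "\<dots> \<le> q i * p ^ card (B i) * (2 * c)"
        using loc[OF i] q i assms(2) by (intro mult_left_mono) auto
      finally show ?thesis by (simp add: algebra_simps)
    qed
    then show ?thesis unfolding sum_distrib_left by (intro sum_mono) auto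
  qed
  \<comment> \<open>Averaging: under the \<open>q\<close>-random choice of \<open>I'\<close> the
    expectation of the right side is at least the left side, so some subfamily attains it.\<close>
  have "\<exists>I'\<in>Pow I. (1 - c) * ?S \<le> ?\<mu> I' - ?\<Delta> I' / 2"
  proof (rule ccontr)
    assume "\<not> ?thesis"
    then have lt: "?\<mu> I' - ?\<Delta> I' / 2 < (1 - c) * ?S" if "I' \<in> Pow I" for I'
      using that by (meson not_le)
    have "(\<Sum>I'\<in>Pow I. rweight I q I' * (?\<mu> I' - ?\<Delta> I' / 2)) < (1 - c) * ?S"
    proof -
      have tot: "(\<Sum>I'\<in>Pow I. rweight I q I') = 1"
        using rprob_True[OF assms(4), of q] by (simp add: rprob_def)
      then obtain I0 where I0: "I0 \<in> Pow I" "rweight I q I0 \<noteq> 0"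
        by (metis sum.neutral zero_neq_one)
      have "(\<Sum>I'\<in>Pow I. rweight I q I' * (?\<mu> I' - ?\<Delta> I' / 2)) < (\<Sum>I'\<in>Pow I. rweight I q I' * ((1 - c) * ?S))"
      proof (rule sum_strict_mono_ex1)
        show "finite (Pow I)" using assms by auto
        show "\<forall>x\<in>Pow I. rweight I q x * (?\<mu> x - ?\<Delta> x / 2) \<le> rweight I q x * ((1 - c) * ?S)"
        proof
          fix x assume x: "x \<in> Pow I"
          show "rweight I q x * (?\<mu> x - ?\<Delta> x / 2) \<le> rweight I q x * ((1 - c) * ?S)"
            using lt[OF x] rweight_nonneg[OF q] x by (intro mult_left_mono) auto
        qed
        show "\<exists>a\<in>Pow I. rweight I q a * (?\<mu> a - ?\<Delta> a / 2) < rweight I q a * ((1 - c) * ?S)"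
        proof
          show "rweight I q I0 * (?\<mu> I0 - ?\<Delta> I0 / 2) < rweight I q I0 * ((1 - c) * ?S)"
            using I0 rweight_nonneg[OF q, of I0] by (intro mult_strict_left_mono lt[OF I0(1)]) auto
        qed (rule I0(1))
      qed
      also have "\<dots> = (1 - c) * ?S" using tot by (simp add: sum_distrib_right[symmetric])
      finally show ?thesis .
    qed
    moreover have "(\<Sum>I'\<in>Pow I. rweight I q I' * (?\<mu> I' - ?\<Delta> I' / 2))
        = (\<Sum>I'\<in>Pow I. rweight I q I' * ?\<mu> I') - (\<Sum>I'\<in>Pow I. rweight I q I' * ?\<Delta> I') / 2"
      by (simp only: sum_subtractf right_diff_distrib times_divide_eq_right sum_divide_distrib[of _ "Pow I"])
    moreover have "(\<Sum>I'\<in>Pow I. rweight I q I' * ?\<mu> I') = ?S"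
      using rprob_sum_card[OF assms(4), of q "\<lambda>i. p ^ card (B i)"] by (simp add: mult.commute)
    moreover have "(\<Sum>I'\<in>Pow I. rweight I q I' * ?\<Delta> I') = (\<Sum>i\<in>I. \<Sum>j\<in>I - {i}. ?g i j * q i * q j)"
      by (rule rprob_sum_pairs[OF assms(4)])
    ultimately show False using D by (simp add: algebra_simps)
  qed
  then obtain I' where I': "I' \<subseteq> I" "(1 - c) * ?S \<le> ?\<mu> I' - ?\<Delta> I' / 2" by auto
  have "rprob \<Omega> ?P (\<lambda>R. \<forall>j\<in>I. \<not> B j \<subseteq> R) \<le> rprob \<Omega> ?P (\<lambda>R. \<forall>j\<in>I'. \<not> B j \<subseteq> R)"
    using I' assms by (intro rprob_mono) auto
  also have "\<dots> \<le> exp (- ?\<mu> I' + ?\<Delta> I' / 2)"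
  proof -
    have "finite I'" "\<forall>j\<in>I'. B j \<subseteq> \<Omega>" using assms I' finite_subset by auto
    then show ?thesis using janson[of \<Omega> ?P I' B] assms(1-3) by (simp only: prod_constant) blast
  qed
  also have "\<dots> \<le> exp (- ((1 - c) * ?S))" unfolding exp_le_cancel_iff using I'(2) by linarith
  finally show ?thesis .
qed

section \<open>From binomial to uniform random subsets\<close>

lemma rprob_by_card:
  assumes "finite \<Omega>"
  shows "rprob \<Omega> (\<lambda>_. p) Q
    = (\<Sum>s\<le>card \<Omega>. p ^ s * (1 - p) ^ (card \<Omega> - s) * real (card {R. R \<subseteq> \<Omega> \<and> card R = s \<and> Q R}))"
proof -
  have "rprob \<Omega> (\<lambda>_. p) Q = (\<Sum>R\<in>Pow \<Omega>. if Q R then p ^ card R * (1 - p) ^ (card \<Omega> - card R) else 0)"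
    unfolding rprob_def rweight_def using assms by (intro sum.cong) (auto simp: card_Diff_subset finite_subset)
  also have "\<dots> = (\<Sum>s\<le>card \<Omega>. \<Sum>R\<in>{R\<in>Pow \<Omega>. card R = s}. if Q R then p ^ card R * (1 - p) ^ (card \<Omega> - card R) else 0)"
    using assms by (subst sum.group) (auto simp: card_mono)
  also have "\<dots> = (\<Sum>s\<le>card \<Omega>. p ^ s * (1 - p) ^ (card \<Omega> - s) * real (card {R. R \<subseteq> \<Omega> \<and> card R = s \<and> Q R}))"
  proof (intro sum.cong refl)
    fix s
    have "(\<Sum>R\<in>{R\<in>Pow \<Omega>. card R = s}. if Q R then p ^ card R * (1 - p) ^ (card \<Omega> - card R) else 0)
        = (\<Sum>R\<in>{R\<in>Pow \<Omega>. card R = s}. if Q R then p ^ s * (1 - p) ^ (card \<Omega> - s) else 0)"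
      by (intro sum.cong) auto
    also have "\<dots> = (\<Sum>R\<in>{R \<in> {R\<in>Pow \<Omega>. card R = s}. Q R}. p ^ s * (1 - p) ^ (card \<Omega> - s))"
      using assms by (intro sum.inter_filter[symmetric]) auto
    also have "\<dots> = p ^ s * (1 - p) ^ (card \<Omega> - s) * real (card {R. R \<subseteq> \<Omega> \<and> card R = s \<and> Q R})"
      by (simp add: conj_assoc)
    finally show "(\<Sum>R\<in>{R\<in>Pow \<Omega>. card R = s}. if Q R then p ^ card R * (1 - p) ^ (card \<Omega> - card R) else 0)
        = p ^ s * (1 - p) ^ (card \<Omega> - s) * real (card {R. R \<subseteq> \<Omega> \<and> card R = s \<and> Q R})" .
  qed
  finally show ?thesis .
qed

lemma card_supersets:
  assumes "finite \<Omega>" "F \<subseteq> \<Omega>"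
  shows "card {R. F \<subseteq> R \<and> R \<subseteq> \<Omega> \<and> card R = M} \<le> (card \<Omega> - card F) choose (M - card F)"
proof -
  have fF: "finite F" using assms finite_subset by auto
  have "card {R. F \<subseteq> R \<and> R \<subseteq> \<Omega> \<and> card R = M} \<le> card {R. R \<subseteq> \<Omega> - F \<and> card R = M - card F}"
  proof (rule card_inj_on_le[where f = "\<lambda>R. R - F"])
    show "inj_on (\<lambda>R. R - F) {R. F \<subseteq> R \<and> R \<subseteq> \<Omega> \<and> card R = M}" by (auto simp: inj_on_def)
    show "(\<lambda>R. R - F) ` {R. F \<subseteq> R \<and> R \<subseteq> \<Omega> \<and> card R = M} \<subseteq> {R. R \<subseteq> \<Omega> - F \<and> card R = M - card F}"
      using fF by (auto simp: card_Diff_subset)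
    show "finite {R. R \<subseteq> \<Omega> - F \<and> card R = M - card F}" using assms by auto
  qed
  also have "\<dots> = (card \<Omega> - card F) choose (M - card F)"
    using assms fF by (simp add: n_subsets card_Diff_subset)
  finally show ?thesis .
qed

text \<open>Double counting of the pairs formed by an \<open>M\<close>-set with property
  \<open>Q\<close> and an \<open>s\<close>-subset of it, which inherits \<open>Q\<close>: the
  proportion of sets with a decreasing property does not grow with their size.\<close>

lemma local_LYM:
  assumes "finite \<Omega>" "\<forall>R R'. Q R \<longrightarrow> R' \<subseteq> R \<longrightarrow> Q R'" "s \<le> M" "M \<le> card \<Omega>"
  shows "card {R. R \<subseteq> \<Omega> \<and> card R = M \<and> Q R} * (card \<Omega> choose s)
    \<le> card {R. R \<subseteq> \<Omega> \<and> card R = s \<and> Q R} * (card \<Omega> choose M)"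
proof -
  let ?A = "{R. R \<subseteq> \<Omega> \<and> card R = M \<and> Q R}" and ?B = "{R. R \<subseteq> \<Omega> \<and> card R = s \<and> Q R}"
  have fin: "finite ?A" "finite ?B" using assms(1) by auto
  have "card ?A * (M choose s) = (\<Sum>R\<in>?A. card {R'. R' \<subseteq> R \<and> card R' = s})"
    using n_subsets[OF finite_subset[OF _ assms(1)]] by simp
  also have "\<dots> = card (SIGMA R:?A. {R'. R' \<subseteq> R \<and> card R' = s})"
    using fin by (subst card_SigmaI) (auto intro!: finite_subset[OF _ finite_Pow_iff[THEN iffD2, OF assms(1)]])
  also have "\<dots> \<le> card (SIGMA R':?B. {R. R' \<subseteq> R \<and> R \<subseteq> \<Omega> \<and> card R = M})"
  proof (rule card_inj_on_le[where f = prod.swap])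
    show "finite (SIGMA R':?B. {R. R' \<subseteq> R \<and> R \<subseteq> \<Omega> \<and> card R = M})"
      using fin assms(1) by (intro finite_SigmaI) auto
  qed (use assms(2) in auto)
  also have "\<dots> = (\<Sum>R'\<in>?B. card {R. R' \<subseteq> R \<and> R \<subseteq> \<Omega> \<and> card R = M})"
    using fin assms(1) by (subst card_SigmaI) auto
  also have "\<dots> \<le> (\<Sum>R'\<in>?B. (card \<Omega> - s) choose (M - s))"
    using card_supersets[OF assms(1)] by (intro sum_mono) fastforce
  also have "\<dots> = card ?B * ((card \<Omega> - s) choose (M - s))" by simp
  finally have 1: "card ?A * (M choose s) \<le> card ?B * ((card \<Omega> - s) choose (M - s))" .
  have 2: "(card \<Omega> choose M) * (M choose s) = (card \<Omega> choose s) * ((card \<Omega> - s) choose (M - s))"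
    using choose_mult[OF assms(3,4)] .
  have pos: "(card \<Omega> - s) choose (M - s) > 0" "M choose s > 0"
    using assms(3,4) by auto
  have "card ?A * (card \<Omega> choose s) * ((card \<Omega> - s) choose (M - s))
      = (card ?A * (M choose s)) * (card \<Omega> choose M)"
    using 2 by (simp add: algebra_simps)
  also have "\<dots> \<le> card ?B * ((card \<Omega> - s) choose (M - s)) * (card \<Omega> choose M)"
    using 1 by (intro mult_right_mono) auto
  finally have "card ?A * (card \<Omega> choose s) * ((card \<Omega> - s) choose (M - s))
     \<le> card ?B * (card \<Omega> choose M) * ((card \<Omega> - s) choose (M - s))"
    by (simp add: algebra_simps)
  then show ?thesis using pos by simp
qed

text \<open>By \<open>local_LYM\<close> a uniform \<open>M\<close>-set satisfies \<open>Q\<close> no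
  more often than a uniform \<open>s\<close>-set with \<open>s\<close> at most \<open>M\<close>. So
  it suffices that the binomial set has at most \<open>M\<close> elements with probability at least
  \<open>\<eta>\<close>; since its mean is at most \<open>(1 - \<eta>) * M\<close>, this is Markov's
  inequality.\<close>

lemma uniform_le_rprob:
  assumes "finite \<Omega>" "0 \<le> p" "p \<le> 1" "\<forall>R R'. Q R \<longrightarrow> R' \<subseteq> R \<longrightarrow> Q R'"
    and "real (card \<Omega>) * p \<le> (1 - \<eta>) * real M" "0 < \<eta>" "\<eta> \<le> 1"
  shows "\<eta> * real (card {R. R \<subseteq> \<Omega> \<and> card R = M \<and> Q R}) \<le> real (card \<Omega> choose M) * rprob \<Omega> (\<lambda>_. p) Q"
proof (cases "M \<le> card \<Omega>")
  case False
  then have "{R. R \<subseteq> \<Omega> \<and> card R = M \<and> Q R} = {}" using assms(1) by (auto dest: card_mono[rotated])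
  then show ?thesis using False by (simp add: binomial_eq_0 del: Collect_empty_eq)
next
  case True
  let ?N = "card \<Omega>"
  let ?c = "\<lambda>Q s. real (card {R. R \<subseteq> \<Omega> \<and> card R = s \<and> Q R})"
  let ?w = "\<lambda>s. p ^ s * (1 - p) ^ (?N - s)"
  have w0: "0 \<le> ?w s" for s using assms by simp
  have p01: "\<forall>x\<in>\<Omega>. 0 \<le> p \<and> p \<le> 1" using assms by auto
  have small: "\<eta> \<le> rprob \<Omega> (\<lambda>_. p) (\<lambda>R. card R \<le> M)"
  proof -
    \<comment> \<open>Markov's inequality is applied with \<open>M + 1\<close>, the least size above
      \<open>M\<close>; unlike \<open>M\<close> it can be divided by when
      \<open>M = 0\<close>.\<close>
    have "(real M + 1) * rprob \<Omega> (\<lambda>_. p) (\<lambda>R. \<not> card R \<le> M) \<le> (\<Sum>R\<in>Pow \<Omega>. rweight \<Omega> (\<lambda>_. p) R * real (card R))"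
      unfolding rprob_def sum_distrib_left
    proof (rule sum_mono)
      fix R assume "R \<in> Pow \<Omega>"
      then have "0 \<le> rweight \<Omega> (\<lambda>_. p) R" using rweight_nonneg[OF p01] by auto
      then show "(real M + 1) * (if \<not> card R \<le> M then rweight \<Omega> (\<lambda>_. p) R else 0) \<le> rweight \<Omega> (\<lambda>_. p) R * real (card R)"
        by (auto simp: mult.commute[of "rweight _ _ _"] intro!: mult_right_mono)
    qed
    also have "\<dots> = real ?N * p" using rprob_sum_card[OF assms(1), of "\<lambda>_. p" "\<lambda>_. 1"] by simp
    finally have "(real M + 1) * rprob \<Omega> (\<lambda>_. p) (\<lambda>R. \<not> card R \<le> M) \<le> (1 - \<eta>) * real M" using assms(5) by linarith
    also have "\<dots> \<le> (1 - \<eta>) * (real M + 1)" using assms(7) by (intro mult_left_mono) auto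
    finally have "rprob \<Omega> (\<lambda>_. p) (\<lambda>R. \<not> card R \<le> M) \<le> 1 - \<eta>"
      by (simp add: mult.commute[of "1 - \<eta>"])
    moreover have "rprob \<Omega> (\<lambda>_. p) (\<lambda>R. card R \<le> M) + rprob \<Omega> (\<lambda>_. p) (\<lambda>R. \<not> card R \<le> M) = 1"
      using rprob_split[of \<Omega> "\<lambda>_. p" "\<lambda>_. True" "\<lambda>R. card R \<le> M"] rprob_True[OF assms(1)] by simp
    ultimately show ?thesis by linarith
  qed
  have cl: "{R. R \<subseteq> \<Omega> \<and> card R = s \<and> card R \<le> M} = (if s \<le> M then {R. R \<subseteq> \<Omega> \<and> card R = s} else {})" for s by auto
  have "?c Q M * rprob \<Omega> (\<lambda>_. p) (\<lambda>R. card R \<le> M)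
     = (\<Sum>s\<le>?N. ?w s * (?c Q M * (if s \<le> M then real (?N choose s) else 0)))"
    unfolding rprob_by_card[OF assms(1)] cl sum_distrib_left
    by (intro sum.cong refl) (auto simp: n_subsets[OF assms(1)])
  also have "\<dots> \<le> (\<Sum>s\<le>?N. ?w s * (?c Q s * real (?N choose M)))"
  proof (intro sum_mono mult_left_mono w0)
    fix s
    show "?c Q M * (if s \<le> M then real (?N choose s) else 0) \<le> ?c Q s * real (?N choose M)"
    proof (cases "s \<le> M")
      case s: True
      show ?thesis
        using local_LYM[of \<Omega> Q s M, OF assms(1,4) s True] s by (simp only: if_True of_nat_mult[symmetric] of_nat_le_iff)
    qed simp
  qed
  also have "\<dots> = real (?N choose M) * rprob \<Omega> (\<lambda>_. p) Q"
    unfolding rprob_by_card[OF assms(1)] sum_distrib_left by (intro sum.cong refl) auto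
  finally have "?c Q M * rprob \<Omega> (\<lambda>_. p) (\<lambda>R. card R \<le> M) \<le> real (?N choose M) * rprob \<Omega> (\<lambda>_. p) Q" .
  moreover have "\<eta> * ?c Q M \<le> ?c Q M * rprob \<Omega> (\<lambda>_. p) (\<lambda>R. card R \<le> M)"
    using small by (simp add: mult.commute mult_right_mono)
  ultimately show ?thesis by linarith
qed

section \<open>Transversals and crossing pairs\<close>

text \<open>Transversals are plain sets rather than choice functions, so that they can be united
  with an edge and intersected with one another.\<close>

definition transv :: "'i set \<Rightarrow> ('i \<Rightarrow> 'a set) \<Rightarrow> 'a set set" where
  "transv I W = {S. S \<subseteq> (\<Union>i\<in>I. W i) \<and> (\<forall>i\<in>I. card (S \<inter> W i) = 1)}"

lemma transv_empty: "transv {} W = {{}}"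
  by (auto simp: transv_def)

lemma transv_restrict:
  assumes "S \<in> transv I W" "I' \<subseteq> I"
  shows "S \<inter> (\<Union>i\<in>I'. W i) \<in> transv I' W"
proof -
  have "S \<inter> (\<Union>i\<in>I'. W i) \<inter> W i = S \<inter> W i" if "i \<in> I'" for i using that by blast
  then show ?thesis using assms by (auto simp: transv_def)
qed

lemma transv_insert:
  assumes "\<forall>i\<in>I. W a \<inter> W i = {}"
  shows "transv (insert a I) W = (\<lambda>(u, S). insert u S) ` (W a \<times> transv I W)"
proof (intro equalityI subsetI)
  fix S assume S: "S \<in> transv (insert a I) W"
  then have "card (S \<inter> W a) = 1" by (auto simp: transv_def)
  then obtain u where u: "S \<inter> W a = {u}" by (auto simp: card_1_singleton_iff)
  have "S \<inter> (\<Union>i\<in>I. W i) \<in> transv I W" using transv_restrict[OF S] by blast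
  moreover have "S = insert u (S \<inter> (\<Union>i\<in>I. W i))" using u S by (auto simp: transv_def)
  moreover have "u \<in> W a" using u by auto
  ultimately show "S \<in> (\<lambda>(u, S). insert u S) ` (W a \<times> transv I W)"
    by (intro image_eqI[of _ _ "(u, S \<inter> (\<Union>i\<in>I. W i))"]) (simp_all only: split_conv mem_Times_iff fst_conv snd_conv simp_thms)
next
  fix S assume "S \<in> (\<lambda>(u, S). insert u S) ` (W a \<times> transv I W)"
  then obtain u S' where S: "S = insert u S'" "u \<in> W a" "S' \<in> transv I W" by auto
  have sub: "S' \<subseteq> (\<Union>i\<in>I. W i)" using S(3) by (auto simp: transv_def)
  have "S \<inter> W a = {u}" using S sub assms by blast
  moreover have "S \<inter> W i = S' \<inter> W i" if "i \<in> I" for i using S assms that by blast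
  moreover have "\<forall>i\<in>I. card (S' \<inter> W i) = 1" using S(3) by (simp add: transv_def)
  moreover have "S \<subseteq> (\<Union>i\<in>insert a I. W i)" using S sub by blast
  ultimately show "S \<in> transv (insert a I) W"
    unfolding transv_def by simp
qed

lemma inj_on_transv_insert:
  assumes "\<forall>i\<in>I. W a \<inter> W i = {}"
  shows "inj_on (\<lambda>(u, S). insert u S) (W a \<times> transv I W)"
proof (rule inj_onI)
  fix x y assume "x \<in> W a \<times> transv I W" "y \<in> W a \<times> transv I W"
    and e: "(case x of (u, S) \<Rightarrow> insert u S) = (case y of (u, S) \<Rightarrow> insert u S)"
  then obtain u S v S' where xy: "x = (u, S)" "y = (v, S')" "u \<in> W a" "v \<in> W a"
    "S \<subseteq> (\<Union>i\<in>I. W i)" "S' \<subseteq> (\<Union>i\<in>I. W i)" by (auto simp: transv_def)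
  have e': "insert u S = insert v S'" using e xy by auto
  have "u \<notin> S" "v \<notin> S" "u \<notin> S'" "v \<notin> S'" using xy assms by blast+
  then have "u = v" using e' by blast
  moreover have "S = S'" using e' \<open>u \<notin> S\<close> \<open>u \<notin> S'\<close> \<open>u = v\<close> by (metis insert_ident)
  ultimately show "x = y" using xy by simp
qed

lemma card_transv:
  assumes "finite I" "disjoint_family_on W I" "\<forall>i\<in>I. finite (W i)"
  shows "finite (transv I W)" "card (transv I W) = (\<Prod>i\<in>I. card (W i))"
proof -
  have "finite (transv I W) \<and> card (transv I W) = (\<Prod>i\<in>I. card (W i))"
    using assms
  proof (induction I rule: finite_induct)
    case empty
    then show ?case by (simp add: transv_empty)
  next
    case (insert a I)
    have d: "\<forall>i\<in>I. W a \<inter> W i = {}" using insert by (auto simp: disjoint_family_on_def)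
    have IH: "finite (transv I W)" "card (transv I W) = (\<Prod>i\<in>I. card (W i))"
      using insert by (auto simp: disjoint_family_on_def)
    show ?case unfolding transv_insert[OF d] card_image[OF inj_on_transv_insert[OF d]]
      using IH insert by (simp add: card_cartesian_product)
  qed
  then show "finite (transv I W)" "card (transv I W) = (\<Prod>i\<in>I. card (W i))" by auto
qed

lemma transv_elem:
  assumes "finite I" "disjoint_family_on W I" "S \<in> transv I W"
  shows "finite S" "card S = card I"
proof -
  have S: "S = (\<Union>i\<in>I. S \<inter> W i)" and c: "\<forall>i\<in>I. card (S \<inter> W i) = 1"
    using assms(3) by (auto simp: transv_def)
  have f: "\<forall>i\<in>I. finite (S \<inter> W i)" using c by (metis card_eq_0_iff zero_neq_one)
  show "finite S" by (subst S) (rule finite_UN_I[OF assms(1)], use f in auto)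
  have "card (\<Union>i\<in>I. S \<inter> W i) = (\<Sum>i\<in>I. card (S \<inter> W i))"
    by (rule card_UN_disjoint) (use assms f in \<open>auto simp: disjoint_family_on_def\<close>)
  then show "card S = card I" using c S by simp
qed

text \<open>The points of \<open>J\<close> fix the choice in \<open>card J\<close> different parts,
  each of size at least \<open>l\<close>, and leave the other parts free.\<close>

lemma transv_count_superset:
  assumes fin: "finite I" and dis: "disjoint_family_on W I" and fW: "\<forall>i\<in>I. finite (W i)"
    and l: "\<forall>i\<in>I. l \<le> real (card (W i))" "0 \<le> l"
  shows "real (card {S \<in> transv I W. J \<subseteq> S}) * l ^ card J \<le> (\<Prod>i\<in>I. real (card (W i)))"
proof (cases "{S \<in> transv I W. J \<subseteq> S} = {}")
  case True
  then show ?thesis by (simp only: card.empty) (simp add: prod_nonneg)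
next
  case False
  then obtain S0 where S0: "S0 \<in> transv I W" "J \<subseteq> S0" by auto
  \<comment> \<open>The parts met by \<open>J\<close>. Once some transversal contains
    \<open>J\<close>, the set \<open>J\<close> is itself a transversal of these parts, so there are
    exactly \<open>card J\<close> of them.\<close>
  define I' where "I' = {i \<in> I. W i \<inter> J \<noteq> {}}"
  have J: "J \<in> transv I' W"
  proof -
    have "J \<inter> W i = S0 \<inter> W i" if "i \<in> I'" for i
    proof -
      have "card (S0 \<inter> W i) = 1" "J \<inter> W i \<noteq> {}" "J \<inter> W i \<subseteq> S0 \<inter> W i"
        using that S0 I'_def by (auto simp: transv_def)
      then show ?thesis by (metis card_1_singletonE subset_singleton_iff)
    qed
    moreover have "J \<subseteq> (\<Union>i\<in>I'. W i)" using S0 unfolding transv_def I'_def by blast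
    ultimately show ?thesis using S0 by (auto simp: transv_def I'_def)
  qed
  have dis': "disjoint_family_on W I'" "disjoint_family_on W (I - I')"
    using dis by (auto simp: disjoint_family_on_def I'_def)
  have cJ: "card J = card I'" using transv_elem(2)[OF _ dis'(1) J] fin by (simp add: I'_def)
  have "card {S \<in> transv I W. J \<subseteq> S} \<le> card (transv (I - I') W)"
  proof (rule card_inj_on_le[where f = "\<lambda>S. S \<inter> (\<Union>i\<in>I - I'. W i)"])
    have *: "S = J \<union> (S \<inter> (\<Union>i\<in>I - I'. W i))" if "S \<in> transv I W" "J \<subseteq> S" for S
    proof -
      have "S \<inter> W i \<subseteq> J" if i: "i \<in> I'" for i
      proof -
        have "card (S \<inter> W i) = 1" "J \<inter> W i \<noteq> {}" "J \<inter> W i \<subseteq> S \<inter> W i"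
          using i \<open>S \<in> transv I W\<close> \<open>J \<subseteq> S\<close> I'_def by (auto simp: transv_def)
        then show ?thesis by (metis Int_lower1 card_1_singletonE subset_singleton_iff)
      qed
      moreover have "S \<subseteq> (\<Union>i\<in>I. W i)" using that by (auto simp: transv_def)
      ultimately have "x \<in> (\<Union>i\<in>I - I'. W i)" if "x \<in> S" "x \<notin> J" for x
        using that by (metis DiffI IntI UN_E UN_I subsetD)
      then show ?thesis using \<open>J \<subseteq> S\<close> by auto
    qed
    show "inj_on (\<lambda>S. S \<inter> (\<Union>i\<in>I - I'. W i)) {S \<in> transv I W. J \<subseteq> S}"
    proof (rule inj_onI)
      fix S T assume "S \<in> {S \<in> transv I W. J \<subseteq> S}" "T \<in> {S \<in> transv I W. J \<subseteq> S}"
        and "S \<inter> (\<Union>i\<in>I - I'. W i) = T \<inter> (\<Union>i\<in>I - I'. W i)"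
      then show "S = T" using *[of S] *[of T] by simp
    qed
    show "(\<lambda>S. S \<inter> (\<Union>i\<in>I - I'. W i)) ` {S \<in> transv I W. J \<subseteq> S} \<subseteq> transv (I - I') W"
      using transv_restrict[of _ I W "I - I'"] by auto
    show "finite (transv (I - I') W)" using card_transv(1)[OF _ dis'(2)] fin fW by auto
  qed
  then have "real (card {S \<in> transv I W. J \<subseteq> S}) \<le> (\<Prod>i\<in>I - I'. real (card (W i)))"
    using card_transv(2)[OF _ dis'(2)] fin fW by (simp flip: of_nat_prod)
  moreover have "l ^ card J \<le> (\<Prod>i\<in>I'. real (card (W i)))"
    unfolding cJ using prod_mono[of I' "\<lambda>_. l" "\<lambda>i. real (card (W i))"] l by (auto simp: I'_def)
  ultimately have "real (card {S \<in> transv I W. J \<subseteq> S}) * l ^ card J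
      \<le> (\<Prod>i\<in>I - I'. real (card (W i))) * (\<Prod>i\<in>I'. real (card (W i)))"
    using l(2) by (intro mult_mono) (auto intro!: prod_nonneg)
  also have "\<dots> = (\<Prod>i\<in>I. real (card (W i)))"
    using fin prod.subset_diff[of I' I "\<lambda>i. real (card (W i))"] by (auto simp: I'_def)
  finally show ?thesis .
qed

section \<open>Crossing pairs inside a vertex set\<close>

definition cross :: "'a set set \<Rightarrow> 'a set \<Rightarrow> 'a set set" where
  "cross P A = {f. f \<subseteq> A \<and> card f = 2 \<and> (\<forall>V\<in>P. \<not> f \<subseteq> V)}"

lemma partition_graph_cross: "partition_graph P = cross P (\<Union>P)"
  by (simp add: partition_graph_def cross_def)

text \<open>Two clique events depend on each other only through the pairs spanned by their common
  vertices; all overlaps below are therefore indexed by a vertex set \<open>J\<close>.\<close>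

lemma cross_Int: "cross P A \<inter> cross P B = cross P (A \<inter> B)"
  by (auto simp: cross_def)

lemma cross_mono: "A \<subseteq> B \<Longrightarrow> cross P A \<subseteq> cross P B"
  by (auto simp: cross_def)

lemma finite_cross: "finite A \<Longrightarrow> finite (cross P A)"
  by (rule finite_subset[of _ "Pow A"]) (auto simp: cross_def)

lemma card_cross_le:
  assumes "finite A"
  shows "card (cross P A) \<le> card A choose 2"
  using card_mono[of "{f. f \<subseteq> A \<and> card f = 2}" "cross P A"] n_subsets[OF assms, of 2] assms
  by (auto simp: cross_def)

lemma transv_no_inner:
  assumes "S \<in> transv I (\<lambda>V. V)" "V \<in> I" "f \<subseteq> S" "f \<subseteq> V"
  shows "card f \<noteq> 2"
proof -
  have "card (S \<inter> V) = 1" using assms by (auto simp: transv_def)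
  then have "card f \<le> 1" using assms card_mono[of "S \<inter> V" f]
    by (metis Int_subset_iff card.infinite zero_neq_one)
  then show ?thesis by simp
qed

lemma cross_transv:
  assumes "S \<in> transv P (\<lambda>V. V)" "J \<subseteq> S"
  shows "cross P J = {f. f \<subseteq> J \<and> card f = 2}"
  using transv_no_inner[OF assms(1)] assms(2) by (fastforce simp: cross_def)

text \<open>\<open>e \<union> S\<close> is the vertex set of a potential clique over the inner edge
  \<open>e\<close>, and of its pairs only \<open>e\<close> is not crossing. This is the origin of
  the exponent \<open>(Suc r choose 2) - 1\<close> below.\<close>

lemma cross_extended_transv:
  assumes dis: "disjoint P" and V: "V \<in> P" "e \<subseteq> V" "card e = 2"
    and S: "S \<in> transv (P - {V}) (\<lambda>V. V)" and J: "J \<subseteq> e \<union> S"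
  shows "cross P J = {f. f \<subseteq> J \<and> card f = 2} - {e}"
proof -
  have "\<Union> (P - {V}) \<inter> V = {}" using dis V(1) unfolding disjoint_def by blast
  then have SV: "S \<inter> V = {}" using S unfolding transv_def by blast
  have "f = e" if f: "f \<subseteq> J" "card f = 2" "W \<in> P" "f \<subseteq> W" for f W
  proof (cases "W = V")
    case True
    then have "f \<subseteq> e" using f J SV by blast
    then show ?thesis using f V card_subset_eq[of e f] by (metis card.infinite zero_neq_numeral)
  next
    case False
    then have "W \<inter> V = {}" using f V dis by (simp add: disjoint_def)
    then have "f \<subseteq> S" using f J V by blast
    then show ?thesis using transv_no_inner[OF S, of W f] f False by auto
  qed
  then show ?thesis using V by (auto simp: cross_def)
qed

lemma card_cross_transv:
  assumes "S \<in> transv P (\<lambda>V. V)" "J \<subseteq> S" "finite J"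
  shows "card (cross P J) = card J choose 2"
  using cross_transv[OF assms(1,2)] n_subsets[OF assms(3)] by simp

lemma card_cross_extended_transv:
  assumes "disjoint P" "V \<in> P" "e \<subseteq> V" "card e = 2"
    and "S \<in> transv (P - {V}) (\<lambda>V. V)" "J \<subseteq> e \<union> S" "finite J" "e \<subseteq> J"
  shows "card (cross P J) = (card J choose 2) - 1"
proof -
  have "finite {f. f \<subseteq> J \<and> card f = 2}" using assms(7) by auto
  then show ?thesis
    using cross_extended_transv[OF assms(1-6)] n_subsets[OF assms(7), of 2] assms(4,8) by simp
qed

text \<open>A given pair lies in at most the fraction \<open>1 / l ^ 2\<close> of all transversals,
  so fewer than \<open>l ^ 2\<close> pairs cannot spoil every one. In the dense range
  \<open>Q\<close> is the set of missing crossing pairs.\<close>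

lemma transv_avoiding:
  assumes fin: "finite I" and dis: "disjoint_family_on W I" and fW: "\<forall>i\<in>I. finite (W i)"
    and l: "\<forall>i\<in>I. l \<le> real (card (W i))" "0 < l" and Q: "finite Q" "\<forall>f\<in>Q. card f = 2"
    and few: "real (card Q) < l ^ 2"
  shows "\<exists>S\<in>transv I W. \<forall>f\<in>Q. \<not> f \<subseteq> S"
proof (rule ccontr)
  assume "\<not> ?thesis"
  then have sub: "transv I W \<subseteq> (\<Union>f\<in>Q. {S \<in> transv I W. f \<subseteq> S})" by auto
  let ?X = "\<Prod>i\<in>I. real (card (W i))"
  have X: "?X = real (card (transv I W))" using card_transv[OF fin dis fW] by simp
  have pos: "?X > 0" using l by (intro prod_pos) force
  have ft: "finite (transv I W)" using card_transv[OF fin dis fW] by simp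
  have "card (transv I W) \<le> card (\<Union>f\<in>Q. {S \<in> transv I W. f \<subseteq> S})"
    using ft Q by (intro card_mono[OF _ sub]) auto
  also have "\<dots> \<le> (\<Sum>f\<in>Q. card {S \<in> transv I W. f \<subseteq> S})" using Q by (intro card_UN_le)
  finally have "?X * l ^ 2 \<le> (\<Sum>f\<in>Q. real (card {S \<in> transv I W. f \<subseteq> S}) * l ^ 2)"
    unfolding X sum_distrib_right[symmetric] of_nat_sum[symmetric]
    by (intro mult_right_mono of_nat_mono) auto
  also have "\<dots> \<le> (\<Sum>f\<in>Q. ?X)"
    using transv_count_superset[OF fin dis fW l(1)] l Q by (intro sum_mono) (metis less_imp_le)
  also have "\<dots> = real (card Q) * ?X" by simp
  also have "\<dots> < l ^ 2 * ?X" using few pos by simp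
  finally show False by (simp add: mult.commute)
qed

section \<open>Inner edges at vertices of small inner degree\<close>

text \<open>For a clique over \<open>e0\<close> and a set \<open>J\<close> of its vertices, the left
  side bounds the expected weight of the kept cliques over edges of \<open>T\<close> that also
  contain \<open>J\<close>, given the crossing pairs of \<open>J\<close>. The three bounds on
  \<open>w\<close> match the three values of \<open>card (J \<inter> e)\<close>: the total weight
  for 0, the weight at a vertex for 1, the weight of one edge for 2. In the last case
  \<open>e\<close> is \<open>e0\<close> itself, and the inner pair saves a factor
  \<open>p\<close>.\<close>

lemma low_edge_sum:
  fixes n p \<tau> \<Lambda> :: real and r cJ :: nat
  assumes r: "2 \<le> r" and n: "n > 0" and p: "0 < p" "p \<le> 1"
    and pw2: "\<And>j. 2 \<le> j \<Longrightarrow> j \<le> r \<Longrightarrow> 1 \<le> n ^ (j - 2) * p ^ ((j choose 2) - 1)"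
    and pw3: "\<And>j. 3 \<le> j \<Longrightarrow> j \<le> r \<Longrightarrow> \<Lambda> \<le> n ^ (j - 2) * p ^ ((j choose 2) - 1)"
    and L: "\<Lambda> > 0"
    and T: "finite T" "\<forall>e\<in>T. card e = 2" and w: "\<forall>e\<in>T. 0 \<le> w e"
    and tau: "sum w T \<le> \<tau> * (n\<^sup>2 * p)" "\<forall>x. (\<Sum>e\<in>{e\<in>T. x \<in> e}. w e) \<le> \<tau> * (n * p)"
      "\<forall>e\<in>T. w e \<le> \<tau> * \<Lambda>" "0 \<le> \<tau>"
    and J: "finite J" "2 \<le> card J" "card J \<le> r" "cJ \<le> card J choose 2"
    and e: "e0 \<in> T" "\<And>e. e \<in> T \<Longrightarrow> e \<subseteq> J \<Longrightarrow> e = e0 \<and> 3 \<le> card J \<and> cJ \<le> (card J choose 2) - 1"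
  shows "(\<Sum>e\<in>T. w e / ((n / (2 * real r)) ^ card (J - e) * p ^ cJ)) \<le> (real r + 2) * (2 * real r) ^ r * \<tau>"
proof -
  define j where "j = card J"
  define C where "C = j choose 2"
  have j: "2 \<le> j" "j \<le> r" using J j_def by auto
  have C1: "C \<ge> 1" using j unfolding C_def by (simp add: Suc_leI)
  define l where "l = n / (2 * real r)"
  have l: "l > 0" using n r by (simp add: l_def)
  have r1: "1 \<le> 2 * real r" using r by simp
  let ?K = "(2 * real r) ^ r"
  have lp: "1 / l ^ i \<le> ?K / n ^ i" if "i \<le> r" for i
  proof -
    have "(2 * real r) ^ i \<le> ?K" using r1 that by (intro power_increasing) auto
    then show ?thesis unfolding l_def using n by (simp add: power_divide divide_right_mono)
  qed
  have pc: "1 / p ^ i \<le> 1 / p ^ i'" if "i \<le> i'" for i i'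
    using p that by (intro divide_left_mono power_decreasing mult_pos_pos) auto
  have K0: "?K \<ge> 0" using r by simp
  \<comment> \<open>The factor split off is the one in the bound on the total weight, and what
    remains is at least 1 by \<open>pw2\<close>; \<open>jb\<close> does the same with the factor in
    the bound at a vertex.\<close>
  have ja: "n ^ j * p ^ C = (n\<^sup>2 * p) * (n ^ (j - 2) * p ^ (C - 1))"
  proof -
    have "n ^ j = n\<^sup>2 * n ^ (j - 2)" using j(1) by (metis le_add_diff_inverse power_add)
    moreover have "p ^ C = p * p ^ (C - 1)" using C1 by (simp flip: power_Suc)
    ultimately show ?thesis by simp
  qed
  have jb: "n ^ (j - 1) * p ^ C = (n * p) * (n ^ (j - 2) * p ^ (C - 1))"
  proof -
    have "j - 1 = Suc (j - 2)" using j(1) by simp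
    then have "n ^ (j - 1) = n * n ^ (j - 2)" by simp
    moreover have "p ^ C = p * p ^ (C - 1)" using C1 by (simp flip: power_Suc)
    ultimately show ?thesis by simp
  qed
  have p2: "1 \<le> n ^ (j - 2) * p ^ (C - 1)" using pw2[OF j] C_def by simp
  have A: "1 / (l ^ j * p ^ cJ) \<le> ?K / (n\<^sup>2 * p)"
  proof -
    have "1 / (l ^ j * p ^ cJ) = 1 / l ^ j * (1 / p ^ cJ)" by simp
    also have "\<dots> \<le> ?K / n ^ j * (1 / p ^ C)"
      using lp[OF j(2)] pc[of cJ C] J(4) l p K0 n C_def j_def by (intro mult_mono) auto
    also have "\<dots> = ?K / ((n\<^sup>2 * p) * (n ^ (j - 2) * p ^ (C - 1)))" using ja by simp
    also have "\<dots> \<le> ?K / (n\<^sup>2 * p)"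
      using mult_left_mono[OF p2, of "n\<^sup>2 * p"] n p K0 by (intro divide_left_mono mult_pos_pos) auto
    finally show ?thesis .
  qed
  have B: "1 / (l ^ (j - 1) * p ^ cJ) \<le> ?K / (n * p)"
  proof -
    have "1 / (l ^ (j - 1) * p ^ cJ) = 1 / l ^ (j - 1) * (1 / p ^ cJ)" by simp
    also have "\<dots> \<le> ?K / n ^ (j - 1) * (1 / p ^ C)"
      using lp[of "j - 1"] pc[of cJ C] J(4) l p K0 n C_def j_def j by (intro mult_mono) auto
    also have "\<dots> = ?K / ((n * p) * (n ^ (j - 2) * p ^ (C - 1)))" using jb by simp
    also have "\<dots> \<le> ?K / (n * p)"
      using mult_left_mono[OF p2, of "n * p"] n p K0 by (intro divide_left_mono mult_pos_pos) auto
    finally show ?thesis .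
  qed
  have Cc: "1 / (l ^ (j - 2) * p ^ cJ) \<le> ?K / \<Lambda>" if "3 \<le> j" "cJ \<le> C - 1"
  proof -
    have "1 / (l ^ (j - 2) * p ^ cJ) = 1 / l ^ (j - 2) * (1 / p ^ cJ)" by simp
    also have "\<dots> \<le> ?K / n ^ (j - 2) * (1 / p ^ (C - 1))"
      using lp[of "j - 2"] pc[OF that(2)] l p K0 n j by (intro mult_mono) auto
    also have "\<dots> = ?K / (n ^ (j - 2) * p ^ (C - 1))" by simp
    also have "\<dots> \<le> ?K / \<Lambda>"
      using pw3[OF that(1) j(2)] n p K0 L C_def by (intro divide_left_mono mult_pos_pos) auto
    finally show ?thesis .
  qed
  let ?t0 = "\<lambda>e. w e * (?K / (n\<^sup>2 * p))"
  let ?t1 = "\<lambda>e. \<Sum>x\<in>J. if x \<in> e then w e * (?K / (n * p)) else 0"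
  let ?t2 = "\<lambda>e. if e = e0 then w e0 * (?K / \<Lambda>) else 0"
  have edge_le: "w e / (l ^ card (J - e) * p ^ cJ) \<le> ?t0 e + ?t1 e + ?t2 e" if eT: "e \<in> T" for e
  proof -
    have w0: "0 \<le> w e" using w eT by auto
    have t0: "0 \<le> ?t0 e" using w0 K0 n p by simp
    have t1: "0 \<le> ?t1 e" using w0 K0 n p by (intro sum_nonneg) auto
    have t2: "0 \<le> ?t2 e" using w e(1) K0 L by simp
    have c2: "card e = 2" "finite e" using T eT by (auto simp: card_ge_0_finite)
    have cJe: "card (J - e) = j - card (J \<inter> e)" using J(1) by (simp add: card_Diff_subset_Int j_def)
    have "card (J \<inter> e) \<le> 2" using c2 by (metis Int_lower2 card_mono)
    then consider "card (J \<inter> e) = 0" | "card (J \<inter> e) = 1" | "card (J \<inter> e) = 2" by linarith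
    then show ?thesis
    proof cases
      case 1
      then have "w e / (l ^ card (J - e) * p ^ cJ) = w e * (1 / (l ^ j * p ^ cJ))" using cJe by simp
      also have "\<dots> \<le> ?t0 e" using A w0 by (intro mult_left_mono)
      finally show ?thesis using t1 t2 by linarith
    next
      case 2
      then obtain x where x: "x \<in> J" "x \<in> e" by (metis IntE card_1_singletonE singletonI)
      have "w e / (l ^ card (J - e) * p ^ cJ) = w e * (1 / (l ^ (j - 1) * p ^ cJ))" using cJe 2 by simp
      also have "\<dots> \<le> w e * (?K / (n * p))" using B w0 by (intro mult_left_mono)
      also have "\<dots> = (if x \<in> e then w e * (?K / (n * p)) else 0)" using x by simp
      also have "\<dots> \<le> ?t1 e"
        using x J(1) w0 K0 n p by (intro member_le_sum) auto
      finally show ?thesis using t0 t2 by linarith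
    next
      case 3
      then have "J \<inter> e = e" using c2 by (metis Int_lower2 card_subset_eq)
      then have "e \<subseteq> J" by auto
      note ee = e(2)[OF eT this]
      have "w e / (l ^ card (J - e) * p ^ cJ) = w e * (1 / (l ^ (j - 2) * p ^ cJ))" using cJe 3 by simp
      also have "\<dots> \<le> w e * (?K / \<Lambda>)" using Cc ee w0 C_def j_def by (intro mult_left_mono) auto
      also have "\<dots> = ?t2 e" using ee by simp
      finally show ?thesis using t0 t1 by linarith
    qed
  qed
  have "(\<Sum>e\<in>T. w e / (l ^ card (J - e) * p ^ cJ)) \<le> (\<Sum>e\<in>T. ?t0 e + ?t1 e + ?t2 e)"
    using edge_le by (rule sum_mono)
  also have "\<dots> = (\<Sum>e\<in>T. ?t0 e) + (\<Sum>e\<in>T. ?t1 e) + (\<Sum>e\<in>T. ?t2 e)" by (simp add: sum.distrib)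
  also have "(\<Sum>e\<in>T. ?t0 e) \<le> ?K * \<tau>"
  proof -
    have "(\<Sum>e\<in>T. ?t0 e) = sum w T * (?K / (n\<^sup>2 * p))" by (simp only: sum_distrib_right)
    also have "\<dots> \<le> (\<tau> * (n\<^sup>2 * p)) * (?K / (n\<^sup>2 * p))" using tau(1) K0 n p by (intro mult_right_mono) auto
    also have "\<dots> = ?K * \<tau>" using n p by simp
    finally show ?thesis .
  qed
  also have "(\<Sum>e\<in>T. ?t1 e) \<le> real r * (?K * \<tau>)"
  proof -
    have "(\<Sum>e\<in>T. ?t1 e) = (\<Sum>x\<in>J. \<Sum>e\<in>T. if x \<in> e then w e * (?K / (n * p)) else 0)" by (rule sum.swap)
    also have "\<dots> = (\<Sum>x\<in>J. (\<Sum>e\<in>{e\<in>T. x \<in> e}. w e) * (?K / (n * p)))"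
      unfolding sum_distrib_right using T(1) by (intro sum.cong refl sum.inter_filter[symmetric])
    also have "\<dots> \<le> (\<Sum>x\<in>J. (\<tau> * (n * p)) * (?K / (n * p)))"
      using tau(2) K0 n p by (intro sum_mono mult_right_mono) auto
    also have "\<dots> = real j * (?K * \<tau>)" using n p by (simp add: j_def)
    also have "\<dots> \<le> real r * (?K * \<tau>)" using j K0 tau by (intro mult_right_mono) auto
    finally show ?thesis .
  qed
  also have "(\<Sum>e\<in>T. ?t2 e) \<le> ?K * \<tau>"
  proof -
    have "(\<Sum>e\<in>T. ?t2 e) = w e0 * (?K / \<Lambda>)" using T(1) e(1) by (simp add: sum.delta)
    also have "\<dots> \<le> (\<tau> * \<Lambda>) * (?K / \<Lambda>)" using tau(3) e(1) K0 L by (intro mult_right_mono) auto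
    also have "\<dots> = ?K * \<tau>" using L by simp
    finally show ?thesis .
  qed
  finally show ?thesis unfolding l_def by (simp add: algebra_simps)
qed

text \<open>The events are the sets of crossing pairs that complete an edge of \<open>T\<close> to a
  clique. An event over \<open>e\<close> is kept with the probability that makes the expected number
  of cliques kept over \<open>e\<close> equal to \<open>w e\<close>; \<open>wM\<close> says that
  this probability is at most 1. The weights are thus free parameters, and \<open>tau\<close> keeps
  the correlations below a small fraction of the main term.\<close>

lemma low_janson:
  fixes P :: "'a set set" and n p \<tau> \<Lambda> :: real and r :: nat
  assumes P: "finite P" "disjoint P" "\<forall>V\<in>P. finite V" "card P = r" and r: "2 \<le> r"
    and size: "\<forall>V\<in>P. n / (2 * real r) \<le> real (card V)" and n: "n > 0" and p: "0 < p" "p \<le> 1"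
    and pw2: "\<And>j. 2 \<le> j \<Longrightarrow> j \<le> r \<Longrightarrow> 1 \<le> n ^ (j - 2) * p ^ ((j choose 2) - 1)"
    and pw3: "\<And>j. 3 \<le> j \<Longrightarrow> j \<le> r \<Longrightarrow> \<Lambda> \<le> n ^ (j - 2) * p ^ ((j choose 2) - 1)"
    and L: "\<Lambda> > 0"
    and T: "finite T" "\<forall>e\<in>T. card e = 2 \<and> (\<exists>V\<in>P. e \<subseteq> V)" and w: "\<forall>e\<in>T. 0 \<le> w e"
    and wM: "\<forall>e\<in>T. \<forall>V\<in>P. w e \<le> (\<Prod>W\<in>P - {V}. real (card W)) * p ^ ((Suc r choose 2) - 1)"
    and tau: "sum w T \<le> \<tau> * (n\<^sup>2 * p)" "\<forall>x. (\<Sum>e\<in>{e\<in>T. x \<in> e}. w e) \<le> \<tau> * (n * p)"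
      "\<forall>e\<in>T. w e \<le> \<tau> * \<Lambda>" "0 \<le> \<tau>"
  shows "rprob (cross P (\<Union>P)) (\<lambda>_. p)
      (\<lambda>R. \<forall>e\<in>T. \<forall>V\<in>P. e \<subseteq> V \<longrightarrow> (\<forall>S\<in>transv (P - {V}) (\<lambda>V. V). \<not> cross P (e \<union> S) \<subseteq> R))
    \<le> exp (- ((1 - 2 ^ r * ((real r + 2) * (2 * real r) ^ r * \<tau>)) * sum w T))"
proof -
  define part where "part = (\<lambda>e. SOME V. V \<in> P \<and> e \<subseteq> V)"
  have part: "part e \<in> P \<and> e \<subseteq> part e" if "e \<in> T" for e
    unfolding part_def using T(2) that by (metis (mono_tags, lifting) someI_ex)
  define tr where "tr = (\<lambda>e. transv (P - {part e}) (\<lambda>V. V))"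
  define X where "X = (\<lambda>e. \<Prod>W\<in>P - {part e}. real (card W))"
  define k where "k = (Suc r choose 2) - 1"
  define I where "I = (SIGMA e:T. tr e)"
  define B where "B = (\<lambda>(e, S). cross P (e \<union> S))"
  define q where "q = (\<lambda>(e, S :: 'a set). w e / (X e * p ^ k))"
  define G where "G = (real r + 2) * (2 * real r) ^ r * \<tau>"
  define l where "l = n / (2 * real r)"
  have l: "l > 0" using n r by (simp add: l_def)
  have X0: "X e > 0" for e unfolding X_def using size l by (intro prod_pos) (force simp: l_def)
  have disP: "disjoint_family_on (\<lambda>V. V) (P - {V})" for V
    using P(2) by (auto simp: disjoint_family_on_def disjoint_def)
  have finT: "finite (tr e)" and cardT: "real (card (tr e)) = X e" for e
    unfolding tr_def X_def using card_transv[OF _ disP] P by auto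
  have finI: "finite I" unfolding I_def using T finT by auto
  have elem: "finite S" "card S = r - 1" "e \<inter> S = {}" "finite (e \<union> S)" "card (e \<union> S) = Suc r" "e \<union> S \<subseteq> \<Union>P"
    "card e = 2" if "e \<in> T" "S \<in> tr e" for e S
  proof -
    have fe: "finite e" and ce: "card e = 2" using T that by (auto simp: card_ge_0_finite)
    show "finite S" and cS: "card S = r - 1"
      using transv_elem[OF _ disP] that P part[of e] unfolding tr_def by auto
    have SP: "S \<subseteq> \<Union>(P - {part e})" using that unfolding tr_def transv_def by auto
    have "\<Union>(P - {part e}) \<inter> part e = {}" using P(2) part[OF that(1)] unfolding disjoint_def by blast
    then show eS: "e \<inter> S = {}" using SP part[OF that(1)] by blast
    show "finite (e \<union> S)" using fe \<open>finite S\<close> by simp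
    show "card (e \<union> S) = Suc r" using card_Un_disjoint[OF fe \<open>finite S\<close> eS] ce cS r by simp
    show "e \<union> S \<subseteq> \<Union>P" using SP part[OF that(1)] by blast
    show "card e = 2" by (rule ce)
  qed
  have crossJ: "cross P J = {f. f \<subseteq> J \<and> card f = 2} - {e}" if "e \<in> T" "S \<in> tr e" "J \<subseteq> e \<union> S" for e S J
    using cross_extended_transv[OF P(2) _ _ _ _ that(3)] part[OF that(1)] elem(7)[OF that(1,2)] that(2)
    unfolding tr_def by blast
  have inner: "e' = e" if "e \<in> T" "S \<in> tr e" "e' \<in> T" "e' \<subseteq> e \<union> S" for e S e'
  proof (rule ccontr)
    assume "e' \<noteq> e"
    then have "e' \<in> cross P (e \<union> S)" using crossJ[OF that(1,2) subset_refl] that T by auto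
    then show False using part[OF that(3)] by (auto simp: cross_def)
  qed
  have cardB: "card (B i) = k" if iI: "i \<in> I" for i
  proof -
    obtain e S where i: "i = (e, S)" "e \<in> T" "S \<in> tr e" using iI unfolding I_def by auto
    show ?thesis unfolding B_def i k_def
      using card_cross_extended_transv[OF P(2) _ _ _ _ subset_refl elem(4)[OF i(2,3)] Un_upper1]
        part[OF i(2)] elem(7)[OF i(2,3)] elem(5)[OF i(2,3)] i(3) unfolding tr_def by fastforce
  qed
  have q01: "0 \<le> q i \<and> q i \<le> 1" if iI: "i \<in> I" for i
  proof -
    obtain e S where i: "i = (e, S)" "e \<in> T" "S \<in> tr e" using iI unfolding I_def by auto
    have "w e \<le> X e * p ^ k" using wM i(2) part[OF i(2)] unfolding X_def k_def by blast
    then show ?thesis using w i X0[of e] p unfolding q_def by (simp add: divide_le_eq)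
  qed
  have qsum: "(\<Sum>i\<in>I. q i * p ^ card (B i)) = sum w T"
  proof -
    have "(\<Sum>i\<in>I. q i * p ^ card (B i)) = (\<Sum>i\<in>I. q i * p ^ k)" using cardB by (intro sum.cong) auto
    also have "\<dots> = (\<Sum>e\<in>T. \<Sum>S\<in>tr e. w e / (X e * p ^ k) * p ^ k)"
      unfolding I_def q_def using T finT by (subst sum.Sigma) (auto intro!: sum.cong)
    also have "\<dots> = sum w T" using cardT X0 p by (intro sum.cong refl) (simp add: less_imp_neq[THEN not_sym])
    finally show ?thesis .
  qed
  have loc: "(\<Sum>j\<in>I - {i}. if B i \<inter> B j \<noteq> {} then q j * p ^ card (B j - B i) else 0) \<le> 2 * (2 ^ r * G)"
    if iI: "i \<in> I" for i
  proof -
    obtain e S where i: "i = (e, S)" "e \<in> T" "S \<in> tr e" using iI unfolding I_def by auto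
    define A where "A = e \<union> S"
    have A: "finite A" "card A = Suc r" using elem[OF i(2,3)] A_def by auto
    \<comment> \<open>The possible overlaps with the vertex set \<open>A\<close> of the given event.
      There are at most \<open>2 ^ Suc r\<close> of them; half of this number appears in the final
      bound because \<open>janson_thinned\<close> works with \<open>2 * c\<close>.\<close>
    define Js where "Js = {J. J \<subseteq> A \<and> J \<noteq> A \<and> cross P J \<noteq> {}}"
    have finJs: "finite Js" unfolding Js_def using A by auto
    have cJs: "card Js \<le> 2 ^ Suc r"
      using card_mono[of "Pow A" Js] A by (auto simp: Js_def card_Pow)
    let ?h = "\<lambda>j J. if J \<subseteq> fst j \<union> snd j then q j * p ^ k / p ^ card (cross P J) else 0"
    have h0: "0 \<le> ?h j J" if "j \<in> I" for j J using q01[OF that] p by simp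
    have "(if B i \<inter> B j \<noteq> {} then q j * p ^ card (B j - B i) else 0) \<le> (\<Sum>J\<in>Js. ?h j J)"
      if j: "j \<in> I - {i}" for j
    proof (cases "B i \<inter> B j \<noteq> {}")
      case True
      obtain e' S' where j': "j = (e', S')" "e' \<in> T" "S' \<in> tr e'" using j unfolding I_def by auto
      define A' where "A' = e' \<union> S'"
      define J where "J = A \<inter> A'"
      have BB: "B i \<inter> B j = cross P J"
        unfolding B_def i j' J_def A_def A'_def by (simp add: cross_Int)
      \<comment> \<open>Equal vertex sets contain the same inner edge of \<open>T\<close>, hence
        belong to the same event.\<close>
      have "J \<noteq> A"
      proof
        assume "J = A"
        then have "A \<subseteq> A'" using J_def by auto
        moreover have "card A' = Suc r" "finite A'" using elem[OF j'(2,3)] A'_def by auto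
        ultimately have "A = A'" using A by (metis card_subset_eq)
        then have "e' = e" using inner[OF i(2,3) j'(2)] A_def A'_def by auto
        moreover have "S' = A' - e'" "S = A - e" using elem(3)[OF i(2,3)] elem(3)[OF j'(2,3)] A_def A'_def by auto
        ultimately show False using j i j' \<open>A = A'\<close> by auto
      qed
      then have JJ: "J \<in> Js" using True BB J_def Js_def by auto
      have fB: "finite (B j)" using finite_cross[OF elem(4)[OF j'(2,3)]] by (simp add: B_def j')
      have "card (cross P J) \<le> k" and "card (B j - B i) = k - card (cross P J)"
      proof -
        have "cross P J \<subseteq> B j" using BB by auto
        then show "card (cross P J) \<le> k" using card_mono[OF fB] cardB j by auto
        have "B j - B i = B j - cross P J" using BB by auto
        then show "card (B j - B i) = k - card (cross P J)"
          using \<open>cross P J \<subseteq> B j\<close> fB cardB[of j] j by (simp add: card_Diff_subset finite_subset)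
      qed
      then have "q j * p ^ card (B j - B i) = q j * p ^ k / p ^ card (cross P J)"
        using p by (simp add: power_diff)
      also have "\<dots> = ?h j J" unfolding J_def A'_def j' by simp
      also have "\<dots> \<le> (\<Sum>J\<in>Js. ?h j J)"
        using JJ finJs h0[of j] j by (intro member_le_sum) auto
      finally show ?thesis using True by simp
    next
      case False
      then show ?thesis using h0[of j] j by (simp add: sum_nonneg)
    qed
    then have "(\<Sum>j\<in>I - {i}. if B i \<inter> B j \<noteq> {} then q j * p ^ card (B j - B i) else 0)
       \<le> (\<Sum>j\<in>I - {i}. \<Sum>J\<in>Js. ?h j J)" by (rule sum_mono)
    also have "\<dots> \<le> (\<Sum>j\<in>I. \<Sum>J\<in>Js. ?h j J)"
      using finI h0 by (intro sum_mono2) (auto intro!: sum_nonneg)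
    also have "\<dots> = (\<Sum>J\<in>Js. \<Sum>j\<in>I. ?h j J)" by (rule sum.swap)
    also have "\<dots> \<le> (\<Sum>J\<in>Js. G)"
    proof (rule sum_mono)
      fix J assume J: "J \<in> Js"
      define c where "c = card (cross P J)"
      have JA: "J \<subseteq> A" "J \<noteq> A" "finite J" "J \<subset> A" using J Js_def A finite_subset by auto
      have J2: "2 \<le> card J"
      proof -
        obtain f where "f \<subseteq> J" "card f = 2" using J by (auto simp: Js_def cross_def)
        then show ?thesis using card_mono[OF JA(3) \<open>f \<subseteq> J\<close>] by simp
      qed
      have Jr: "card J \<le> r" using psubset_card_mono[OF A(1) JA(4)] A(2) by simp
      have "(\<Sum>j\<in>I. ?h j J) = (\<Sum>e'\<in>T. \<Sum>S'\<in>tr e'. ?h (e', S') J)"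
        unfolding I_def using T finT by (subst sum.Sigma) (auto intro!: sum.cong)
      also have "\<dots> \<le> (\<Sum>e'\<in>T. w e' / (l ^ card (J - e') * p ^ c))"
      proof (rule sum_mono)
        fix e' assume e': "e' \<in> T"
        have w0: "0 \<le> w e'" using w e' by auto
        have "(\<Sum>S'\<in>tr e'. ?h (e', S') J) = (\<Sum>S'\<in>{S'\<in>tr e'. J \<subseteq> e' \<union> S'}. w e' / X e' / p ^ c)"
          unfolding sum.inter_filter[OF finT] using p by (intro sum.cong refl) (simp add: q_def c_def)
        also have "\<dots> = real (card {S'\<in>tr e'. J \<subseteq> e' \<union> S'}) * (w e' / X e' / p ^ c)" by simp
        also have "\<dots> \<le> (X e' / l ^ card (J - e')) * (w e' / X e' / p ^ c)"
        proof (rule mult_right_mono)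
          have "card {S'\<in>tr e'. J \<subseteq> e' \<union> S'} \<le> card {S'\<in>tr e'. J - e' \<subseteq> S'}"
            using finT by (intro card_mono) auto
          then have "real (card {S'\<in>tr e'. J \<subseteq> e' \<union> S'}) * l ^ card (J - e')
              \<le> real (card {S'\<in>tr e'. J - e' \<subseteq> S'}) * l ^ card (J - e')"
            using l by (intro mult_right_mono) auto
          also have "\<dots> \<le> X e'"
            unfolding tr_def X_def
            by (rule transv_count_superset[OF _ disP]) (use P size l in \<open>auto simp: l_def\<close>)
          finally show "real (card {S'\<in>tr e'. J \<subseteq> e' \<union> S'}) \<le> X e' / l ^ card (J - e')"
            using l by (simp add: pos_le_divide_eq)
          show "0 \<le> w e' / X e' / p ^ c" using w0 X0[of e'] p by simp
        qed
        also have "\<dots> = w e' / (l ^ card (J - e') * p ^ c)" using X0[of e'] by simp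
        finally show "(\<Sum>S'\<in>tr e'. ?h (e', S') J) \<le> w e' / (l ^ card (J - e') * p ^ c)" .
      qed
      also have "\<dots> \<le> G" unfolding G_def l_def
      proof (rule low_edge_sum[OF r n p pw2 pw3 L T(1) _ w tau JA(3) J2 Jr])
        show "\<forall>e\<in>T. card e = 2" using T by auto
        show "c \<le> card J choose 2" unfolding c_def by (rule card_cross_le[OF JA(3)])
        show "e \<in> T" by (rule i)
        fix e' assume e': "e' \<in> T" "e' \<subseteq> J"
        have ee: "e' = e" using inner[OF i(2,3) e'(1)] e'(2) JA A_def by auto
        have cc: "c = (card J choose 2) - 1" unfolding c_def
          using card_cross_extended_transv[OF P(2) _ _ _ _ _ JA(3), of "part e" e S] part[OF i(2)]
            elem(7)[OF i(2,3)] i(3) JA A_def e'(2) ee unfolding tr_def by auto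
        \<comment> \<open>Here \<open>J\<close> contains the inner edge; if it were just that edge,
          it would span no crossing pair.\<close>
        have "card J \<noteq> 2"
        proof
          assume "card J = 2"
          then have "c = 0" using cc by simp
          then show False using J finite_cross[OF JA(3)] by (auto simp: c_def Js_def)
        qed
        then show "e' = e \<and> 3 \<le> card J \<and> c \<le> (card J choose 2) - 1" using ee cc J2 by auto
      qed
      finally show "(\<Sum>j\<in>I. ?h j J) \<le> G" .
    qed
    also have "\<dots> = real (card Js) * G" by simp
    also have "\<dots> \<le> 2 ^ Suc r * G"
    proof (rule mult_right_mono)
      show "real (card Js) \<le> 2 ^ Suc r" using cJs by (metis of_nat_le_iff of_nat_numeral of_nat_power)
      show "0 \<le> G" unfolding G_def using tau by simp
    qed
    finally show ?thesis by simp
  qed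
  have "rprob (cross P (\<Union>P)) (\<lambda>_. p) (\<lambda>R. \<forall>i\<in>I. \<not> B i \<subseteq> R)
      \<le> exp (- ((1 - 2 ^ r * G) * (\<Sum>i\<in>I. q i * p ^ card (B i))))"
  proof (rule janson_thinned[OF _ _ p(2) finI])
    show "finite (cross P (\<Union>P))" using P by (intro finite_cross) auto
    show "\<forall>j\<in>I. B j \<subseteq> cross P (\<Union>P)"
    proof
      fix j assume "j \<in> I"
      then obtain e S where j: "j = (e, S)" "e \<in> T" "S \<in> tr e" by (auto simp: I_def)
      then show "B j \<subseteq> cross P (\<Union>P)" using cross_mono[OF elem(6)[OF j(2,3)], of P] by (simp add: B_def)
    qed
  qed (use p q01 loc in auto)
  moreover have "rprob (cross P (\<Union>P)) (\<lambda>_. p)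
      (\<lambda>R. \<forall>e\<in>T. \<forall>V\<in>P. e \<subseteq> V \<longrightarrow> (\<forall>S\<in>transv (P - {V}) (\<lambda>V. V). \<not> cross P (e \<union> S) \<subseteq> R))
    \<le> rprob (cross P (\<Union>P)) (\<lambda>_. p) (\<lambda>R. \<forall>i\<in>I. \<not> B i \<subseteq> R)"
    by (rule rprob_mono) (use p part in \<open>auto simp: I_def B_def tr_def\<close>)
  ultimately show ?thesis unfolding qsum G_def by linarith
qed

text \<open>Stars are split off in order of decreasing degree; this keeps the inverse square roots of the
  star sizes summable at every vertex.\<close>

lemma star_decomposition:
  fixes T :: "'a set set" and d :: nat
  assumes "finite T" "\<forall>e\<in>T. card e = 2"
  shows "\<exists>c. (\<forall>e\<in>T. c e \<in> e) \<and> (\<forall>x.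
    (\<Sum>e\<in>{e\<in>T. x \<in> e \<and> card {f\<in>T. c f = c e} \<le> d}. 1 / sqrt (real (card {f\<in>T. c f = c e})))
      \<le> 2 * sqrt (real (min (card {e\<in>T. x \<in> e}) d)))"
  using assms
proof (induction "card T" arbitrary: T rule: less_induct)
  case less
  note fin = less.prems(1)
  let ?dg = "\<lambda>T x. card {e\<in>T. x \<in> e}"
  show ?case
  proof (cases "T = {}")
    case True
    then show ?thesis by auto
  next
    case False
    have fU: "finite (\<Union>T)" using fin less.prems(2) by (auto simp: card_ge_0_finite)
    have neU: "\<Union>T \<noteq> {}" using False less.prems(2) by (metis Union_empty_conv card.empty ex_in_conv zero_neq_numeral)
    obtain v where v: "v \<in> \<Union>T" "\<forall>x\<in>\<Union>T. ?dg T x \<le> ?dg T v"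
    proof -
      have "Max (?dg T ` \<Union>T) \<in> ?dg T ` \<Union>T" using fU neU by simp
      then obtain v where "v \<in> \<Union>T" "?dg T v = Max (?dg T ` \<Union>T)" by (metis (no_types, lifting) imageE)
      then show ?thesis using that[of v] Max_ge[of "?dg T ` \<Union>T"] fU by auto
    qed
    have vmax: "?dg T x \<le> ?dg T v" for x
    proof (cases "x \<in> \<Union>T")
      case False
      then have "{e\<in>T. x \<in> e} = {}" by auto
      then show ?thesis by (simp only: card.empty)
    qed (use v in auto)
    define T1 where "T1 = {e\<in>T. v \<notin> e}"
    have "T1 \<subset> T" using v T1_def by auto
    then have "card T1 < card T" using fin by (simp add: psubset_card_mono)
    moreover have "finite T1" "\<forall>e\<in>T1. card e = 2" using fin less.prems T1_def by auto
    ultimately obtain c1 where c1: "\<forall>e\<in>T1. c1 e \<in> e"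
      "\<And>x. (\<Sum>e\<in>{e\<in>T1. x \<in> e \<and> card {f\<in>T1. c1 f = c1 e} \<le> d}. 1 / sqrt (real (card {f\<in>T1. c1 f = c1 e})))
      \<le> 2 * sqrt (real (min (?dg T1 x) d))"
      using less.hyps[of T1] by blast
    define c where "c = (\<lambda>e. if v \<in> e then v else c1 e)"
    define a where "a = ?dg T v"
    have cT: "\<forall>e\<in>T. c e \<in> e" using c1(1) by (auto simp: c_def T1_def)
    have cv: "c e = v \<longleftrightarrow> v \<in> e" if "e \<in> T" for e using that c1(1) by (auto simp: c_def T1_def)
    have av: "card {f\<in>T. c f = c e} = a" if "e \<in> T" "v \<in> e" for e
    proof -
      have "{f\<in>T. c f = c e} = {f\<in>T. v \<in> f}" using cv[OF that(1)] that cv by auto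
      then show ?thesis by (simp add: a_def)
    qed
    have a1: "card {f\<in>T. c f = c e} = card {f\<in>T1. c1 f = c1 e}" if "e \<in> T1" for e
    proof -
      have "{f\<in>T. c f = c e} = {f\<in>T1. c1 f = c1 e}" using that c1(1) by (auto simp: c_def T1_def)
      then show ?thesis by simp
    qed
    have apos: "a > 0" unfolding a_def using v fin by (auto simp: card_gt_0_iff)
    have main: "(\<Sum>e\<in>{e\<in>T. x \<in> e \<and> card {f\<in>T. c f = c e} \<le> d}. 1 / sqrt (real (card {f\<in>T. c f = c e})))
      \<le> 2 * sqrt (real (min (?dg T x) d))" for x
    proof -
      let ?S1 = "{e\<in>T1. x \<in> e \<and> card {f\<in>T1. c1 f = c1 e} \<le> d}"
      let ?S2 = "{e\<in>T. v \<in> e \<and> x \<in> e \<and> a \<le> d}"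
      have split: "{e\<in>T. x \<in> e \<and> card {f\<in>T. c f = c e} \<le> d} = ?S1 \<union> ?S2"
      proof (rule set_eqI)
        fix e
        have "e \<in> T1 \<longleftrightarrow> e \<in> T \<and> v \<notin> e" by (simp add: T1_def)
        then show "e \<in> {e\<in>T. x \<in> e \<and> card {f\<in>T. c f = c e} \<le> d} \<longleftrightarrow> e \<in> ?S1 \<union> ?S2"
          using a1[of e] av[of e] by (cases "v \<in> e") auto
      qed
      have "(\<Sum>e\<in>{e\<in>T. x \<in> e \<and> card {f\<in>T. c f = c e} \<le> d}. 1 / sqrt (real (card {f\<in>T. c f = c e})))
        = (\<Sum>e\<in>?S1. 1 / sqrt (real (card {f\<in>T. c f = c e}))) + (\<Sum>e\<in>?S2. 1 / sqrt (real (card {f\<in>T. c f = c e})))"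
        unfolding split using fin by (intro sum.union_disjoint) (auto simp: T1_def)
      also have "(\<Sum>e\<in>?S1. 1 / sqrt (real (card {f\<in>T. c f = c e}))) = (\<Sum>e\<in>?S1. 1 / sqrt (real (card {f\<in>T1. c1 f = c1 e})))"
        using a1 by (intro sum.cong) auto
      also have "\<dots> \<le> 2 * sqrt (real (min (?dg T1 x) d))" by (rule c1(2))
      also have "(\<Sum>e\<in>?S2. 1 / sqrt (real (card {f\<in>T. c f = c e}))) = real (card ?S2) / sqrt (real a)"
        using av by simp
      finally have le: "(\<Sum>e\<in>{e\<in>T. x \<in> e \<and> card {f\<in>T. c f = c e} \<le> d}. 1 / sqrt (real (card {f\<in>T. c f = c e})))
         \<le> 2 * sqrt (real (min (?dg T1 x) d)) + real (card ?S2) / sqrt (real a)" by simp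
      have mono: "?dg T1 x \<le> ?dg T x" using fin by (intro card_mono) (auto simp: T1_def)
      show ?thesis
      proof (cases "?S2 = {}")
        case True
        have "2 * sqrt (real (min (?dg T1 x) d)) \<le> 2 * sqrt (real (min (?dg T x) d))" using mono by auto
        moreover have "real (card ?S2) / sqrt (real a) = 0" unfolding True by simp
        ultimately show ?thesis using le by linarith
      next
        case False
        \<comment> \<open>A star counted here has size at most \<open>d\<close>, so by maximality of
          \<open>v\<close> all degrees are at most \<open>d\<close> and the minimum with
          \<open>d\<close> is the degree itself.\<close>
        then have ad: "a \<le> d" by auto
        show ?thesis
        proof (cases "x = v")
          case True
          have "{e\<in>T1. x \<in> e} = {}" using True by (auto simp: T1_def)
          then have "?dg T1 x = 0" by (simp only: card.empty)
          moreover have "?S2 = {e\<in>T. v \<in> e}" using True ad by auto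
          then have "card ?S2 = a" by (simp add: a_def)
          moreover have "real a / sqrt (real a) = sqrt (real a)" using apos by (simp add: real_div_sqrt)
          moreover have "min (?dg T x) d = a" using True ad a_def by simp
          ultimately show ?thesis using le by simp (smt (verit) real_sqrt_ge_zero of_nat_0_le_iff)
        next
          case xv: False
          \<comment> \<open>At a vertex other than the centre the star has a single edge, and its
            size \<open>a\<close> is at least the degree of \<open>x\<close> because
            \<open>v\<close> has maximum degree. So the new term \<open>1 / sqrt a\<close> is at
            most the increase of \<open>2 * sqrt\<close> from \<open>m\<close> to
            \<open>Suc m\<close>, and the bound telescopes.\<close>
          have S2: "?S2 \<subseteq> {{x, v}}"
          proof
            fix e assume e: "e \<in> ?S2"
            then have "card e = 2" "{x, v} \<subseteq> e" using less.prems by auto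
            then have "e = {x, v}" using xv card_subset_eq[of e "{x, v}"]
              by (metis card_2_iff card.infinite zero_neq_numeral)
            then show "e \<in> {{x, v}}" by simp
          qed
          then have S2': "?S2 = {{x, v}}" using False by blast
          then have c2: "card ?S2 = 1" by simp
          have "{e\<in>T. x \<in> e} = insert {x, v} {e\<in>T1. x \<in> e}"
            using S2' ad by (auto simp: T1_def)
          moreover have "{x, v} \<notin> {e\<in>T1. x \<in> e}" "finite {e\<in>T1. x \<in> e}" using fin by (auto simp: T1_def)
          ultimately have dS: "?dg T x = Suc (?dg T1 x)" by simp
          define m where "m = ?dg T1 x"
          have ma: "Suc m \<le> a" using vmax[of x] dS by (simp add: m_def a_def)
          have s: "2 * sqrt (real m) + 1 / sqrt (real a) \<le> 2 * sqrt (real (Suc m))"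
          proof -
            have "1 / sqrt (real a) \<le> 1 / sqrt (real (Suc m))" using ma by (intro divide_left_mono) auto
            moreover have "2 * sqrt (real m) + 1 / sqrt (real (Suc m)) \<le> 2 * sqrt (real (Suc m))"
            proof -
              define b where "b = sqrt (real (Suc m))"
              have b: "b > 0" "b * b = real m + 1" by (auto simp: b_def)
              have "2 * (sqrt (real m) * b) \<le> real m + b * b"
                using sum_squares_bound[of "sqrt (real m)" b] by (simp add: power2_eq_square)
              then have "2 * sqrt (real m) * b + 1 \<le> 2 * b * b" using b(2) by simp
              then have "(2 * sqrt (real m) + 1 / b) * b \<le> 2 * b * b" using b(1) by (simp add: algebra_simps)
              then show ?thesis using b(1) unfolding b_def[symmetric] by simp
            qed
            ultimately show ?thesis by linarith
          qed
          have "min m d = m" "min (?dg T x) d = Suc m" using ma ad dS by (auto simp: m_def)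
          then show ?thesis using le s c2 by (simp add: m_def)
        qed
      qed
    qed
    show ?thesis using cT main by blast
  qed
qed

section \<open>Vertices of large inner degree\<close>

lemma transv_cong: "(\<And>i. i \<in> I \<Longrightarrow> W i = W' i) \<Longrightarrow> transv I W = transv I W'"
  by (auto simp: transv_def)

lemma disjoint_family_on_shrink:
  assumes "disjoint_family_on W' I" "\<And>i. i \<in> I \<Longrightarrow> W i \<subseteq> W' i"
  shows "disjoint_family_on W I"
  unfolding disjoint_family_on_def
proof (intro ballI impI)
  fix i j assume ij: "i \<in> I" "j \<in> I" "i \<noteq> j"
  have "W i \<inter> W j \<subseteq> W' i \<inter> W' j" by (rule Int_mono[OF assms(2)[OF ij(1)] assms(2)[OF ij(2)]])
  then show "W i \<inter> W j = {}" using assms(1) ij unfolding disjoint_family_on_def by (metis subset_empty)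
qed

lemma transv_shrink:
  assumes "disjoint_family_on W' I" "\<And>i. i \<in> I \<Longrightarrow> W i \<subseteq> W' i"
  shows "transv I W \<subseteq> transv I W'"
proof
  fix S assume S: "S \<in> transv I W"
  have "S \<inter> W' i = S \<inter> W i" if i: "i \<in> I" for i
  proof -
    have "x \<in> W i" if x: "x \<in> S" "x \<in> W' i" for x
    proof -
      obtain j where j: "j \<in> I" "x \<in> W j" using S x by (auto simp: transv_def)
      then have "x \<in> W' j \<inter> W' i" using assms(2)[OF j(1)] x by auto
      then have "j = i" using assms(1) i j(1) unfolding disjoint_family_on_def by (metis empty_iff)
      then show ?thesis using j by simp
    qed
    then show ?thesis using assms(2)[OF i] by blast
  qed
  moreover have "S \<subseteq> (\<Union>i\<in>I. W' i)" using S assms(2) unfolding transv_def by blast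
  ultimately show "S \<in> transv I W'" using S by (simp add: transv_def)
qed

section \<open>Boxes of d-subsets: all but exponentially few are good\<close>

lemma binomial_le_power_fact: "real (n choose d) \<le> real n ^ d / fact d"
proof -
  have "(n choose d) * fact d \<le> n ^ d" by (rule binomial_fact_pow)
  then have "real ((n choose d) * fact d) \<le> real (n ^ d)" by (simp only: of_nat_le_iff)
  then show ?thesis by (simp add: pos_le_divide_eq)
qed

lemma card_subsets_le_power_fact:
  assumes "finite V" "real (card V) \<le> n"
  shows "real (card {A. A \<subseteq> V \<and> card A = d}) \<le> n ^ d / fact d"
proof -
  have "real (card V) ^ d \<le> n ^ d" using assms by (intro power_mono) auto
  then show ?thesis using binomial_le_power_fact[of "card V" d] assms
    by (simp add: n_subsets divide_le_cancel) (smt (verit) divide_right_mono fact_ge_zero)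
qed

text \<open>Choose \<open>h\<close> elements inside \<open>U\<close> and the others anywhere: this
  gains \<open>s ^ h\<close> and loses a binomial coefficient of at most \<open>2 ^ d\<close>. As
  \<open>h\<close> is a fixed fraction of \<open>d\<close>, a small \<open>s\<close> beats any
  prescribed \<open>\<rho>\<close>.\<close>

lemma card_large_intersection:
  fixes s c n \<rho> :: real
  assumes V: "finite V" "real (card V) \<le> n" "0 < n" and U: "U \<subseteq> V" "real (card U) \<le> s * n"
    and s: "0 < s" "s \<le> 1" "s powr (c / 2) \<le> \<rho> / 4" and c: "0 < c"
  shows "real (card {A. A \<subseteq> V \<and> card A = d \<and> c * real d / 2 \<le> real (card (A \<inter> U))}) \<le> (\<rho> / 2) ^ d * (n ^ d / fact d)"
    (is "real (card ?X) \<le> _")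
proof -
  define h where "h = nat \<lceil>c * real d / 2\<rceil>"
  have h: "c * real d / 2 \<le> real h" using c by (simp add: h_def)
  have \<rho>: "0 < \<rho>" using s by (metis less_le_trans powr_gt_zero zero_less_divide_iff zero_less_numeral less_numeral_extra(3) not_less_iff_gr_or_eq)
  have hA: "h \<le> card (A \<inter> U)" if "A \<in> ?X" for A
  proof -
    have "c * real d / 2 \<le> real (card (A \<inter> U))" using that by auto
    then show ?thesis unfolding h_def by linarith
  qed
  show ?thesis
  proof (cases "h \<le> d")
    case False
    have "?X = {}"
    proof (rule ccontr)
      assume "?X \<noteq> {}"
      then obtain A where A: "A \<in> ?X" by auto
      then have "card (A \<inter> U) \<le> d" using V by (metis (mono_tags, lifting) Int_lower1 card_mono finite_subset mem_Collect_eq)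
      then show False using hA[OF A] False by simp
    qed
    then have z: "real (card ?X) = 0" by (simp only: card.empty of_nat_0)
    show ?thesis unfolding z using \<rho> V by simp
  next
    case True
    have fU: "finite U" using U V finite_subset by auto
    have "?X \<subseteq> (\<lambda>(B, C). B \<union> C) ` ({B. B \<subseteq> U \<and> card B = h} \<times> {C. C \<subseteq> V \<and> card C = d - h})"
    proof
      fix A assume A: "A \<in> ?X"
      have fA: "finite A" using A V finite_subset by auto
      obtain B where B: "B \<subseteq> A \<inter> U" "card B = h" using obtain_subset_with_card_n[OF hA[OF A]] by metis
      have BA: "B \<subseteq> A" "finite B" using B fA by (auto intro: finite_subset)
      then have "card (A - B) = d - h" using A B(2) card_Diff_subset[OF BA(2,1)] by simp
      moreover have "A = B \<union> (A - B)" using B by auto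
      ultimately show "A \<in> (\<lambda>(B, C). B \<union> C) ` ({B. B \<subseteq> U \<and> card B = h} \<times> {C. C \<subseteq> V \<and> card C = d - h})"
        using A B by (intro image_eqI[of _ _ "(B, A - B)"]) auto
    qed
    then have "card ?X \<le> card ((\<lambda>(B, C). B \<union> C) ` ({B. B \<subseteq> U \<and> card B = h} \<times> {C. C \<subseteq> V \<and> card C = d - h}))"
      using fU V by (intro card_mono) auto
    also have "\<dots> \<le> card ({B. B \<subseteq> U \<and> card B = h} \<times> {C. C \<subseteq> V \<and> card C = d - h})"
      using fU V by (intro card_image_le) auto
    also have "\<dots> = card {B. B \<subseteq> U \<and> card B = h} * card {C. C \<subseteq> V \<and> card C = d - h}"
      by (rule card_cartesian_product)
    finally have "real (card ?X) \<le> real (card {B. B \<subseteq> U \<and> card B = h}) * real (card {C. C \<subseteq> V \<and> card C = d - h})"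
      by (simp only: of_nat_mult[symmetric] of_nat_le_iff)
    also have "\<dots> \<le> ((s * n) ^ h / fact h) * (n ^ (d - h) / fact (d - h))"
      using card_subsets_le_power_fact[OF fU U(2), of h] card_subsets_le_power_fact[OF V(1,2), of "d - h"] s V
      by (intro mult_mono) auto
    also have "\<dots> = s ^ h * (n ^ d / fact d) * real (d choose h)"
    proof -
      have "n ^ d = n ^ h * n ^ (d - h)" using True by (simp flip: power_add)
      moreover have "real (d choose h) = fact d / (fact h * fact (d - h))" using True by (rule binomial_fact)
      ultimately show ?thesis by (simp add: power_mult_distrib)
    qed
    also have "\<dots> \<le> (\<rho> / 4) ^ d * (n ^ d / fact d) * 2 ^ d"
    proof (intro mult_mono)
      have "s ^ h = s powr real h" using s by (simp add: powr_realpow)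
      also have "\<dots> \<le> s powr (c * real d / 2)" using s h by (intro powr_mono') auto
      also have "\<dots> = (s powr (c / 2)) ^ d" using s by (simp add: powr_powr[symmetric] powr_realpow flip: powr_realpow) (simp add: powr_powr)
      also have "\<dots> \<le> (\<rho> / 4) ^ d" using s by (intro power_mono) auto
      finally show "s ^ h \<le> (\<rho> / 4) ^ d" .
      have "d choose h \<le> 2 ^ d" by (rule binomial_le_pow2)
      then show "real (d choose h) \<le> 2 ^ d" by (metis of_nat_le_iff of_nat_numeral of_nat_power)
    qed (use \<rho> V in auto)
    also have "\<dots> = (\<rho> / 2) ^ d * (n ^ d / fact d)"
    proof -
      have "(\<rho> / 4) ^ d * 2 ^ d = (\<rho> / 2) ^ d" by (simp flip: power_mult_distrib)
      then show ?thesis by (simp add: mult.commute mult.left_commute)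
    qed
    finally show ?thesis .
  qed
qed

text \<open>Induction on the number of parts. Call a vertex of the first part bad if its link in
  \<open>\<J>\<close> is dense; since \<open>\<J>\<close> is sparse, few vertices are bad. If
  \<open>\<J>\<close> is dense in a box, then either the first side contains many bad vertices, or
  some other vertex of it has a link that is dense in the rest of the box, which is rare by
  induction. The exponent \<open>d\<close> suffices because it will be of order p n, while
  \<open>\<rho>\<close> can be taken as small as desired.\<close>

lemma few_dense_boxes:
  assumes "0 < c" "0 < \<rho>"
  shows "\<exists>\<sigma>>0. \<forall>(I :: 'a set set) n d \<J>. finite I \<longrightarrow> card I = j \<longrightarrow> disjoint I \<longrightarrow>
      (\<forall>V\<in>I. finite V \<and> real (card V) \<le> n) \<longrightarrow> 0 < n \<longrightarrow> 1 \<le> d \<longrightarrow>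
      \<J> \<subseteq> transv I (\<lambda>V. V) \<longrightarrow> real (card \<J>) \<le> \<sigma> * n ^ j \<longrightarrow>
      real (card {W \<in> PiE I (\<lambda>V. {A. A \<subseteq> V \<and> card A = d}). c * real d ^ j \<le> real (card {S\<in>\<J>. S \<in> transv I W})})
        \<le> \<rho> ^ d * (n ^ d / fact d) ^ j"
  using assms
proof (induction j arbitrary: c \<rho>)
  case 0
  show ?case
  \<comment> \<open>Without parts the empty set is the only transversal, so a density of at most 1/2
    forces the family to be empty.\<close>
  proof (intro exI[of _ "1 / 2"] conjI allI impI)
    fix I :: "'a set set" and n :: real and d :: nat and \<J> :: "'a set set"
    assume a: "finite I" "card I = 0" "\<J> \<subseteq> transv I (\<lambda>V. V)" "real (card \<J>) \<le> 1 / 2 * n ^ 0"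
    then have I: "I = {}" by auto
    have "finite \<J>" using a(3) finite_subset unfolding I transv_empty by auto
    moreover have "card \<J> = 0" using a(4) by simp
    ultimately have "\<J> = {}" by simp
    then show "real (card {W \<in> PiE I (\<lambda>V. {A. A \<subseteq> V \<and> card A = d}). c * real d ^ 0 \<le> real (card {S\<in>\<J>. S \<in> transv I W})})
        \<le> \<rho> ^ d * (n ^ d / fact d) ^ 0" using 0 by simp
  qed simp
next
  case (Suc j)
  have "0 < c / 2" "0 < \<rho> / 4" using Suc.prems by auto
  from Suc.IH[OF this] obtain \<sigma>1 where \<sigma>1: "\<sigma>1 > 0" and IH:
    "\<And>(I :: 'a set set) n d \<J>. finite I \<Longrightarrow> card I = j \<Longrightarrow> disjoint I \<Longrightarrow>
      (\<forall>V\<in>I. finite V \<and> real (card V) \<le> n) \<Longrightarrow> 0 < n \<Longrightarrow> 1 \<le> d \<Longrightarrow>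
      \<J> \<subseteq> transv I (\<lambda>V. V) \<Longrightarrow> real (card \<J>) \<le> \<sigma>1 * n ^ j \<Longrightarrow>
      real (card {W \<in> PiE I (\<lambda>V. {A. A \<subseteq> V \<and> card A = d}). c / 2 * real d ^ j \<le> real (card {S\<in>\<J>. S \<in> transv I W})})
        \<le> (\<rho> / 4) ^ d * (n ^ d / fact d) ^ j"
    by blast
  define s where "s = min (min \<sigma>1 1) ((\<rho> / 4) powr (2 / c))"
  have s: "0 < s" "s \<le> \<sigma>1" "s \<le> 1" using \<sigma>1 Suc.prems by (auto simp: s_def)
  have sc: "s powr (c / 2) \<le> \<rho> / 4"
  proof -
    have "s powr (c / 2) \<le> ((\<rho> / 4) powr (2 / c)) powr (c / 2)"
      using s Suc.prems by (intro powr_mono2) (auto simp: s_def)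
    then show ?thesis using Suc.prems by (simp add: powr_powr)
  qed
  show ?case
  \<comment> \<open>A family of density \<open>s\<^sup>2\<close> leaves at most \<open>s * n\<close>
    vertices whose link has density above \<open>s\<close>.\<close>
  proof (intro exI[of _ "s\<^sup>2"] conjI allI impI)
    show "s\<^sup>2 > 0" using s by simp
    fix I0 :: "'a set set" and n :: real and d :: nat and \<J> :: "'a set set"
    assume a: "finite I0" "card I0 = Suc j" "disjoint I0" "\<forall>V\<in>I0. finite V \<and> real (card V) \<le> n" "0 < n"
      "1 \<le> d" "\<J> \<subseteq> transv I0 (\<lambda>V. V)" "real (card \<J>) \<le> s\<^sup>2 * n ^ Suc j"
    obtain a0 I where I0: "I0 = insert a0 I" "a0 \<notin> I" using a(2) card_Suc_eq[of I0 j] by blast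
    have I: "finite I" "card I = j" "disjoint I" "\<forall>V\<in>I. finite V \<and> real (card V) \<le> n"
      using a I0 by (auto simp: disjoint_def)
    have fa: "finite a0" "real (card a0) \<le> n" using a(4) I0 by auto
    have dis: "\<forall>V\<in>I. a0 \<inter> V = {}" using a(3) I0 by (auto simp: disjoint_def)
    have djf: "disjoint_family_on (\<lambda>V. V) I" "disjoint_family_on (\<lambda>V. V) I0"
      using I(3) a(3) by (auto simp: disjoint_def disjoint_family_on_def)
    have ft: "finite (transv I (\<lambda>V. V))" "finite (transv I0 (\<lambda>V. V))"
      using card_transv(1)[OF I(1) djf(1)] card_transv(1)[OF a(1) djf(2)] I(4) a(4) by auto
    have fJ: "finite \<J>" using a(7) ft finite_subset by blast
    define \<J>u where "\<J>u = (\<lambda>u. {S \<in> transv I (\<lambda>V. V). insert u S \<in> \<J>})"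
    have fJu: "finite (\<J>u u)" for u using ft by (simp add: \<J>u_def)
    define U where "U = {u\<in>a0. s * n ^ j < real (card (\<J>u u))}"
    have un: "u \<notin> S" if "u \<in> a0" "S \<in> transv I (\<lambda>V. V)" for u S
      using that dis by (fastforce simp: transv_def)
    have inj: "inj_on (\<lambda>(u, S). insert u S) (a0 \<times> transv I (\<lambda>V. V))"
      by (rule inj_on_transv_insert[of I "\<lambda>V. V" a0]) (rule dis)
    have U: "real (card U) \<le> s * n"
    proof -
      have "(\<Sum>u\<in>U. card (\<J>u u)) = card (SIGMA u:U. \<J>u u)"
        using fa fJu by (subst card_SigmaI) (auto simp: U_def)
      also have "\<dots> \<le> card \<J>"
        by (rule card_inj_on_le[where f = "\<lambda>(u, S). insert u S"])
          (auto simp: U_def \<J>u_def fJ intro!: inj_on_subset[OF inj])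
      finally have *: "real (\<Sum>u\<in>U. card (\<J>u u)) \<le> real (card \<J>)" by (simp only: of_nat_le_iff)
      have "real (card U) * (s * n ^ j) = (\<Sum>u\<in>U. s * n ^ j)" by simp
      also have "\<dots> \<le> (\<Sum>u\<in>U. real (card (\<J>u u)))" by (rule sum_mono) (auto simp: U_def)
      also have "\<dots> \<le> s\<^sup>2 * n ^ Suc j" using * a(8) by simp
      also have "\<dots> = (s * n) * (s * n ^ j)" by (simp add: power2_eq_square)
      finally show ?thesis using s a(5) by (simp add: mult.commute)
    qed
    let ?ds = "\<lambda>V. {A. A \<subseteq> V \<and> card A = d}"
    let ?bad = "{W \<in> PiE I0 ?ds. c * real d ^ Suc j \<le> real (card {S\<in>\<J>. S \<in> transv I0 W})}"
    let ?bu = "\<lambda>u. {W \<in> PiE I ?ds. c / 2 * real d ^ j \<le> real (card {S\<in>\<J>u u. S \<in> transv I W})}"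
    let ?A1 = "{A. A \<subseteq> a0 \<and> card A = d \<and> c * real d / 2 \<le> real (card (A \<inter> U))}"
    let ?A2 = "\<lambda>u. {A. A \<subseteq> a0 \<and> card A = d \<and> u \<in> A}"
    let ?\<phi> = "\<lambda>(A, W). W(a0 := A)"
    define X where "X = n ^ d / fact d"
    have X: "X > 0" using a(5) by (simp add: X_def)
    have fds: "finite (?ds V)" if "V \<in> I" for V using I(4) that by auto
    have fPi: "finite (PiE I ?ds)" using I(1) fds by (intro finite_PiE) auto
    have cPi: "real (card (PiE I ?ds)) \<le> X ^ j"
    proof -
      have "real (card (PiE I ?ds)) = (\<Prod>V\<in>I. real (card (?ds V)))" using I(1) by (simp add: card_PiE)
      also have "\<dots> \<le> (\<Prod>V\<in>I. X)"
        unfolding X_def using card_subsets_le_power_fact I(4) by (intro prod_mono) auto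
      finally show ?thesis using I(2) by simp
    qed
    have sub: "?bad \<subseteq> ?\<phi> ` (?A1 \<times> PiE I ?ds) \<union> (\<lambda>(u, AW). ?\<phi> AW) ` (SIGMA u:a0 - U. ?A2 u \<times> ?bu u)"
    proof
      fix W assume W: "W \<in> ?bad"
      then have WP: "W \<in> PiE I0 ?ds" by simp
      define W' where "W' = restrict W I"
      have W'P: "W' \<in> PiE I ?ds" using WP I0 by (auto simp: W'_def PiE_def)
      have WW: "W = W'(a0 := W a0)"
      proof
        fix x show "W x = (W'(a0 := W a0)) x"
          using PiE_arb[OF WP, of x] I0 by (cases "x = a0"; cases "x \<in> I") (simp_all add: W'_def)
      qed
      have tW: "transv I W = transv I W'" by (rule transv_cong) (simp add: W'_def)
      have Wa: "W a0 \<subseteq> a0" "card (W a0) = d" using WP I0 by auto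
      have fWa: "finite (W a0)" using Wa fa finite_subset by auto
      have WI: "W V \<subseteq> V" if "V \<in> I" for V using WP I0 that by auto
      have disW: "\<forall>V\<in>I. W a0 \<inter> W V = {}" 
      proof
        fix V assume V: "V \<in> I"
        have "W a0 \<inter> W V \<subseteq> a0 \<inter> V" by (rule Int_mono[OF Wa(1) WI[OF V]])
        then show "W a0 \<inter> W V = {}" using dis V by simp
      qed
      have djW: "disjoint_family_on W I" by (rule disjoint_family_on_shrink[OF djf(1) WI])
      have cW: "card (W V) = d" "finite (W V)" if "V \<in> I" for V
      proof -
        show "card (W V) = d" using WP I0 that by auto
        then show "finite (W V)" using a(6) by (metis card.infinite not_one_le_zero)
      qed
      have ctW: "finite (transv I W)" "card (transv I W) = d ^ j"
        using card_transv[OF I(1) djW] cW I(2) by auto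
      have tsub: "transv I W \<subseteq> transv I (\<lambda>V. V)" by (rule transv_shrink[OF djf(1) WI])
      show "W \<in> ?\<phi> ` (?A1 \<times> PiE I ?ds) \<union> (\<lambda>(u, AW). ?\<phi> AW) ` (SIGMA u:a0 - U. ?A2 u \<times> ?bu u)"
      proof (cases "W a0 \<in> ?A1")
        case True
        then show ?thesis using WW W'P by (intro UnI1 image_eqI[of _ _ "(W a0, W')"]) auto
      next
        case False
        then have lt1: "real (card (W a0 \<inter> U)) < c * real d / 2" using Wa by auto
        have "\<exists>u\<in>W a0 - U. c / 2 * real d ^ j \<le> real (card {S\<in>\<J>u u. S \<in> transv I W})"
        proof (rule ccontr)
          assume "\<not> ?thesis"
          then have lt2: "real (card {S\<in>\<J>u u. S \<in> transv I W}) \<le> c / 2 * real d ^ j" if "u \<in> W a0 - U" for u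
            using that by force
          have "{S\<in>\<J>. S \<in> transv I0 W} \<subseteq> (\<lambda>(u, S). insert u S) ` (SIGMA u:W a0. {S\<in>\<J>u u. S \<in> transv I W})"
            unfolding I0 transv_insert[OF disW] using tsub by (auto simp: \<J>u_def)
          then have "card {S\<in>\<J>. S \<in> transv I0 W} \<le> card ((\<lambda>(u, S). insert u S) ` (SIGMA u:W a0. {S\<in>\<J>u u. S \<in> transv I W}))"
            using fWa fJu by (intro card_mono) auto
          also have "\<dots> \<le> card (SIGMA u:W a0. {S\<in>\<J>u u. S \<in> transv I W})"
            using fWa fJu by (intro card_image_le) auto
          also have "\<dots> = (\<Sum>u\<in>W a0. card {S\<in>\<J>u u. S \<in> transv I W})"
            using fWa fJu by (subst card_SigmaI) auto
          finally have "real (card {S\<in>\<J>. S \<in> transv I0 W}) \<le> (\<Sum>u\<in>W a0. real (card {S\<in>\<J>u u. S \<in> transv I W}))"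
            by (simp only: of_nat_sum[symmetric] of_nat_le_iff)
          also have "\<dots> = (\<Sum>u\<in>W a0 \<inter> U. real (card {S\<in>\<J>u u. S \<in> transv I W})) + (\<Sum>u\<in>W a0 - U. real (card {S\<in>\<J>u u. S \<in> transv I W}))"
            using fWa by (subst sum.union_disjoint[symmetric]) (auto simp: Int_Diff_Un)
          also have "\<dots> \<le> (\<Sum>u\<in>W a0 \<inter> U. real d ^ j) + (\<Sum>u\<in>W a0 - U. c / 2 * real d ^ j)"
          proof (intro add_mono sum_mono)
            fix u
            have "card {S\<in>\<J>u u. S \<in> transv I W} \<le> d ^ j"
              using card_mono[OF ctW(1), of "{S\<in>\<J>u u. S \<in> transv I W}"] ctW(2) by auto
            then show "real (card {S\<in>\<J>u u. S \<in> transv I W}) \<le> real d ^ j"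
              by (simp only: of_nat_power[symmetric] of_nat_le_iff)
          qed (rule lt2)
          also have "\<dots> = real (card (W a0 \<inter> U)) * real d ^ j + real (card (W a0 - U)) * (c / 2 * real d ^ j)" by simp
          also have "\<dots> < c * real d / 2 * real d ^ j + real d * (c / 2 * real d ^ j)"
          proof (rule add_less_le_mono)
            show "real (card (W a0 \<inter> U)) * real d ^ j < c * real d / 2 * real d ^ j"
              using lt1 a(6) by (intro mult_strict_right_mono) auto
            have "card (W a0 - U) \<le> d" using Wa fWa by (metis Diff_subset card_mono)
            then show "real (card (W a0 - U)) * (c / 2 * real d ^ j) \<le> real d * (c / 2 * real d ^ j)"
              using Suc.prems by (intro mult_right_mono) auto
          qed
          also have "\<dots> = c * real d ^ Suc j" by simp
          finally show False using W by simp
        qed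
        then obtain u where u: "u \<in> W a0 - U" "c / 2 * real d ^ j \<le> real (card {S\<in>\<J>u u. S \<in> transv I W'})"
          unfolding tW by auto
        then show ?thesis using WW W'P Wa by (intro UnI2 image_eqI[of _ _ "(u, W a0, W')"]) auto
      qed
    qed
    have fA2: "finite (?A2 u)" for u using fa by auto
    have fbu: "finite (?bu u)" for u using fPi by auto
    have fS: "finite (SIGMA u:a0 - U. ?A2 u \<times> ?bu u)" using fa fA2 fbu by auto
    have fP1: "finite (?A1 \<times> PiE I ?ds)" using fa fPi by auto
    have "card ?bad \<le> card (?\<phi> ` (?A1 \<times> PiE I ?ds) \<union> (\<lambda>(u, AW). ?\<phi> AW) ` (SIGMA u:a0 - U. ?A2 u \<times> ?bu u))"
      using fS fP1 by (intro card_mono[OF _ sub] finite_UnI finite_imageI)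
    also have "\<dots> \<le> card (?\<phi> ` (?A1 \<times> PiE I ?ds)) + card ((\<lambda>(u, AW). ?\<phi> AW) ` (SIGMA u:a0 - U. ?A2 u \<times> ?bu u))"
      by (rule card_Un_le)
    also have "\<dots> \<le> card (?A1 \<times> PiE I ?ds) + card (SIGMA u:a0 - U. ?A2 u \<times> ?bu u)"
      using fS fP1 by (intro add_mono card_image_le)
    finally have c1: "real (card ?bad) \<le> real (card (?A1 \<times> PiE I ?ds)) + real (card (SIGMA u:a0 - U. ?A2 u \<times> ?bu u))"
      by (simp only: of_nat_add[symmetric] of_nat_le_iff)
    have c2: "real (card (?A1 \<times> PiE I ?ds)) \<le> (\<rho> / 2) ^ d * X ^ Suc j"
    proof -
      have "real (card ?A1) \<le> (\<rho> / 2) ^ d * X"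
        unfolding X_def by (rule card_large_intersection[OF fa a(5) _ U s(1,3) sc Suc.prems(1)]) (auto simp: U_def)
      then have "real (card ?A1) * real (card (PiE I ?ds)) \<le> ((\<rho> / 2) ^ d * X) * X ^ j"
        using cPi X Suc.prems by (intro mult_mono) auto
      then show ?thesis by (simp add: card_cartesian_product)
    qed
    have c3: "real (card (SIGMA u:a0 - U. ?A2 u \<times> ?bu u)) \<le> (\<rho> / 2) ^ d * X ^ Suc j"
    proof -
      have "real (card (SIGMA u:a0 - U. ?A2 u \<times> ?bu u)) = (\<Sum>u\<in>a0 - U. real (card (?A2 u)) * real (card (?bu u)))"
        using fa fA2 fbu by (subst card_SigmaI) (auto simp: card_cartesian_product)
      also have "\<dots> \<le> (\<Sum>u\<in>a0 - U. real (card (?A2 u)) * ((\<rho> / 4) ^ d * X ^ j))"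
      proof (intro sum_mono mult_left_mono)
        fix u assume u: "u \<in> a0 - U"
        then have "real (card (\<J>u u)) \<le> s * n ^ j" by (auto simp: U_def)
        also have "\<dots> \<le> \<sigma>1 * n ^ j" using s a(5) by (intro mult_right_mono) auto
        finally have le: "real (card (\<J>u u)) \<le> \<sigma>1 * n ^ j" .
        show "real (card (?bu u)) \<le> (\<rho> / 4) ^ d * X ^ j"
          unfolding X_def by (rule IH[OF I a(5,6) _ le]) (auto simp: \<J>u_def)
      qed simp
      also have "\<dots> \<le> (\<Sum>u\<in>a0. real (card (?A2 u)) * ((\<rho> / 4) ^ d * X ^ j))"
        using fa Suc.prems X by (intro sum_mono2) auto
      also have "\<dots> = real (\<Sum>u\<in>a0. card (?A2 u)) * ((\<rho> / 4) ^ d * X ^ j)" by (simp add: sum_distrib_right)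
      also have "(\<Sum>u\<in>a0. card (?A2 u)) = d * card (?ds a0)"
      proof -
        have "(\<Sum>u\<in>a0. card (?A2 u)) = card (SIGMA u:a0. ?A2 u)" using fa fA2 by (subst card_SigmaI) auto
        also have "\<dots> = card (SIGMA A:?ds a0. A)"
          by (rule bij_betw_same_card[where f = prod.swap]) (auto simp: bij_betw_def inj_on_def image_def)
        also have "\<dots> = (\<Sum>A\<in>?ds a0. card A)" using fa finite_subset by (subst card_SigmaI) auto
        finally show ?thesis by simp
      qed
      \<comment> \<open>The union over the vertices of the first side costs a factor
        \<open>d\<close>, absorbed by \<open>2 ^ d\<close>; this is why the induction hypothesis is
        applied with \<open>\<rho> / 4\<close>.\<close>
      also have "real (d * card (?ds a0)) * ((\<rho> / 4) ^ d * X ^ j) \<le> (2 ^ d * X) * ((\<rho> / 4) ^ d * X ^ j)"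
      proof (rule mult_right_mono)
        have "d \<le> 2 ^ d" by (rule less_imp_le[OF less_exp])
        then have "real d \<le> 2 ^ d" by (metis of_nat_le_iff of_nat_numeral of_nat_power)
        moreover have "real (card (?ds a0)) \<le> X" unfolding X_def by (rule card_subsets_le_power_fact[OF fa])
        ultimately show "real (d * card (?ds a0)) \<le> 2 ^ d * X" using X by (simp add: mult_mono)
        show "0 \<le> (\<rho> / 4) ^ d * X ^ j" using Suc.prems X by simp
      qed
      also have "\<dots> = (\<rho> / 2) ^ d * X ^ Suc j"
      proof -
        have "2 ^ d * (\<rho> / 4) ^ d = (\<rho> / 2) ^ d" by (simp flip: power_mult_distrib)
        then show ?thesis by (simp add: mult.commute mult.left_commute)
      qed
      finally show ?thesis .
    qed
    have "real (card ?bad) \<le> (2 * (\<rho> / 2) ^ d) * X ^ Suc j" using c1 c2 c3 by linarith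
    also have "\<dots> \<le> \<rho> ^ d * X ^ Suc j"
    proof (rule mult_right_mono)
      have "(2::real) \<le> 2 ^ d" using a(6) power_increasing[of 1 d "2::real"] by simp
      then have "2 * (\<rho> / 2) ^ d \<le> 2 ^ d * (\<rho> / 2) ^ d" using Suc.prems by (intro mult_right_mono) auto
      also have "\<dots> = \<rho> ^ d" by (simp flip: power_mult_distrib)
      finally show "2 * (\<rho> / 2) ^ d \<le> \<rho> ^ d" .
      show "0 \<le> X ^ Suc j" using X by simp
    qed
    finally show "real (card ?bad) \<le> \<rho> ^ d * (n ^ d / fact d) ^ Suc j" unfolding X_def .
  qed
qed

section \<open>Greedy choice of a spread family of transversals\<close>

definition heavy :: "(nat \<Rightarrow> real) \<Rightarrow> 'a set set \<Rightarrow> 'a set \<Rightarrow> bool" where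
  "heavy \<kappa> \<S> S \<longleftrightarrow> (\<exists>J\<subseteq>S. 2 \<le> card J \<and> \<kappa> (card J) / 2 < real (card {S'\<in>\<S>. J \<subseteq> S'}))"

text \<open>\<open>\<kappa> j\<close> limits how many members share a set of \<open>j\<close>
  vertices. It may be below 1, so one member is allowed for free; Janson's inequality compares
  distinct members only and does not see it. \<open>heavy\<close> already stops at half of
  \<open>\<kappa>\<close>, since the old members and those from the current box are tested
  separately.\<close>

definition capped :: "(nat \<Rightarrow> real) \<Rightarrow> 'a set set \<Rightarrow> bool" where
  "capped \<kappa> \<S> \<longleftrightarrow> (\<forall>J. 2 \<le> card J \<longrightarrow> (\<exists>S\<in>\<S>. J \<subseteq> S) \<longrightarrow> real (card {S\<in>\<S>. J \<subseteq> S}) \<le> 1 + \<kappa> (card J))"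

text \<open>A member has \<open>2 ^ r\<close> subsets, so the saturated sets \<open>J\<close> have
  total degree at most \<open>2 ^ r * card \<N>\<close>. One of size \<open>j\<close> has degree
  above \<open>\<kappa> j / 2\<close> and spoils at most the fraction \<open>1 / l ^ j\<close> of
  the transversals; trading degree against the number of saturated sets gives the bound.\<close>

lemma heavy_count:
  assumes fin: "finite I" "card I = r" and dis: "disjoint_family_on W I" and fW: "\<forall>i\<in>I. finite (W i)"
    and l: "\<forall>i\<in>I. l \<le> real (card (W i))" "0 < l"
    and N: "finite \<N>" "\<forall>S\<in>\<N>. finite S \<and> card S = r"
    and kap: "\<And>j. 2 \<le> j \<Longrightarrow> j \<le> r \<Longrightarrow> 0 < \<kappa> j \<and> 2 ^ Suc r * real (card \<N>) \<le> \<theta> * (\<kappa> j * l ^ j)"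
    and th: "0 \<le> \<theta>"
  shows "real (card {S\<in>transv I W. heavy \<kappa> \<N> S}) \<le> \<theta> * (\<Prod>i\<in>I. real (card (W i)))"
proof -
  let ?dg = "\<lambda>J. card {S'\<in>\<N>. J \<subseteq> S'}"
  let ?X = "\<Prod>i\<in>I. real (card (W i))"
  define H where "H = {J \<in> (\<Union>S\<in>\<N>. Pow S). 2 \<le> card J \<and> \<kappa> (card J) / 2 < real (?dg J)}"
  have fP: "finite (\<Union>S\<in>\<N>. Pow S)" using N by auto
  have fH: "finite H" unfolding H_def by (rule finite_subset[OF _ fP]) blast
  have ft: "finite (transv I W)" using card_transv[OF fin(1) dis fW] by simp
  have X0: "0 \<le> ?X" by (intro prod_nonneg) auto
  have Hj: "card J \<le> r" "2 \<le> card J" "\<kappa> (card J) / 2 < real (?dg J)" if JH: "J \<in> H" for J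
  proof -
    obtain S where S: "S \<in> \<N>" "J \<subseteq> S" using JH H_def by auto
    then show "card J \<le> r" using N card_mono by metis
    show "2 \<le> card J" "\<kappa> (card J) / 2 < real (?dg J)" using JH H_def by auto
  qed
  have key: "{S\<in>transv I W. heavy \<kappa> \<N> S} \<subseteq> (\<Union>J\<in>H. {S\<in>transv I W. J \<subseteq> S})"
  proof
    fix S assume S: "S \<in> {S\<in>transv I W. heavy \<kappa> \<N> S}"
    then obtain J where J: "J \<subseteq> S" "2 \<le> card J" "\<kappa> (card J) / 2 < real (?dg J)" by (auto simp: heavy_def)
    have "finite S" "card S = r" using transv_elem[OF fin(1) dis] S fin(2) by auto
    then have "card J \<le> r" using card_mono[OF _ J(1)] by auto
    then have "0 < \<kappa> (card J)" using kap J(2) by blast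
    then have "?dg J > 0" using J(3) by (metis gr0I half_gt_zero less_asym of_nat_0)
    then obtain S' where "S' \<in> \<N>" "J \<subseteq> S'" by (metis (no_types, lifting) card_gt_0_iff ex_in_conv mem_Collect_eq)
    then have "J \<in> H" using J by (auto simp: H_def)
    then show "S \<in> (\<Union>J\<in>H. {S\<in>transv I W. J \<subseteq> S})" using S J by auto
  qed
  have degsum: "(\<Sum>J\<in>H. real (?dg J)) \<le> 2 ^ r * real (card \<N>)"
  proof -
    have "(\<Sum>J\<in>H. ?dg J) = card (SIGMA J:H. {S'\<in>\<N>. J \<subseteq> S'})" using fH N by (subst card_SigmaI) auto
    also have "\<dots> \<le> card (SIGMA S:\<N>. Pow S)"
      by (rule card_inj_on_le[where f = prod.swap]) (use N in \<open>auto intro!: finite_SigmaI\<close>)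
    also have "\<dots> = (\<Sum>S\<in>\<N>. card (Pow S))" using N by (subst card_SigmaI) auto
    also have "\<dots> = card \<N> * 2 ^ r" using N by (simp add: card_Pow)
    finally have "real (\<Sum>J\<in>H. ?dg J) \<le> real (card \<N> * 2 ^ r)" by (simp only: of_nat_le_iff)
    then show ?thesis by (simp add: mult.commute)
  qed
  have each: "real (card {S\<in>transv I W. J \<subseteq> S}) * (2 ^ r * real (card \<N>)) \<le> \<theta> * ?X * real (?dg J)" if J: "J \<in> H" for J
  proof -
    let ?c = "real (card {S\<in>transv I W. J \<subseteq> S})" and ?k = "\<kappa> (card J)" and ?l = "l ^ card J"
    have k: "0 < ?k" "2 ^ Suc r * real (card \<N>) \<le> \<theta> * (?k * ?l)" using kap[OF Hj(2,1)[OF J]] by auto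
    have "?c * ?l \<le> ?X"
      using transv_count_superset[OF fin(1) dis fW l(1)] l(2) by simp
    moreover have "?k \<le> 2 * real (?dg J)" using Hj(3)[OF J] by simp
    ultimately have "(?c * ?l) * ?k \<le> ?X * (2 * real (?dg J))" using k X0 l by (intro mult_mono) auto
    then have "\<theta> * ((?c * ?l) * ?k) \<le> \<theta> * (?X * (2 * real (?dg J)))" using th by (rule mult_left_mono)
    moreover have "?c * (2 ^ Suc r * real (card \<N>)) \<le> ?c * (\<theta> * (?k * ?l))" using k by (intro mult_left_mono) auto
    ultimately show ?thesis by (simp add: algebra_simps)
  qed
  have "card {S\<in>transv I W. heavy \<kappa> \<N> S} \<le> card (\<Union>J\<in>H. {S\<in>transv I W. J \<subseteq> S})"
    using fH ft by (intro card_mono[OF _ key]) auto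
  also have "\<dots> \<le> (\<Sum>J\<in>H. card {S\<in>transv I W. J \<subseteq> S})" using fH by (rule card_UN_le)
  finally have 1: "real (card {S\<in>transv I W. heavy \<kappa> \<N> S}) \<le> (\<Sum>J\<in>H. real (card {S\<in>transv I W. J \<subseteq> S}))"
    by (simp only: of_nat_sum[symmetric] of_nat_le_iff)
  show ?thesis
  proof (cases "\<N> = {}")
    case True
    then have "H = {}" by (auto simp: H_def)
    then show ?thesis using 1 X0 th by (simp only: sum.empty) (smt (verit) mult_nonneg_nonneg)
  next
    case False
    then have pos: "2 ^ r * real (card \<N>) > 0" using N by (simp add: card_gt_0_iff)
    have "real (card {S\<in>transv I W. heavy \<kappa> \<N> S}) * (2 ^ r * real (card \<N>))
        \<le> (\<Sum>J\<in>H. real (card {S\<in>transv I W. J \<subseteq> S})) * (2 ^ r * real (card \<N>))"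
      using 1 pos by (intro mult_right_mono) auto
    also have "\<dots> \<le> (\<Sum>J\<in>H. \<theta> * ?X * real (?dg J))"
      unfolding sum_distrib_right using each by (rule sum_mono)
    also have "\<dots> = \<theta> * ?X * (\<Sum>J\<in>H. real (?dg J))" by (simp only: sum_distrib_left)
    also have "\<dots> \<le> \<theta> * ?X * (2 ^ r * real (card \<N>))" using degsum th X0 by (intro mult_left_mono) auto
    finally show ?thesis by (rule mult_right_le_imp_le[OF _ pos])
  qed
qed

text \<open>One more transversal can be added as long as not all those in the box are heavy: the old
  family spoils less than half of them by \<open>good\<close>, and the at most \<open>N\<close> new
  members spoil at most half by \<open>heavy_count\<close> with side length \<open>d\<close>. The
  old family may be too large for that count inside a single box, hence the separate hypothesis
  \<open>good\<close>.\<close>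

lemma greedy_extend:
  assumes P: "finite P" "card P = r" "disjoint P" "2 \<le> r" and W: "\<forall>V\<in>P. W V \<subseteq> V \<and> card (W V) = d" and d: "1 \<le> d"
    and S: "finite \<S>" "capped \<kappa> \<S>" "\<S> \<subseteq> transv P (\<lambda>V. V)"
    and kap: "\<And>j. 2 \<le> j \<Longrightarrow> j \<le> r \<Longrightarrow> 0 < \<kappa> j \<and> 2 ^ Suc r * real N \<le> 1 / 2 * (\<kappa> j * real d ^ j)" and kr: "\<kappa> r < 1"
    and good: "real (card {S\<in>transv P W. heavy \<kappa> \<S> S}) < 1 / 2 * real d ^ r"
    and M: "M \<le> N"
  shows "\<exists>\<S>'. \<S> \<subseteq> \<S>' \<and> \<S>' \<subseteq> \<S> \<union> transv P W \<and> capped \<kappa> \<S>' \<and> card \<S>' = card \<S> + M"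
  using M
proof (induction M)
  case 0
  then show ?case using S by auto
next
  case (Suc M)
  then obtain \<S>' where S': "\<S> \<subseteq> \<S>'" "\<S>' \<subseteq> \<S> \<union> transv P W" "capped \<kappa> \<S>'" "card \<S>' = card \<S> + M" by auto
  have dj: "disjoint_family_on (\<lambda>V. V) P" using P(3) by (auto simp: disjoint_def disjoint_family_on_def)
  have djW: "disjoint_family_on W P" by (rule disjoint_family_on_shrink[OF dj]) (use W in auto)
  have fW: "\<forall>V\<in>P. finite (W V)" using W d by (metis card.infinite not_one_le_zero)
  have tsub: "transv P W \<subseteq> transv P (\<lambda>V. V)" by (rule transv_shrink[OF dj]) (use W in auto)
  have ft: "finite (transv P W)" and ct: "card (transv P W) = d ^ r"
    using card_transv[OF P(1) djW fW] W P(2) by auto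
  have fS': "finite \<S>'" using S' S ft by (meson finite_UnI finite_subset)
  define \<N> where "\<N> = \<S>' - \<S>"
  have fN: "finite \<N>" and cN: "card \<N> = M" using fS' S'(1,4) S(1) by (auto simp: \<N>_def card_Diff_subset)
  have Nt: "\<N> \<subseteq> transv P W" using S' \<N>_def by auto
  have "real (card {S\<in>transv P W. heavy \<kappa> \<N> S}) \<le> 1 / 2 * (\<Prod>V\<in>P. real (card (W V)))"
  proof (rule heavy_count[OF P(1,2) djW fW, where l = "real d"])
    show "\<forall>S\<in>\<N>. finite S \<and> card S = r" using transv_elem[OF P(1) djW] Nt P(2) by auto
    fix j assume j: "2 \<le> j" "j \<le> r"
    have "2 ^ Suc r * real (card \<N>) \<le> 2 ^ Suc r * real N" using cN Suc.prems by simp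
    then show "0 < \<kappa> j \<and> 2 ^ Suc r * real (card \<N>) \<le> 1 / 2 * (\<kappa> j * real d ^ j)" using kap[OF j] by linarith
  qed (use W d fN in auto)
  then have h2: "real (card {S\<in>transv P W. heavy \<kappa> \<N> S}) \<le> 1 / 2 * real d ^ r" using W P(2) by simp
  let ?B = "{S\<in>transv P W. heavy \<kappa> \<S> S} \<union> {S\<in>transv P W. heavy \<kappa> \<N> S}"
  have "real (card ?B) \<le> real (card {S\<in>transv P W. heavy \<kappa> \<S> S}) + real (card {S\<in>transv P W. heavy \<kappa> \<N> S})"
    by (simp only: of_nat_add[symmetric] of_nat_le_iff card_Un_le)
  moreover have "real (card (transv P W)) = real d ^ r" using ct by simp
  ultimately have "real (card ?B) < real (card (transv P W))" using h2 good by linarith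
  then have "?B \<noteq> transv P W" by (metis less_irrefl)
  then obtain S0 where S0: "S0 \<in> transv P W" "\<not> heavy \<kappa> \<S> S0" "\<not> heavy \<kappa> \<N> S0" by blast
  have fS0: "finite S0" "card S0 = r" using transv_elem[OF P(1) djW S0(1)] P(2) by auto
  have low: "real (card {S\<in>\<S>'. J \<subseteq> S}) \<le> \<kappa> (card J)" if J: "J \<subseteq> S0" "2 \<le> card J" for J
  proof -
    have "{S\<in>\<S>'. J \<subseteq> S} = {S\<in>\<S>. J \<subseteq> S} \<union> {S\<in>\<N>. J \<subseteq> S}" using S'(1) by (auto simp: \<N>_def)
    then have "real (card {S\<in>\<S>'. J \<subseteq> S}) \<le> real (card {S\<in>\<S>. J \<subseteq> S}) + real (card {S\<in>\<N>. J \<subseteq> S})"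
      by (simp only: of_nat_add[symmetric] of_nat_le_iff card_Un_le)
    moreover have "real (card {S\<in>\<S>. J \<subseteq> S}) \<le> \<kappa> (card J) / 2" "real (card {S\<in>\<N>. J \<subseteq> S}) \<le> \<kappa> (card J) / 2"
      using S0 J unfolding heavy_def by (meson not_le)+
    ultimately show ?thesis by linarith
  qed
  \<comment> \<open>As \<open>\<kappa> r < 1\<close>, a member would be heavy through
    \<open>J\<close> equal to itself; a transversal that is not heavy is therefore new.\<close>
  have new: "S0 \<notin> \<S>'"
  proof
    assume "S0 \<in> \<S>'"
    then have "card {S\<in>\<S>'. S0 \<subseteq> S} > 0" using fS' unfolding card_gt_0_iff by auto
    moreover have "real (card {S\<in>\<S>'. S0 \<subseteq> S}) < 1" using low[of S0] fS0 P(4) kr by auto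
    ultimately show False by linarith
  qed
  have "capped \<kappa> (insert S0 \<S>')"
    unfolding capped_def
  proof (intro allI impI)
    fix J assume J: "2 \<le> card J" "\<exists>S\<in>insert S0 \<S>'. J \<subseteq> S"
    show "real (card {S\<in>insert S0 \<S>'. J \<subseteq> S}) \<le> 1 + \<kappa> (card J)"
    proof (cases "J \<subseteq> S0")
      case True
      then have "{S\<in>insert S0 \<S>'. J \<subseteq> S} = insert S0 {S\<in>\<S>'. J \<subseteq> S}" by auto
      then have "card {S\<in>insert S0 \<S>'. J \<subseteq> S} = Suc (card {S\<in>\<S>'. J \<subseteq> S})" using new fS' by simp
      then show ?thesis using low[OF True J(1)] by simp
    next
      case False
      then have "{S\<in>insert S0 \<S>'. J \<subseteq> S} = {S\<in>\<S>'. J \<subseteq> S}" by auto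
      then show ?thesis using S'(3) J False by (auto simp: capped_def)
    qed
  qed
  then show ?case using S' S0 new fS' by (intro exI[of _ "insert S0 \<S>'"]) auto
qed

text \<open>The cap is made for this estimate: given the crossing pairs of \<open>J\<close>, the
  expected number of other members containing \<open>J\<close> is at most \<open>1 / 2 ^ r\<close>.
  A member has at most \<open>2 ^ r\<close> subsets, so the correlations cost no more than half of
  the exponent. All members are kept, with weight 1.\<close>

lemma high_janson:
  fixes P :: "'a set set" and p :: real and r :: nat
  assumes P: "finite P" "card P = r" "disjoint P" "\<forall>V\<in>P. finite V" and p: "0 < p" "p \<le> 1"
    and S: "finite \<S>" "\<S> \<subseteq> transv P (\<lambda>V. V)"
    and cap: "capped (\<lambda>j. (1 / 2 ^ r) * p ^ (j choose 2) / p ^ (r choose 2)) \<S>"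
  shows "rprob (cross P (\<Union>P)) (\<lambda>_. p) (\<lambda>R. \<forall>S\<in>\<S>. \<not> cross P S \<subseteq> R)
    \<le> exp (- (1 / 2 * (real (card \<S>) * p ^ (r choose 2))))"
proof -
  have dj: "disjoint_family_on (\<lambda>V. V) P" using P(3) by (auto simp: disjoint_def disjoint_family_on_def)
  have el: "finite S" "card S = r" "S \<subseteq> \<Union>P" if "S \<in> \<S>" for S
    using transv_elem[OF P(1) dj, of S] S that P(2) by (auto simp: transv_def)
  have cc: "card (cross P J) = card J choose 2" if "S \<in> \<S>" "J \<subseteq> S" for S J
    using card_cross_transv[of S P J] S that el(1)[OF that(1)] finite_subset by auto
  have "rprob (cross P (\<Union>P)) (\<lambda>_. p) (\<lambda>R. \<forall>S\<in>\<S>. \<not> cross P S \<subseteq> R)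
    \<le> exp (- ((1 - 1 / 2) * (\<Sum>S\<in>\<S>. 1 * p ^ card (cross P S))))"
  proof (rule janson_thinned[OF _ _ p(2) S(1)])
    show "finite (cross P (\<Union>P))" using P by (intro finite_cross) auto
    show "\<forall>S\<in>\<S>. cross P S \<subseteq> cross P (\<Union>P)" using el(3) cross_mono by blast
    fix S assume SS: "S \<in> \<S>"
    note eS = el[OF SS]
    define Js where "Js = {J. J \<subseteq> S \<and> J \<noteq> S \<and> 2 \<le> card J}"
    have fJs: "finite Js" using eS unfolding Js_def by auto
    have cJs: "card Js \<le> 2 ^ r" using card_mono[of "Pow S" Js] eS by (auto simp: Js_def card_Pow)
    let ?h = "\<lambda>S' J. if J \<subseteq> S' then p ^ (r choose 2) / p ^ (card J choose 2) else 0"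
    have h0: "0 \<le> ?h S' J" for S' J using p by simp
    have "(\<Sum>S'\<in>\<S> - {S}. if cross P S \<inter> cross P S' \<noteq> {} then 1 * p ^ card (cross P S' - cross P S) else 0)
       \<le> (\<Sum>S'\<in>\<S> - {S}. \<Sum>J\<in>Js. ?h S' J)"
    proof (rule sum_mono)
      fix S' assume S': "S' \<in> \<S> - {S}"
      then have S'': "S' \<in> \<S>" by auto
      note eS' = el[OF S'']
      show "(if cross P S \<inter> cross P S' \<noteq> {} then 1 * p ^ card (cross P S' - cross P S) else 0) \<le> (\<Sum>J\<in>Js. ?h S' J)"
      proof (cases "cross P S \<inter> cross P S' \<noteq> {}")
        case True
        define J where "J = S \<inter> S'"
        have BB: "cross P S \<inter> cross P S' = cross P J" by (simp add: cross_Int J_def)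
        have "2 \<le> card J"
        proof -
          obtain f where f: "f \<subseteq> J" "card f = 2" using True BB by (auto simp: cross_def)
          then show ?thesis using card_mono[OF _ f(1)] eS by (simp add: J_def)
        qed
        moreover have "J \<noteq> S"
        proof
          assume "J = S"
          then have "S \<subseteq> S'" by (auto simp: J_def)
          then have "S = S'" using card_subset_eq[OF eS'(1)] eS eS' by simp
          then show False using S' by auto
        qed
        ultimately have JJ: "J \<in> Js" by (auto simp: Js_def J_def)
        have cJ: "card (cross P J) = card J choose 2" using cc[OF SS] by (simp add: J_def)
        have sub: "cross P J \<subseteq> cross P S'" using BB by auto
        have fS': "finite (cross P S')" using eS' by (simp add: finite_cross)
        have cS': "card (cross P S') = r choose 2" using cc[OF S'' subset_refl] eS' by simp
        have "cross P S' - cross P S = cross P S' - cross P J" using BB by auto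
        then have "card (cross P S' - cross P S) = (r choose 2) - (card J choose 2)"
          using sub fS' cJ cS' by (simp add: card_Diff_subset finite_subset)
        moreover have "card J choose 2 \<le> r choose 2" using card_mono[OF fS' sub] cJ cS' by simp
        ultimately have "1 * p ^ card (cross P S' - cross P S) = ?h S' J"
          using p by (simp add: power_diff J_def)
        also have "\<dots> \<le> (\<Sum>J\<in>Js. ?h S' J)" by (intro member_le_sum JJ fJs h0)
        finally show ?thesis using True by simp
      next
        case False
        have "0 \<le> (\<Sum>J\<in>Js. ?h S' J)" by (intro sum_nonneg h0)
        then show ?thesis using False by (simp only: if_False simp_thms)
      qed
    qed
    also have "\<dots> = (\<Sum>J\<in>Js. \<Sum>S'\<in>\<S> - {S}. ?h S' J)" by (rule sum.swap)
    also have "\<dots> \<le> (\<Sum>J\<in>Js. 1 / 2 ^ r)"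
    proof (rule sum_mono)
      fix J assume J: "J \<in> Js"
      let ?g = "p ^ (r choose 2) / p ^ (card J choose 2)"
      have "(\<Sum>S'\<in>\<S> - {S}. ?h S' J) = (\<Sum>S'\<in>{S' \<in> \<S> - {S}. J \<subseteq> S'}. ?g)"
        using S(1) by (intro sum.inter_filter[symmetric]) auto
      also have "\<dots> = real (card {S' \<in> \<S> - {S}. J \<subseteq> S'}) * ?g" by simp
      also have "\<dots> \<le> (1 / 2 ^ r * p ^ (card J choose 2) / p ^ (r choose 2)) * ?g"
      proof (rule mult_right_mono)
        have "{S' \<in> \<S>. J \<subseteq> S'} = insert S {S' \<in> \<S> - {S}. J \<subseteq> S'}" using J SS by (auto simp: Js_def)
        then have "card {S' \<in> \<S>. J \<subseteq> S'} = Suc (card {S' \<in> \<S> - {S}. J \<subseteq> S'})" using S(1) by simp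
        moreover have "real (card {S' \<in> \<S>. J \<subseteq> S'}) \<le> 1 + 1 / 2 ^ r * p ^ (card J choose 2) / p ^ (r choose 2)"
          using cap J SS unfolding capped_def Js_def by blast
        ultimately show "real (card {S' \<in> \<S> - {S}. J \<subseteq> S'}) \<le> 1 / 2 ^ r * p ^ (card J choose 2) / p ^ (r choose 2)"
          by linarith
      qed (use p in simp)
      also have "\<dots> = 1 / 2 ^ r" using p by simp
      finally show "(\<Sum>S'\<in>\<S> - {S}. ?h S' J) \<le> 1 / 2 ^ r" .
    qed
    also have "\<dots> = real (card Js) / 2 ^ r" by simp
    also have "\<dots> \<le> 1"
    proof -
      have "real (card Js) \<le> 2 ^ r" using cJs by (metis of_nat_le_iff of_nat_numeral of_nat_power)
      then show ?thesis by simp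
    qed
    finally show "(\<Sum>S'\<in>\<S> - {S}. if cross P S \<inter> cross P S' \<noteq> {} then 1 * p ^ card (cross P S' - cross P S) else 0) \<le> 2 * (1 / 2)"
      by simp
  qed (use p in auto)
  moreover have "(\<Sum>S\<in>\<S>. 1 * p ^ card (cross P S)) = real (card \<S>) * p ^ (r choose 2)"
    using cc[OF _ subset_refl] el(2) by simp
  ultimately show ?thesis by simp
qed

text \<open>The sum over sequences of boxes is estimated by revealing one box at a time. The state
  \<open>s\<close> will be the family built so far, and \<open>Ok k s\<close> will say that it still
  has room for \<open>k\<close> boxes.\<close>

lemma foldl_sum_bound:
  fixes f :: "'s \<Rightarrow> 'w \<Rightarrow> 's" and \<Phi> :: "'s \<Rightarrow> real"
  assumes fin: "finite A" and B: "0 \<le> B"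
    and step: "\<And>k s w. Ok (Suc k) s \<Longrightarrow> w \<in> A \<Longrightarrow> Ok k (f s w)"
    and bound: "\<And>k s. Ok (Suc k) s \<Longrightarrow> (\<Sum>w\<in>A. \<Phi> (f s w)) \<le> B * \<Phi> s"
  shows "Ok y s \<Longrightarrow> (\<Sum>xs\<in>{xs. set xs \<subseteq> A \<and> length xs = y}. \<Phi> (foldl f s xs)) \<le> B ^ y * \<Phi> s"
proof (induction y arbitrary: s)
  case 0
  have "{xs. set xs \<subseteq> A \<and> length xs = 0} = {[]}" by auto
  then show ?case by simp
next
  case (Suc y)
  let ?L = "\<lambda>y. {xs. set xs \<subseteq> A \<and> length xs = y}"
  have fL: "finite (?L y)" using finite_lists_length_eq[OF fin] by simp
  have L: "?L (Suc y) = (\<lambda>(w, xs). w # xs) ` (A \<times> ?L y)"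
    by (auto simp: length_Suc_conv image_iff)
  have inj: "inj_on (\<lambda>(w, xs). w # xs) (A \<times> ?L y)" by (auto simp: inj_on_def)
  have "(\<Sum>xs\<in>?L (Suc y). \<Phi> (foldl f s xs)) = (\<Sum>(w, xs)\<in>A \<times> ?L y. \<Phi> (foldl f (f s w) xs))"
    unfolding L sum.reindex[OF inj] by (intro sum.cong) auto
  also have "\<dots> = (\<Sum>w\<in>A. \<Sum>xs\<in>?L y. \<Phi> (foldl f (f s w) xs))" by (rule sum.cartesian_product[symmetric])
  also have "\<dots> \<le> (\<Sum>w\<in>A. B ^ y * \<Phi> (f s w))" using Suc step by (intro sum_mono) blast
  also have "\<dots> = B ^ y * (\<Sum>w\<in>A. \<Phi> (f s w))" by (simp add: sum_distrib_left)
  also have "\<dots> \<le> B ^ y * (B * \<Phi> s)" using bound[OF Suc.prems] B by (intro mult_left_mono) auto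
  finally show ?case by (simp add: algebra_simps)
qed

text \<open>\<open>h xs\<close> is the Janson exponent of the family built greedily along
  \<open>xs\<close>. A box that is good for the current family contributes \<open>N\<close>
  transversals, a bad one nothing, but bad ones amount to a fraction \<open>\<rho> ^ d\<close> only;
  hence the two summands per box. The factor \<open>b\<close> is present because only a small
  fraction of the exponent remains after mixing with the bound for the low stars. The first
  numerical condition lets \<open>N\<close> transversals fit into a box, the second keeps all
  \<open>y * N\<close> of them from saturating too much of the whole parts.\<close>

lemma high_degree_sum:
  fixes r :: nat and \<rho> :: real
  assumes r: "2 \<le> r" and \<rho>: "0 < \<rho>"
  shows "\<exists>\<sigma>>0. \<forall>(P :: 'a set set) n p d N y. finite P \<longrightarrow> card P = r \<longrightarrow> disjoint P \<longrightarrow>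
    (\<forall>V\<in>P. finite V \<and> n / (2 * real r) \<le> real (card V) \<and> real (card V) \<le> n) \<longrightarrow> 0 < n \<longrightarrow> 0 < p \<longrightarrow> p \<le> 1 \<longrightarrow> 1 \<le> d \<longrightarrow>
    (\<forall>j. 2 \<le> j \<longrightarrow> j \<le> r \<longrightarrow> 2 ^ Suc r * real N \<le> 1 / 2 * ((1 / 2 ^ r) * p ^ (j choose 2) / p ^ (r choose 2) * real d ^ j)) \<longrightarrow>
    (\<forall>j. 2 \<le> j \<longrightarrow> j \<le> r \<longrightarrow> 2 ^ Suc r * (real y * real N)
        \<le> \<sigma> * ((1 / 2 ^ r) * p ^ (j choose 2) / p ^ (r choose 2) * (n / (2 * real r)) ^ j)) \<longrightarrow>
    (\<exists>h. (\<forall>xs. set xs \<subseteq> PiE P (\<lambda>V. {A. A \<subseteq> V \<and> card A = d}) \<and> length xs = y \<longrightarrow>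
        rprob (cross P (\<Union>P)) (\<lambda>_. p) (\<lambda>R. \<forall>W\<in>set xs. \<forall>S\<in>transv P W. \<not> cross P S \<subseteq> R) \<le> exp (- h xs)) \<and>
      (\<forall>b. 0 \<le> b \<longrightarrow> (\<Sum>xs\<in>{xs. set xs \<subseteq> PiE P (\<lambda>V. {A. A \<subseteq> V \<and> card A = d}) \<and> length xs = y}. exp (- (b * h xs)))
        \<le> ((\<rho> ^ d + exp (- (b * (1 / 2 * (real N * p ^ (r choose 2)))))) * (n ^ d / fact d) ^ r) ^ y))"
proof -
  obtain \<sigma> where \<sigma>: "\<sigma> > 0" and few:
    "\<And>(I :: 'a set set) n d \<J>. finite I \<Longrightarrow> card I = r \<Longrightarrow> disjoint I \<Longrightarrow>
      (\<forall>V\<in>I. finite V \<and> real (card V) \<le> n) \<Longrightarrow> 0 < n \<Longrightarrow> 1 \<le> d \<Longrightarrow>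
      \<J> \<subseteq> transv I (\<lambda>V. V) \<Longrightarrow> real (card \<J>) \<le> \<sigma> * n ^ r \<Longrightarrow>
      real (card {W \<in> PiE I (\<lambda>V. {A. A \<subseteq> V \<and> card A = d}). 1 / 2 * real d ^ r \<le> real (card {S\<in>\<J>. S \<in> transv I W})})
        \<le> \<rho> ^ d * (n ^ d / fact d) ^ r"
    using few_dense_boxes[of "1 / 2" \<rho> r, where 'a = 'a] \<rho> by auto
  show ?thesis
  proof (intro exI[of _ \<sigma>] conjI allI impI)
    show "\<sigma> > 0" by (rule \<sigma>)
    fix P :: "'a set set" and n p :: real and d N y :: nat
    assume P: "finite P" "card P = r" "disjoint P"
      and size: "\<forall>V\<in>P. finite V \<and> n / (2 * real r) \<le> real (card V) \<and> real (card V) \<le> n"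
      and n: "0 < n" and p: "0 < p" "p \<le> 1" and d: "1 \<le> d"
      and own: "\<forall>j. 2 \<le> j \<longrightarrow> j \<le> r \<longrightarrow> 2 ^ Suc r * real N \<le> 1 / 2 * ((1 / 2 ^ r) * p ^ (j choose 2) / p ^ (r choose 2) * real d ^ j)"
      and old: "\<forall>j. 2 \<le> j \<longrightarrow> j \<le> r \<longrightarrow> 2 ^ Suc r * (real y * real N)
        \<le> \<sigma> * ((1 / 2 ^ r) * p ^ (j choose 2) / p ^ (r choose 2) * (n / (2 * real r)) ^ j)"
    define \<kappa> where "\<kappa> = (\<lambda>j. (1 / 2 ^ r) * p ^ (j choose 2) / p ^ (r choose 2))"
    define A where "A = PiE P (\<lambda>V. {A. A \<subseteq> V \<and> card A = d})"
    define Q where "Q = (\<lambda>s (W :: 'a set \<Rightarrow> 'a set) s'. s \<subseteq> s' \<and> s' \<subseteq> s \<union> transv P W \<and> capped \<kappa> s' \<and> card s' = card s + N)"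
    \<comment> \<open>In a box where the extension fails the family stays as it is: the box yields
      no gain, but the process goes on.\<close>
    define ext where "ext = (\<lambda>s W. if \<exists>s'. Q s W s' then SOME s'. Q s W s' else s)"
    define Ok where "Ok = (\<lambda>k s. finite s \<and> capped \<kappa> s \<and> s \<subseteq> transv P (\<lambda>V. V) \<and> card s + k * N \<le> y * N)"
    define X where "X = n ^ d / fact d"
    have X: "X > 0" using n by (simp add: X_def)
    have \<kappa>pos: "\<kappa> j > 0" for j using p by (simp add: \<kappa>_def)
    have \<kappa>r: "\<kappa> r < 1" using p r by (simp add: \<kappa>_def)
    have dj: "disjoint_family_on (\<lambda>V. V) P" using P(3) by (auto simp: disjoint_def disjoint_family_on_def)
    have fA: "finite A" unfolding A_def using P size by (intro finite_PiE) auto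
    have cA: "real (card A) \<le> X ^ r"
    proof -
      have "real (card A) = (\<Prod>V\<in>P. real (card {A. A \<subseteq> V \<and> card A = d}))" unfolding A_def using P(1) by (simp add: card_PiE)
      also have "\<dots> \<le> (\<Prod>V\<in>P. X)" unfolding X_def using card_subsets_le_power_fact size by (intro prod_mono) auto
      finally show ?thesis using P(2) by simp
    qed
    have AW: "\<forall>V\<in>P. W V \<subseteq> V \<and> card (W V) = d" if "W \<in> A" for W using that by (auto simp: A_def)
    have tsub: "transv P W \<subseteq> transv P (\<lambda>V. V)" if "W \<in> A" for W
      by (rule transv_shrink[OF dj]) (use AW[OF that] in auto)
    have ft: "finite (transv P (\<lambda>V. V))" using card_transv(1)[OF P(1) dj] size by auto
    have extQ: "Q s W (ext s W) \<or> ((\<nexists>s'. Q s W s') \<and> ext s W = s)" for s W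
      unfolding ext_def by (cases "\<exists>s'. Q s W s'") (auto intro: someI_ex)
    have ext_sub: "s \<subseteq> ext s W" "ext s W \<subseteq> s \<union> transv P W" "capped \<kappa> s \<Longrightarrow> capped \<kappa> (ext s W)"
      "card (ext s W) \<le> card s + N" for s W
      using extQ[of s W] by (auto simp: Q_def)
    have step: "Ok k (ext s W)" if "Ok (Suc k) s" "W \<in> A" for k s W
    proof -
      have "ext s W \<subseteq> transv P (\<lambda>V. V)" using ext_sub(2)[of s W] tsub[OF that(2)] that(1) by (auto simp: Ok_def)
      moreover have "finite (ext s W)" using calculation ft finite_subset by blast
      ultimately show ?thesis using that(1) ext_sub(3,4)[of s W] by (auto simp: Ok_def)
    qed
    have bound: "(\<Sum>W\<in>A. exp (- (b * (1 / 2 * (real (card (ext s W)) * p ^ (r choose 2))))))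
       \<le> ((\<rho> ^ d + exp (- (b * (1 / 2 * (real N * p ^ (r choose 2)))))) * X ^ r) * exp (- (b * (1 / 2 * (real (card s) * p ^ (r choose 2)))))"
      if Ok: "Ok (Suc k) s" and b: "0 \<le> b" for k s b
    proof -
      let ?q = "b * (1 / 2 * p ^ (r choose 2))"
      let ?c = "exp (- (?q * real (card s)))" and ?eN = "exp (- (?q * real N))"
      define \<J> where "\<J> = {S\<in>transv P (\<lambda>V. V). heavy \<kappa> s S}"
      define bad where "bad = {W \<in> A. 1 / 2 * real d ^ r \<le> real (card {S\<in>\<J>. S \<in> transv P W})}"
      have s: "finite s" "capped \<kappa> s" "s \<subseteq> transv P (\<lambda>V. V)" "card s \<le> y * N" using Ok by (auto simp: Ok_def)
      have "real (card \<J>) \<le> \<sigma> * (\<Prod>V\<in>P. real (card V))"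
        unfolding \<J>_def
      proof (rule heavy_count[OF P(1,2) dj, where l = "n / (2 * real r)"])
        show "\<forall>S\<in>s. finite S \<and> card S = r" using transv_elem[OF P(1) dj] s(3) P(2) by auto
        fix j assume j: "2 \<le> j" "j \<le> r"
        have "real (card s) \<le> real y * real N" using s(4) by (simp only: of_nat_mult[symmetric] of_nat_le_iff)
        then have "2 ^ Suc r * real (card s) \<le> 2 ^ Suc r * (real y * real N)" by simp
        also have "\<dots> \<le> \<sigma> * (\<kappa> j * (n / (2 * real r)) ^ j)" using old j by (simp add: \<kappa>_def)
        finally show "0 < \<kappa> j \<and> 2 ^ Suc r * real (card s) \<le> \<sigma> * (\<kappa> j * (n / (2 * real r)) ^ j)" using \<kappa>pos by simp
      qed (use size n r s \<sigma> in auto)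
      also have "\<dots> \<le> \<sigma> * n ^ r"
        using prod_mono[of P "\<lambda>V. real (card V)" "\<lambda>_. n"] size \<sigma> P(2) by (intro mult_left_mono) auto
      finally have "real (card \<J>) \<le> \<sigma> * n ^ r" .
      then have cbad: "real (card bad) \<le> \<rho> ^ d * X ^ r"
        unfolding bad_def A_def X_def using P size n d by (intro few) (auto simp: \<J>_def)
      have fbad: "finite bad" "bad \<subseteq> A" using fA by (auto simp: bad_def)
      have good: "Q s W (ext s W)" if W: "W \<in> A" "W \<notin> bad" for W
      proof -
        have "{S\<in>\<J>. S \<in> transv P W} = {S\<in>transv P W. heavy \<kappa> s S}" using tsub[OF W(1)] by (auto simp: \<J>_def)
        then have "real (card {S\<in>transv P W. heavy \<kappa> s S}) < 1 / 2 * real d ^ r" using W by (auto simp: bad_def)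
        then have "\<exists>s'. Q s W s'"
          unfolding Q_def using greedy_extend[OF P r AW[OF W(1)] d s(1,2,3) _ \<kappa>r _ order_refl, of N] own \<kappa>pos
          by (auto simp: \<kappa>_def)
        then show ?thesis using extQ[of s W] by blast
      qed
      have term_le: "exp (- (b * (1 / 2 * (real (card (ext s W)) * p ^ (r choose 2))))) \<le> ?eN * ?c + (if W \<in> bad then ?c else 0)"
        if W: "W \<in> A" for W
      proof (cases "W \<in> bad")
        case True
        have "card s \<le> card (ext s W)" using extQ[of s W] by (auto simp: Q_def)
        then have "?q * real (card s) \<le> ?q * real (card (ext s W))" using b p by (intro mult_left_mono) auto
        then have "exp (- (b * (1 / 2 * (real (card (ext s W)) * p ^ (r choose 2))))) \<le> ?c"
          by (simp add: algebra_simps)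
        then show ?thesis using True by (smt (verit) exp_gt_zero mult_pos_pos)
      next
        case False
        then have "card (ext s W) = card s + N" using good[OF W] by (simp add: Q_def)
        then have "exp (- (b * (1 / 2 * (real (card (ext s W)) * p ^ (r choose 2))))) = ?eN * ?c"
          by (simp add: exp_add[symmetric] algebra_simps)
        then show ?thesis using False by simp
      qed
      have "(\<Sum>W\<in>A. exp (- (b * (1 / 2 * (real (card (ext s W)) * p ^ (r choose 2))))))
        \<le> (\<Sum>W\<in>A. ?eN * ?c + (if W \<in> bad then ?c else 0))" using term_le by (rule sum_mono)
      also have "\<dots> = real (card A) * (?eN * ?c) + real (card bad) * ?c"
      proof -
        have "(\<Sum>W\<in>A. if W \<in> bad then ?c else 0) = (\<Sum>W\<in>bad. ?c)"
          using fA fbad by (simp add: sum.If_cases Int_absorb1)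
        then show ?thesis by (simp add: sum.distrib)
      qed
      also have "\<dots> \<le> X ^ r * (?eN * ?c) + (\<rho> ^ d * X ^ r) * ?c"
        using cA cbad by (intro add_mono mult_right_mono) auto
      finally show ?thesis by (simp add: algebra_simps)
    qed
    have Ok0: "Ok y {}" by (simp add: Ok_def capped_def)
    have Okf: "Ok 0 (foldl ext s xs) \<and> foldl ext s xs \<subseteq> s \<union> (\<Union>W\<in>set xs. transv P W)"
      if "set xs \<subseteq> A" "Ok (length xs) s" for xs s
      using that
    proof (induction xs arbitrary: s)
      case Nil
      then show ?case by simp
    next
      case (Cons W xs)
      have "Ok (length xs) (ext s W)" using step Cons.prems by simp
      then have "Ok 0 (foldl ext (ext s W) xs) \<and> foldl ext (ext s W) xs \<subseteq> ext s W \<union> (\<Union>W\<in>set xs. transv P W)"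
        using Cons by simp
      then show ?case using ext_sub(2)[of s W] by auto
    qed
    let ?h = "\<lambda>xs. 1 / 2 * (real (card (foldl ext {} xs)) * p ^ (r choose 2))"
    show "\<exists>h. (\<forall>xs. set xs \<subseteq> PiE P (\<lambda>V. {A. A \<subseteq> V \<and> card A = d}) \<and> length xs = y \<longrightarrow>
        rprob (cross P (\<Union>P)) (\<lambda>_. p) (\<lambda>R. \<forall>W\<in>set xs. \<forall>S\<in>transv P W. \<not> cross P S \<subseteq> R) \<le> exp (- h xs)) \<and>
      (\<forall>b. 0 \<le> b \<longrightarrow> (\<Sum>xs\<in>{xs. set xs \<subseteq> PiE P (\<lambda>V. {A. A \<subseteq> V \<and> card A = d}) \<and> length xs = y}. exp (- (b * h xs)))
        \<le> ((\<rho> ^ d + exp (- (b * (1 / 2 * (real N * p ^ (r choose 2)))))) * (n ^ d / fact d) ^ r) ^ y)"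
      unfolding A_def[symmetric] X_def[symmetric]
    proof (intro exI[of _ ?h] conjI allI impI)
      fix xs assume xs: "set xs \<subseteq> A \<and> length xs = y"
      let ?F = "foldl ext {} xs"
      have F: "Ok 0 ?F" "?F \<subseteq> (\<Union>W\<in>set xs. transv P W)" using Okf[of xs "{}"] xs Ok0 by auto
      have "rprob (cross P (\<Union>P)) (\<lambda>_. p) (\<lambda>R. \<forall>W\<in>set xs. \<forall>S\<in>transv P W. \<not> cross P S \<subseteq> R)
         \<le> rprob (cross P (\<Union>P)) (\<lambda>_. p) (\<lambda>R. \<forall>S\<in>?F. \<not> cross P S \<subseteq> R)"
        by (rule rprob_mono) (use p F in auto)
      also have "\<dots> \<le> exp (- ?h xs)"
        using F(1) high_janson[OF P _ p, of ?F] size by (auto simp: Ok_def \<kappa>_def)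
      finally show "rprob (cross P (\<Union>P)) (\<lambda>_. p) (\<lambda>R. \<forall>W\<in>set xs. \<forall>S\<in>transv P W. \<not> cross P S \<subseteq> R) \<le> exp (- ?h xs)" .
    next
      fix b :: real assume b: "0 \<le> b"
      have "0 \<le> (\<rho> ^ d + exp (- (b * (1 / 2 * (real N * p ^ (r choose 2)))))) * X ^ r"
        using \<rho> X by (intro mult_nonneg_nonneg add_nonneg_nonneg) auto
      from foldl_sum_bound[OF fA this, of Ok ext "\<lambda>s. exp (- (b * (1 / 2 * (real (card s) * p ^ (r choose 2)))))", OF step bound[OF _ b] Ok0]
      show "(\<Sum>xs\<in>{xs. set xs \<subseteq> A \<and> length xs = y}. exp (- (b * ?h xs)))
        \<le> ((\<rho> ^ d + exp (- (b * (1 / 2 * (real N * p ^ (r choose 2)))))) * X ^ r) ^ y"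
        by simp
    qed
  qed
qed

section \<open>The dense range\<close>

lemma sum_Pow_power:
  fixes c :: real
  assumes "finite A"
  shows "(\<Sum>X\<in>Pow A. c ^ card X) = (1 + c) ^ card A"
  using assms
proof (induction A rule: finite_induct)
  case (insert x A)
  have "(\<Sum>X\<in>Pow A. c ^ card (insert x X)) = (\<Sum>X\<in>Pow A. c * c ^ card X)"
  proof (intro sum.cong refl)
    fix X assume "X \<in> Pow A"
    then have "x \<notin> X" "finite X" using insert finite_subset by auto
    then show "c ^ card (insert x X) = c * c ^ card X" by simp
  qed
  then show ?case using insert by (simp add: sum_Pow_insert sum_distrib_left[symmetric] algebra_simps)
qed simp

text \<open>Forcing one more element costs \<open>(s - a) / (N - a)\<close>, which is at most
  \<open>s / N\<close> because \<open>s\<close> is at most \<open>N\<close>.\<close>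

lemma choose_shift:
  assumes "a \<le> s" "s \<le> N"
  shows "real ((N - a) choose (s - a)) \<le> (real s / real N) ^ a * real (N choose s)"
  using assms
proof (induction a)
  case (Suc a)
  let ?N = "N - a" and ?s = "s - a"
  have pos: "0 < ?s" "?s \<le> ?N" "0 < ?N" "0 < N" using Suc.prems by auto
  have "?s * (?N choose ?s) = ?N * ((?N - 1) choose (?s - 1))" using times_binomial_minus1_eq[OF pos(1), of ?N] .
  then have "real ?s * real (?N choose ?s) = real ?N * real ((N - Suc a) choose (s - Suc a))"
    by (metis of_nat_mult diff_Suc_eq_diff_pred diff_commute diff_Suc_1 Suc_diff_Suc diff_Suc_eq_diff_pred)
  then have "real ((N - Suc a) choose (s - Suc a)) = (real ?s / real ?N) * real (?N choose ?s)"
    using pos by (simp add: field_simps)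
  also have "\<dots> \<le> (real s / real N) * ((real s / real N) ^ a * real (N choose s))"
  proof (rule mult_mono)
    have "real ?s * real N \<le> real s * real ?N"
    proof -
      have "real ?s = real s - real a" "real ?N = real N - real a" using Suc.prems by (auto simp: of_nat_diff)
      moreover have "real a * real s \<le> real a * real N" using Suc.prems by (intro mult_left_mono) auto
      ultimately show ?thesis by (simp add: algebra_simps)
    qed
    then show "real ?s / real ?N \<le> real s / real N" using pos by (simp add: divide_le_eq le_divide_eq mult.commute)
    show "real (?N choose ?s) \<le> (real s / real N) ^ a * real (N choose s)" using Suc by simp
  qed auto
  finally show ?case by simp
qed simp

section \<open>Graphs of the family over a fixed partition\<close>

definition inner_edges :: "nat set set \<Rightarrow> nat set set \<Rightarrow> nat set set" where
  "inner_edges P G = {e\<in>G. \<exists>V\<in>P. e \<subseteq> V}"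

locale vertex_partition =
  fixes n r :: nat and P :: "nat set set"
  assumes P: "P \<in> r_partitions n r" and r2: "2 \<le> r"
begin

lemma card_P: "card P = r" and Union_P: "\<Union>P = {1..n}"
  using P by (auto simp: r_partitions_def)

lemma finite_P: "finite P"
  using card_P r2 by (metis card.infinite not_numeral_le_zero)

lemma disjoint_P: "disjoint P"
  using P by (auto simp: r_partitions_def disjoint_def)

lemma disj_fam: "I \<subseteq> P \<Longrightarrow> disjoint_family_on (\<lambda>V. V) I"
  using disjoint_P by (auto simp: disjoint_def disjoint_family_on_def)

lemma part_sub: "V \<in> P \<Longrightarrow> V \<subseteq> {1..n}"
  using Union_P by auto

lemma finite_part: "V \<in> P \<Longrightarrow> finite V"
  using part_sub finite_subset by blast

lemma same_part: "V \<in> P \<Longrightarrow> W \<in> P \<Longrightarrow> x \<in> V \<Longrightarrow> x \<in> W \<Longrightarrow> V = W"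
  using disjoint_P unfolding disjoint_def by blast

lemma finite_E: "finite (partition_graph P)"
  unfolding partition_graph_cross Union_P by (intro finite_cross) simp

lemma E_edge: "f \<in> partition_graph P \<Longrightarrow> f \<subseteq> {1..n} \<and> card f = 2"
  by (simp add: partition_graph_def Union_P)

lemma E_pair:
  assumes "V \<in> P" "W \<in> P" "V \<noteq> W" "x \<in> V" "y \<in> W"
  shows "{x, y} \<in> partition_graph P"
proof -
  have "x \<noteq> y" using same_part[OF assms(1,2), of x] assms by auto
  moreover have "\<not> {x, y} \<subseteq> U" if "U \<in> P" for U using same_part[OF that] assms that by auto
  ultimately show ?thesis using assms by (auto simp: partition_graph_def)
qed

lemma transv_pair:
  assumes "I \<subseteq> P" "\<And>V. V \<in> I \<Longrightarrow> W V \<subseteq> V" "S \<in> transv I W" "x \<in> S" "y \<in> S" "x \<noteq> y"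
  shows "{x, y} \<in> partition_graph P"
proof -
  have S: "S \<in> transv I (\<lambda>V. V)" using transv_shrink[OF disj_fam[OF assms(1)]] assms(2,3) by blast
  obtain V V' where V: "V \<in> I" "x \<in> V" "V' \<in> I" "y \<in> V'" 
    using S assms(4,5) unfolding transv_def by blast
  have "V \<noteq> V'" using transv_no_inner[OF S V(1), of "{x, y}"] assms V by auto
  then show ?thesis using E_pair V assms(1) by blast
qed

context
  fixes m :: nat and \<delta> \<gamma> :: real and G
  assumes G: "G \<in> F_star n m r \<delta> \<gamma> P"
begin

lemma G_edge: "e \<in> G \<Longrightarrow> e \<subseteq> {1..n} \<and> card e = 2"
  using G by (auto simp: F_star_def F_delta_gamma_def Kfree_graphs_def graphs_on_def)

lemma card_G: "card G = m"
  using G by (auto simp: F_star_def F_delta_gamma_def Kfree_graphs_def)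

lemma finite_G: "finite G"
  by (rule finite_subset[of _ "Pow {1..n}"]) (use G_edge in auto)

lemma no_clique: "A \<subseteq> {1..n} \<Longrightarrow> card A = Suc r \<Longrightarrow> \<exists>u\<in>A. \<exists>v\<in>A. u \<noteq> v \<and> {u, v} \<notin> G"
  using G by (auto simp: F_star_def F_delta_gamma_def Kfree_graphs_def clique_free_def)

lemma G_split: "G = inner_edges P G \<union> (G \<inter> partition_graph P)" "inner_edges P G \<inter> partition_graph P = {}"
  using G_edge by (auto simp: inner_edges_def partition_graph_def Union_P)

lemma card_inner: "card (inner_edges P G) = (\<Sum>V\<in>P. e_inside G V)"
proof -
  have "inner_edges P G = (\<Union>V\<in>P. {e\<in>G. e \<subseteq> V})" by (auto simp: inner_edges_def)
  also have "card \<dots> = (\<Sum>V\<in>P. card {e\<in>G. e \<subseteq> V})"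
  proof (rule card_UN_disjoint)
    show "\<forall>V\<in>P. \<forall>W\<in>P. V \<noteq> W \<longrightarrow> {e\<in>G. e \<subseteq> V} \<inter> {e\<in>G. e \<subseteq> W} = {}"
    proof (intro ballI impI equals0I)
      fix V W e assume a: "V \<in> P" "W \<in> P" "V \<noteq> W" "e \<in> {e\<in>G. e \<subseteq> V} \<inter> {e\<in>G. e \<subseteq> W}"
      then have "e \<noteq> {}" using G_edge by fastforce
      then show False using a same_part[OF a(1,2)] by auto
    qed
  qed (use finite_P finite_G in auto)
  finally show ?thesis by (simp add: e_inside_def)
qed

lemma inner_pos: "inner_edges P G \<noteq> {}"
  using G card_inner by (auto simp: F_star_def)

lemma inner_le: "real (card (inner_edges P G)) \<le> \<delta> * real m"
  using G card_inner by (auto simp: F_star_def condA_def)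

lemma inner_edge:
  assumes "e \<in> inner_edges P G"
  obtains V where "V \<in> P" "e \<subseteq> V" "card e = 2" "e \<in> G"
  using assms G_edge by (auto simp: inner_edges_def)

lemma card_cut: "card (G \<inter> partition_graph P) + card (inner_edges P G) = m"
proof -
  have "card G = card (inner_edges P G) + card (G \<inter> partition_graph P)"
    by (subst G_split(1), rule card_Un_disjoint)
      (use finite_G G_split(2) in \<open>auto simp: inner_edges_def\<close>)
  then show ?thesis using card_G by simp
qed

lemma card_missing: "card (partition_graph P - G) + m = e_part P + card (inner_edges P G)"
proof -
  have "card (partition_graph P) = card (partition_graph P - G) + card (G \<inter> partition_graph P)"
    by (subst card_Un_disjoint[symmetric]) (use finite_E in \<open>auto intro!: arg_cong[of _ _ card]\<close>)
  then show ?thesis using card_cut by (simp add: e_part_def)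
qed

lemma inner_degree:
  assumes "v \<in> V" "V \<in> P"
  shows "card {e\<in>inner_edges P G. v \<in> e} = deg_in G v V"
proof -
  have "{e\<in>inner_edges P G. v \<in> e} = (\<lambda>u. {v, u}) ` {u\<in>V. {v, u} \<in> G}"
  proof (intro equalityI subsetI)
    fix e assume e: "e \<in> {e\<in>inner_edges P G. v \<in> e}"
    then obtain W where W: "W \<in> P" "e \<subseteq> W" "card e = 2" "e \<in> G" using inner_edge by blast
    then have "W = V" using same_part[OF W(1) assms(2), of v] e assms by auto
    moreover obtain u where "e = {v, u}" using e W(3) by (auto simp: card_2_iff)
    ultimately show "e \<in> (\<lambda>u. {v, u}) ` {u\<in>V. {v, u} \<in> G}" using W by auto
  qed (use assms in \<open>auto simp: inner_edges_def\<close>)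
  moreover have "inj_on (\<lambda>u. {v, u}) {u\<in>V. {v, u} \<in> G}" by (auto simp: inj_on_def doubleton_eq_iff)
  ultimately show ?thesis by (simp add: card_image deg_in_def)
qed

lemma degree_balance:
  assumes "v \<in> V" "V \<in> P" "W \<in> P"
  shows "deg_in G v V \<le> deg_in G v W"
  using G assms by (cases "W = V") (auto simp: F_star_def condB_def)

text \<open>If all crossing pairs of a transversal of neighbours of \<open>v\<close> were edges,
  they would form a clique together with \<open>v\<close>. The part of \<open>v\<close> itself takes
  part as well, so one vertex of the transversal is an inner neighbour.\<close>

lemma clique_at_vertex:
  assumes "v \<in> {1..n}" "\<And>V. V \<in> P \<Longrightarrow> W V \<subseteq> {u\<in>V. {v, u} \<in> G}" "S \<in> transv P W"
  shows "\<not> cross P S \<subseteq> G"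
proof
  assume a: "cross P S \<subseteq> G"
  have WV: "W V \<subseteq> V" if "V \<in> P" for V using assms(2)[OF that] by auto
  have djW: "disjoint_family_on W P" by (rule disjoint_family_on_shrink[OF disj_fam[OF order_refl] WV])
  have S: "finite S" "card S = r" using transv_elem[OF finite_P djW assms(3)] card_P by auto
  have SP: "S \<subseteq> {1..n}" using assms(3) WV Union_P unfolding transv_def by blast
  have Sv: "{v, u} \<in> G" if "u \<in> S" for u using that assms(2,3) unfolding transv_def by blast
  have "v \<notin> S" using Sv[of v] G_edge[of "{v, v}"] by auto
  then have "card (insert v S) = Suc r" using S by simp
  then obtain x y where xy: "x \<in> insert v S" "y \<in> insert v S" "x \<noteq> y" "{x, y} \<notin> G"
    using no_clique[of "insert v S"] SP assms(1) by auto
  have Sv': "{u, v} \<in> G" if "u \<in> S" for u using Sv[OF that] by (simp add: insert_commute)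
  have "x \<in> S" "y \<in> S" using xy Sv Sv' by blast+
  have "{x, y} \<in> partition_graph P"
    by (rule transv_pair[OF order_refl WV assms(3) \<open>x \<in> S\<close> \<open>y \<in> S\<close> xy(3)])
  then have "{x, y} \<in> cross P S" using \<open>x \<in> S\<close> \<open>y \<in> S\<close> by (simp add: partition_graph_def cross_def)
  then show False using a xy by auto
qed

lemma clique_at_edge:
  assumes "e \<in> inner_edges P G" "V \<in> P" "e \<subseteq> V" "S \<in> transv (P - {V}) (\<lambda>V. V)"
  shows "\<not> cross P (e \<union> S) \<subseteq> G"
proof
  assume a: "cross P (e \<union> S) \<subseteq> G"
  have e: "e \<in> G" "card e = 2" "finite e" 
    using assms(1) G_edge by (auto simp: inner_edges_def card_ge_0_finite)
  have S: "finite S" "card S = r - 1" using transv_elem[OF _ disj_fam assms(4)] finite_P card_P assms(2) by auto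
  have SV: "S \<subseteq> \<Union>(P - {V})" using assms(4) by (auto simp: transv_def)
  have "e \<inter> S = {}" using SV assms same_part by blast
  then have "card (e \<union> S) = Suc r" using S e r2 by (simp add: card_Un_disjoint)
  moreover have sub: "e \<union> S \<subseteq> {1..n}" using SV Union_P assms by blast
  ultimately obtain x y where xy: "x \<in> e \<union> S" "y \<in> e \<union> S" "x \<noteq> y" "{x, y} \<notin> G" using no_clique by blast
  have "{x, y} \<noteq> e" using xy e by auto
  then have "{x, y} \<in> cross P (e \<union> S)"
    using cross_extended_transv[OF disjoint_P assms(2,3) e(2) assms(4) order_refl] xy by auto
  then show False using a xy by auto
qed

end

text \<open>In the dense range every inner edge has an endpoint that misses linearly many crossing edges,
  and no vertex has large inner degree; the missing edges then outweigh the inner ones.\<close>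

lemma dense_structure:
  assumes G: "G \<in> F_star n m r \<delta> \<gamma> P" and n: "0 < n"
    and size: "\<forall>V\<in>P. real n / (2 * real r) \<le> real (card V)"
    and few: "real (card (partition_graph P - G)) < (real n / (64 * real r)) ^ 2"
  shows "\<exists>X F. X \<subseteq> {1..n} \<and> X \<noteq> {} \<and> inner_edges P G \<subseteq> {e. e \<subseteq> {1..n} \<and> card e = 2 \<and> e \<inter> X \<noteq> {}} \<and>
    64 * r * card (inner_edges P G) \<le> card X * n \<and>
    F \<subseteq> partition_graph P - G \<and> F \<subseteq> {e. e \<subseteq> {1..n} \<and> card e = 2 \<and> e \<inter> X \<noteq> {}} \<and>
    real (card F) = \<lceil>real (card X) * real n / (16 * real r)\<rceil>"
proof -
  define Q where "Q = partition_graph P - G"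
  define l where "l = real n / (64 * real r)"
  have l: "l > 0" using n r2 by (simp add: l_def)
  have r0: "0 < real r" using r2 by simp
  have Q: "finite Q" "\<forall>f\<in>Q. card f = 2" using finite_E E_edge by (auto simp: Q_def)
  have few': "real (card Q) < l ^ 2" using few by (simp add: Q_def l_def)
  \<comment> \<open>The threshold n/(8r) is such that two vertices of one part that stay below it
    keep at least n/(4r) common neighbours in every other part.\<close>
  define X where "X = {v\<in>{1..n}. real n / (8 * real r) \<le> real (card {f\<in>Q. v \<in> f})}"
  let ?T = "inner_edges P G"
  have fT: "finite ?T" using finite_G[OF G] by (simp add: inner_edges_def)
  have notQ: "cross P S \<subseteq> G" if "\<forall>f\<in>Q. \<not> f \<subseteq> S" "S \<subseteq> {1..n}" for S
  proof
    fix f assume f: "f \<in> cross P S"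
    then have "f \<in> partition_graph P" using that(2) Union_P by (auto simp: cross_def partition_graph_def)
    then show "f \<in> G" using that(1) f by (auto simp: Q_def cross_def)
  qed
  \<comment> \<open>A vertex of inner degree above \<open>l\<close> has more than \<open>l\<close>
    neighbours in every part by condition (B), and the missing pairs are too few to destroy all
    transversals of these neighbourhoods.\<close>
  have deg: "real (card {e\<in>?T. v \<in> e}) \<le> l" for v
  proof (rule ccontr)
    assume "\<not> ?thesis"
    then have big: "real (card {e\<in>?T. v \<in> e}) > l" by simp
    then have "{e\<in>?T. v \<in> e} \<noteq> {}" using l by (metis card.empty not_less_iff_gr_or_eq of_nat_0)
    then obtain e where "e \<in> G" "v \<in> e" by (auto simp: inner_edges_def)
    then have "v \<in> {1..n}" using G_edge[OF G] by blast
    then obtain V where V: "V \<in> P" "v \<in> V" unfolding Union_P[symmetric] by blast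
    let ?W = "\<lambda>W. {u\<in>W. {v, u} \<in> G}"
    have djW: "disjoint_family_on ?W P" by (rule disjoint_family_on_shrink[OF disj_fam[OF order_refl]]) auto
    have "l \<le> real (card (?W U))" if U: "U \<in> P" for U
      using degree_balance[OF G V(2,1) U] inner_degree[OF G V(2,1)] big by (simp add: deg_in_def)
    then obtain S where S: "S \<in> transv P ?W" "\<forall>f\<in>Q. \<not> f \<subseteq> S"
      using transv_avoiding[OF finite_P djW _ _ l Q few'] finite_part by auto
    have "S \<subseteq> {1..n}" using S(1) Union_P unfolding transv_def by blast
    then show False using clique_at_vertex[OF G \<open>v \<in> {1..n}\<close> _ S(1)] notQ S(2) by auto
  qed
  have cover: "e \<inter> X \<noteq> {}" if e: "e \<in> ?T" for e
  proof
    assume eX: "e \<inter> X = {}"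
    obtain V where V: "V \<in> P" "e \<subseteq> V" "card e = 2" using inner_edge[OF G e] by metis
    obtain u v where uv: "e = {u, v}" "u \<noteq> v" using V(3) by (auto simp: card_2_iff)
    have uvn: "u \<in> {1..n}" "v \<in> {1..n}" using V uv part_sub by blast+
    have small: "real (card {f\<in>Q. w \<in> f}) < real n / (8 * real r)" if "w \<in> e" for w
      using that eX uvn uv by (auto simp: X_def)
    let ?W = "\<lambda>W. {w\<in>W. {u, w} \<in> G \<and> {v, w} \<in> G}"
    have djW: "disjoint_family_on ?W (P - {V})" by (rule disjoint_family_on_shrink[OF disj_fam]) auto
    have "l \<le> real (card (?W U))" if U: "U \<in> P - {V}" for U
    proof -
      have half: "real (card {w\<in>U. {x, w} \<notin> G}) < real n / (8 * real r)" if x: "x \<in> e" for x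
      proof -
        have "(\<lambda>w. {x, w}) ` {w\<in>U. {x, w} \<notin> G} \<subseteq> {f\<in>Q. x \<in> f}"
          using E_pair[of V U x] V x U by (auto simp: Q_def)
        moreover have "inj_on (\<lambda>w. {x, w}) {w\<in>U. {x, w} \<notin> G}" by (auto simp: inj_on_def doubleton_eq_iff)
        ultimately have "card {w\<in>U. {x, w} \<notin> G} \<le> card {f\<in>Q. x \<in> f}" using Q(1) by (intro card_inj_on_le) auto
        then show ?thesis using small[OF x] by linarith
      qed
      have "U \<subseteq> ?W U \<union> ({w\<in>U. {u, w} \<notin> G} \<union> {w\<in>U. {v, w} \<notin> G})" by auto
      then have "card U \<le> card (?W U \<union> ({w\<in>U. {u, w} \<notin> G} \<union> {w\<in>U. {v, w} \<notin> G}))"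
        using finite_part U by (intro card_mono) auto
      also have "\<dots> \<le> card (?W U) + card ({w\<in>U. {u, w} \<notin> G} \<union> {w\<in>U. {v, w} \<notin> G})" by (rule card_Un_le)
      also have "\<dots> \<le> card (?W U) + (card {w\<in>U. {u, w} \<notin> G} + card {w\<in>U. {v, w} \<notin> G})"
        using card_Un_le by (rule add_left_mono)
      finally have "real (card U) \<le> real (card (?W U)) + (real (card {w\<in>U. {u, w} \<notin> G}) + real (card {w\<in>U. {v, w} \<notin> G}))"
        by linarith
      moreover have "real n / (2 * real r) \<le> real (card U)" using size U by auto
      moreover have "real (card {w\<in>U. {u, w} \<notin> G}) < real n / (8 * real r)"
        "real (card {w\<in>U. {v, w} \<notin> G}) < real n / (8 * real r)" using half[of u] half[of v] uv by auto
      moreover have "l + (real n / (8 * real r) + real n / (8 * real r)) \<le> real n / (2 * real r)"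
        unfolding l_def using r0 by (simp add: field_simps)
      ultimately show ?thesis by linarith
    qed
    then obtain S where S: "S \<in> transv (P - {V}) ?W" "\<forall>f\<in>Q. \<not> f \<subseteq> S"
      using transv_avoiding[OF _ djW _ _ l Q few'] finite_part finite_P by auto
    have S': "S \<in> transv (P - {V}) (\<lambda>V. V)"
      using transv_shrink[OF disj_fam[of "P - {V}"], of ?W] S(1) by auto
    have Sn: "S \<subseteq> {1..n}" using S(1) Union_P unfolding transv_def by blast
    have Sc: "{u, w} \<in> G \<and> {v, w} \<in> G" if "w \<in> S" for w using that S(1) unfolding transv_def by blast
    have "cross P (e \<union> S) \<subseteq> G"
    proof
      fix f assume f: "f \<in> cross P (e \<union> S)"
      show "f \<in> G"
      proof (cases "f \<subseteq> S")
        case True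
        then have "f \<in> cross P S" using f by (auto simp: cross_def)
        then show ?thesis using notQ[OF S(2) Sn] by auto
      next
        case False
        then obtain x where x: "x \<in> f" "x \<in> e" using f by (auto simp: cross_def)
        obtain y where y: "f = {x, y}" "x \<noteq> y" using f x(1) by (auto simp: cross_def card_2_iff)
        have "y \<in> S"
        proof (rule ccontr)
          assume "y \<notin> S"
          then have "f \<subseteq> V" using y x V f by (auto simp: cross_def)
          then show False using f V(1) by (auto simp: cross_def)
        qed
        then show ?thesis using Sc[of y] x(2) y uv by auto
      qed
    qed
    then show False using clique_at_edge[OF G e V(1,2) S'] by auto
  qed
  have fX: "finite X" by (simp add: X_def)
  have Xne: "X \<noteq> {}" using cover inner_pos[OF G] by auto
  let ?EX = "{e. e \<subseteq> {1..n} \<and> card e = 2 \<and> e \<inter> X \<noteq> {}}"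
  have Tsub: "?T \<subseteq> ?EX" using cover G_edge[OF G] by (auto simp: inner_edges_def)
  have Tc: "64 * r * card ?T \<le> card X * n"
  proof -
    have "?T \<subseteq> (\<Union>v\<in>X. {e\<in>?T. v \<in> e})" using cover by auto
    then have "card ?T \<le> card (\<Union>v\<in>X. {e\<in>?T. v \<in> e})" using fX fT by (intro card_mono) auto
    also have "\<dots> \<le> (\<Sum>v\<in>X. card {e\<in>?T. v \<in> e})" using fX by (rule card_UN_le)
    finally have "real (card ?T) \<le> (\<Sum>v\<in>X. real (card {e\<in>?T. v \<in> e}))" by (simp only: of_nat_sum[symmetric] of_nat_le_iff)
    also have "\<dots> \<le> real (card X) * l" using sum_mono[of X _ "\<lambda>_. l"] deg by simp
    finally have "real (card ?T) * (64 * real r) \<le> real (card X) * real n" unfolding l_def using r0 by (simp add: field_simps)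
    then have "real (64 * r * card ?T) \<le> real (card X * n)" by (simp add: mult.commute mult.left_commute)
    then show ?thesis by (simp only: of_nat_le_iff)
  qed
  let ?QX = "{f\<in>Q. f \<inter> X \<noteq> {}}"
  have fQX: "finite ?QX" using Q(1) by simp
  have finf: "finite f" if "f \<in> ?QX" for f
    by (rule card_ge_0_finite) (use that Q(2) in simp)
  \<comment> \<open>A missing pair meets \<open>X\<close> in at most two vertices, which turns
    n/(8r) per vertex into n/(16r).\<close>
  have QX: "real (card X) * real n / (16 * real r) \<le> real (card ?QX)"
  proof -
    have "real (card X) * (real n / (8 * real r)) = (\<Sum>v\<in>X. real n / (8 * real r))" by simp
    also have "\<dots> \<le> (\<Sum>v\<in>X. real (card {f\<in>Q. v \<in> f}))" by (rule sum_mono) (auto simp: X_def)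
    also have "\<dots> = real (\<Sum>v\<in>X. card {f\<in>Q. v \<in> f})" by simp
    also have "(\<Sum>v\<in>X. card {f\<in>Q. v \<in> f}) = card (SIGMA v:X. {f\<in>Q. v \<in> f})" using fX Q by (subst card_SigmaI) auto
    also have "\<dots> \<le> card (SIGMA f:?QX. f)"
    proof (rule card_inj_on_le[where f = prod.swap])
      show "finite (SIGMA f:?QX. f)" by (rule finite_SigmaI[OF fQX finf])
    qed auto
    also have "\<dots> = (\<Sum>f\<in>?QX. card f)" by (rule card_SigmaI[OF fQX]) (use finf in blast)
    also have "\<dots> = card ?QX * 2" using Q by simp
    finally show ?thesis using r0 by (simp add: field_simps)
  qed
  \<comment> \<open>Only a fixed number of the missing pairs is recorded, so that the size of
    \<open>F\<close> is known when supersets of \<open>F\<close> are counted.\<close>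
  define fx where "fx = nat \<lceil>real (card X) * real n / (16 * real r)\<rceil>"
  have "fx \<le> card ?QX" using QX by (simp add: fx_def nat_le_iff ceiling_le_iff)
  then obtain F where F: "F \<subseteq> ?QX" "card F = fx" by (meson obtain_subset_with_card_n)
  have "F \<subseteq> ?EX" using F Q E_edge by (auto simp: Q_def)
  moreover have "real (card F) = \<lceil>real (card X) * real n / (16 * real r)\<rceil>" using F(2) by (simp add: fx_def)
  moreover have "X \<subseteq> {1..n}" by (auto simp: X_def)
  ultimately show ?thesis using F Xne Tsub Tc by (intro exI[of _ X] exI[of _ F]) (auto simp: Q_def)
qed

section \<open>Counting in the dense range\<close>

abbreviation touching :: "nat set \<Rightarrow> nat set set" where
  "touching X \<equiv> {e. e \<subseteq> {1..n} \<and> card e = 2 \<and> e \<inter> X \<noteq> {}}"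

lemma finite_touching: "finite (touching X)"
  by (rule finite_subset[of _ "Pow {1..n}"]) auto

lemma card_touching:
  assumes "X \<subseteq> {1..n}"
  shows "card (touching X) \<le> card X * n"
proof -
  have fX: "finite X" using assms finite_subset by blast
  have "touching X \<subseteq> (\<lambda>(v, u). {v, u}) ` (X \<times> {1..n})"
  proof
    fix e assume e: "e \<in> touching X"
    then obtain v where v: "v \<in> e" "v \<in> X" by auto
    then obtain u where u: "e = {v, u}" using e by (auto simp: card_2_iff)
    then show "e \<in> (\<lambda>(v, u). {v, u}) ` (X \<times> {1..n})" using e v by (intro image_eqI[of _ _ "(v, u)"]) auto
  qed
  then have "card (touching X) \<le> card ((\<lambda>(v, u). {v, u}) ` (X \<times> {1..n}))" using fX by (intro card_mono) auto
  also have "\<dots> \<le> card (X \<times> {1..n})" using fX by (intro card_image_le) auto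
  finally show ?thesis by (simp add: card_cartesian_product)
qed

lemma edges_le: "finite A \<Longrightarrow> \<forall>e\<in>A. e \<subseteq> {1..n} \<and> card e = 2 \<Longrightarrow> 2 * real (card A) \<le> real n ^ 2"
proof -
  assume a: "finite A" "\<forall>e\<in>A. e \<subseteq> {1..n} \<and> card e = 2"
  have fin: "finite {e. e \<subseteq> {1..n} \<and> card e = 2}" by (rule finite_subset[of _ "Pow {1..n}"]) auto
  have "card A \<le> card {e. e \<subseteq> {1..n} \<and> card e = 2}" by (rule card_mono[OF fin]) (use a(2) in blast)
  also have "\<dots> = n * (n - 1) div 2" by (simp add: n_subsets choose_two)
  finally have "2 * card A \<le> n * (n - 1)" by linarith
  also have "\<dots> \<le> n * n" by simp
  finally have "real (2 * card A) \<le> real (n * n)" by (simp only: of_nat_le_iff)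
  then show ?thesis by (simp add: power2_eq_square)
qed

text \<open>\<open>Q\<close> is the set of missing crossing pairs. Forcing \<open>F\<close> into it
  and enlarging it by one pair for every inner edge leaves a gain of \<open>card F - card T\<close>
  factors (e - m)/e, each at most 16^(-32 r). The difference is at least 3/64 of
  \<open>card X * n / r\<close>, so the exponent 32 r yields more than the claimed power of
  1/16.\<close>

lemma dense_fibre:
  assumes X: "64 * r * card T \<le> card X * n"
    and F: "F \<subseteq> partition_graph P" "real (card F) = \<lceil>real (card X) * real n / (16 * real r)\<rceil>"
    and m: "(1 - (1 / 16) ^ (32 * r)) * real (e_part P) \<le> real m"
  shows "real (card {Q. F \<subseteq> Q \<and> Q \<subseteq> partition_graph P \<and> card Q + m = e_part P + card T})
    \<le> ((1 / 16) ^ n) ^ card X * real (e_part P choose m)"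
proof -
  let ?D = "{Q. F \<subseteq> Q \<and> Q \<subseteq> partition_graph P \<and> card Q + m = e_part P + card T}"
  let ?f = "card F" and ?t = "card T" and ?e = "e_part P"
  have r0: "0 < real r" using r2 by simp
  show ?thesis
  proof (cases "?D = {}")
    case True
    then show ?thesis by (simp only: card.empty) simp
  next
    case False
    then obtain Q where Q: "F \<subseteq> Q" "Q \<subseteq> partition_graph P" "card Q + m = ?e + ?t" by auto
    have fQ: "?f \<le> card Q" using Q finite_E by (meson card_mono finite_subset)
    have f16: "real (card X) * real n \<le> 16 * real r * real ?f"
    proof -
      have "real (card X) * real n / (16 * real r) \<le> real ?f" unfolding F(2) by (rule le_of_int_ceiling)
      then show ?thesis using r0 by (simp add: field_simps)
    qed
    have "real (64 * r * ?t) \<le> real (card X * n)" using X by (simp only: of_nat_le_iff)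
    then have t64: "64 * real r * real ?t \<le> real (card X) * real n" by simp
    have "real r * real ?t \<le> real r * real ?f"
    proof -
      have "0 \<le> real r * real ?t" "0 \<le> real r * real ?f" by auto
      moreover have "64 * (real r * real ?t) \<le> 16 * (real r * real ?f)" using f16 t64 by (simp only: mult.assoc)
      ultimately show ?thesis by linarith
    qed
    then have tf: "?t \<le> ?f" using r0 by simp
    define a where "a = ?f - ?t"
    have am: "a \<le> ?e - m" "m \<le> ?e" using fQ Q(3) tf by (auto simp: a_def)
    have "card ?D \<le> card {R. F \<subseteq> R \<and> R \<subseteq> partition_graph P \<and> card R = card Q}"
    proof (rule card_mono)
      show "finite {R. F \<subseteq> R \<and> R \<subseteq> partition_graph P \<and> card R = card Q}"
        by (rule finite_subset[of _ "Pow (partition_graph P)"]) (use finite_E in auto)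
    qed (use Q(3) in auto)
    also have "\<dots> \<le> (?e - ?f) choose (card Q - ?f)" unfolding e_part_def by (rule card_supersets[OF finite_E F(1)])
    also have "card Q - ?f = (?e - m) - a" using Q(3) fQ tf am by (simp add: a_def)
    \<comment> \<open>After enlarging the ground set to \<open>?e - a\<close> both entries are
      shifted by the same \<open>a\<close>, as \<open>choose_shift\<close> requires.\<close>
    also have "((?e - ?f) choose ((?e - m) - a)) \<le> ((?e - a) choose ((?e - m) - a))"
      by (rule binomial_right_mono) (simp add: a_def)
    finally have "real (card ?D) \<le> real ((?e - a) choose ((?e - m) - a))" by (simp only: of_nat_le_iff)
    also have "\<dots> \<le> (real (?e - m) / real ?e) ^ a * real (?e choose (?e - m))"
      by (rule choose_shift) (use am in auto)
    also have "?e choose (?e - m) = ?e choose m" using am by (simp add: binomial_symmetric[symmetric])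
    also have "(real (?e - m) / real ?e) ^ a \<le> ((1 / 16) ^ (32 * r)) ^ a"
    proof (rule power_mono)
      have "real (?e - m) \<le> (1 / 16) ^ (32 * r) * real ?e" using am m by (simp add: of_nat_diff algebra_simps)
      then show "real (?e - m) / real ?e \<le> (1 / 16) ^ (32 * r)"
        by (cases "?e = 0") (simp_all add: divide_le_eq)
    qed simp
    also have "((1 / 16 :: real) ^ (32 * r)) ^ a = (1 / 16) ^ (32 * r * a)" by (simp only: power_mult)
    also have "\<dots> \<le> (1 / 16) ^ (n * card X)"
    proof (rule power_decreasing)
      have "real a = real ?f - real ?t" using tf by (simp add: a_def of_nat_diff)
      then have "real (32 * r * a) = 32 * real r * (real ?f - real ?t)" by simp
      then have "real (32 * r * a) = 2 * (16 * real r * real ?f) - (64 * real r * real ?t) / 2" by (simp only: right_diff_distrib)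
      moreover have "0 \<le> real (card X) * real n" by simp
      ultimately have "real (n * card X) \<le> real (32 * r * a)" using f16 t64 by (simp only: of_nat_mult mult.commute[of "real n"])
      then show "n * card X \<le> 32 * r * a" by (simp only: of_nat_le_iff)
    qed auto
    also have "(1 / 16 :: real) ^ (n * card X) = ((1 / 16) ^ n) ^ card X" by (simp only: power_mult)
    finally show ?thesis by (simp add: mult_right_mono)
  qed
qed

text \<open>For a given \<open>X\<close> the inner edges and the set \<open>F\<close> consist of
  pairs meeting \<open>X\<close>, which leaves at most \<open>2 ^ (card X * n)\<close> choices for
  each. Against the gain from \<open>dense_fibre\<close> a factor \<open>(1 / 4) ^ n\<close> per
  vertex of \<open>X\<close> survives, and the sum over nonempty \<open>X\<close> is a binomial
  expansion without its constant term.\<close>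

lemma dense_bound:
  assumes n: "0 < n" and size: "\<forall>V\<in>P. real n / (2 * real r) \<le> real (card V)"
    and m: "(1 - (1 / 16) ^ (32 * r)) * real (e_part P) \<le> real m"
    and \<delta>: "\<delta> \<le> 1 / (2 ^ 13 * real r ^ 2)"
  shows "real (card (F_star n m r \<delta> \<gamma> P)) \<le> ((1 + (1 / 4) ^ n) ^ n - 1) * real (e_part P choose m)"
proof -
  let ?E = "partition_graph P" and ?e = "e_part P"
  let ?B = "\<lambda>X. {T. T \<subseteq> touching X \<and> 64 * r * card T \<le> card X * n}"
  let ?C = "\<lambda>X. {F. F \<subseteq> ?E \<and> F \<subseteq> touching X \<and> real (card F) = \<lceil>real (card X) * real n / (16 * real r)\<rceil>}"
  let ?D = "\<lambda>T F. {Q. F \<subseteq> Q \<and> Q \<subseteq> ?E \<and> card Q + m = ?e + card T}"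
  let ?A = "Pow {1..n} - {{}}"
  have r0: "0 < real r" using r2 by simp
  have fB: "finite (?B X)" for X by (rule finite_subset[of _ "Pow (touching X)"]) (use finite_touching in auto)
  have fC: "finite (?C X)" for X by (rule finite_subset[of _ "Pow ?E"]) (use finite_E in auto)
  have fD: "finite (?D T F)" for T F by (rule finite_subset[of _ "Pow ?E"]) (use finite_E in auto)
  have sub: "F_star n m r \<delta> \<gamma> P \<subseteq> (\<Union>X\<in>?A. \<Union>T\<in>?B X. \<Union>F\<in>?C X. (\<lambda>Q. T \<union> (?E - Q)) ` ?D T F)"
  proof
    fix G assume G: "G \<in> F_star n m r \<delta> \<gamma> P"
    let ?T = "inner_edges P G" and ?Q = "?E - G"
    have few: "real (card ?Q) < (real n / (64 * real r)) ^ 2"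
    proof -
      have eq: "real (card ?Q) + real m = real ?e + real (card ?T)"
        using card_missing[OF G] by (simp only: of_nat_add[symmetric] of_nat_eq_iff)
      have e2: "2 * real ?e \<le> real n ^ 2" unfolding e_part_def using edges_le[OF finite_E] E_edge by blast
      have m2: "2 * real m \<le> real n ^ 2" using edges_le[OF finite_G[OF G]] G_edge[OF G] card_G[OF G] by blast
      have q: "(1 / 16) ^ (32 * r) \<le> 1 / (2 ^ 13 * real r ^ 2)"
      proof -
        have "real r \<le> 2 ^ r" using less_exp[of r] by (metis less_imp_le of_nat_le_iff of_nat_numeral of_nat_power)
        then have "real r ^ 2 \<le> (2 ^ r) ^ 2" using r0 by (intro power_mono) auto
        also have "\<dots> = 2 ^ (2 * r)" by (simp add: power_mult[symmetric] mult.commute)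
        finally have "2 ^ 13 * real r ^ 2 \<le> 2 ^ 13 * 2 ^ (2 * r)" by simp
        also have "\<dots> = 2 ^ (13 + 2 * r)" by (simp add: power_add)
        also have "\<dots> \<le> 2 ^ (4 * (32 * r))" using r2 by (intro power_increasing) auto
        also have "\<dots> = 16 ^ (32 * r)" by (simp add: power_mult)
        finally have "2 ^ 13 * real r ^ 2 \<le> 16 ^ (32 * r)" .
        then have "1 / 16 ^ (32 * r) \<le> 1 / (2 ^ 13 * real r ^ 2)" using r0 by (intro divide_left_mono) auto
        then show ?thesis by (simp add: power_one_over)
      qed
      have "real (card ?Q) \<le> (1 / 16) ^ (32 * r) * real ?e + \<delta> * real m"
        using eq m inner_le[OF G] by (simp add: algebra_simps)
      \<comment> \<open>Both \<open>?e\<close> and \<open>m\<close> are at most half of n^2, so the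
        two coefficients 1/(2^13 r^2) together use at most half of the allowed (n/(64 r))^2.\<close>
      also have "\<dots> \<le> 1 / (2 ^ 13 * real r ^ 2) * real ?e + 1 / (2 ^ 13 * real r ^ 2) * real m"
        using q \<delta> by (intro add_mono mult_right_mono) auto
      also have "\<dots> = (1 / (2 ^ 13 * real r ^ 2)) * (real ?e + real m)" by (simp add: distrib_left)
      also have "\<dots> \<le> (1 / (2 ^ 13 * real r ^ 2)) * real n ^ 2" using e2 m2 by (intro mult_left_mono) auto
      also have "\<dots> < (1 / (2 ^ 12 * real r ^ 2)) * real n ^ 2"
        using n r0 by (intro mult_strict_right_mono) (auto simp: field_simps)
      also have "\<dots> = (real n / (64 * real r)) ^ 2" by (simp add: power2_eq_square)
      finally show ?thesis .
    qed
    obtain X F where XF: "X \<subseteq> {1..n}" "X \<noteq> {}" "?T \<subseteq> touching X" "64 * r * card ?T \<le> card X * n"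
      "F \<subseteq> ?Q" "F \<subseteq> touching X" "real (card F) = \<lceil>real (card X) * real n / (16 * real r)\<rceil>"
      using dense_structure[OF G n size few] by (elim exE conjE) (rule that)
    have "G = ?T \<union> (?E - ?Q)" using G_split(1)[OF G] by auto
    moreover have "?Q \<in> ?D ?T F" using XF card_missing[OF G] by auto
    ultimately have "G \<in> (\<lambda>Q. ?T \<union> (?E - Q)) ` ?D ?T F" by (rule image_eqI)
    moreover have "F \<in> ?C X" "?T \<in> ?B X" "X \<in> ?A" using XF by auto
    ultimately show "G \<in> (\<Union>X\<in>?A. \<Union>T\<in>?B X. \<Union>F\<in>?C X. (\<lambda>Q. T \<union> (?E - Q)) ` ?D T F)" by blast
  qed
  have "card (F_star n m r \<delta> \<gamma> P) \<le> card (\<Union>X\<in>?A. \<Union>T\<in>?B X. \<Union>F\<in>?C X. (\<lambda>Q. T \<union> (?E - Q)) ` ?D T F)"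
    by (intro card_mono[OF _ sub] finite_UN_I fB fC finite_imageI fD) auto
  also have "\<dots> \<le> (\<Sum>X\<in>?A. card (\<Union>T\<in>?B X. \<Union>F\<in>?C X. (\<lambda>Q. T \<union> (?E - Q)) ` ?D T F))"
    by (rule card_UN_le) simp
  also have "\<dots> \<le> (\<Sum>X\<in>?A. \<Sum>T\<in>?B X. card (\<Union>F\<in>?C X. (\<lambda>Q. T \<union> (?E - Q)) ` ?D T F))"
    by (intro sum_mono card_UN_le fB)
  also have "\<dots> \<le> (\<Sum>X\<in>?A. \<Sum>T\<in>?B X. \<Sum>F\<in>?C X. card ((\<lambda>Q. T \<union> (?E - Q)) ` ?D T F))"
    by (intro sum_mono card_UN_le fC)
  also have "\<dots> \<le> (\<Sum>X\<in>?A. \<Sum>T\<in>?B X. \<Sum>F\<in>?C X. card (?D T F))"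
    by (intro sum_mono card_image_le fD)
  finally have "real (card (F_star n m r \<delta> \<gamma> P)) \<le> (\<Sum>X\<in>?A. \<Sum>T\<in>?B X. \<Sum>F\<in>?C X. real (card (?D T F)))"
    by (simp only: of_nat_sum[symmetric] of_nat_le_iff)
  also have "\<dots> \<le> (\<Sum>X\<in>?A. \<Sum>T\<in>?B X. \<Sum>F\<in>?C X. ((1 / 16) ^ n) ^ card X * real (?e choose m))"
    by (intro sum_mono dense_fibre) (use m in auto)
  also have "\<dots> = (\<Sum>X\<in>?A. real (card (?B X)) * (real (card (?C X)) * (((1 / 16) ^ n) ^ card X * real (?e choose m))))"
    by simp
  also have "\<dots> \<le> (\<Sum>X\<in>?A. 2 ^ (card X * n) * (2 ^ (card X * n) * (((1 / 16) ^ n) ^ card X * real (?e choose m))))"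
  proof (rule sum_mono)
    fix X assume X: "X \<in> ?A"
    have pw: "real (card \<A>) \<le> 2 ^ (card X * n)" if "\<A> \<subseteq> Pow (touching X)" for \<A>
    proof -
      have "card \<A> \<le> card (Pow (touching X))" using that finite_touching by (intro card_mono) auto
      also have "\<dots> = 2 ^ card (touching X)" using finite_touching by (simp add: card_Pow)
      also have "\<dots> \<le> 2 ^ (card X * n)" using card_touching[of X] X by (intro power_increasing) auto
      finally have "real (card \<A>) \<le> real (2 ^ (card X * n))" by (simp only: of_nat_le_iff)
      then show ?thesis by simp
    qed
    show "real (card (?B X)) * (real (card (?C X)) * (((1 / 16) ^ n) ^ card X * real (?e choose m)))
      \<le> 2 ^ (card X * n) * (2 ^ (card X * n) * (((1 / 16) ^ n) ^ card X * real (?e choose m)))"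
      by (intro mult_mono pw) auto
  qed
  also have "\<dots> = (\<Sum>X\<in>?A. ((1 / 4) ^ n) ^ card X * real (?e choose m))"
  proof (intro sum.cong refl)
    fix X :: "nat set"
    have "2 ^ k * (2 ^ k * (1 / 16) ^ k) = (1 / 4 :: real) ^ k" for k by (simp flip: power_mult_distrib)
    then have "2 ^ (n * card X) * (2 ^ (n * card X) * ((1 / 16) ^ n) ^ card X) = ((1 / 4 :: real) ^ n) ^ card X"
      by (simp only: power_mult[symmetric])
    then show "2 ^ (card X * n) * (2 ^ (card X * n) * (((1 / 16) ^ n) ^ card X * real (?e choose m))) = ((1 / 4) ^ n) ^ card X * real (?e choose m)"
      by (simp only: mult.assoc[symmetric] mult.commute[of n])
  qed
  also have "\<dots> = (\<Sum>X\<in>?A. ((1 / 4) ^ n) ^ card X) * real (?e choose m)" by (simp only: sum_distrib_right)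
  also have "(\<Sum>X\<in>?A. ((1 / 4 :: real) ^ n) ^ card X) = (1 + (1 / 4) ^ n) ^ n - 1"
    using sum_Pow_power[of "{1..n}" "(1 / 4 :: real) ^ n"] by (simp add: sum_diff1)
  finally show ?thesis .
qed

end

section \<open>The sparse range\<close>

text \<open>Moving an edge from the crossing pairs into a part multiplies the number of choices for
  the crossing edges by at most \<open>m / (N - m)\<close>; the parameter \<open>z\<close> below
  bounds this ratio.\<close>

lemma choose_down:
  assumes "t \<le> m" "m < N"
  shows "real (N choose (m - t)) \<le> (real m / real (N - m)) ^ t * real (N choose m)"
  using assms
proof (induction t)
  case (Suc t)
  define k where "k = m - t"
  have k: "0 < k" "k \<le> m" "m - Suc t = k - 1" using Suc.prems by (auto simp: k_def)
  have "k * (N choose k) = (N - (k - 1)) * (N choose (k - 1))"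
    using binomial_absorb_comp[of N "k - 1"] binomial_absorption[of "k - 1" "N"] k
    by (metis One_nat_def Suc_pred binomial_absorption mult.commute binomial_absorb_comp)
  then have eq: "real k * real (N choose k) = real (N - (k - 1)) * real (N choose (k - 1))"
    by (metis of_nat_mult)
  have pos: "0 < real (N - (k - 1))" "0 < real (N - m)" "real (N - m) \<le> real (N - (k - 1))" using k assms(2) by auto
  have "real (N choose (m - Suc t)) = (real k / real (N - (k - 1))) * real (N choose k)"
    unfolding k(3) using eq pos(1) by (simp add: field_simps)
  also have "\<dots> \<le> (real m / real (N - m)) * ((real m / real (N - m)) ^ t * real (N choose m))"
    using Suc k pos by (intro mult_mono frac_le) (auto simp: k_def)
  finally show ?case by simp
qed simp

context vertex_partition
begin

text \<open>The \<open>t\<close> inner edges cost \<open>z ^ t\<close> by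
  \<open>choose_down\<close>, the prescribed crossing edges cost \<open>z ^ card F\<close> by
  \<open>choose_shift\<close>, and the remaining crossing edges form a uniform subset of the
  complement of \<open>F\<close>, to which \<open>uniform_le_rprob\<close> applies. Since the event
  is decreasing, putting \<open>F\<close> back can only make it rarer.\<close>

lemma fibre_count:
  fixes p \<eta> z :: real and F :: "nat set set"
  assumes p: "0 \<le> p" "p \<le> 1" and \<eta>: "0 < \<eta>" "\<eta> \<le> 1"
    and m: "m < e_part P" "real m \<le> z * real (e_part P - m)"
    and dens: "real (e_part P) * p \<le> (1 - \<eta>) * (real m - real t - real (card F))"
    and F: "F \<subseteq> partition_graph P"
    and Q: "\<forall>R R'. Q R \<longrightarrow> R' \<subseteq> R \<longrightarrow> Q R'"
  shows "\<eta> * real (card {H. F \<subseteq> H \<and> H \<subseteq> partition_graph P \<and> card H + t = m \<and> Q H})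
    \<le> z ^ (t + card F) * real (e_part P choose m) * rprob (partition_graph P) (\<lambda>_. p) Q"
proof -
  let ?E = "partition_graph P" and ?e = "e_part P" and ?f = "card F"
  let ?D = "{H. F \<subseteq> H \<and> H \<subseteq> ?E \<and> card H + t = m \<and> Q H}"
  have p01: "\<forall>x\<in>?E. 0 \<le> p \<and> p \<le> 1" using p by auto
  have R0: "0 \<le> rprob ?E (\<lambda>_. p) Q" by (rule rprob_nonneg[OF p01])
  have zpos: "0 \<le> z" using m by (metis of_nat_0_le_iff of_nat_0_less_iff zero_less_diff order_trans zero_le_mult_iff not_le)
  show ?thesis
  proof (cases "?D = {}")
    case True
    then show ?thesis using R0 zpos by (simp only: card.empty) simp
  next
    case False
    have fF: "finite F" using F finite_E finite_subset by blast
    obtain H0 where H0: "F \<subseteq> H0" "H0 \<subseteq> ?E" "card H0 + t = m" using False by auto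
    have fm: "?f + t \<le> m" using H0 finite_E by (metis add_le_mono1 card_mono finite_subset)
    define M where "M = m - t - ?f"
    let ?Q = "\<lambda>R. Q (R \<union> F)"
    have "card ?D \<le> card {R. R \<subseteq> ?E - F \<and> card R = M \<and> ?Q R}"
    proof (rule card_inj_on_le[where f = "\<lambda>H. H - F"])
      show "inj_on (\<lambda>H. H - F) ?D" by (auto simp: inj_on_def)
      show "(\<lambda>H. H - F) ` ?D \<subseteq> {R. R \<subseteq> ?E - F \<and> card R = M \<and> ?Q R}"
      proof
        fix R assume "R \<in> (\<lambda>H. H - F) ` ?D"
        then obtain H where H: "R = H - F" "F \<subseteq> H" "H \<subseteq> ?E" "card H + t = m" "Q H" by auto
        have "R \<union> F = H" using H by auto
        moreover have "card R = M" using H fF by (simp add: card_Diff_subset M_def)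
        ultimately show "R \<in> {R. R \<subseteq> ?E - F \<and> card R = M \<and> ?Q R}" using H by auto
      qed
      show "finite {R. R \<subseteq> ?E - F \<and> card R = M \<and> ?Q R}" using finite_E by simp
    qed
    then have "\<eta> * real (card ?D) \<le> \<eta> * real (card {R. R \<subseteq> ?E - F \<and> card R = M \<and> ?Q R})" using \<eta> by simp
    also have "\<dots> \<le> real (card (?E - F) choose M) * rprob (?E - F) (\<lambda>_. p) ?Q"
    proof (rule uniform_le_rprob[OF _ p _ _ \<eta>])
      show "finite (?E - F)" using finite_E by simp
      show "\<forall>R R'. ?Q R \<longrightarrow> R' \<subseteq> R \<longrightarrow> ?Q R'" using Q by (meson Un_mono order_refl)
      have "real (card (?E - F)) * p \<le> real ?e * p"
        unfolding e_part_def using p finite_E by (intro mult_right_mono) (auto intro!: card_mono)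
      also have "\<dots> \<le> (1 - \<eta>) * real M" 
      proof -
        have "real M = real m - real t - real ?f" using fm by (simp add: M_def of_nat_diff)
        then show ?thesis using dens by simp
      qed
      finally show "real (card (?E - F)) * p \<le> (1 - \<eta>) * real M" .
    qed
    also have "\<dots> \<le> (z ^ (t + ?f) * real (?e choose m)) * rprob ?E (\<lambda>_. p) Q"
    proof (rule mult_mono)
      have "card (?E - F) = ?e - ?f" using F fF by (simp add: card_Diff_subset e_part_def)
      then have "real (card (?E - F) choose M) = real ((?e - ?f) choose ((m - t) - ?f))" by (simp add: M_def)
      also have "\<dots> \<le> (real (m - t) / real ?e) ^ ?f * real (?e choose (m - t))"
        by (rule choose_shift) (use fm m in auto)
      also have "\<dots> \<le> z ^ ?f * (z ^ t * real (?e choose m))"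
      proof (intro mult_mono power_mono)
        have "real m / real (?e - m) \<le> z" using m by (simp add: divide_le_eq)
        moreover have "real (m - t) / real ?e \<le> real m / real (?e - m)" using m by (intro frac_le) auto
        ultimately show "real (m - t) / real ?e \<le> z" by (meson order_trans)
        have "real (?e choose (m - t)) \<le> (real m / real (?e - m)) ^ t * real (?e choose m)"
          by (rule choose_down) (use fm m in auto)
        also have "\<dots> \<le> z ^ t * real (?e choose m)"
          using \<open>real m / real (?e - m) \<le> z\<close> by (intro mult_right_mono power_mono) auto
        finally show "real (?e choose (m - t)) \<le> z ^ t * real (?e choose m)" .
      qed (use zpos in auto)
      also have "\<dots> = z ^ (t + ?f) * real (?e choose m)" by (simp add: power_add)
      finally show "real (card (?E - F) choose M) \<le> z ^ (t + ?f) * real (?e choose m)" .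
      have "rprob (?E - F) (\<lambda>_. p) ?Q = rprob ?E (\<lambda>_. p) ?Q" by (rule rprob_union_irrelevant[OF finite_E F, symmetric])
      also have "\<dots> \<le> rprob ?E (\<lambda>_. p) Q" by (rule rprob_mono[OF p01]) (meson Q Un_upper1)
      finally show "rprob (?E - F) (\<lambda>_. p) ?Q \<le> rprob ?E (\<lambda>_. p) Q" .
      show "0 \<le> rprob (?E - F) (\<lambda>_. p) ?Q" by (rule rprob_nonneg) (use p in simp)
    qed (use zpos in simp)
    finally show ?thesis .
  qed
qed

section \<open>Janson's inequality for low stars\<close>

definition low_free :: "nat set set \<Rightarrow> nat set set \<Rightarrow> bool" where
  "low_free T R \<longleftrightarrow> (\<forall>e\<in>T. \<forall>V\<in>P. e \<subseteq> V \<longrightarrow> (\<forall>S\<in>transv (P - {V}) (\<lambda>V. V). \<not> cross P (e \<union> S) \<subseteq> R))"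

text \<open>The weight of an edge depends on the size of its star only. The condition at a vertex is
  where the decomposition enters: the inverse square roots there sum to at most
  \<open>2 * sqrt d\<close>, and \<open>d\<close> is a small multiple of p n. When the total weight
  exceeds what Janson's inequality tolerates, all weights are scaled down by the common factor
  \<open>s\<close>; this gives the minimum in the exponent.\<close>

lemma low_gain:
  fixes p \<tau> \<Lambda> \<epsilon>1 M :: real and d :: nat
  assumes n: "0 < n" and size: "\<forall>V\<in>P. real n / (2 * real r) \<le> real (card V)" and p: "0 < p" "p \<le> 1"
    and pw2: "\<And>j. 2 \<le> j \<Longrightarrow> j \<le> r \<Longrightarrow> 1 \<le> real n ^ (j - 2) * p ^ ((j choose 2) - 1)"
    and pw3: "\<And>j. 3 \<le> j \<Longrightarrow> j \<le> r \<Longrightarrow> \<Lambda> \<le> real n ^ (j - 2) * p ^ ((j choose 2) - 1)"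
    and L: "\<Lambda> > 0" and M: "0 \<le> M" "M \<le> \<tau> * \<Lambda>"
      "\<forall>V\<in>P. M \<le> (\<Prod>W\<in>P - {V}. real (card W)) * p ^ ((Suc r choose 2) - 1)"
    and \<tau>: "0 < \<tau>" "2 ^ r * ((real r + 2) * (2 * real r) ^ r * \<tau>) \<le> \<epsilon>1" "\<epsilon>1 \<le> 1"
    and d: "2 * sqrt (real d) \<le> \<tau> * sqrt (p * real n)"
    and T: "finite T" "\<forall>e\<in>T. card e = 2 \<and> (\<exists>V\<in>P. e \<subseteq> V)"
    and c: "\<And>x. (\<Sum>e\<in>{e\<in>T. x \<in> e \<and> card {f\<in>T. c f = c e} \<le> d}. 1 / sqrt (real (card {f\<in>T. c f = c e})))
      \<le> 2 * sqrt (real (min (card {e\<in>T. x \<in> e}) d))"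
  shows "rprob (partition_graph P) (\<lambda>_. p) (low_free {e\<in>T. card {f\<in>T. c f = c e} \<le> d})
    \<le> exp (- ((1 - \<epsilon>1) * min (\<Sum>e\<in>{e\<in>T. card {f\<in>T. c f = c e} \<le> d}.
          min M (sqrt (p * real n / real (card {f\<in>T. c f = c e})))) (\<tau> * (real n ^ 2 * p))))"
proof -
  define a where "a = (\<lambda>e. card {f\<in>T. c f = c e})"
  define Tl where "Tl = {e\<in>T. a e \<le> d}"
  define w0 where "w0 = (\<lambda>e. min M (sqrt (p * real n / real (a e))))"
  define g where "g = sum w0 Tl"
  define y where "y = \<tau> * (real n ^ 2 * p)"
  define s where "s = (if g \<le> y then 1 else y / g)"
  have y0: "0 < y" using \<tau> n p by (simp add: y_def)
  have w00: "0 \<le> w0 e" for e using M p by (simp add: w0_def)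
  have g0: "0 \<le> g" unfolding g_def using w00 by (simp add: sum_nonneg)
  have s: "0 \<le> s" "s \<le> 1" using y0 by (auto simp: s_def)
  have sg: "s * g = min g y" using y0 by (auto simp: s_def)
  have ws: "s * w0 e \<le> w0 e" for e using s w00[of e] mult_right_mono[of s 1 "w0 e"] by simp
  have wM: "s * w0 e \<le> M" for e using ws[of e] by (simp add: w0_def)
  have fTl: "finite Tl" using T by (simp add: Tl_def)
  have "rprob (cross P (\<Union>P)) (\<lambda>_. p)
      (\<lambda>R. \<forall>e\<in>Tl. \<forall>V\<in>P. e \<subseteq> V \<longrightarrow> (\<forall>S\<in>transv (P - {V}) (\<lambda>V. V). \<not> cross P (e \<union> S) \<subseteq> R))
    \<le> exp (- ((1 - 2 ^ r * ((real r + 2) * (2 * real r) ^ r * \<tau>)) * sum (\<lambda>e. s * w0 e) Tl))"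
  proof (rule low_janson[OF finite_P disjoint_P _ card_P r2 size _ p pw2 pw3 L fTl])
    show "\<forall>V\<in>P. finite V" using finite_part by blast
    show "0 < real n" using n by simp
    show "\<forall>e\<in>Tl. card e = 2 \<and> (\<exists>V\<in>P. e \<subseteq> V)" using T by (simp add: Tl_def)
    show "\<forall>e\<in>Tl. 0 \<le> s * w0 e" using s w00 by simp
    show "\<forall>e\<in>Tl. \<forall>V\<in>P. s * w0 e \<le> (\<Prod>W\<in>P - {V}. real (card W)) * p ^ ((Suc r choose 2) - 1)"
      using wM M(3) by (meson order_trans)
    show "(\<Sum>e\<in>Tl. s * w0 e) \<le> \<tau> * ((real n)\<^sup>2 * p)"
      using sg y_def g_def by (simp add: sum_distrib_left[symmetric])
    show "\<forall>e\<in>Tl. s * w0 e \<le> \<tau> * \<Lambda>" using wM M(2) by (meson order_trans)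
    show "0 \<le> \<tau>" using \<tau> by simp
    show "\<forall>x. (\<Sum>e\<in>{e\<in>Tl. x \<in> e}. s * w0 e) \<le> \<tau> * (real n * p)"
    proof
      fix x
      have eqs: "{e\<in>Tl. x \<in> e} = {e\<in>T. x \<in> e \<and> card {f\<in>T. c f = c e} \<le> d}" by (auto simp: Tl_def a_def)
      have "(\<Sum>e\<in>{e\<in>Tl. x \<in> e}. s * w0 e) \<le> (\<Sum>e\<in>{e\<in>Tl. x \<in> e}. sqrt (p * real n) * (1 / sqrt (real (a e))))"
      proof (rule sum_mono)
        fix e
        have "s * w0 e \<le> sqrt (p * real n / real (a e))" using ws[of e] by (simp add: w0_def)
        then show "s * w0 e \<le> sqrt (p * real n) * (1 / sqrt (real (a e)))" by (simp add: real_sqrt_divide)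
      qed
      also have "\<dots> = sqrt (p * real n) * (\<Sum>e\<in>{e\<in>Tl. x \<in> e}. 1 / sqrt (real (a e)))" by (simp only: sum_distrib_left)
      also have "\<dots> \<le> sqrt (p * real n) * (2 * sqrt (real (min (card {e\<in>T. x \<in> e}) d)))"
        using c[of x] p unfolding eqs a_def by (intro mult_left_mono) auto
      also have "\<dots> \<le> sqrt (p * real n) * (2 * sqrt (real d))" using p by (intro mult_left_mono) auto
      also have "\<dots> \<le> sqrt (p * real n) * (\<tau> * sqrt (p * real n))" using d p by (intro mult_left_mono) auto
      also have "\<dots> = \<tau> * (real n * p)" using p by (simp add: mult.commute mult.left_commute)
      finally show "(\<Sum>e\<in>{e\<in>Tl. x \<in> e}. s * w0 e) \<le> \<tau> * (real n * p)" .
    qed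
  qed
  also have "\<dots> \<le> exp (- ((1 - \<epsilon>1) * min g y))"
  proof -
    have "sum (\<lambda>e. s * w0 e) Tl = min g y" using sg g_def by (simp add: sum_distrib_left[symmetric])
    moreover have "(1 - \<epsilon>1) * min g y \<le> (1 - 2 ^ r * ((real r + 2) * (2 * real r) ^ r * \<tau>)) * min g y"
      using \<tau> g0 y0 by (intro mult_right_mono) auto
    ultimately show ?thesis by simp
  qed
  finally show ?thesis
    unfolding partition_graph_cross low_free_def Tl_def g_def w0_def y_def a_def .
qed

end

text \<open>Rankin's trick: when \<open>card T\<close> is at most \<open>b\<close>, the factor
  \<open>(1 / \<theta>) ^ card T\<close> is at most \<open>(1 / \<theta>)\<close> to the power
  \<open>b\<close>, so the sum extends to all subsets with \<open>z\<close> replaced by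
  \<open>\<theta> * z\<close>.\<close>

lemma sum_small_subsets:
  fixes z \<theta> b :: real
  assumes A: "finite A" and \<theta>: "0 < \<theta>" "\<theta> \<le> 1" and z: "0 \<le> z"
  shows "(\<Sum>T\<in>{T\<in>Pow A. real (card T) \<le> b}. z ^ card T) \<le> exp (b * ln (1 / \<theta>) + \<theta> * z * real (card A))"
proof -
  have "(\<Sum>T\<in>{T\<in>Pow A. real (card T) \<le> b}. z ^ card T)
      \<le> (\<Sum>T\<in>{T\<in>Pow A. real (card T) \<le> b}. exp (b * ln (1 / \<theta>)) * (\<theta> * z) ^ card T)"
  proof (rule sum_mono)
    fix T assume T: "T \<in> {T\<in>Pow A. real (card T) \<le> b}"
    have "(1 / \<theta>) ^ card T = exp (real (card T) * ln (1 / \<theta>))" using \<theta> by (simp add: exp_of_nat_mult)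
    also have "\<dots> \<le> exp (b * ln (1 / \<theta>))" using T \<theta> by (auto intro!: mult_right_mono)
    finally have "(1 / \<theta>) ^ card T * (\<theta> * z) ^ card T \<le> exp (b * ln (1 / \<theta>)) * (\<theta> * z) ^ card T"
      using \<theta> z by (intro mult_right_mono) auto
    moreover have "(1 / \<theta>) ^ card T * (\<theta> * z) ^ card T = z ^ card T" using \<theta> by (simp flip: power_mult_distrib)
    ultimately show "z ^ card T \<le> exp (b * ln (1 / \<theta>)) * (\<theta> * z) ^ card T" by simp
  qed
  also have "\<dots> \<le> (\<Sum>T\<in>Pow A. exp (b * ln (1 / \<theta>)) * (\<theta> * z) ^ card T)"
    using A \<theta> z by (intro sum_mono2) auto
  also have "\<dots> = exp (b * ln (1 / \<theta>)) * (1 + \<theta> * z) ^ card A"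
    using A by (simp add: sum_distrib_left[symmetric] sum_Pow_power)
  also have "\<dots> \<le> exp (b * ln (1 / \<theta>)) * exp (\<theta> * z) ^ card A"
    using \<theta> z by (intro mult_left_mono power_mono exp_ge_add_one_self) auto
  also have "\<dots> = exp (b * ln (1 / \<theta>) + \<theta> * z * real (card A))"
    by (simp add: exp_add exp_of_nat_mult[symmetric] mult.commute)
  finally show ?thesis .
qed

text \<open>\<open>p\<close> is the binomial density, \<open>\<eta>\<close> the margin in the
  comparison with the uniform set, \<open>z\<close> the price of a prescribed or inner edge,
  \<open>\<theta>\<close> the parameter for \<open>sum_small_subsets\<close>. Stars with at most
  \<open>d\<close> edges are low. \<open>h\<close> is the exponent earned by a sequence of boxes and
  \<open>b0\<close> the bound per box on the corresponding sum; \<open>u\<close> is what remains for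
  each high centre after all entropy is paid, and \<open>S\<close> bounds the contribution of
  nonempty low stars at one vertex.\<close>

locale sparse_range = vertex_partition n r P for n r :: nat and P :: "nat set set" +
  fixes m d :: nat and p \<eta> z \<tau> \<Lambda> \<epsilon>1 M \<delta> \<gamma> u \<theta> b0 S :: real
    and h :: "(nat set \<Rightarrow> nat set) list \<Rightarrow> real"
  assumes n0: "0 < n" and size: "\<forall>V\<in>P. real n / (2 * real r) \<le> real (card V)"
    and p: "0 < p" "p \<le> 1" and \<eta>: "0 < \<eta>" "\<eta> \<le> 1"
    and me: "m < e_part P" and mz: "real m \<le> z * real (e_part P - m)" and z0: "0 < z"
    and \<delta>: "0 \<le> \<delta>"
    and dens: "real (e_part P) * p \<le> (1 - \<eta>) * ((1 - (real r + 1) * \<delta>) * real m)"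
    and pw2: "\<And>j. 2 \<le> j \<Longrightarrow> j \<le> r \<Longrightarrow> 1 \<le> real n ^ (j - 2) * p ^ ((j choose 2) - 1)"
    and pw3: "\<And>j. 3 \<le> j \<Longrightarrow> j \<le> r \<Longrightarrow> \<Lambda> \<le> real n ^ (j - 2) * p ^ ((j choose 2) - 1)"
    and L: "\<Lambda> > 0" and M: "0 \<le> M" "M \<le> \<tau> * \<Lambda>"
      "\<forall>V\<in>P. M \<le> (\<Prod>W\<in>P - {V}. real (card W)) * p ^ ((Suc r choose 2) - 1)"
    and \<tau>: "0 < \<tau>" "2 ^ r * ((real r + 2) * (2 * real r) ^ r * \<tau>) \<le> \<epsilon>1"
    and \<epsilon>1: "0 < \<epsilon>1" "\<epsilon>1 \<le> 1"
    and d: "1 \<le> d" "2 * sqrt (real d) \<le> \<tau> * sqrt (p * real n)"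
    and \<theta>: "0 < \<theta>" "\<theta> \<le> 1"
    and h1: "\<And>xs. set xs \<subseteq> PiE P (\<lambda>V. {A. A \<subseteq> V \<and> card A = d}) \<Longrightarrow> real (length xs) * real d \<le> \<delta> * real m \<Longrightarrow>
        rprob (cross P (\<Union>P)) (\<lambda>_. p) (\<lambda>R. \<forall>W\<in>set xs. \<forall>S\<in>transv P W. \<not> cross P S \<subseteq> R) \<le> exp (- h xs)"
    and h2: "\<And>y. real y * real d \<le> \<delta> * real m \<Longrightarrow>
        (\<Sum>xs\<in>{xs. set xs \<subseteq> PiE P (\<lambda>V. {A. A \<subseteq> V \<and> card A = d}) \<and> length xs = y}. exp (- (\<epsilon>1 * h xs))) \<le> b0 ^ y"
    and u0: "0 \<le> u" and b0: "0 \<le> b0" "b0 * z ^ (r * d) \<le> exp (- (real r * (z * real n + u)))"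
    and S: "(\<Sum>B\<in>{B\<in>Pow {1..n}. card B \<le> d}. z ^ card B *
        exp (- ((1 - \<epsilon>1) ^ 2 * (real (card B) * min M (sqrt (p * real n / real (card B))))))) \<le> 1 + S"
begin

section \<open>Graphs whose low stars have a large total gain\<close>

definition wl :: "nat \<Rightarrow> real" where "wl a = min M (sqrt (p * real n / real a))"

abbreviation "E \<equiv> partition_graph P"
abbreviation "\<W> \<equiv> PiE P (\<lambda>V. {A. A \<subseteq> V \<and> card A = d})"

text \<open>Only this estimate on the centre map survives from \<open>star_decomposition\<close>;
  how the stars were peeled off is forgotten.\<close>

definition is_star :: "nat set set \<Rightarrow> (nat set \<Rightarrow> nat) \<Rightarrow> bool" where
  "is_star T c \<longleftrightarrow> (\<forall>e\<in>T. c e \<in> e) \<and> (\<forall>x.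
    (\<Sum>e\<in>{e\<in>T. x \<in> e \<and> card {f\<in>T. c f = c e} \<le> d}. 1 / sqrt (real (card {f\<in>T. c f = c e})))
      \<le> 2 * sqrt (real (min (card {e\<in>T. x \<in> e}) d)))"

definition lowpart :: "nat set set \<Rightarrow> (nat set \<Rightarrow> nat) \<Rightarrow> nat set set" where
  "lowpart T c = {e\<in>T. card {f\<in>T. c f = c e} \<le> d}"

definition gain :: "nat set set \<Rightarrow> (nat set \<Rightarrow> nat) \<Rightarrow> real" where
  "gain T c = (\<Sum>e\<in>lowpart T c. wl (card {f\<in>T. c f = c e}))"

lemma low_prob:
  assumes "finite T" "\<forall>e\<in>T. card e = 2 \<and> (\<exists>V\<in>P. e \<subseteq> V)" "is_star T c"
  shows "rprob E (\<lambda>_. p) (low_free (lowpart T c)) \<le> exp (- ((1 - \<epsilon>1) * min (gain T c) (\<tau> * (real n ^ 2 * p))))"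
  unfolding lowpart_def gain_def wl_def
  by (rule low_gain[OF n0 size p pw2 pw3 L M \<tau> \<epsilon>1(2) d(2) assms(1,2)])
    (use assms(3) in \<open>auto simp: is_star_def\<close>)

lemma low_free_antimono: "\<forall>R R'. low_free T R \<longrightarrow> R' \<subseteq> R \<longrightarrow> low_free T R'"
  unfolding low_free_def by (meson order_trans)

lemma p01: "\<forall>x\<in>E. 0 \<le> p \<and> p \<le> 1"
  using p by auto

lemma G_low_free:
  assumes "G \<in> F_star n m r \<delta> \<gamma> P" "T \<subseteq> inner_edges P G"
  shows "low_free T (G \<inter> E)"
  unfolding low_free_def using clique_at_edge[OF assms(1)] assms(2) by blast

lemma inner_props:
  assumes "G \<in> F_star n m r \<delta> \<gamma> P"
  shows "finite (inner_edges P G)" "\<forall>e\<in>inner_edges P G. card e = 2 \<and> (\<exists>V\<in>P. e \<subseteq> V)"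
  using finite_G[OF assms] inner_edge[OF assms] by (auto simp: inner_edges_def G_edge[OF assms])

text \<open>Here the minimum in \<open>low_gain\<close> is the cut-off, an exponent of order n^2 p.
  It outweighs the number of all inner graphs with at most \<open>\<delta> * m\<close> edges,
  whatever their structure.\<close>

definition class1 :: "nat set set set" where
  "class1 = {G\<in>F_star n m r \<delta> \<gamma> P. \<exists>c. is_star (inner_edges P G) c \<and> \<tau> * (real n ^ 2 * p) < gain (inner_edges P G) c}"

lemma class1_count:
  "\<eta> * real (card class1) \<le> real (e_part P choose m) *
     exp (- ((1 - \<epsilon>1) * (\<tau> * (real n ^ 2 * p))) + (\<delta> * real m * ln (1 / \<theta>) + \<theta> * z * real n ^ 2))"
proof -
  let ?y = "\<tau> * (real n ^ 2 * p)"
  let ?pairs = "{e. e \<subseteq> {1..n} \<and> card e = 2}"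
  have fpairs: "finite ?pairs" by (rule finite_subset[of _ "Pow {1..n}"]) auto
  define ok where "ok = (\<lambda>T c. is_star T c \<and> ?y < gain T c)"
  \<comment> \<open>The union runs over \<open>T\<close> alone: one decomposition is fixed for each
    \<open>T\<close>, so that decompositions are not counted.\<close>
  define cs where "cs = (\<lambda>T. SOME c. ok T c)"
  define \<T> where "\<T> = {T\<in>Pow ?pairs. real (card T) \<le> \<delta> * real m \<and> (\<forall>e\<in>T. \<exists>V\<in>P. e \<subseteq> V) \<and> (\<exists>c. ok T c)}"
  let ?D = "\<lambda>T. {H. {} \<subseteq> H \<and> H \<subseteq> E \<and> card H + card T = m \<and> low_free (lowpart T (cs T)) H}"
  have f\<T>: "finite \<T>" unfolding \<T>_def by (rule finite_subset[of _ "Pow ?pairs"]) (use fpairs in auto)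
  have fD: "finite (?D T)" for T by (rule finite_subset[of _ "Pow E"]) (use finite_E in auto)
  have sub: "class1 \<subseteq> (\<Union>T\<in>\<T>. (\<lambda>H. T \<union> H) ` ?D T)"
  proof
    fix G assume "G \<in> class1"
    then have G: "G \<in> F_star n m r \<delta> \<gamma> P" and ex: "\<exists>c. ok (inner_edges P G) c" by (auto simp: class1_def ok_def)
    let ?T = "inner_edges P G"
    have "?T \<subseteq> ?pairs" using G_edge[OF G] unfolding inner_edges_def by blast
    moreover have "\<forall>e\<in>?T. \<exists>V\<in>P. e \<subseteq> V" using inner_props(2)[OF G] by blast
    ultimately have T: "?T \<in> \<T>" unfolding \<T>_def using inner_le[OF G] ex by blast
    have "lowpart ?T (cs ?T) \<subseteq> ?T" by (auto simp: lowpart_def)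
    then have "G \<inter> E \<in> ?D ?T" using card_cut[OF G] G_low_free[OF G] by simp
    then have "?T \<union> (G \<inter> E) \<in> (\<lambda>H. ?T \<union> H) ` ?D ?T" by (rule imageI)
    then have "G \<in> (\<lambda>H. ?T \<union> H) ` ?D ?T" by (simp only: G_split(1)[OF G, symmetric])
    with T show "G \<in> (\<Union>T\<in>\<T>. (\<lambda>H. T \<union> H) ` ?D T)" by (rule UN_I)
  qed
  have fibre: "\<eta> * real (card (?D T)) \<le> z ^ card T * (real (e_part P choose m) * exp (- ((1 - \<epsilon>1) * ?y)))" if T: "T \<in> \<T>" for T
  proof -
    have okT: "ok T (cs T)" unfolding cs_def using T unfolding \<T>_def by (intro someI_ex[of "ok T"]) blast
    have T': "finite T" "\<forall>e\<in>T. card e = 2 \<and> (\<exists>V\<in>P. e \<subseteq> V)" "real (card T) \<le> \<delta> * real m"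
    proof -
      have "T \<subseteq> ?pairs" using T unfolding \<T>_def by blast
      then show "finite T" by (rule finite_subset[OF _ fpairs])
      show "\<forall>e\<in>T. card e = 2 \<and> (\<exists>V\<in>P. e \<subseteq> V)" using T unfolding \<T>_def by blast
      show "real (card T) \<le> \<delta> * real m" using T unfolding \<T>_def by blast
    qed
    have "\<eta> * real (card (?D T)) \<le> z ^ (card T + card ({} :: nat set set)) * real (e_part P choose m) * rprob E (\<lambda>_. p) (low_free (lowpart T (cs T)))"
    proof (rule fibre_count[OF _ p(2) \<eta> me mz])
      have "(1 - (real r + 1) * \<delta>) * real m \<le> real m - real (card T) - real (card ({} :: nat set set))"
      proof -
        have "0 \<le> real r * \<delta> * real m" using \<delta> by simp
        then show ?thesis using T'(3) by (simp add: algebra_simps)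
      qed
      then have "(1 - \<eta>) * ((1 - (real r + 1) * \<delta>) * real m) \<le> (1 - \<eta>) * (real m - real (card T) - real (card ({} :: nat set set)))"
        using \<eta> by (intro mult_left_mono) auto
      then show "real (e_part P) * p \<le> (1 - \<eta>) * (real m - real (card T) - real (card ({} :: nat set set)))" using dens by linarith
      show "\<forall>R R'. low_free (lowpart T (cs T)) R \<longrightarrow> R' \<subseteq> R \<longrightarrow> low_free (lowpart T (cs T)) R'" by (rule low_free_antimono)
    qed (use p in auto)
    also have "\<dots> \<le> z ^ (card T + card ({} :: nat set set)) * real (e_part P choose m) * exp (- ((1 - \<epsilon>1) * ?y))"
    proof (rule mult_left_mono)
      have "rprob E (\<lambda>_. p) (low_free (lowpart T (cs T))) \<le> exp (- ((1 - \<epsilon>1) * min (gain T (cs T)) ?y))"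
        by (rule low_prob[OF T'(1,2)]) (use okT in \<open>simp add: ok_def\<close>)
      moreover have "min (gain T (cs T)) ?y = ?y" using okT by (simp add: ok_def)
      ultimately show "rprob E (\<lambda>_. p) (low_free (lowpart T (cs T))) \<le> exp (- ((1 - \<epsilon>1) * ?y))" by simp
    qed (use z0 in auto)
    finally show ?thesis by simp
  qed
  have "card class1 \<le> card (\<Union>T\<in>\<T>. (\<lambda>H. T \<union> H) ` ?D T)"
    by (intro card_mono[OF _ sub] finite_UN_I f\<T> finite_imageI fD)
  also have "\<dots> \<le> (\<Sum>T\<in>\<T>. card ((\<lambda>H. T \<union> H) ` ?D T))" by (rule card_UN_le[OF f\<T>])
  also have "\<dots> \<le> (\<Sum>T\<in>\<T>. card (?D T))" by (intro sum_mono card_image_le fD)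
  finally have "real (card class1) \<le> (\<Sum>T\<in>\<T>. real (card (?D T)))" by (simp only: of_nat_sum[symmetric] of_nat_le_iff)
  then have "\<eta> * real (card class1) \<le> \<eta> * (\<Sum>T\<in>\<T>. real (card (?D T)))" using \<eta> by simp
  also have "\<dots> = (\<Sum>T\<in>\<T>. \<eta> * real (card (?D T)))" by (rule sum_distrib_left)
  also have "\<dots> \<le> (\<Sum>T\<in>\<T>. z ^ card T * (real (e_part P choose m) * exp (- ((1 - \<epsilon>1) * ?y))))"
    using fibre by (rule sum_mono)
  also have "\<dots> = (\<Sum>T\<in>\<T>. z ^ card T) * (real (e_part P choose m) * exp (- ((1 - \<epsilon>1) * ?y)))"
    by (simp only: sum_distrib_right)
  also have "\<dots> \<le> exp (\<delta> * real m * ln (1 / \<theta>) + \<theta> * z * real n ^ 2) * (real (e_part P choose m) * exp (- ((1 - \<epsilon>1) * ?y)))"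
  proof (rule mult_right_mono)
    have "(\<Sum>T\<in>\<T>. z ^ card T) \<le> (\<Sum>T\<in>{T\<in>Pow ?pairs. real (card T) \<le> \<delta> * real m}. z ^ card T)"
      using fpairs z0 by (intro sum_mono2) (auto simp: \<T>_def)
    also have "\<dots> \<le> exp (\<delta> * real m * ln (1 / \<theta>) + \<theta> * z * real (card ?pairs))"
      by (rule sum_small_subsets[OF fpairs \<theta>]) (use z0 in simp)
    also have "\<dots> \<le> exp (\<delta> * real m * ln (1 / \<theta>) + \<theta> * z * real n ^ 2)"
    proof -
      have "2 * real (card ?pairs) \<le> real n ^ 2" by (rule edges_le[OF fpairs]) simp
      then have "real (card ?pairs) \<le> real n ^ 2" by linarith
      then show ?thesis using \<theta> z0 by simp
    qed
    finally show "(\<Sum>T\<in>\<T>. z ^ card T) \<le> exp (\<delta> * real m * ln (1 / \<theta>) + \<theta> * z * real n ^ 2)" .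
  qed simp
  finally show ?thesis by (simp only: exp_add mult_ac)
qed

text \<open>The price of a star with \<open>a\<close> leaves. One factor
  \<open>1 - \<epsilon>1\<close> is the loss from correlations, the other the loss from mixing with
  the bound for high stars. A star with more than \<open>d\<close> leaves has no gain of its own; it
  is paid for by its box.\<close>

definition \<psi> :: "nat \<Rightarrow> real" where
  "\<psi> a = z ^ a * (if a \<le> d then exp (- ((1 - \<epsilon>1) ^ 2 * (real a * wl a))) else 1)"

abbreviation "\<N>s \<equiv> PiE {1..n} (\<lambda>_. Pow {1..n})"

definition big :: "(nat \<Rightarrow> nat set) \<Rightarrow> nat set" where
  "big N = {v\<in>{1..n}. d < card (N v)}"

text \<open>An inner graph is replaced by the function from centres to leaf sets. Its price is then
  a product over the vertices, and sums over inner graphs factorise.\<close>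

definition \<phi> :: "(nat \<Rightarrow> nat set) \<Rightarrow> real" where
  "\<phi> N = (\<Prod>v\<in>{1..n}. \<psi> (card (N v)))"

lemma \<psi>_nonneg: "0 \<le> \<psi> a"
  using z0 by (simp add: \<psi>_def)

lemma \<phi>_nonneg: "0 \<le> \<phi> N"
  unfolding \<phi>_def by (intro prod_nonneg) (simp add: \<psi>_nonneg)

lemma sum_low: "(\<Sum>B\<in>{B\<in>Pow {1..n}. card B \<le> d}. \<psi> (card B)) \<le> 1 + S"
proof -
  have "(\<Sum>B\<in>{B\<in>Pow {1..n}. card B \<le> d}. \<psi> (card B)) = (\<Sum>B\<in>{B\<in>Pow {1..n}. card B \<le> d}. z ^ card B *
        exp (- ((1 - \<epsilon>1) ^ 2 * (real (card B) * min M (sqrt (p * real n / real (card B)))))))"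
    by (intro sum.cong) (auto simp: \<psi>_def wl_def)
  then show ?thesis using S by simp
qed

lemma S_nonneg: "0 \<le> S"
proof -
  have "\<psi> (card ({} :: nat set)) \<le> (\<Sum>B\<in>{B\<in>Pow {1..n}. card B \<le> d}. \<psi> (card B))"
    using \<psi>_nonneg by (intro member_le_sum) auto
  then show ?thesis using sum_low by (simp add: \<psi>_def)
qed

lemma sum_high: "(\<Sum>B\<in>{B\<in>Pow {1..n}. d < card B}. \<psi> (card B)) \<le> exp (z * real n)"
proof -
  have "(\<Sum>B\<in>{B\<in>Pow {1..n}. d < card B}. \<psi> (card B)) = (\<Sum>B\<in>{B\<in>Pow {1..n}. d < card B}. z ^ card B)"
    by (intro sum.cong) (auto simp: \<psi>_def)
  also have "\<dots> \<le> (\<Sum>B\<in>Pow {1..n}. z ^ card B)" using z0 by (intro sum_mono2) auto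
  also have "\<dots> = (1 + z) ^ n" by (simp add: sum_Pow_power)
  also have "\<dots> \<le> exp z ^ n" using z0 by (intro power_mono exp_ge_add_one_self) auto
  also have "\<dots> = exp (z * real n)" by (simp add: exp_of_nat_mult[symmetric] mult.commute)
  finally show ?thesis .
qed

text \<open>One side of the box at a high centre consists of leaves of its star. Prescribing these
  \<open>d\<close> leaves yields \<open>z ^ d\<close>, which pays for the choice of that
  side.\<close>

lemma sum_high_superset:
  assumes "A \<subseteq> {1..n}" "card A = d"
  shows "(\<Sum>B\<in>{B\<in>Pow {1..n}. d < card B \<and> A \<subseteq> B}. \<psi> (card B)) \<le> exp (z * real n) * z ^ d"
proof -
  let ?s = "{B\<in>Pow {1..n}. d < card B \<and> A \<subseteq> B}"
  have inj: "inj_on (\<lambda>B. B - A) ?s" by (auto simp: inj_on_def)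
  have fA: "finite A" using assms finite_subset by blast
  have "(\<Sum>B\<in>?s. \<psi> (card B)) = (\<Sum>B\<in>?s. z ^ d * z ^ card (B - A))"
  proof (intro sum.cong refl)
    fix B assume B: "B \<in> ?s"
    then have "card (B - A) = card B - d" using assms fA by (simp add: card_Diff_subset)
    then show "\<psi> (card B) = z ^ d * z ^ card (B - A)" using B by (simp add: \<psi>_def power_add[symmetric])
  qed
  also have "\<dots> = z ^ d * (\<Sum>C\<in>(\<lambda>B. B - A) ` ?s. z ^ card C)"
    by (simp only: sum_distrib_left[symmetric] sum.reindex[OF inj] o_def)
  also have "\<dots> \<le> z ^ d * (\<Sum>C\<in>Pow {1..n}. z ^ card C)"
    using z0 by (intro mult_left_mono sum_mono2) auto
  also have "\<dots> = z ^ d * (1 + z) ^ n" by (simp add: sum_Pow_power)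
  also have "\<dots> \<le> z ^ d * exp z ^ n" using z0 by (intro mult_left_mono power_mono exp_ge_add_one_self) auto
  also have "\<dots> = exp (z * real n) * z ^ d" by (simp add: exp_of_nat_mult[symmetric] mult.commute)
  finally show ?thesis .
qed

text \<open>\<open>X\<close> is the set of high centres, and \<open>Y\<close> consists of those
  whose boxes are recorded.\<close>

lemma sum_\<phi>:
  assumes X: "X \<subseteq> {1..n}" "Y \<subseteq> X" and B: "\<And>v. v \<in> Y \<Longrightarrow> B v \<subseteq> {1..n} \<and> card (B v) = d"
  shows "(\<Sum>N\<in>{N\<in>\<N>s. big N = X \<and> (\<forall>v\<in>Y. B v \<subseteq> N v)}. \<phi> N)
    \<le> (1 + S) ^ n * exp (z * real n) ^ card X * (z ^ d) ^ card Y"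
proof -
  define Ch where "Ch = (\<lambda>v. if v \<notin> X then {B\<in>Pow {1..n}. card B \<le> d}
     else if v \<in> Y then {A\<in>Pow {1..n}. d < card A \<and> B v \<subseteq> A} else {B\<in>Pow {1..n}. d < card B})"
  define fac where "fac = (\<lambda>v. (if v \<in> X then exp (z * real n) else 1 + S) * (if v \<in> Y then z ^ d else 1))"
  have "{N\<in>\<N>s. big N = X \<and> (\<forall>v\<in>Y. B v \<subseteq> N v)} \<subseteq> PiE {1..n} Ch"
  proof
    fix N assume "N \<in> {N\<in>\<N>s. big N = X \<and> (\<forall>v\<in>Y. B v \<subseteq> N v)}"
    then have N: "N \<in> \<N>s" "big N = X" "\<forall>v\<in>Y. B v \<subseteq> N v" by auto
    have "N v \<in> Ch v" if v: "v \<in> {1..n}" for v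
    proof -
      have "N v \<subseteq> {1..n}" using N(1) v by auto
      moreover have "v \<in> X \<longleftrightarrow> d < card (N v)" using N(2) v by (auto simp: big_def)
      ultimately show ?thesis using N(3) by (auto simp: Ch_def)
    qed
    then show "N \<in> PiE {1..n} Ch" using N(1) by (auto simp: PiE_def)
  qed
  moreover have fCh: "finite (Ch v)" for v by (simp add: Ch_def)
  ultimately have "(\<Sum>N\<in>{N\<in>\<N>s. big N = X \<and> (\<forall>v\<in>Y. B v \<subseteq> N v)}. \<phi> N) \<le> (\<Sum>N\<in>PiE {1..n} Ch. \<phi> N)"
    using \<phi>_nonneg by (intro sum_mono2 finite_PiE) auto
  also have "\<dots> = (\<Prod>v\<in>{1..n}. \<Sum>A\<in>Ch v. \<psi> (card A))"
    unfolding \<phi>_def using fCh by (intro prod_sum_PiE[symmetric]) auto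
  also have "\<dots> \<le> (\<Prod>v\<in>{1..n}. fac v)"
  proof (intro prod_mono conjI)
    fix v assume "v \<in> {1..n}"
    show "0 \<le> (\<Sum>A\<in>Ch v. \<psi> (card A))" using \<psi>_nonneg by (intro sum_nonneg) auto
    show "(\<Sum>A\<in>Ch v. \<psi> (card A)) \<le> fac v"
    proof (cases "v \<in> X")
      case False
      then have "v \<notin> Y" using X by auto
      then show ?thesis using False sum_low by (simp add: Ch_def fac_def)
    next
      case True
      then show ?thesis using sum_high sum_high_superset[of "B v"] B[of v]
        by (cases "v \<in> Y") (auto simp: Ch_def fac_def)
    qed
  qed
  also have "\<dots> = (\<Prod>v\<in>{1..n}. if v \<in> X then exp (z * real n) else 1 + S) * (\<Prod>v\<in>{1..n}. if v \<in> Y then z ^ d else 1)"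
    unfolding fac_def by (rule prod.distrib)
  also have "(\<Prod>v\<in>{1..n}. if v \<in> Y then z ^ d else 1) = (z ^ d) ^ card Y"
  proof -
    have "{1..n} \<inter> {v. v \<in> Y} = Y" using X by auto
    then show ?thesis by (simp add: prod.If_cases)
  qed
  also have "(\<Prod>v\<in>{1..n}. if v \<in> X then exp (z * real n) else 1 + S) \<le> (1 + S) ^ n * exp (z * real n) ^ card X"
  proof -
    have eqs: "{1..n} \<inter> {v. v \<in> X} = X" "{1..n} \<inter> - {v. v \<in> X} = {1..n} - X" using X by auto
    have "(\<Prod>v\<in>{1..n}. if v \<in> X then exp (z * real n) else 1 + S) = exp (z * real n) ^ card X * (1 + S) ^ card ({1..n} - X)"
      using prod.If_cases[of "{1..n}" "\<lambda>v. v \<in> X" "\<lambda>_. exp (z * real n)" "\<lambda>_. 1 + S"] eqs by simp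
    also have "\<dots> \<le> exp (z * real n) ^ card X * (1 + S) ^ n"
      using S_nonneg card_mono[of "{1..n}" "{1..n} - X"] by (intro mult_left_mono power_increasing) auto
    finally show ?thesis by (simp add: mult.commute)
  qed
  finally show ?thesis using z0 by (simp add: mult_right_mono)
qed

text \<open>The empty configuration has price exactly 1. It is excluded because the graphs have an
  inner edge, and only its removal makes the bound small.\<close>

lemma sum_\<phi>_empty:
  "(\<Sum>N\<in>{N\<in>\<N>s. big N = {} \<and> 0 < (\<Sum>v\<in>{1..n}. card (N v))}. \<phi> N) \<le> (1 + S) ^ n - 1"
proof -
  define N0 where "N0 = (\<lambda>v\<in>{1..n}. {} :: nat set)"
  let ?A = "{N\<in>\<N>s. big N = {} \<and> (\<forall>v\<in>{}. {} \<subseteq> N v)}"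
  let ?B = "{N\<in>\<N>s. big N = {} \<and> 0 < (\<Sum>v\<in>{1..n}. card (N v))}"
  have N0: "N0 \<in> ?A" "N0 \<notin> ?B" by (auto simp: N0_def big_def)
  have f0: "\<phi> N0 = 1" by (simp add: \<phi>_def N0_def \<psi>_def)
  have fA: "finite ?A" by (rule finite_subset[of _ \<N>s]) (auto intro!: finite_PiE)
  have fB: "finite ?B" by (rule finite_subset[OF _ fA]) auto
  have "(\<Sum>N\<in>?B. \<phi> N) + 1 = (\<Sum>N\<in>insert N0 ?B. \<phi> N)"
    unfolding sum.insert[OF fB N0(2)] f0 by simp
  also have "\<dots> \<le> (\<Sum>N\<in>?A. \<phi> N)" using fA N0(1) \<phi>_nonneg by (intro sum_mono2) auto
  also have "\<dots> \<le> (1 + S) ^ n * exp (z * real n) ^ card ({} :: nat set) * (z ^ d) ^ card ({} :: nat set)"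
    by (rule sum_\<phi>[of "{}" "{}" "\<lambda>_. {}"]) auto
  finally show ?thesis by simp
qed

end

section \<open>Encoding a graph by stars, boxes and crossing edges\<close>

context sparse_range
begin

definition star_edges :: "(nat \<Rightarrow> nat set) \<Rightarrow> nat set set" where
  "star_edges N = {e. \<exists>v\<in>{1..n}. \<exists>u\<in>N v. e = {v, u}}"

definition low_edges :: "(nat \<Rightarrow> nat set) \<Rightarrow> nat set set" where
  "low_edges N = {e. \<exists>v\<in>{1..n}. card (N v) \<le> d \<and> (\<exists>u\<in>N v. e = {v, u})}"

definition low_weight :: "(nat \<Rightarrow> nat set) \<Rightarrow> real" where
  "low_weight N = (\<Sum>v\<in>{1..n}. if card (N v) \<le> d then real (card (N v)) * wl (card (N v)) else 0)"

definition total :: "(nat \<Rightarrow> nat set) \<Rightarrow> nat" where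
  "total N = (\<Sum>v\<in>{1..n}. card (N v))"

lemma \<phi>_eq: "\<phi> N = z ^ total N * exp (- ((1 - \<epsilon>1) ^ 2 * low_weight N))"
proof -
  have "\<phi> N = (\<Prod>v\<in>{1..n}. z ^ card (N v)) *
      (\<Prod>v\<in>{1..n}. exp (- ((1 - \<epsilon>1) ^ 2 * (if card (N v) \<le> d then real (card (N v)) * wl (card (N v)) else 0))))"
    unfolding \<phi>_def \<psi>_def prod.distrib[symmetric] by (intro prod.cong) auto
  also have "(\<Prod>v\<in>{1..n}. z ^ card (N v)) = z ^ total N" by (simp add: total_def power_sum)
  also have "(\<Prod>v\<in>{1..n}. exp (- ((1 - \<epsilon>1) ^ 2 * (if card (N v) \<le> d then real (card (N v)) * wl (card (N v)) else 0))))
     = exp (- ((1 - \<epsilon>1) ^ 2 * low_weight N))"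
    unfolding low_weight_def sum_distrib_left sum_negf[symmetric] by (rule exp_sum[symmetric]) simp
  finally show ?thesis .
qed

text \<open>Grouping the edges by their centres turns the gain, a sum over edges, into a sum over
  stars, which is the form needed for the product \<open>\<phi>\<close>.\<close>

lemma star_encoding:
  assumes T: "finite T" "\<forall>e\<in>T. e \<subseteq> {1..n} \<and> card e = 2" and c: "\<forall>e\<in>T. c e \<in> e"
  defines "N \<equiv> (\<lambda>v\<in>{1..n}. {u. {v, u} \<in> T \<and> c {v, u} = v})"
  shows "N \<in> \<N>s" "star_edges N = T" "low_edges N = lowpart T c" "total N = card T" "low_weight N = gain T c"
proof -
  have Nv: "N v = {u. {v, u} \<in> T \<and> c {v, u} = v}" if "v \<in> {1..n}" for v using that by (simp add: N_def)
  have cn: "c e \<in> {1..n}" if "e \<in> T" for e using T(2) c that by blast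
  show "N \<in> \<N>s" unfolding N_def using T(2) by auto
  have img: "(\<lambda>u. {v, u}) ` N v = {f\<in>T. c f = v}" if v: "v \<in> {1..n}" for v
  proof (intro equalityI subsetI)
    fix f assume f: "f \<in> {f\<in>T. c f = v}"
    then have "v \<in> f" "card f = 2" using c T(2) by auto
    then obtain u where "f = {v, u}" by (auto simp: card_2_iff)
    then show "f \<in> (\<lambda>u. {v, u}) ` N v" using f Nv[OF v] by auto
  qed (use Nv[OF v] in auto)
  have inj: "inj_on (\<lambda>u. {v, u}) A" for v :: nat and A by (auto simp: inj_on_def doubleton_eq_iff)
  have cN: "card (N v) = card {f\<in>T. c f = v}" if v: "v \<in> {1..n}" for v
    using card_image[OF inj, of v "N v"] img[OF v] by simp
  have mem: "(\<exists>u\<in>N v. e = {v, u}) \<longleftrightarrow> e \<in> T \<and> c e = v" if v: "v \<in> {1..n}" for v e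
  proof -
    have "(\<exists>u\<in>N v. e = {v, u}) \<longleftrightarrow> e \<in> (\<lambda>u. {v, u}) ` N v" by (simp only: image_iff)
    then show ?thesis unfolding img[OF v] by simp
  qed
  show "star_edges N = T"
  proof (rule set_eqI)
    fix e
    have "e \<in> star_edges N \<longleftrightarrow> (\<exists>v\<in>{1..n}. e \<in> T \<and> c e = v)"
      unfolding star_edges_def mem_Collect_eq using mem by (intro bex_cong refl) blast
    then show "e \<in> star_edges N \<longleftrightarrow> e \<in> T" using cn by blast
  qed
  show "low_edges N = lowpart T c"
  proof (rule set_eqI)
    fix e
    have "e \<in> low_edges N \<longleftrightarrow> (\<exists>v\<in>{1..n}. card (N v) \<le> d \<and> e \<in> T \<and> c e = v)"
      unfolding low_edges_def mem_Collect_eq using mem by (intro bex_cong refl) blast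
    also have "\<dots> \<longleftrightarrow> e \<in> T \<and> card (N (c e)) \<le> d" using cn by blast
    also have "\<dots> \<longleftrightarrow> e \<in> lowpart T c" using cN[OF cn] by (auto simp: lowpart_def)
    finally show "e \<in> low_edges N \<longleftrightarrow> e \<in> lowpart T c" .
  qed
  show "total N = card T"
  proof -
    have "total N = (\<Sum>v\<in>{1..n}. \<Sum>e\<in>{e\<in>T. c e = v}. 1)" unfolding total_def using cN by (intro sum.cong) auto
    also have "\<dots> = (\<Sum>e\<in>T. 1)" by (rule sum.group) (use T(1) cn in auto)
    finally show ?thesis by simp
  qed
  show "low_weight N = gain T c"
  proof -
    have "gain T c = (\<Sum>v\<in>{1..n}. \<Sum>e\<in>{e\<in>lowpart T c. c e = v}. wl (card {f\<in>T. c f = c e}))"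
      unfolding gain_def by (rule sum.group[symmetric]) (use T(1) cn in \<open>auto simp: lowpart_def\<close>)
    also have "\<dots> = low_weight N" unfolding low_weight_def
    proof (intro sum.cong refl)
      fix v assume v: "v \<in> {1..n}"
      have "{e\<in>lowpart T c. c e = v} = (if card (N v) \<le> d then {e\<in>T. c e = v} else {})"
        using cN[OF v] by (auto simp: lowpart_def)
      moreover have "(\<Sum>e\<in>{e\<in>T. c e = v}. wl (card {f\<in>T. c f = c e})) = real (card (N v)) * wl (card (N v))"
        using cN[OF v] by simp
      ultimately show "(\<Sum>e\<in>{e\<in>lowpart T c. c e = v}. wl (card {f\<in>T. c f = c e}))
         = (if card (N v) \<le> d then real (card (N v)) * wl (card (N v)) else 0)" by auto
    qed
    finally show ?thesis by simp
  qed
qed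

text \<open>The edges from the recorded centres to those sides of their boxes that lie outside
  \<open>V0\<close>. All centres lie in the one part \<open>V0\<close>, so different centres have
  different spokes and their number is exact. The sides inside \<open>V0\<close> are inner edges and
  belong to the stars.\<close>

definition spokes :: "nat list \<Rightarrow> nat set \<Rightarrow> (nat set \<Rightarrow> nat set) list \<Rightarrow> nat set set" where
  "spokes ys V0 xs = (\<lambda>(i, V, u). {ys ! i, u}) ` (SIGMA i:{..<length xs}. SIGMA V:P - {V0}. (xs ! i) V)"

lemma spokes:
  assumes V0: "V0 \<in> P" and ys: "distinct ys" "set ys \<subseteq> V0" "length ys = length xs" and xs: "set xs \<subseteq> \<W>"
  shows "spokes ys V0 xs \<subseteq> E" "card (spokes ys V0 xs) = length xs * ((r - 1) * d)"
proof -
  have W: "(xs ! i) V \<subseteq> V" "card ((xs ! i) V) = d" if "i < length xs" "V \<in> P" for i V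
  proof -
    have "xs ! i \<in> \<W>" using xs that nth_mem by blast
    then show "(xs ! i) V \<subseteq> V" "card ((xs ! i) V) = d" using that by auto
  qed
  have yV: "ys ! i \<in> V0" if "i < length xs" for i using ys that nth_mem by (metis subsetD)
  show "spokes ys V0 xs \<subseteq> E"
  proof
    fix e assume "e \<in> spokes ys V0 xs"
    then obtain i V u where iu: "i < length xs" "V \<in> P - {V0}" "u \<in> (xs ! i) V" "e = {ys ! i, u}"
      unfolding spokes_def by (elim imageE SigmaE) simp
    then show "e \<in> E" using E_pair[OF V0, of V "ys ! i" u] yV[of i] W(1)[of i V] by auto
  qed
  let ?D = "SIGMA i:{..<length xs}. SIGMA V:P - {V0}. (xs ! i) V"
  have "inj_on (\<lambda>(i, V, u). {ys ! i, u}) ?D"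
  proof (rule inj_onI)
    fix a b assume ab0: "a \<in> ?D" "b \<in> ?D" and eq: "(case a of (i, V, u) \<Rightarrow> {ys ! i, u}) = (case b of (i, V, u) \<Rightarrow> {ys ! i, u})"
    obtain i V u j V' u' where e: "a = (i, V, u)" "b = (j, V', u')" by (metis prod.exhaust)
    have ab: "a = (i, V, u)" "b = (j, V', u')" "i < length xs" "V \<in> P - {V0}" "u \<in> (xs ! i) V"
      "j < length xs" "V' \<in> P - {V0}" "u' \<in> (xs ! j) V'" using ab0 unfolding e by simp_all
    have uV: "u \<in> V" "u' \<in> V'" using W(1) ab by blast+
    have "u \<notin> V0" "u' \<notin> V0" using same_part[OF V0] uV ab by blast+
    then have "ys ! i = ys ! j" "u = u'" using eq ab yV[of i] yV[of j] by (auto simp: doubleton_eq_iff)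
    moreover have "i = j" using calculation(1) ys ab nth_eq_iff_index_eq by metis
    moreover have "V = V'" using same_part[of V V' u] uV ab calculation by auto
    ultimately show "a = b" using ab by simp
  qed
  then have "card (spokes ys V0 xs) = card ?D" unfolding spokes_def by (rule card_image)
  also have "\<dots> = (\<Sum>i<length xs. \<Sum>V\<in>P - {V0}. card ((xs ! i) V))"
  proof -
    have f: "finite ((xs ! i) V)" if "i < length xs" "V \<in> P" for i V using W[OF that] finite_part[OF that(2)] finite_subset by blast
    then have "card (SIGMA V:P - {V0}. (xs ! i) V) = (\<Sum>V\<in>P - {V0}. card ((xs ! i) V))" if "i < length xs" for i
      using that finite_P by (intro card_SigmaI) auto
    then show ?thesis using f finite_P by (subst card_SigmaI) (auto intro!: finite_SigmaI)
  qed
  also have "\<dots> = (\<Sum>i<length xs. \<Sum>V\<in>P - {V0}. d)" using W(2) by (intro sum.cong) auto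
  also have "\<dots> = length xs * ((r - 1) * d)" using V0 finite_P card_P by simp
  finally show "card (spokes ys V0 xs) = length xs * ((r - 1) * d)" .
qed

definition high_free :: "(nat set \<Rightarrow> nat set) list \<Rightarrow> nat set set \<Rightarrow> bool" where
  "high_free xs R \<longleftrightarrow> (\<forall>W\<in>set xs. \<forall>S\<in>transv P W. \<not> cross P S \<subseteq> R)"

text \<open>The probability bound is part of the definition: it is the one consequence of the star
  decomposition that is needed once \<open>N\<close> is given.\<close>

definition \<N>g :: "(nat \<Rightarrow> nat set) set" where
  "\<N>g = {N\<in>\<N>s. 0 < total N \<and> real (total N) \<le> \<delta> * real m \<and>
      rprob E (\<lambda>_. p) (low_free (low_edges N)) \<le> exp (- ((1 - \<epsilon>1) * low_weight N))}"

lemma card_big: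
  assumes "N \<in> \<N>g"
  shows "real (card (big N)) * real d \<le> \<delta> * real m" "card (big N) * d \<le> total N"
proof -
  have "card (big N) * d = (\<Sum>v\<in>big N. d)" by simp
  also have "\<dots> \<le> (\<Sum>v\<in>big N. card (N v))" by (rule sum_mono) (auto simp: big_def)
  also have "\<dots> \<le> total N" unfolding total_def by (rule sum_mono2) (auto simp: big_def)
  finally show 1: "card (big N) * d \<le> total N" .
  then have "real (card (big N) * d) \<le> real (total N)" by (simp only: of_nat_le_iff)
  then show "real (card (big N)) * real d \<le> \<delta> * real m" using assms by (simp add: \<N>g_def)
qed

text \<open>The joint event has at most the smaller of the two probabilities, and the larger of the
  two exponents is at least their mean with weights \<open>1 - \<epsilon>1\<close> and
  \<open>\<epsilon>1\<close>. The prescribed crossing edges are the spokes.\<close>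

lemma fibre2:
  assumes N: "N \<in> \<N>g" and V0: "V0 \<in> P" and xs: "set xs \<subseteq> \<W>" "length xs = card (big N \<inter> V0)"
  defines "F \<equiv> spokes (sorted_list_of_set (big N \<inter> V0)) V0 xs"
  shows "\<eta> * real (card {H. F \<subseteq> H \<and> H \<subseteq> E \<and> card H + total N = m \<and> low_free (low_edges N) H \<and> high_free xs H})
    \<le> real (e_part P choose m) * (\<phi> N * (z ^ (length xs * ((r - 1) * d)) * exp (- (\<epsilon>1 * h xs))))"
proof -
  have fY: "finite (big N \<inter> V0)" by (simp add: big_def)
  have F: "F \<subseteq> E" "card F = length xs * ((r - 1) * d)"
    unfolding F_def using spokes[OF V0, of "sorted_list_of_set (big N \<inter> V0)" xs] xs fY by auto
  have yb: "length xs \<le> card (big N)" unfolding xs(2) by (rule card_mono) (auto simp: big_def)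
  have yd: "length xs * d \<le> total N" using yb card_big(2)[OF N] by (meson le_trans mult_le_mono1)
  have tN: "real (total N) \<le> \<delta> * real m" using N by (simp add: \<N>g_def)
  have ydm: "real (length xs) * real d \<le> \<delta> * real m" using yd tN by (metis of_nat_le_iff of_nat_mult order_trans)
  let ?Q = "\<lambda>H. low_free (low_edges N) H \<and> high_free xs H"
  have "\<eta> * real (card {H. F \<subseteq> H \<and> H \<subseteq> E \<and> card H + total N = m \<and> ?Q H})
     \<le> z ^ (total N + card F) * real (e_part P choose m) * rprob E (\<lambda>_. p) ?Q"
  proof (rule fibre_count[OF _ p(2) \<eta> me mz _ F(1)])
    \<comment> \<open>The spokes number at most \<open>r\<close> times the inner edges. Together
      with these they take at most \<open>(real r + 1) * \<delta> * m\<close> edges, the amount that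
      \<open>dens\<close> sets aside.\<close>
    have "card F \<le> r * total N"
    proof -
      have "card F = (r - 1) * (length xs * d)" using F(2) by simp
      also have "\<dots> \<le> r * total N" using yd by (intro mult_le_mono) auto
      finally show ?thesis .
    qed
    then have "real (card F) \<le> real r * real (total N)" by (metis of_nat_le_iff of_nat_mult)
    also have "\<dots> \<le> real r * (\<delta> * real m)" using tN by (intro mult_left_mono) auto
    finally have "(1 - (real r + 1) * \<delta>) * real m \<le> real m - real (total N) - real (card F)"
      using tN by (simp add: algebra_simps)
    then have "(1 - \<eta>) * ((1 - (real r + 1) * \<delta>) * real m) \<le> (1 - \<eta>) * (real m - real (total N) - real (card F))"
      using \<eta> by (intro mult_left_mono) auto
    then show "real (e_part P) * p \<le> (1 - \<eta>) * (real m - real (total N) - real (card F))" using dens by linarith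
    show "\<forall>R R'. ?Q R \<longrightarrow> R' \<subseteq> R \<longrightarrow> ?Q R'"
      using low_free_antimono unfolding high_free_def by (meson order_trans)
  qed (use p in auto)
  also have "\<dots> \<le> z ^ (total N + card F) * real (e_part P choose m) *
      (exp (- ((1 - \<epsilon>1) ^ 2 * low_weight N)) * exp (- (\<epsilon>1 * h xs)))"
  proof (rule mult_left_mono)
    let ?a = "(1 - \<epsilon>1) * low_weight N"
    have A: "rprob E (\<lambda>_. p) ?Q \<le> exp (- ?a)"
    proof -
      have "rprob E (\<lambda>_. p) ?Q \<le> rprob E (\<lambda>_. p) (low_free (low_edges N))" by (rule rprob_mono[OF p01]) auto
      then show ?thesis using N by (auto simp: \<N>g_def)
    qed
    have B: "rprob E (\<lambda>_. p) ?Q \<le> exp (- h xs)"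
    proof -
      have "rprob E (\<lambda>_. p) ?Q \<le> rprob E (\<lambda>_. p) (\<lambda>R. \<forall>W\<in>set xs. \<forall>S\<in>transv P W. \<not> cross P S \<subseteq> R)"
        by (rule rprob_mono[OF p01]) (auto simp: high_free_def)
      then show ?thesis using h1[OF xs(1) ydm] by (simp add: partition_graph_cross)
    qed
    have "(1 - \<epsilon>1) * ?a + \<epsilon>1 * h xs \<le> max ?a (h xs)"
    proof -
      have "(1 - \<epsilon>1) * ?a \<le> (1 - \<epsilon>1) * max ?a (h xs)" "\<epsilon>1 * h xs \<le> \<epsilon>1 * max ?a (h xs)"
        using \<epsilon>1 by (auto intro!: mult_left_mono)
      then show ?thesis by (simp add: algebra_simps)
    qed
    then have "exp (- max ?a (h xs)) \<le> exp (- ((1 - \<epsilon>1) * ?a) + - (\<epsilon>1 * h xs))" by simp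
    moreover have "rprob E (\<lambda>_. p) ?Q \<le> exp (- max ?a (h xs))" using A B by (cases "?a \<le> h xs") (auto simp: max_def)
    ultimately have "rprob E (\<lambda>_. p) ?Q \<le> exp (- ((1 - \<epsilon>1) * ?a) + - (\<epsilon>1 * h xs))" by linarith
    then show "rprob E (\<lambda>_. p) ?Q \<le> exp (- ((1 - \<epsilon>1) ^ 2 * low_weight N)) * exp (- (\<epsilon>1 * h xs))"
      by (simp only: exp_add power2_eq_square mult.assoc)
  qed (use z0 in auto)
  also have "\<dots> = real (e_part P choose m) * (\<phi> N * (z ^ (length xs * ((r - 1) * d)) * exp (- (\<epsilon>1 * h xs))))"
    unfolding \<phi>_eq F(2) by (simp add: power_add)
  finally show ?thesis .
qed

abbreviation "Vs X \<equiv> {V0\<in>P. card X \<le> r * card (X \<inter> V0)}"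

text \<open>Boxes are listed in the increasing order of their centres, so no centre has to be stored
  along with its box.\<close>

definition fits :: "(nat \<Rightarrow> nat set) \<Rightarrow> nat set \<Rightarrow> (nat set \<Rightarrow> nat set) list \<Rightarrow> bool" where
  "fits N V0 xs \<longleftrightarrow> (\<forall>i<length xs. (xs ! i) V0 \<subseteq> N (sorted_list_of_set (big N \<inter> V0) ! i))"

abbreviation "Ls y \<equiv> {xs. set xs \<subseteq> \<W> \<and> length xs = y}"

lemma decompose:
  assumes G: "G \<in> F_star n m r \<delta> \<gamma> P" "G \<notin> class1"
  shows "\<exists>N\<in>\<N>g. \<exists>V0\<in>Vs (big N). \<exists>xs\<in>Ls (card (big N \<inter> V0)). fits N V0 xs \<and>
    G \<in> (\<lambda>H. star_edges N \<union> H) ` {H. spokes (sorted_list_of_set (big N \<inter> V0)) V0 xs \<subseteq> H \<and> H \<subseteq> E \<and>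
        card H + total N = m \<and> low_free (low_edges N) H \<and> high_free xs H}"
proof -
  let ?T = "inner_edges P G"
  note T = inner_props[OF G(1)]
  obtain c where c: "is_star ?T c" using star_decomposition[OF T(1), of d] T(2) unfolding is_star_def by blast
  have gain: "gain ?T c \<le> \<tau> * (real n ^ 2 * p)" using G c unfolding class1_def by (auto simp: not_less)
  define N where "N = (\<lambda>v\<in>{1..n}. {u. {v, u} \<in> ?T \<and> c {v, u} = v})"
  have cT: "\<forall>e\<in>?T. c e \<in> e" using c by (simp add: is_star_def)
  have Tn: "\<forall>e\<in>?T. e \<subseteq> {1..n} \<and> card e = 2" using G_edge[OF G(1)] by (auto simp: inner_edges_def)
  note enc = star_encoding[OF T(1) Tn cT, folded N_def]
  have NG: "N \<in> \<N>g"
  proof -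
    have "0 < total N" using enc(4) inner_pos[OF G(1)] T(1) by (simp add: card_gt_0_iff)
    moreover have "rprob E (\<lambda>_. p) (low_free (low_edges N)) \<le> exp (- ((1 - \<epsilon>1) * low_weight N))"
      using low_prob[OF T c] gain unfolding enc(3,5) by (simp add: min_absorb1)
    ultimately show ?thesis using enc inner_le[OF G(1)] by (simp add: \<N>g_def)
  qed
  define X where "X = big N"
  have fX: "finite X" "X \<subseteq> \<Union>P" unfolding Union_P by (auto simp: X_def big_def)
  \<comment> \<open>Pigeonhole: some part contains at least the fraction 1/r of the high centres.
    Recording boxes only there keeps the spokes distinct; the loss is made up by the factor
    \<open>real r\<close> in the exponent of the hypothesis on \<open>b0\<close>.\<close>
  have "\<exists>V0\<in>P. card X \<le> r * card (X \<inter> V0)"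
  proof (rule ccontr)
    assume "\<not> ?thesis"
    then have lt: "r * card (X \<inter> V) < card X" if "V \<in> P" for V using that by force
    have "X = (\<Union>V\<in>P. X \<inter> V)" using fX by blast
    then have "card X \<le> (\<Sum>V\<in>P. card (X \<inter> V))" using card_UN_le[OF finite_P, of "\<lambda>V. X \<inter> V"] by simp
    then have "r * card X \<le> (\<Sum>V\<in>P. r * card (X \<inter> V))" by (metis mult_le_mono2 sum_distrib_left)
    also have "\<dots> < (\<Sum>V\<in>P. card X)"
      using lt finite_P card_P r2 by (intro sum_strict_mono) auto
    also have "\<dots> = r * card X" using card_P by simp
    finally show False by simp
  qed
  then obtain V0 where V0: "V0 \<in> P" "card X \<le> r * card (X \<inter> V0)" by blast
  define ys where "ys = sorted_list_of_set (X \<inter> V0)"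
  have fY: "finite (X \<inter> V0)" using fX by auto
  have ys: "set ys = X \<inter> V0" "distinct ys" "length ys = card (X \<inter> V0)" using fY by (auto simp: ys_def)
  \<comment> \<open>Condition (B) gives \<open>v\<close> at least \<open>d\<close> neighbours in
    every part. The side in \<open>V0\<close> is taken from the leaves of the star at
    \<open>v\<close>, so it uses no further edges.\<close>
  have ex: "\<exists>W\<in>\<W>. W V0 \<subseteq> N v \<and> (\<forall>V\<in>P. W V \<subseteq> {u\<in>V. {v, u} \<in> G})" if v: "v \<in> X \<inter> V0" for v
  proof -
    have vn: "v \<in> {1..n}" "d < card (N v)" using v by (auto simp: X_def big_def)
    have Nv: "N v = {u. {v, u} \<in> ?T \<and> c {v, u} = v}" using vn by (simp add: N_def)
    have Nsub: "N v \<subseteq> {u\<in>V0. {v, u} \<in> G}"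
    proof
      fix u assume "u \<in> N v"
      then have e: "{v, u} \<in> ?T" using Nv by auto
      then obtain V where V: "V \<in> P" "{v, u} \<subseteq> V" "{v, u} \<in> G" by (auto simp: inner_edges_def)
      then have "V = V0" using same_part[OF V(1) V0(1), of v] v by auto
      then show "u \<in> {u\<in>V0. {v, u} \<in> G}" using V by auto
    qed
    have deg: "d \<le> card {u\<in>V. {v, u} \<in> G}" if V: "V \<in> P" for V
    proof -
      have "card (N v) \<le> card {u\<in>V0. {v, u} \<in> G}" using finite_part[OF V0(1)] by (intro card_mono[OF _ Nsub]) auto
      also have "\<dots> \<le> card {u\<in>V. {v, u} \<in> G}"
        using degree_balance[OF G(1) _ V0(1) V, of v] v by (simp add: deg_in_def)
      finally show ?thesis using vn by simp
    qed
    have "\<forall>V\<in>P. \<exists>A. A \<subseteq> {u\<in>V. {v, u} \<in> G} \<and> card A = d \<and> (V = V0 \<longrightarrow> A \<subseteq> N v)"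
    proof
      fix V assume V: "V \<in> P"
      show "\<exists>A. A \<subseteq> {u\<in>V. {v, u} \<in> G} \<and> card A = d \<and> (V = V0 \<longrightarrow> A \<subseteq> N v)"
      proof (cases "V = V0")
        case True
        obtain A where A: "A \<subseteq> N v" "card A = d" using obtain_subset_with_card_n[of d "N v"] vn(2) by (metis less_imp_le)
        moreover have "A \<subseteq> {u\<in>V. {v, u} \<in> G}" using A(1) Nsub True by blast
        ultimately show ?thesis by blast
      next
        case False
        then show ?thesis using obtain_subset_with_card_n[OF deg[OF V]] by metis
      qed
    qed
    then obtain W where W: "\<forall>V\<in>P. W V \<subseteq> {u\<in>V. {v, u} \<in> G} \<and> card (W V) = d \<and> (V = V0 \<longrightarrow> W V \<subseteq> N v)" by metis
    then have "restrict W P \<in> \<W>" by auto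
    moreover have "restrict W P V0 \<subseteq> N v" "\<forall>V\<in>P. restrict W P V \<subseteq> {u\<in>V. {v, u} \<in> G}" using W V0 by auto
    ultimately show ?thesis by blast
  qed
  have "\<forall>v\<in>X \<inter> V0. \<exists>W. W \<in> \<W> \<and> W V0 \<subseteq> N v \<and> (\<forall>V\<in>P. W V \<subseteq> {u\<in>V. {v, u} \<in> G})"
    using ex by (simp only: Bex_def) blast
  from bchoice[OF this] obtain Wf where Wf: "\<And>v. v \<in> X \<inter> V0 \<Longrightarrow> Wf v \<in> \<W> \<and> Wf v V0 \<subseteq> N v \<and> (\<forall>V\<in>P. Wf v V \<subseteq> {u\<in>V. {v, u} \<in> G})"
    by blast
  define xs where "xs = map Wf ys"
  have lx: "length xs = card (X \<inter> V0)" using ys by (simp add: xs_def)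
  have xsW: "set xs \<subseteq> \<W>" unfolding xs_def set_map ys(1) using Wf by blast
  have yi: "ys ! i \<in> X \<inter> V0" if "i < length xs" for i using that ys by (metis length_map nth_mem xs_def)
  have xi: "xs ! i = Wf (ys ! i)" if "i < length xs" for i using that by (simp add: xs_def)
  have fit: "fits N V0 xs" unfolding fits_def X_def[symmetric] ys_def[symmetric] using Wf yi xi by simp
  have sp: "spokes ys V0 xs \<subseteq> G \<inter> E"
  proof
    fix e assume e: "e \<in> spokes ys V0 xs"
    then obtain i V u where iu: "i < length xs" "V \<in> P - {V0}" "u \<in> (xs ! i) V" "e = {ys ! i, u}"
      unfolding spokes_def by (elim imageE SigmaE) simp
    then have "(xs ! i) V \<subseteq> {u\<in>V. {ys ! i, u} \<in> G}" using Wf[OF yi[OF iu(1)]] unfolding xi[OF iu(1)] by blast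
    then have "e \<in> G" using iu(3,4) by blast
    moreover have "set ys \<subseteq> V0" "length ys = length xs" using ys lx by auto
    then have "e \<in> E" using e spokes(1)[OF V0(1) ys(2) _ _ xsW] by blast
    ultimately show "e \<in> G \<inter> E" by simp
  qed
  have hf: "high_free xs (G \<inter> E)" unfolding high_free_def
  proof (intro ballI)
    fix W Sx assume W: "W \<in> set xs" and Sx: "Sx \<in> transv P W"
    then obtain v where v: "v \<in> X \<inter> V0" "W = Wf v" using ys by (auto simp: xs_def)
    have "\<not> cross P Sx \<subseteq> G"
    proof (rule clique_at_vertex[OF G(1) _ _ Sx])
      show "v \<in> {1..n}" using v by (auto simp: X_def big_def)
      show "\<And>V. V \<in> P \<Longrightarrow> W V \<subseteq> {u\<in>V. {v, u} \<in> G}" using Wf[OF v(1)] v(2) by blast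
    qed
    then show "\<not> cross P Sx \<subseteq> G \<inter> E" by blast
  qed
  have "low_edges N \<subseteq> ?T" unfolding enc(3) by (auto simp: lowpart_def)
  then have lf: "low_free (low_edges N) (G \<inter> E)" by (rule G_low_free[OF G(1)])
  have "card (G \<inter> E) + total N = m" using card_cut[OF G(1)] enc(4) by simp
  then have mem: "G \<inter> E \<in> {H. spokes ys V0 xs \<subseteq> H \<and> H \<subseteq> E \<and> card H + total N = m \<and> low_free (low_edges N) H \<and> high_free xs H}"
    using sp hf lf by simp
  have "star_edges N \<union> (G \<inter> E) = G" unfolding enc(2) by (rule G_split(1)[OF G(1), symmetric])
  then have "G \<in> (\<lambda>H. star_edges N \<union> H) ` {H. spokes ys V0 xs \<subseteq> H \<and> H \<subseteq> E \<and> card H + total N = m \<and> low_free (low_edges N) H \<and> high_free xs H}"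
    using imageI[OF mem, of "\<lambda>H. star_edges N \<union> H"] by simp
  moreover have "xs \<in> Ls (card (big N \<inter> V0))" using xsW lx by (simp add: X_def)
  moreover have "V0 \<in> Vs (big N)" using V0 by (simp add: X_def)
  ultimately show ?thesis using NG fit unfolding ys_def X_def by (intro bexI[of _ N] bexI[of _ V0] bexI[of _ xs] conjI)
qed

lemma sum_fits:
  assumes X: "X \<subseteq> {1..n}" "X \<noteq> {}" and V0: "V0 \<in> P" and xs: "xs \<in> Ls (card (X \<inter> V0))"
  shows "(\<Sum>N\<in>{N\<in>\<N>g. big N = X \<and> fits N V0 xs}. \<phi> N) \<le> (1 + S) ^ n * exp (z * real n) ^ card X * (z ^ d) ^ card (X \<inter> V0)"
proof -
  define ys where "ys = sorted_list_of_set (X \<inter> V0)"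
  have fY: "finite (X \<inter> V0)" using X finite_subset by blast
  have ys: "set ys = X \<inter> V0" "length ys = length xs" using fY xs by (auto simp: ys_def)
  define idx where "idx = (\<lambda>v. SOME i. i < length xs \<and> ys ! i = v)"
  define B where "B = (\<lambda>v. (xs ! idx v) V0)"
  have idx: "idx v < length xs \<and> ys ! idx v = v" if "v \<in> X \<inter> V0" for v
  proof -
    have "v \<in> set ys" using that ys(1) by simp
    then have "\<exists>i. i < length xs \<and> ys ! i = v" unfolding in_set_conv_nth ys(2) .
    then show ?thesis unfolding idx_def by (rule someI_ex)
  qed
  have sub: "{N\<in>\<N>g. big N = X \<and> fits N V0 xs} \<subseteq> {N\<in>\<N>s. big N = X \<and> (\<forall>v\<in>X \<inter> V0. B v \<subseteq> N v)}"
  proof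
    fix N assume N: "N \<in> {N\<in>\<N>g. big N = X \<and> fits N V0 xs}"
    then have N': "N \<in> \<N>g" "big N = X" "fits N V0 xs" by auto
    have "N \<in> \<N>s" using N'(1) unfolding \<N>g_def by blast
    moreover have "\<forall>i<length xs. (xs ! i) V0 \<subseteq> N (ys ! i)"
      using N'(3) unfolding fits_def N'(2) ys_def[symmetric] .
    ultimately show "N \<in> {N\<in>\<N>s. big N = X \<and> (\<forall>v\<in>X \<inter> V0. B v \<subseteq> N v)}" 
      using idx N'(2) unfolding B_def mem_Collect_eq by (metis (full_types))
  qed
  have "finite \<N>s" by (intro finite_PiE) auto
  then have "(\<Sum>N\<in>{N\<in>\<N>g. big N = X \<and> fits N V0 xs}. \<phi> N) \<le> (\<Sum>N\<in>{N\<in>\<N>s. big N = X \<and> (\<forall>v\<in>X \<inter> V0. B v \<subseteq> N v)}. \<phi> N)"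
    by (intro sum_mono2[OF _ sub]) (auto simp: \<phi>_nonneg)
  also have "\<dots> \<le> (1 + S) ^ n * exp (z * real n) ^ card X * (z ^ d) ^ card (X \<inter> V0)"
  proof (rule sum_\<phi>[OF X(1)])
    fix v assume v: "v \<in> X \<inter> V0"
    then have "xs ! idx v \<in> \<W>" using idx[OF v] xs nth_mem by blast
    then have "B v \<subseteq> V0 \<and> card (B v) = d" using V0 unfolding B_def by auto
    then show "B v \<subseteq> {1..n} \<and> card (B v) = d" using part_sub[OF V0] by blast
  qed auto
  finally show ?thesis .
qed

text \<open>The sum is organised by the set \<open>X\<close> of high centres. Each costs
  \<open>exp (z * n)\<close> for its star, and each of the at least \<open>card X / r\<close>
  recorded boxes earns \<open>exp (- (r * (z * n + u)))\<close>, so the balance is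
  \<open>exp (- u)\<close> per high centre. Summing over \<open>X\<close> is a binomial expansion;
  the subtracted 1 is the excluded empty inner graph, and the factor \<open>real r\<close> bounds
  the number of choices of \<open>V0\<close>.\<close>

lemma class2_count:
  "\<eta> * real (card (F_star n m r \<delta> \<gamma> P - class1))
    \<le> real (e_part P choose m) * (real r * (((1 + S) * (1 + exp (- u))) ^ n - 1))"
proof -
  let ?D = "\<lambda>N V0 xs. {H. spokes (sorted_list_of_set (big N \<inter> V0)) V0 xs \<subseteq> H \<and> H \<subseteq> E \<and>
        card H + total N = m \<and> low_free (low_edges N) H \<and> high_free xs H}"
  let ?X = "\<lambda>N V0. {xs\<in>Ls (card (big N \<inter> V0)). fits N V0 xs}"
  let ?C = "real (e_part P choose m)"
  define g where "g = (\<lambda>xs. z ^ (length xs * ((r - 1) * d)) * exp (- (\<epsilon>1 * h xs)))"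
  define \<X> where "\<X> = {X\<in>Pow {1..n}. real (card X) * real d \<le> \<delta> * real m}"
  have g0: "0 \<le> g xs" for xs using z0 by (simp add: g_def)
  have fN: "finite \<N>g" unfolding \<N>g_def by (rule finite_subset[of _ \<N>s]) (auto intro!: finite_PiE)
  have fW: "finite \<W>" using finite_P finite_part by (intro finite_PiE) auto
  have fL: "finite (Ls y)" for y using finite_lists_length_eq[OF fW] by simp
  have fV: "finite (Vs X)" for X using finite_P by simp
  have fX: "finite (?X N V0)" for N V0 by (rule finite_subset[OF _ fL]) blast
  have fD: "finite (?D N V0 xs)" for N V0 xs by (rule finite_subset[of _ "Pow E"]) (use finite_E in auto)
  have sub: "F_star n m r \<delta> \<gamma> P - class1 \<subseteq> (\<Union>N\<in>\<N>g. \<Union>V0\<in>Vs (big N). \<Union>xs\<in>?X N V0. (\<lambda>H. star_edges N \<union> H) ` ?D N V0 xs)"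
  proof
    fix G assume "G \<in> F_star n m r \<delta> \<gamma> P - class1"
    then obtain N V0 xs where "N \<in> \<N>g" "V0 \<in> Vs (big N)" "xs \<in> Ls (card (big N \<inter> V0))" "fits N V0 xs"
      "G \<in> (\<lambda>H. star_edges N \<union> H) ` ?D N V0 xs" using decompose[of G] by blast
    then show "G \<in> (\<Union>N\<in>\<N>g. \<Union>V0\<in>Vs (big N). \<Union>xs\<in>?X N V0. (\<lambda>H. star_edges N \<union> H) ` ?D N V0 xs)"
      by (intro UN_I[of N] UN_I[of V0] UN_I[of xs]) simp_all
  qed
  have "card (F_star n m r \<delta> \<gamma> P - class1) \<le> card (\<Union>N\<in>\<N>g. \<Union>V0\<in>Vs (big N). \<Union>xs\<in>?X N V0. (\<lambda>H. star_edges N \<union> H) ` ?D N V0 xs)"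
    by (rule card_mono[OF _ sub]) (intro finite_UN_I fN fV fX finite_imageI fD)
  also have "\<dots> \<le> (\<Sum>N\<in>\<N>g. card (\<Union>V0\<in>Vs (big N). \<Union>xs\<in>?X N V0. (\<lambda>H. star_edges N \<union> H) ` ?D N V0 xs))"
    by (rule card_UN_le[OF fN])
  also have "\<dots> \<le> (\<Sum>N\<in>\<N>g. \<Sum>V0\<in>Vs (big N). card (\<Union>xs\<in>?X N V0. (\<lambda>H. star_edges N \<union> H) ` ?D N V0 xs))"
    by (intro sum_mono card_UN_le fV)
  also have "\<dots> \<le> (\<Sum>N\<in>\<N>g. \<Sum>V0\<in>Vs (big N). \<Sum>xs\<in>?X N V0. card ((\<lambda>H. star_edges N \<union> H) ` ?D N V0 xs))"
    by (intro sum_mono card_UN_le fX)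
  also have "\<dots> \<le> (\<Sum>N\<in>\<N>g. \<Sum>V0\<in>Vs (big N). \<Sum>xs\<in>?X N V0. card (?D N V0 xs))"
    by (intro sum_mono card_image_le fD)
  finally have "real (card (F_star n m r \<delta> \<gamma> P - class1)) \<le> (\<Sum>N\<in>\<N>g. \<Sum>V0\<in>Vs (big N). \<Sum>xs\<in>?X N V0. real (card (?D N V0 xs)))"
    by (simp only: of_nat_sum[symmetric] of_nat_le_iff)
  then have "\<eta> * real (card (F_star n m r \<delta> \<gamma> P - class1)) \<le> \<eta> * (\<Sum>N\<in>\<N>g. \<Sum>V0\<in>Vs (big N). \<Sum>xs\<in>?X N V0. real (card (?D N V0 xs)))"
    using \<eta> by simp
  also have "\<dots> = (\<Sum>N\<in>\<N>g. \<Sum>V0\<in>Vs (big N). \<Sum>xs\<in>?X N V0. \<eta> * real (card (?D N V0 xs)))"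
    by (simp only: sum_distrib_left)
  also have "\<dots> \<le> (\<Sum>N\<in>\<N>g. \<Sum>V0\<in>Vs (big N). \<Sum>xs\<in>?X N V0. ?C * (\<phi> N * g xs))"
    unfolding g_def by (intro sum_mono fibre2) auto
  also have "\<dots> = ?C * (\<Sum>N\<in>\<N>g. \<Sum>V0\<in>Vs (big N). \<Sum>xs\<in>?X N V0. \<phi> N * g xs)"
    by (simp only: sum_distrib_left)
  also have "(\<Sum>N\<in>\<N>g. \<Sum>V0\<in>Vs (big N). \<Sum>xs\<in>?X N V0. \<phi> N * g xs)
     = (\<Sum>X\<in>\<X>. \<Sum>N\<in>{N\<in>\<N>g. big N = X}. \<Sum>V0\<in>Vs (big N). \<Sum>xs\<in>?X N V0. \<phi> N * g xs)"
  proof (rule sum.group[symmetric])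
    show "finite \<X>" by (simp add: \<X>_def)
    show "big ` \<N>g \<subseteq> \<X>" using card_big(1) by (auto simp: \<X>_def big_def)
  qed (rule fN)
  also have "\<dots> \<le> (\<Sum>X\<in>\<X>. real r * (if X = {} then (1 + S) ^ n - 1 else (1 + S) ^ n * exp (- u) ^ card X))"
  proof (rule sum_mono)
    fix X assume X: "X \<in> \<X>"
    let ?NX = "{N\<in>\<N>g. big N = X}"
    let ?b = "if X = {} then (1 + S) ^ n - 1 else (1 + S) ^ n * exp (- u) ^ card X"
    have Xn: "X \<subseteq> {1..n}" using X by (simp add: \<X>_def)
    have b0': "0 \<le> ?b" using S_nonneg one_le_power[of "1 + S" n] by simp
    have "(\<Sum>N\<in>?NX. \<Sum>V0\<in>Vs (big N). \<Sum>xs\<in>?X N V0. \<phi> N * g xs)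
       = (\<Sum>N\<in>?NX. \<Sum>V0\<in>Vs X. \<Sum>xs\<in>Ls (card (X \<inter> V0)). if fits N V0 xs then \<phi> N * g xs else 0)"
    proof (rule sum.cong[OF refl])
      fix N assume "N \<in> ?NX"
      then have bN: "big N = X" by simp
      show "(\<Sum>V0\<in>Vs (big N). \<Sum>xs\<in>?X N V0. \<phi> N * g xs)
        = (\<Sum>V0\<in>Vs X. \<Sum>xs\<in>Ls (card (X \<inter> V0)). if fits N V0 xs then \<phi> N * g xs else 0)"
        unfolding bN by (intro sum.cong refl sum.inter_filter fL)
    qed
    also have "\<dots> = (\<Sum>V0\<in>Vs X. \<Sum>N\<in>?NX. \<Sum>xs\<in>Ls (card (X \<inter> V0)). if fits N V0 xs then \<phi> N * g xs else 0)"
      by (rule sum.swap)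
    also have "\<dots> = (\<Sum>V0\<in>Vs X. \<Sum>xs\<in>Ls (card (X \<inter> V0)). \<Sum>N\<in>?NX. if fits N V0 xs then \<phi> N * g xs else 0)"
      by (intro sum.cong refl sum.swap)
    also have "\<dots> = (\<Sum>V0\<in>Vs X. \<Sum>xs\<in>Ls (card (X \<inter> V0)). g xs * (\<Sum>N\<in>{N\<in>\<N>g. big N = X \<and> fits N V0 xs}. \<phi> N))"
    proof (intro sum.cong refl)
      fix V0 xs
      have "(\<Sum>N\<in>?NX. if fits N V0 xs then \<phi> N * g xs else 0) = (\<Sum>N\<in>{N\<in>?NX. fits N V0 xs}. \<phi> N * g xs)"
        using fN by (intro sum.inter_filter[symmetric]) simp
      also have "{N\<in>?NX. fits N V0 xs} = {N\<in>\<N>g. big N = X \<and> fits N V0 xs}" by auto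
      finally show "(\<Sum>N\<in>?NX. if fits N V0 xs then \<phi> N * g xs else 0) = g xs * (\<Sum>N\<in>{N\<in>\<N>g. big N = X \<and> fits N V0 xs}. \<phi> N)"
        by (simp only: sum_distrib_left mult.commute)
    qed
    also have "\<dots> \<le> (\<Sum>V0\<in>Vs X. ?b)"
    proof (rule sum_mono)
      fix V0 assume V0: "V0 \<in> Vs X"
      define y where "y = card (X \<inter> V0)"
      have yX: "y \<le> card X" unfolding y_def using Xn finite_subset by (intro card_mono) blast+
      have "real y * real d \<le> real (card X) * real d" using yX by (intro mult_right_mono) auto
      then have yd: "real y * real d \<le> \<delta> * real m" using X by (simp add: \<X>_def)
      note hy = h2[OF yd]
      have gs: "(\<Sum>xs\<in>Ls y. g xs) \<le> z ^ (y * ((r - 1) * d)) * b0 ^ y"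
      proof -
        have "(\<Sum>xs\<in>Ls y. g xs) = z ^ (y * ((r - 1) * d)) * (\<Sum>xs\<in>Ls y. exp (- (\<epsilon>1 * h xs)))"
          unfolding sum_distrib_left by (intro sum.cong refl) (simp add: g_def)
        then show ?thesis using hy z0 by (simp add: mult_left_mono)
      qed
      show "(\<Sum>xs\<in>Ls (card (X \<inter> V0)). g xs * (\<Sum>N\<in>{N\<in>\<N>g. big N = X \<and> fits N V0 xs}. \<phi> N)) \<le> ?b"
      proof (cases "X = {}")
        case True
        have y0: "y = 0" using True by (simp add: y_def)
        have "(\<Sum>N\<in>{N\<in>\<N>g. big N = X \<and> fits N V0 xs}. \<phi> N) \<le> ?b" for xs
        proof -
          have "(\<Sum>N\<in>{N\<in>\<N>g. big N = X \<and> fits N V0 xs}. \<phi> N)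
             \<le> (\<Sum>N\<in>{N\<in>\<N>s. big N = {} \<and> 0 < (\<Sum>v\<in>{1..n}. card (N v))}. \<phi> N)"
          proof (rule sum_mono2)
            show "finite {N\<in>\<N>s. big N = {} \<and> 0 < (\<Sum>v\<in>{1..n}. card (N v))}"
              by (rule finite_subset[of _ \<N>s]) (auto intro!: finite_PiE)
          qed (auto simp: \<N>g_def total_def True \<phi>_nonneg)
          also have "\<dots> \<le> (1 + S) ^ n - 1" by (rule sum_\<phi>_empty)
          finally show ?thesis using True by simp
        qed
        then have "(\<Sum>xs\<in>Ls y. g xs * (\<Sum>N\<in>{N\<in>\<N>g. big N = X \<and> fits N V0 xs}. \<phi> N)) \<le> (\<Sum>xs\<in>Ls y. g xs * ?b)"
          using g0 by (intro sum_mono mult_left_mono) auto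
        also have "\<dots> = (\<Sum>xs\<in>Ls y. g xs) * ?b" by (simp only: sum_distrib_right)
        also have "\<dots> \<le> 1 * ?b" using gs y0 b0' by (intro mult_right_mono) auto
        finally show ?thesis by (simp add: y_def)
      next
        case False
        let ?c = "(1 + S) ^ n * exp (z * real n) ^ card X * (z ^ d) ^ y"
        have c0: "0 \<le> ?c" using S_nonneg z0 by simp
        have "(\<Sum>xs\<in>Ls y. g xs * (\<Sum>N\<in>{N\<in>\<N>g. big N = X \<and> fits N V0 xs}. \<phi> N)) \<le> (\<Sum>xs\<in>Ls y. g xs * ?c)"
        proof (intro sum_mono mult_left_mono g0)
          fix xs assume "xs \<in> Ls y"
          then show "(\<Sum>N\<in>{N\<in>\<N>g. big N = X \<and> fits N V0 xs}. \<phi> N) \<le> ?c"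
            unfolding y_def using V0 by (intro sum_fits[OF Xn False]) auto
        qed
        also have "\<dots> = (\<Sum>xs\<in>Ls y. g xs) * ?c" by (simp only: sum_distrib_right)
        also have "\<dots> \<le> (z ^ (y * ((r - 1) * d)) * b0 ^ y) * ?c" by (rule mult_right_mono[OF gs c0])
        \<comment> \<open>A box accounts for \<open>r * d\<close> prescribed edges:
          \<open>(r - 1) * d\<close> spokes and \<open>d\<close> leaves.\<close>
        also have "\<dots> = (1 + S) ^ n * exp (z * real n) ^ card X * (b0 * z ^ (r * d)) ^ y"
        proof -
          have "z ^ (r * d) = z ^ ((r - 1) * d) * z ^ d"
          proof -
            have "r * d = (r - 1) * d + d" using r2 by (cases r) auto
            then show ?thesis by (simp add: power_add)
          qed
          then have "(b0 * z ^ (r * d)) ^ y = b0 ^ y * ((z ^ ((r - 1) * d)) ^ y * (z ^ d) ^ y)"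
            by (simp add: power_mult_distrib)
          moreover have "(z ^ ((r - 1) * d)) ^ y = z ^ (y * ((r - 1) * d))" by (simp add: power_mult[symmetric] mult.commute)
          ultimately show ?thesis by simp
        qed
        also have "\<dots> \<le> (1 + S) ^ n * exp (z * real n) ^ card X * exp (- (real r * (z * real n + u))) ^ y"
          using b0 z0 S_nonneg by (intro mult_left_mono power_mono) auto
        also have "\<dots> = (1 + S) ^ n * exp (z * real n * real (card X) - real r * (z * real n + u) * real y)"
        proof -
          have "exp (z * real n) ^ card X = exp (z * real n * real (card X))" by (simp add: exp_of_nat_mult[symmetric] mult.commute)
          moreover have "exp (- (real r * (z * real n + u))) ^ y = exp (- (real r * (z * real n + u) * real y))"
            by (simp add: exp_of_nat_mult[symmetric] mult.commute)
          ultimately show ?thesis by (simp only: mult.assoc exp_add[symmetric] diff_conv_add_uminus)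
        qed
        also have "\<dots> \<le> (1 + S) ^ n * exp (- (u * real (card X)))"
        proof (rule mult_left_mono)
          have "card X \<le> r * y" using V0 by (simp add: y_def)
          then have "real (card X) \<le> real r * real y" by (metis of_nat_le_iff of_nat_mult)
          then have "(z * real n + u) * real (card X) \<le> (z * real n + u) * (real r * real y)"
            using z0 u0 by (intro mult_left_mono) auto
          then show "exp (z * real n * real (card X) - real r * (z * real n + u) * real y) \<le> exp (- (u * real (card X)))"
            by (simp add: algebra_simps)
        qed (use S_nonneg in simp)
        also have "\<dots> = ?b" using False by (simp add: exp_of_nat_mult[symmetric] mult.commute)
        finally show ?thesis by (simp add: y_def)
      qed
    qed
    also have "\<dots> = real (card (Vs X)) * ?b" by simp
    also have "\<dots> \<le> real r * ?b"
    proof (rule mult_right_mono[OF _ b0'])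
      have "card (Vs X) \<le> card P" using finite_P by (intro card_mono) auto
      then show "real (card (Vs X)) \<le> real r" using card_P by simp
    qed
    finally show "(\<Sum>N\<in>?NX. \<Sum>V0\<in>Vs (big N). \<Sum>xs\<in>?X N V0. \<phi> N * g xs) \<le> real r * ?b" .
  qed
  also have "\<dots> \<le> (\<Sum>X\<in>Pow {1..n}. real r * (if X = {} then (1 + S) ^ n - 1 else (1 + S) ^ n * exp (- u) ^ card X))"
    using S_nonneg one_le_power[of "1 + S" n] by (intro sum_mono2) (auto simp: \<X>_def)
  also have "\<dots> = real r * (((1 + S) * (1 + exp (- u))) ^ n - 1)"
  proof -
    have split: "(\<Sum>X\<in>Pow {1..n}. f X) = f {} + (\<Sum>X\<in>Pow {1..n} - {{}}. f X)" for f :: "nat set \<Rightarrow> real"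
      by (rule sum.remove) auto
    have "(\<Sum>X\<in>Pow {1..n}. exp (- u) ^ card X) = (1 + exp (- u)) ^ n" by (simp add: sum_Pow_power)
    then have s1: "(\<Sum>X\<in>Pow {1..n} - {{}}. exp (- u) ^ card X) = (1 + exp (- u)) ^ n - 1"
      using split[of "\<lambda>X. exp (- u) ^ card X"] by simp
    have "(\<Sum>X\<in>Pow {1..n} - {{}}. if X = {} then (1 + S) ^ n - 1 else (1 + S) ^ n * exp (- u) ^ card X)
      = (\<Sum>X\<in>Pow {1..n} - {{}}. (1 + S) ^ n * exp (- u) ^ card X)" by (intro sum.cong) auto
    also have "\<dots> = (1 + S) ^ n * ((1 + exp (- u)) ^ n - 1)" unfolding sum_distrib_left[symmetric] s1 ..
    finally show ?thesis unfolding sum_distrib_left[symmetric]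
      using split[of "\<lambda>X. if X = {} then (1 + S) ^ n - 1 else (1 + S) ^ n * exp (- u) ^ card X"]
      by (simp add: power_mult_distrib right_diff_distrib)
  qed
  finally show ?thesis by (simp add: mult_left_mono)
qed

lemma sparse_bound:
  "\<eta> * real (card (F_star n m r \<delta> \<gamma> P)) \<le> real (e_part P choose m) *
    (exp (- ((1 - \<epsilon>1) * (\<tau> * (real n ^ 2 * p))) + (\<delta> * real m * ln (1 / \<theta>) + \<theta> * z * real n ^ 2))
      + real r * (((1 + S) * (1 + exp (- u))) ^ n - 1))"
proof -
  have "F_star n m r \<delta> \<gamma> P = class1 \<union> (F_star n m r \<delta> \<gamma> P - class1)" by (auto simp: class1_def)
  then have "card (F_star n m r \<delta> \<gamma> P) \<le> card class1 + card (F_star n m r \<delta> \<gamma> P - class1)" by (metis card_Un_le)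
  then have "real (card (F_star n m r \<delta> \<gamma> P)) \<le> real (card class1) + real (card (F_star n m r \<delta> \<gamma> P - class1))" by linarith
  then have "\<eta> * real (card (F_star n m r \<delta> \<gamma> P)) \<le> \<eta> * real (card class1) + \<eta> * real (card (F_star n m r \<delta> \<gamma> P - class1))"
    using \<eta> by (simp add: distrib_left[symmetric])
  then show ?thesis using class1_count class2_count by (simp only: distrib_left)
qed

end

section \<open>Choice of the parameters\<close>

lemma power_div_fact_le_exp:
  fixes x :: real
  assumes "0 \<le> x"
  shows "x ^ k / fact k \<le> exp x"
proof -
  have s: "(\<lambda>n. x ^ n / fact n) sums exp x" using exp_converges[of x] by (simp add: field_simps)
  have "(\<Sum>n\<in>{k}. x ^ n / fact n) \<le> (\<Sum>n. x ^ n / fact n)"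
    using sums_summable[OF s] assms by (intro sum_le_suminf) auto
  then show ?thesis using sums_unique[OF s] by simp
qed

lemma one_plus_power_le:
  fixes q :: real
  assumes "0 \<le> q" "real n * q \<le> 1"
  shows "(1 + q) ^ n - 1 \<le> 2 * (real n * q)"
proof -
  have "(1 + q) ^ n \<le> exp q ^ n" using assms by (intro power_mono exp_ge_add_one_self) auto
  also have "\<dots> = exp (real n * q)" by (simp add: exp_of_nat_mult)
  also have "\<dots> \<le> 1 + real n * q + (real n * q)\<^sup>2" using assms by (intro exp_bound) auto
  also have "(real n * q)\<^sup>2 \<le> real n * q" using assms by (simp add: power2_eq_square mult_left_le)
  finally show ?thesis by linarith
qed

section \<open>Powers of n and p\<close>

lemma two_choose_two: "2 * (j choose 2) = j * (j - 1)"
proof -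
  have "even (j * (j - 1))" by (cases j) simp_all
  then show ?thesis unfolding choose_two by (rule dvd_mult_div_cancel)
qed

lemma two_choose_two_real: "2 * real (j choose 2) = real j * (real j - 1)"
proof -
  have "real (2 * (j choose 2)) = real (j * (j - 1))" by (simp only: two_choose_two)
  then show ?thesis by (cases j) (auto simp: algebra_simps)
qed

text \<open>\<open>(j choose 2) - 1\<close> is half of \<open>(j - 2) * (j + 1)\<close>, and
  squaring removes the half. For \<open>p \<le> 1\<close> the base
  \<open>n\<^sup>2 * p ^ (j + 1)\<close> decreases with \<open>j\<close>, so a bound on it for
  \<open>j = r + 1\<close> controls all smaller \<open>j\<close>.\<close>

lemma pw_square:
  fixes n p :: real
  assumes "2 \<le> j"
  shows "(n ^ (j - 2) * p ^ ((j choose 2) - 1))\<^sup>2 = (n\<^sup>2 * p ^ (j + 1)) ^ (j - 2)"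
proof -
  obtain i where j: "j = i + 2" using assms by (metis add.commute le_Suc_ex)
  have "2 * (j choose 2) = (i + 2) * (i + 1)" using two_choose_two[of j] j by simp
  then have e: "((j choose 2) - 1) * 2 = (i + 3) * i" by (simp add: algebra_simps)
  have "(n ^ i * p ^ ((j choose 2) - 1))\<^sup>2 = n ^ (i * 2) * p ^ (((j choose 2) - 1) * 2)"
    by (simp only: power_mult_distrib power_mult)
  also have "\<dots> = (n\<^sup>2) ^ i * (p ^ (i + 3)) ^ i" unfolding e by (simp only: power_mult[symmetric] mult.commute[of i 2])
  also have "\<dots> = (n\<^sup>2 * p ^ (i + 3)) ^ i" by (simp only: power_mult_distrib)
  finally have "(n ^ i * p ^ ((j choose 2) - 1))\<^sup>2 = (n\<^sup>2 * p ^ (i + 3)) ^ i" .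
  moreover have "j - 2 = i" "j + 1 = i + 3" using j by simp_all
  ultimately show ?thesis by (simp only:)
qed

lemma pw_square1:
  fixes n p :: real
  assumes "1 \<le> j"
  shows "(n ^ (j - 1) * p ^ ((j choose 2) + (j - 1)))\<^sup>2 = (n\<^sup>2 * p ^ (j + 2)) ^ (j - 1)"
proof -
  obtain i where j: "j = i + 1" using assms by (metis add.commute le_Suc_ex)
  have "2 * (j choose 2) = (i + 1) * i" using two_choose_two[of j] j by simp
  then have e: "((j choose 2) + i) * 2 = (i + 3) * i" by (simp add: algebra_simps)
  have "(n ^ i * p ^ ((j choose 2) + i))\<^sup>2 = n ^ (i * 2) * p ^ (((j choose 2) + i) * 2)"
    by (simp only: power_mult_distrib power_mult)
  also have "\<dots> = (n\<^sup>2) ^ i * (p ^ (i + 3)) ^ i" unfolding e by (simp only: power_mult[symmetric] mult.commute[of i 2])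
  also have "\<dots> = (n\<^sup>2 * p ^ (i + 3)) ^ i" by (simp only: power_mult_distrib)
  finally have "(n ^ i * p ^ ((j choose 2) + i))\<^sup>2 = (n\<^sup>2 * p ^ (i + 3)) ^ i" .
  moreover have "j - 1 = i" "j + 2 = i + 3" using j by simp_all
  ultimately show ?thesis by (simp only:)
qed

lemma root_le:
  fixes x y :: real
  assumes "0 \<le> x" "0 < y" "x \<le> y ^ k" "0 < k"
  shows "x powr (1 / real k) \<le> y"
proof -
  have "x powr (1 / real k) \<le> (y ^ k) powr (1 / real k)" using assms by (intro powr_mono2) auto
  also have "\<dots> = y" using assms by (simp add: powr_realpow[symmetric] powr_powr)
  finally show ?thesis .
qed

text \<open>Everything follows from one lower bound on \<open>n\<^sup>2 * p ^ (r + 2)\<close>. The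
  two polynomial bounds come from the identities
  \<open>(p * n) ^ (r + 2) = n ^ r * (n\<^sup>2 * p ^ (r + 2))\<close> and \<open>(n\<^sup>2 * p ^
  (r + 1)) ^ (r + 2) = n\<^sup>2 * (n\<^sup>2 * p ^ (r + 2)) ^ (r + 1)\<close>.\<close>

lemma pw_facts:
  fixes n p L :: real and r :: nat
  assumes n: "1 \<le> n" and p: "0 < p" "p \<le> 1" and L: "1 \<le> L" "L\<^sup>2 \<le> n\<^sup>2 * p ^ (r + 2)" and r: "1 \<le> r"
  shows "\<And>j. 2 \<le> j \<Longrightarrow> j \<le> r \<Longrightarrow> 1 \<le> n ^ (j - 2) * p ^ ((j choose 2) - 1)"
    and "\<And>j. 2 \<le> j \<Longrightarrow> j \<le> r \<Longrightarrow> L \<le> n ^ (j - 1) * p ^ ((j choose 2) + (j - 1))"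
    and "n powr (1 / real (r + 2)) \<le> p * n"
    and "\<And>j. 3 \<le> j \<Longrightarrow> j \<le> r \<Longrightarrow> n powr (1 / real (r + 2)) \<le> n ^ (j - 2) * p ^ ((j choose 2) - 1)"
proof -
  let ?Y = "n\<^sup>2 * p ^ (r + 2)"
  have L1: "1 \<le> L\<^sup>2" using L(1) by simp
  have Y1: "1 \<le> ?Y" using L(2) L1 by linarith
  have mono: "n\<^sup>2 * p ^ b \<le> n\<^sup>2 * p ^ a" if "a \<le> b" for a b
    using p n that by (intro mult_left_mono power_decreasing) auto
  show "1 \<le> n ^ (j - 2) * p ^ ((j choose 2) - 1)" if j: "2 \<le> j" "j \<le> r" for j
  proof (rule power2_le_imp_le)
    have "1 \<le> n\<^sup>2 * p ^ (j + 1)" using mono[of "j + 1" "r + 2"] Y1 j by linarith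
    then show "1\<^sup>2 \<le> (n ^ (j - 2) * p ^ ((j choose 2) - 1))\<^sup>2" unfolding pw_square[OF j(1)] one_power2 by (rule one_le_power)
  qed (use n p in auto)
  show "L \<le> n ^ (j - 1) * p ^ ((j choose 2) + (j - 1))" if j: "2 \<le> j" "j \<le> r" for j
  proof (rule power2_le_imp_le)
    have a: "?Y \<le> n\<^sup>2 * p ^ (j + 2)" using mono[of "j + 2" "r + 2"] j by linarith
    have "L\<^sup>2 \<le> n\<^sup>2 * p ^ (j + 2)" using a L(2) by linarith
    also have "\<dots> \<le> (n\<^sup>2 * p ^ (j + 2)) ^ (j - 1)" using a Y1 j by (intro self_le_power) linarith+
    finally show "L\<^sup>2 \<le> (n ^ (j - 1) * p ^ ((j choose 2) + (j - 1)))\<^sup>2" using pw_square1[of j n p] j by simp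
  qed (use n p in auto)
  show "n powr (1 / real (r + 2)) \<le> p * n"
  proof (rule root_le)
    have "n \<le> n ^ r" using n r by (intro self_le_power) auto
    also have "\<dots> \<le> n ^ r * ?Y" using Y1 n mult_left_mono[OF Y1, of "n ^ r"] by simp
    also have "\<dots> = (p * n) ^ (r + 2)" by (simp add: power_add power_mult_distrib power2_eq_square)
    finally show "n \<le> (p * n) ^ (r + 2)" .
  qed (use n p in auto)
  show "n powr (1 / real (r + 2)) \<le> n ^ (j - 2) * p ^ ((j choose 2) - 1)" if j: "3 \<le> j" "j \<le> r" for j
  proof (rule power2_le_imp_le)
    have "(n powr (1 / real (r + 2)))\<^sup>2 = (n\<^sup>2) powr (1 / real (r + 2))" unfolding power2_eq_square using n by (simp add: powr_mult)
    also have "\<dots> \<le> n\<^sup>2 * p ^ (r + 1)"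
    proof (rule root_le)
      have "n\<^sup>2 \<le> n\<^sup>2 * ?Y ^ (r + 1)" using mult_left_mono[OF one_le_power[OF Y1, of "r + 1"], of "n\<^sup>2"] by simp
      also have "\<dots> = (n\<^sup>2 * p ^ (r + 1)) ^ (r + 2)"
      proof -
        have "(p ^ (r + 2)) ^ (r + 1) = (p ^ (r + 1)) ^ (r + 2)" by (simp only: power_mult[symmetric] mult.commute)
        moreover have "(n\<^sup>2) ^ (r + 2) = n\<^sup>2 * (n\<^sup>2) ^ (r + 1)" by simp
        ultimately show ?thesis by (simp only: power_mult_distrib mult.assoc)
      qed
      finally show "n\<^sup>2 \<le> (n\<^sup>2 * p ^ (r + 1)) ^ (r + 2)" .
    qed (use n p in auto)
    also have "\<dots> \<le> n\<^sup>2 * p ^ (j + 1)" using mono[of "j + 1" "r + 1"] j by linarith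
    also have "\<dots> \<le> (n\<^sup>2 * p ^ (j + 1)) ^ (j - 2)"
      using mono[of "j + 1" "r + 2"] Y1 j by (intro self_le_power) linarith+
    also have "\<dots> = (n ^ (j - 2) * p ^ ((j choose 2) - 1))\<^sup>2" using pw_square[of j n p] j by simp
    finally show "(n powr (1 / real (r + 2)))\<^sup>2 \<le> (n ^ (j - 2) * p ^ ((j choose 2) - 1))\<^sup>2" .
  qed (use n p in auto)
qed

text \<open>The variance of the part sizes is nonnegative. The bound holds for unbalanced partitions
  too, and makes the density m / e at least its value for equal parts.\<close>

lemma (in vertex_partition) e_part_le: "real (e_part P) \<le> (real r - 1) / (2 * real r) * real n ^ 2"
proof -
  let ?in = "\<lambda>V. {f. f \<subseteq> V \<and> card f = 2}"
  let ?pairs = "{f. f \<subseteq> {1..n} \<and> card f = 2}"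
  have fpairs: "finite ?pairs" by (rule finite_subset[of _ "Pow {1..n}"]) auto
  have fin: "finite (?in V)" if "V \<in> P" for V
    by (rule finite_subset[of _ "Pow V"]) (use finite_part[OF that] in auto)
  have "card (partition_graph P) + card (\<Union>V\<in>P. ?in V) = card (partition_graph P \<union> (\<Union>V\<in>P. ?in V))"
    by (rule card_Un_disjoint[symmetric]) (use finite_E finite_P fin in \<open>auto simp: partition_graph_def\<close>)
  also have "\<dots> \<le> card ?pairs"
  proof (rule card_mono[OF fpairs])
    show "partition_graph P \<union> (\<Union>V\<in>P. ?in V) \<subseteq> ?pairs" using E_edge part_sub by blast
  qed
  also have "card (\<Union>V\<in>P. ?in V) = (\<Sum>V\<in>P. card (?in V))"
  proof (rule card_UN_disjoint[OF finite_P])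
    show "\<forall>V\<in>P. finite (?in V)" using fin by blast
    show "\<forall>V\<in>P. \<forall>W\<in>P. V \<noteq> W \<longrightarrow> ?in V \<inter> ?in W = {}"
    proof (intro ballI impI equals0I)
      fix V W f assume a: "V \<in> P" "W \<in> P" "V \<noteq> W" "f \<in> ?in V \<inter> ?in W"
      then have "f \<noteq> {}" by auto
      then show False using a same_part[OF a(1,2)] by auto
    qed
  qed
  also have "\<dots> = (\<Sum>V\<in>P. card V choose 2)" using n_subsets finite_part by (intro sum.cong) auto
  finally have "e_part P + (\<Sum>V\<in>P. card V choose 2) \<le> n choose 2" by (simp add: e_part_def n_subsets)
  then have "real (e_part P + (\<Sum>V\<in>P. card V choose 2)) \<le> real (n choose 2)" by (simp only: of_nat_le_iff)
  then have "2 * real (e_part P) + (\<Sum>V\<in>P. 2 * real (card V choose 2)) \<le> 2 * real (n choose 2)"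
    by (simp add: sum_distrib_left[symmetric])
  then have "2 * real (e_part P) + (\<Sum>V\<in>P. real (card V) * (real (card V) - 1)) \<le> real n * (real n - 1)"
    by (simp only: two_choose_two_real)
  moreover have sumn: "(\<Sum>V\<in>P. real (card V)) = real n"
  proof -
    have "card (\<Union>P) = (\<Sum>V\<in>P. card V)"
      using card_Union_disjoint[of P] disjoint_P finite_part by (simp add: disjoint_def pairwise_def disjnt_def)
    then show ?thesis unfolding Union_P by (simp flip: of_nat_sum)
  qed
  moreover have "(\<Sum>V\<in>P. real (card V) * (real (card V) - 1)) = (\<Sum>V\<in>P. real (card V) ^ 2) - real n"
    unfolding sumn[symmetric] sum_subtractf[symmetric] by (intro sum.cong) (auto simp: algebra_simps power2_eq_square)
  moreover have "real n ^ 2 / real r \<le> (\<Sum>V\<in>P. real (card V) ^ 2)"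
  proof -
    have r0: "real r > 0" using r2 by simp
    have "0 \<le> (\<Sum>V\<in>P. (real (card V) - real n / real r) ^ 2)" by (intro sum_nonneg) auto
    also have "\<dots> = (\<Sum>V\<in>P. real (card V) ^ 2 - 2 * (real n / real r) * real (card V) + (real n / real r) ^ 2)"
      by (intro sum.cong) (auto simp: power2_diff)
    also have "\<dots> = (\<Sum>V\<in>P. real (card V) ^ 2) - 2 * (real n / real r) * real n + real r * (real n / real r) ^ 2"
      by (simp only: sum.distrib sum_subtractf sum_distrib_left[symmetric] sumn sum_constant card_P)
    also have "real r * (real n / real r) ^ 2 = real n ^ 2 / real r" using r0 by (simp add: power2_eq_square)
    also have "2 * (real n / real r) * real n = 2 * (real n ^ 2 / real r)" by (simp add: power2_eq_square)
    finally show ?thesis by simp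
  qed
  ultimately have "2 * real (e_part P) \<le> real n ^ 2 - real n ^ 2 / real r" by (simp add: algebra_simps power2_eq_square)
  also have "\<dots> = 2 * ((real r - 1) / (2 * real r) * real n ^ 2)" using r2 by (simp add: field_simps)
  finally show ?thesis by linarith
qed

text \<open>Here \<open>theta r\<close> is decoded. Its factor (r-1)/(2r) cancels against the bound
  on \<open>e\<close>; the bracket, raised to the power \<open>k\<close>, becomes r^(r-1) times
  (2r+2)/(r+2) because 2k/(r+2) = r-1; and the logarithm carries the exponent 1/k. Divided by
  r^(r-1) the conclusion says that, up to the factors \<open>q\<close> and
  \<open>1 + \<epsilon>\<close>, an inner edge has at least (2 - 2/(r+2)) log n expected
  cliques.\<close>

lemma density_lower:
  fixes q \<epsilon> e p :: real and r n m :: nat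
  assumes r: "2 \<le> r" and n: "2 \<le> n" and e: "0 < e" "e \<le> (real r - 1) / (2 * real r) * real n ^ 2"
    and q: "0 < q" and \<epsilon>: "0 < \<epsilon>" and m: "(1 + \<epsilon>) * m_r r n \<le> real m" and p: "p = q * real m / e"
  shows "(q * (1 + \<epsilon>)) ^ ((Suc r choose 2) - 1) * real r ^ (r - 1) * ((2 * real r + 2) / (real r + 2)) * ln (real n)
    \<le> real n ^ (r - 1) * p ^ ((Suc r choose 2) - 1)"
proof -
  define k where "k = (Suc r choose 2) - 1"
  define C0 where "C0 = (2 * real r + 2) / (real r + 2)"
  define B where "B = (real r * C0 powr (1 / (real r - 1))) powr (2 / (real r + 2))"
  define t where "t = (real r - 1) / (2 * real r)"
  have r1: "real r - 1 > 0" "real r > 0" using r by auto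
  have C0: "C0 > 0" unfolding C0_def by simp
  have t0: "t > 0" using r1 by (simp add: t_def)
  have n0: "real n > 1" "ln (real n) > 0" using n by auto
  have kr: "2 * real k = (real r - 1) * (real r + 2)"
  proof -
    have "1 \<le> (Suc r choose 2)" using r by (simp add: Suc_leI)
    then have "real k = real (Suc r choose 2) - 1" by (simp add: k_def of_nat_diff)
    then show ?thesis using two_choose_two_real[of "Suc r"] by (simp add: algebra_simps)
  qed
  have k0: "real k > 0" using kr r1 by (smt (verit) mult_pos_pos)
  have kk: "real ((r + 1) choose 2) - 1 = real k" using two_choose_two_real[of "r + 1"] kr by (simp add: algebra_simps)
  have B0: "B > 0" unfolding B_def using r1 C0 by simp
  define p1 where "p1 = q * (1 + \<epsilon>) * B * real n powr (- (2 / (real r + 2))) * ln (real n) powr (1 / real k)"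
  have p10: "p1 > 0" unfolding p1_def using q \<epsilon> B0 n0 by simp
  have mr: "m_r r n = t * B * real n powr (2 - 2 / (real r + 2)) * ln (real n) powr (1 / real k)"
    unfolding m_r_def theta_def kk B_def C0_def t_def by simp
  have "p1 \<le> p"
  proof -
    have np: "real n powr (2 - 2 / (real r + 2)) = real n ^ 2 * real n powr (- (2 / (real r + 2)))"
      using n0 by (simp add: powr_diff powr_minus divide_inverse powr_numeral)
    have "p1 * e \<le> p1 * (t * real n ^ 2)" using e(2) p10 by (intro mult_left_mono) (auto simp: t_def)
    also have "\<dots> = q * ((1 + \<epsilon>) * m_r r n)" unfolding p1_def mr np by (simp only: mult_ac)
    also have "\<dots> \<le> q * real m" using m q by (intro mult_left_mono) auto
    finally show ?thesis unfolding p using e(1) by (simp add: pos_le_divide_eq)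
  qed
  then have "p1 ^ k \<le> p ^ k" using p10 by (intro power_mono) auto
  then have le: "real n ^ (r - 1) * p1 ^ k \<le> real n ^ (r - 1) * p ^ k" by (intro mult_left_mono) auto
  have e1: "2 / (real r + 2) * real k = real r - 1" using kr by (simp add: field_simps)
  have "B ^ k = real r ^ (r - 1) * C0"
  proof -
    have "B ^ k = B powr real k" using B0 by (simp add: powr_realpow)
    also have "\<dots> = (real r * C0 powr (1 / (real r - 1))) powr (2 / (real r + 2) * real k)" by (simp add: B_def powr_powr)
    also have "\<dots> = (real r * C0 powr (1 / (real r - 1))) powr (real r - 1)" unfolding e1 ..
    also have "\<dots> = real r powr (real r - 1) * (C0 powr (1 / (real r - 1))) powr (real r - 1)" using r1 by (simp add: powr_mult)
    also have "(C0 powr (1 / (real r - 1))) powr (real r - 1) = C0" using C0 r1 by (simp add: powr_powr)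
    also have "real r powr (real r - 1) = real r ^ (r - 1)" using r1 r by (simp add: powr_realpow[symmetric] of_nat_diff)
    finally show ?thesis .
  qed
  moreover have "(real n powr (- (2 / (real r + 2)))) ^ k = 1 / real n ^ (r - 1)"
  proof -
    have "(real n powr (- (2 / (real r + 2)))) ^ k = real n powr (- (2 / (real r + 2)) * real k)"
      using n0 by (simp add: powr_realpow[symmetric] powr_powr)
    also have "\<dots> = real n powr (- (real r - 1))" using e1 by simp
    also have "\<dots> = inverse (real n powr (real r - 1))" by (rule powr_minus)
    also have "real n powr (real r - 1) = real n ^ (r - 1)" using n0 r by (simp add: powr_realpow[symmetric] of_nat_diff)
    also have "inverse (real n ^ (r - 1)) = 1 / real n ^ (r - 1)" by (rule inverse_eq_divide)
    finally show ?thesis .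
  qed
  moreover have "(ln (real n) powr (1 / real k)) ^ k = ln (real n)"
    using n0 k0 by (simp add: powr_realpow[symmetric] powr_powr)
  ultimately have "p1 ^ k = (q * (1 + \<epsilon>)) ^ k * (real r ^ (r - 1) * C0) * (1 / real n ^ (r - 1)) * ln (real n)"
    unfolding p1_def by (simp only: power_mult_distrib)
  then have "real n ^ (r - 1) * p1 ^ k = (q * (1 + \<epsilon>)) ^ k * real r ^ (r - 1) * C0 * ln (real n)" using n0 by simp
  then show ?thesis using le unfolding k_def C0_def by simp
qed

text \<open>While \<open>M\<close> is the smaller term, the stars of size \<open>a\<close>
  contribute at most the \<open>a\<close>-th power of \<open>z * n * exp (- (s * M))\<close>, a
  geometric series. Otherwise put x = p n / a: the number of stars times \<open>z ^ a\<close> is at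
  most (C e x)^a with e the base of the logarithm, the gain per edge is \<open>s * sqrt x\<close>,
  and by \<open>lns\<close> the logarithm is at most a quarter of the root. What remains is
  \<open>exp (- (1 / 2 * a * sqrt x))\<close>, and a sqrt x = sqrt (a p n).\<close>

lemma star_sum_bound:
  fixes n d :: nat and p z s M C :: real
  assumes n: "1 \<le> n" and p: "0 < p" and z: "z = C * p" and C: "0 < C" and s: "3 / 4 \<le> s"
    and d: "d \<le> n" and lns: "\<And>a. 1 \<le> a \<Longrightarrow> a \<le> d \<Longrightarrow> ln (C * exp 1 * (p * real n / real a)) \<le> sqrt (p * real n / real a) / 4"
    and \<zeta>: "z * real n * exp (- (s * M)) \<le> 1 / 2"
  shows "(\<Sum>B\<in>{B\<in>Pow {1..n}. card B \<le> d}. z ^ card B * exp (- (s * (real (card B) * min M (sqrt (p * real n / real (card B)))))))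
    \<le> 1 + (2 * (z * real n * exp (- (s * M))) + real n * exp (- (1 / 2 * sqrt (p * real n))))"
proof -
  let ?\<zeta> = "z * real n * exp (- (s * M))" and ?E = "exp (- (1 / 2 * sqrt (p * real n)))"
  define f where "f = (\<lambda>a. z ^ a * exp (- (s * (real a * min M (sqrt (p * real n / real a))))))"
  have z0: "z > 0" using z C p by simp
  have f0: "0 \<le> f a" for a using z0 by (simp add: f_def)
  have \<zeta>0: "0 \<le> ?\<zeta>" using z0 by simp
  have t: "real (n choose a) * f a \<le> ?\<zeta> * (1 / 2) ^ (a - 1) + ?E" if a: "1 \<le> a" "a \<le> d" for a
  proof -
    have bin: "real (n choose a) \<le> real n ^ a / fact a" by (rule binomial_le_power_fact)
    show ?thesis
    proof (cases "M \<le> sqrt (p * real n / real a)")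
      case True
      have "real (n choose a) \<le> real n ^ a" using bin
        by (rule order_trans) (simp add: divide_le_eq mult_left_le fact_ge_1 mult_le_cancel_left1)
      then have "real (n choose a) * f a \<le> real n ^ a * f a" using f0 by (rule mult_right_mono)
      also have "\<dots> = ?\<zeta> ^ a" unfolding f_def using True
        by (simp add: min_absorb1 power_mult_distrib exp_of_nat_mult[symmetric] mult_ac)
      also have "\<dots> = ?\<zeta> * ?\<zeta> ^ (a - 1)" using a by (cases a) auto
      also have "\<dots> \<le> ?\<zeta> * (1 / 2) ^ (a - 1)" using \<zeta> \<zeta>0 by (intro mult_left_mono power_mono) auto
      finally show ?thesis by (simp add: add_increasing2)
    next
      case False
      define x where "x = p * real n / real a"
      have a0: "real a > 0" using a by simp
      have x0: "x > 0" using p n a0 by (simp add: x_def)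
      have "real (n choose a) * z ^ a \<le> (real n ^ a / fact a) * z ^ a" using bin z0 by (intro mult_right_mono) auto
      also have "\<dots> \<le> (C * exp 1 * x) ^ a"
      proof -
        have "real a ^ a / fact a \<le> exp 1 ^ a"
          using power_div_fact_le_exp[of "real a" a] by (simp add: exp_of_nat_mult[symmetric])
        then have "(C * x) ^ a * (real a ^ a / fact a) \<le> (C * x) ^ a * exp 1 ^ a" using C x0 by (intro mult_left_mono) auto
        moreover have "(C * x) ^ a * (real a ^ a / fact a) = real n ^ a / fact a * z ^ a"
        proof -
          have "C * x * real a = real n * z" using a0 by (simp add: x_def z)
          then have "(C * x) ^ a * real a ^ a = real n ^ a * z ^ a" by (metis power_mult_distrib)
          then show ?thesis by simp
        qed
        moreover have "(C * x) ^ a * exp 1 ^ a = (C * exp 1 * x) ^ a" by (simp add: power_mult_distrib)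
        ultimately show ?thesis by linarith
      qed
      also have "\<dots> = exp (real a * ln (C * exp 1 * x))" using C x0 by (simp add: exp_of_nat_mult)
      finally have b: "real (n choose a) * z ^ a \<le> exp (real a * ln (C * exp 1 * x))" .
      have "real (n choose a) * f a = (real (n choose a) * z ^ a) * exp (- (s * (real a * sqrt x)))"
        using False by (simp add: f_def x_def min_absorb2)
      also have "\<dots> \<le> exp (real a * ln (C * exp 1 * x)) * exp (- (s * (real a * sqrt x)))" using b by (rule mult_right_mono) simp
      also have "\<dots> = exp (real a * (ln (C * exp 1 * x) - s * sqrt x))" by (simp add: exp_add[symmetric] algebra_simps)
      also have "\<dots> \<le> exp (real a * (- (1 / 2 * sqrt x)))"
      proof -
        have "3 / 4 * sqrt x \<le> s * sqrt x" using s x0 by (intro mult_right_mono) auto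
        then have "ln (C * exp 1 * x) - s * sqrt x \<le> - (1 / 2 * sqrt x)" using lns[OF a] by (simp add: x_def)
        then show ?thesis unfolding exp_le_cancel_iff using a0 by (intro mult_left_mono) auto
      qed
      also have "\<dots> \<le> ?E"
      proof -
        have "sqrt (p * real n) \<le> real a * sqrt x"
        proof -
          have "real a * sqrt x = sqrt (real a) * sqrt (p * real n)"
            unfolding x_def real_sqrt_divide using a0 by (simp add: real_div_sqrt field_simps)
          moreover have "1 * sqrt (p * real n) \<le> sqrt (real a) * sqrt (p * real n)" using a p by (intro mult_right_mono) auto
          ultimately show ?thesis by simp
        qed
        then show ?thesis by simp
      qed
      finally show ?thesis using \<zeta>0 by (simp add: add_increasing)
    qed
  qed
  have "(\<Sum>B\<in>{B\<in>Pow {1..n}. card B \<le> d}. f (card B)) = (\<Sum>a\<in>{..d}. \<Sum>B\<in>{B\<in>{B\<in>Pow {1..n}. card B \<le> d}. card B = a}. f (card B))"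
    by (rule sum.group[symmetric]) auto
  also have "\<dots> = (\<Sum>a\<in>{..d}. real (n choose a) * f a)"
  proof (intro sum.cong refl)
    fix a assume "a \<in> {..d}"
    then have "{B\<in>{B\<in>Pow {1..n}. card B \<le> d}. card B = a} = {B. B \<subseteq> {1..n} \<and> card B = a}" by auto
    then have "(\<Sum>B\<in>{B\<in>{B\<in>Pow {1..n}. card B \<le> d}. card B = a}. f (card B)) = (\<Sum>B\<in>{B. B \<subseteq> {1..n} \<and> card B = a}. f a)"
      by (simp add: sum.cong)
    then show "(\<Sum>B\<in>{B\<in>{B\<in>Pow {1..n}. card B \<le> d}. card B = a}. f (card B)) = real (n choose a) * f a"
      by (simp add: n_subsets)
  qed
  also have "\<dots> = 1 + (\<Sum>a\<in>{1..d}. real (n choose a) * f a)"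
  proof -
    have "{..d} = insert 0 {1..d}" by auto
    then show ?thesis by (simp add: f_def)
  qed
  finally have eq: "(\<Sum>B\<in>{B\<in>Pow {1..n}. card B \<le> d}. f (card B)) = 1 + (\<Sum>a\<in>{1..d}. real (n choose a) * f a)" .
  have "(\<Sum>a\<in>{1..d}. real (n choose a) * f a) \<le> (\<Sum>a\<in>{1..d}. ?\<zeta> * (1 / 2) ^ (a - 1) + ?E)"
    using t by (intro sum_mono) auto
  also have "\<dots> = ?\<zeta> * (\<Sum>a\<in>{1..d}. (1 / 2) ^ (a - 1)) + real d * ?E"
    by (simp add: sum.distrib sum_distrib_left)
  also have "\<dots> \<le> ?\<zeta> * 2 + real n * ?E"
  proof (intro add_mono mult_left_mono mult_right_mono \<zeta>0)
    have "(\<Sum>a\<in>{1..d}. (1 / 2 :: real) ^ (a - 1)) = 2 - 2 * (1 / 2) ^ d" by (induction d) auto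
    then show "(\<Sum>a\<in>{1..d}. (1 / 2 :: real) ^ (a - 1)) \<le> 2" by simp
  qed (use d in auto)
  finally show ?thesis using eq unfolding f_def by linarith
qed

lemma floor_half: "1 \<le> (x :: real) \<Longrightarrow> x / 2 \<le> real (nat \<lfloor>x\<rfloor>)"
proof -
  assume x: "1 \<le> x"
  then have f: "1 \<le> \<lfloor>x\<rfloor>" by (simp add: le_floor_iff)
  have "real (nat \<lfloor>x\<rfloor>) = real_of_int \<lfloor>x\<rfloor>" using f by simp
  then show ?thesis using f real_of_int_floor_gt_diff_one[of x] by linarith
qed

lemma ceiling_double: "1 \<le> (x :: real) \<Longrightarrow> real (nat \<lceil>x\<rceil>) \<le> 2 * x"
  by linarith

text \<open>The factor \<open>(1 - r * \<eta>) ^ (r - 1)\<close> is the loss from parts smaller than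
  n/r, and \<open>(1 - \<eta>)\<^sup>2\<close> that from a binomial density below m / e. Both tend
  to 1 with \<open>\<eta>\<close>, so half of the surplus \<open>\<epsilon>\<close>
  survives.\<close>

lemma small_loss:
  fixes \<epsilon> :: real
  assumes r: "2 \<le> r" and \<epsilon>: "0 < \<epsilon>" and k: "1 \<le> k"
  shows "\<exists>\<eta>. 0 < \<eta> \<and> \<eta> \<le> 1 / (2 * real r) \<and> 1 + \<epsilon> / 2 \<le> (1 - real r * \<eta>) ^ (r - 1) * ((1 - \<eta>)\<^sup>2 * (1 + \<epsilon>)) ^ k"
proof -
  let ?f = "\<lambda>\<eta>. (1 - real r * \<eta>) ^ (r - 1) * ((1 - \<eta>)\<^sup>2 * (1 + \<epsilon>)) ^ k"
  have "(?f \<longlongrightarrow> ?f 0) (at_right 0)" by (intro tendsto_intros)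
  moreover have "1 + \<epsilon> / 2 < ?f 0"
  proof -
    have "1 + \<epsilon> \<le> (1 + \<epsilon>) ^ k" using \<epsilon> k by (intro self_le_power) auto
    then show ?thesis using \<epsilon> by simp
  qed
  ultimately have "eventually (\<lambda>\<eta>. 1 + \<epsilon> / 2 < ?f \<eta>) (at_right 0)" by (rule order_tendstoD(1))
  moreover have "eventually (\<lambda>\<eta>. \<eta> \<in> {0<..<1 / (2 * real r)}) (at_right (0 :: real))"
    using r by (intro eventually_at_right_real) auto
  ultimately have "eventually (\<lambda>\<eta>. 0 < \<eta> \<and> \<eta> \<le> 1 / (2 * real r) \<and> 1 + \<epsilon> / 2 \<le> ?f \<eta>) (at_right 0)"
    by eventually_elim auto
  then show ?thesis using eventually_happens by force
qed

text \<open>All requirements that only ask for a large \<open>n\<close>; p n will be at least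
  \<open>x powr a\<close>. The last conjunct is the final error term, split into four summands that
  are compared with the target one by one.\<close>

lemma eventually_small:
  fixes \<tau> \<beta> C a \<epsilon> C0 c0 A \<kappa> B \<eta> R :: real
  assumes "0 < \<tau>" "0 < \<beta>" "0 < C" "0 < a" "0 < c0" "c0 < c1" "0 < A" "0 < \<kappa>" "0 < \<eta>" "0 < R"
  shows "\<exists>X\<ge>2. \<forall>x\<ge>X. B \<le> ln x ^ 2 \<and> 4 * ln x / \<tau> \<le> x powr a \<and> 1 \<le> \<beta> * x powr a \<and> 1 \<le> ln x \<and>
    (A * ln x) powr \<kappa> * x powr (- c1) \<le> x powr (- c0) \<and> C * x powr (- c0) \<le> 1 / 2 \<and>
    2 * (2 * C * x powr (- c0) + x\<^sup>2 * exp (- (1 / 2 * sqrt (x powr a)))) + x * exp (- (x powr a)) \<le> 1 \<and>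
    1 / \<eta> * (exp (- (\<tau> / 4 * (x * x powr a))) + R * (2 * (2 * (2 * C * x powr (- c0) + x\<^sup>2 * exp (- (1 / 2 * sqrt (x powr a)))) + x * exp (- (x powr a)))))
      \<le> x powr (- (c0 / 2))"
proof -
  have "eventually (\<lambda>x. B \<le> ln x ^ 2) at_top" by real_asymp
  moreover have "eventually (\<lambda>x. 4 * ln x / \<tau> \<le> x powr a) at_top" using assms by real_asymp
  moreover have "eventually (\<lambda>x. 1 \<le> \<beta> * x powr a) at_top" using assms by real_asymp
  moreover have "eventually (\<lambda>x::real. 1 \<le> ln x) at_top" by real_asymp
  moreover have "eventually (\<lambda>x. (A * ln x) powr \<kappa> * x powr (- c1) \<le> x powr (- c0)) at_top" using assms by real_asymp
  moreover have "eventually (\<lambda>x. C * x powr (- c0) \<le> 1 / 2) at_top" using assms by real_asymp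
  moreover have "eventually (\<lambda>x. 2 * (2 * C * x powr (- c0) + x\<^sup>2 * exp (- (1 / 2 * sqrt (x powr a)))) + x * exp (- (x powr a)) \<le> 1) at_top"
    using assms by real_asymp
  moreover have "eventually (\<lambda>x. 1 / \<eta> * (exp (- (\<tau> / 4 * (x * x powr a))) + R * (2 * (2 * (2 * C * x powr (- c0) + x\<^sup>2 * exp (- (1 / 2 * sqrt (x powr a)))) + x * exp (- (x powr a)))))
      \<le> x powr (- (c0 / 2))) at_top"
  proof -
    have "eventually (\<lambda>x. 1 / \<eta> * exp (- (\<tau> / 4 * (x * x powr a))) \<le> x powr (- (c0 / 2)) / 4) at_top" using assms by real_asymp
    moreover have "eventually (\<lambda>x. 8 * C * R / \<eta> * x powr (- c0) \<le> x powr (- (c0 / 2)) / 4) at_top" using assms by real_asymp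
    moreover have "eventually (\<lambda>x. 4 * R / \<eta> * (x\<^sup>2 * exp (- (1 / 2 * sqrt (x powr a)))) \<le> x powr (- (c0 / 2)) / 4) at_top" using assms by real_asymp
    moreover have "eventually (\<lambda>x. 2 * R / \<eta> * (x * exp (- (x powr a))) \<le> x powr (- (c0 / 2)) / 4) at_top" using assms by real_asymp
    ultimately show ?thesis
    proof eventually_elim
      case (elim x)
      have "1 / \<eta> * (exp (- (\<tau> / 4 * (x * x powr a))) + R * (2 * (2 * (2 * C * x powr (- c0) + x\<^sup>2 * exp (- (1 / 2 * sqrt (x powr a)))) + x * exp (- (x powr a)))))
        = 1 / \<eta> * exp (- (\<tau> / 4 * (x * x powr a))) + 8 * C * R / \<eta> * x powr (- c0)
          + 4 * R / \<eta> * (x\<^sup>2 * exp (- (1 / 2 * sqrt (x powr a)))) + 2 * R / \<eta> * (x * exp (- (x powr a)))"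
        by (simp add: distrib_left add_divide_distrib mult_ac)
      then show ?case using elim by linarith
    qed
  qed
  moreover have "eventually (\<lambda>x::real. 2 \<le> x) at_top" by (rule eventually_ge_at_top)
  ultimately have "eventually (\<lambda>x. 2 \<le> x \<and> B \<le> ln x ^ 2 \<and> 4 * ln x / \<tau> \<le> x powr a \<and> 1 \<le> \<beta> * x powr a \<and> 1 \<le> ln x \<and>
    (A * ln x) powr \<kappa> * x powr (- c1) \<le> x powr (- c0) \<and> C * x powr (- c0) \<le> 1 / 2 \<and>
    2 * (2 * C * x powr (- c0) + x\<^sup>2 * exp (- (1 / 2 * sqrt (x powr a)))) + x * exp (- (x powr a)) \<le> 1 \<and>
    1 / \<eta> * (exp (- (\<tau> / 4 * (x * x powr a))) + R * (2 * (2 * (2 * C * x powr (- c0) + x\<^sup>2 * exp (- (1 / 2 * sqrt (x powr a)))) + x * exp (- (x powr a)))))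
      \<le> x powr (- (c0 / 2))) at_top"
    by eventually_elim simp
  then obtain X where X: "\<forall>x\<ge>X. 2 \<le> x \<and> B \<le> ln x ^ 2 \<and> 4 * ln x / \<tau> \<le> x powr a \<and> 1 \<le> \<beta> * x powr a \<and> 1 \<le> ln x \<and>
    (A * ln x) powr \<kappa> * x powr (- c1) \<le> x powr (- c0) \<and> C * x powr (- c0) \<le> 1 / 2 \<and>
    2 * (2 * C * x powr (- c0) + x\<^sup>2 * exp (- (1 / 2 * sqrt (x powr a)))) + x * exp (- (x powr a)) \<le> 1 \<and>
    1 / \<eta> * (exp (- (\<tau> / 4 * (x * x powr a))) + R * (2 * (2 * (2 * C * x powr (- c0) + x\<^sup>2 * exp (- (1 / 2 * sqrt (x powr a)))) + x * exp (- (x powr a)))))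
      \<le> x powr (- (c0 / 2))" unfolding eventually_at_top_linorder by blast
  then show ?thesis by (intro exI[of _ "max X 2"]) auto
qed

text \<open>The expected number of dangerous inner edges, \<open>n\<^sup>2 p\<close> times the probability \<open>exp (- s M)\<close> that
  an inner edge closes no clique; this is where the threshold constant enters.\<close>

lemma expected_inner_edges:
  fixes n p M0 s \<epsilon> C0 A c0 :: real and r k :: nat
  assumes n: "2 \<le> n" "1 \<le> ln n" and p: "0 < p" "p \<le> 1" and r: "2 \<le> r" and k: "2 * real k = (real r - 1) * (real r + 2)"
    and C0: "C0 = (2 * real r + 2) / (real r + 2)" and \<epsilon>: "0 < \<epsilon>"
    and s: "3 / 4 \<le> s" "1 + \<epsilon> / 4 \<le> s * (1 + \<epsilon> / 2)" and M0: "(1 + \<epsilon> / 2) * C0 * ln n \<le> M0"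
    and M0p: "n ^ (r - 1) * p ^ k \<le> (2 * real r) ^ (r - 1) * M0"
    and A: "A = 4 * (2 * real r) ^ (r - 1)" and c0: "c0 \<le> 1"
    and big: "(A * ln n) powr (1 / real k) * n powr (- (\<epsilon> * C0 / 4)) \<le> n powr (- c0)"
  shows "p * n\<^sup>2 * exp (- (s * min M0 (4 * ln n))) \<le> n powr (- c0)"
\<comment> \<open>The cap at 4 log n handles large \<open>p\<close>: above it a probability of at
  most n^(-3) beats n^2. Below it \<open>M0p\<close> bounds \<open>p\<close> from above by
  n^(-2/(r+2)) up to logarithms, which matters because n^2 p grows with \<open>p\<close>.\<close>
proof (cases "4 * ln n \<le> M0")
  case True
  have "s * min M0 (4 * ln n) \<ge> 3 * ln n" using True s(1) n mult_right_mono[OF s(1), of "4 * ln n"] by (simp add: min_absorb2)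
  then have "exp (- (s * min M0 (4 * ln n))) \<le> exp (- (3 * ln n))" by simp
  also have "\<dots> = n powr (- 3)" using n by (simp add: powr_def)
  finally have "p * n\<^sup>2 * exp (- (s * min M0 (4 * ln n))) \<le> 1 * n\<^sup>2 * n powr (- 3)"
    using p n by (intro mult_mono) auto
  also have "\<dots> = n powr 2 * n powr (- 3)" using n by (simp add: powr_numeral)
  also have "\<dots> = n powr (- 1)" by (simp add: powr_add[symmetric])
  also have "\<dots> \<le> n powr (- c0)" using c0 n by (intro powr_mono) auto
  finally show ?thesis .
next
  case False
  have k0: "k > 0"
  proof (rule gr0I)
    assume "k = 0"
    then show False using k r by simp
  qed
  have A0: "A > 0" using A r by simp
  have "min M0 (4 * ln n) = M0" using False by simp
  moreover have "(1 + \<epsilon> / 4) * C0 * ln n \<le> s * M0"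
  proof -
    have C0': "0 \<le> C0 * ln n" using C0 n by simp
    have "(1 + \<epsilon> / 4) * (C0 * ln n) \<le> s * (1 + \<epsilon> / 2) * (C0 * ln n)" by (rule mult_right_mono[OF s(2) C0'])
    also have "\<dots> = s * ((1 + \<epsilon> / 2) * C0 * ln n)" by simp
    also have "\<dots> \<le> s * M0" using M0 s by (intro mult_left_mono) auto
    finally show ?thesis by (simp add: mult.assoc)
  qed
  ultimately have e: "exp (- (s * min M0 (4 * ln n))) \<le> n powr (- ((1 + \<epsilon> / 4) * C0))" using n by (simp add: powr_def)
  have "n powr (real r - 1) * p powr real k \<le> A * ln n"
  proof -
    have "n ^ (r - 1) * p ^ k \<le> (2 * real r) ^ (r - 1) * (4 * ln n)"
      using M0p by (rule order_trans) (intro mult_left_mono, use False in auto)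
    then show ?thesis unfolding A using n p r by (simp add: powr_realpow[symmetric] of_nat_diff mult_ac)
  qed
  then have "(n powr (real r - 1) * p powr real k) powr (1 / real k) \<le> (A * ln n) powr (1 / real k)"
    using n p by (intro powr_mono2) auto
  moreover have "(n powr (real r - 1) * p powr real k) powr (1 / real k) = n powr ((real r - 1) / real k) * p"
    using n p k0 by (simp add: powr_mult powr_powr)
  moreover have "(real r - 1) / real k = 2 / (real r + 2)" using k k0 by (simp add: field_simps)
  ultimately have pn: "n powr (2 / (real r + 2)) * p \<le> (A * ln n) powr (1 / real k)" by simp
  have "p * n\<^sup>2 * n powr (- ((1 + \<epsilon> / 4) * C0)) = (n powr (2 / (real r + 2)) * p) * n powr (- (\<epsilon> * C0 / 4))"
  proof -
    \<comment> \<open>With this value the exponent 2 - 2/(r+2) of n^2 p cancels against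
      \<open>C0\<close>, and only the surplus \<open>\<epsilon> * C0 / 4\<close> is left.\<close>
    have C0': "C0 = 2 - 2 / (real r + 2)" unfolding C0 by (simp add: field_simps)
    have "n\<^sup>2 * n powr (- ((1 + \<epsilon> / 4) * C0)) = n powr (2 + - ((1 + \<epsilon> / 4) * C0))"
    proof -
      have "n\<^sup>2 = n powr 2" using n by (simp add: powr_numeral)
      then show ?thesis by (simp only: powr_add)
    qed
    also have "2 + - ((1 + \<epsilon> / 4) * C0) = 2 / (real r + 2) + - (\<epsilon> * C0 / 4)" using C0' by (simp add: algebra_simps)
    also have "n powr \<dots> = n powr (2 / (real r + 2)) * n powr (- (\<epsilon> * C0 / 4))" by (rule powr_add)
    finally show ?thesis by (simp add: mult_ac)
  qed
  also have "\<dots> \<le> (A * ln n) powr (1 / real k) * n powr (- (\<epsilon> * C0 / 4))" using pn by (intro mult_right_mono) auto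
  also have "\<dots> \<le> n powr (- c0)" by (rule big)
  finally have "p * n\<^sup>2 * n powr (- ((1 + \<epsilon> / 4) * C0)) \<le> n powr (- c0)" .
  moreover have "p * n\<^sup>2 * exp (- (s * min M0 (4 * ln n))) \<le> p * n\<^sup>2 * n powr (- ((1 + \<epsilon> / 4) * C0))"
    using e p n by (intro mult_left_mono) auto
  ultimately show ?thesis by linarith
qed

text \<open>The constants depend on each other in the order \<open>\<eta>\<close>,
  \<open>\<epsilon>1\<close>, \<open>C\<close>, \<open>\<tau>\<close>, \<open>\<beta>\<close>,
  \<open>Kc\<close>, \<open>\<rho>\<close>, \<open>\<sigma>\<close>, \<open>\<delta>0\<close>. In
  particular \<open>\<eta>\<close>, which also serves as \<gamma>, does not depend on
  \<open>\<delta>0\<close>.\<close>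

lemma sparse_case:
  fixes r :: nat and \<epsilon> :: real
  assumes r: "2 \<le> r" and \<epsilon>: "0 < \<epsilon>"
  shows "\<exists>\<gamma> c \<delta>0. \<exists>N0::nat. 0 < \<gamma> \<and> \<gamma> \<le> 1 / (2 * real r) \<and> 0 < c \<and> 0 < \<delta>0 \<and>
    (\<forall>n m \<delta> P. N0 \<le> n \<longrightarrow> 0 < \<delta> \<longrightarrow> \<delta> < \<delta>0 \<longrightarrow> (1 + \<epsilon>) * m_r r n \<le> real m \<longrightarrow> P \<in> balanced_partitions n r \<gamma> \<longrightarrow>
      real m < (1 - (1 / 16) ^ (32 * r)) * real (e_part P) \<longrightarrow>
      real (card (F_star n m r \<delta> \<gamma> P)) \<le> real n powr (- c) * real (e_part P choose m))"
proof -
  define k where "k = (Suc r choose 2) - 1"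
  define C0 where "C0 = (2 * real r + 2) / (real r + 2)"
  have r0: "0 < real r" "1 \<le> real r" using r by auto
  have kr: "2 * real k = (real r - 1) * (real r + 2)"
  proof -
    have "1 \<le> (Suc r choose 2)" using r by (simp add: Suc_leI)
    then have "real k = real (Suc r choose 2) - 1" by (simp add: k_def of_nat_diff)
    then show ?thesis using two_choose_two_real[of "Suc r"] by (simp add: algebra_simps)
  qed
  have k1: "1 \<le> k"
  proof -
    have "0 < 2 * real k" unfolding kr using r by simp
    then show ?thesis by simp
  qed
  obtain \<eta> where \<eta>: "0 < \<eta>" "\<eta> \<le> 1 / (2 * real r)"
    "1 + \<epsilon> / 2 \<le> (1 - real r * \<eta>) ^ (r - 1) * ((1 - \<eta>)\<^sup>2 * (1 + \<epsilon>)) ^ k"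
    using small_loss[OF r \<epsilon> k1] by blast
  have \<eta>4: "\<eta> \<le> 1 / 4"
  proof -
    have "1 / (2 * real r) \<le> 1 / (2 * 2)" using r by (intro divide_left_mono) auto
    then show ?thesis using \<eta>(2) by simp
  qed
  have r\<eta>: "real r * \<eta> \<le> 1 / 2" using \<eta>(2) r0 by (simp add: field_simps)
  \<comment> \<open>One factor \<open>1 - \<eta>\<close> pays for Markov's inequality, the other for
    the edges used by stars and spokes.\<close>
  define q where "q = (1 - \<eta>)\<^sup>2"
  have q: "1 / 4 \<le> q" "q \<le> 1 - \<eta>" "q \<le> 1"
  proof -
    have "(1 / 2)\<^sup>2 \<le> (1 - \<eta>)\<^sup>2" using \<eta>4 by (intro power_mono) auto
    then show "1 / 4 \<le> q" by (simp add: q_def power2_eq_square)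
    show "q \<le> 1 - \<eta>" unfolding q_def power2_eq_square using \<eta> \<eta>4 by (simp add: mult_left_le)
    then show "q \<le> 1" using \<eta> by simp
  qed
  \<comment> \<open>Small enough that two factors \<open>1 - \<epsilon>1\<close> have a product of
    at least 3/4 and keep half of the surplus \<open>\<epsilon> / 2\<close>.\<close>
  define \<epsilon>1 where "\<epsilon>1 = min (1 / 8) (\<epsilon> / (8 + 4 * \<epsilon>))"
  have \<epsilon>1: "0 < \<epsilon>1" "\<epsilon>1 \<le> 1 / 8" "\<epsilon>1 * (8 + 4 * \<epsilon>) \<le> \<epsilon>"
  proof -
    show "0 < \<epsilon>1" unfolding \<epsilon>1_def using \<epsilon> by simp
    show "\<epsilon>1 \<le> 1 / 8" unfolding \<epsilon>1_def by (rule min.cobounded1)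
    have "\<epsilon>1 \<le> \<epsilon> / (8 + 4 * \<epsilon>)" by (simp add: \<epsilon>1_def)
    then show "\<epsilon>1 * (8 + 4 * \<epsilon>) \<le> \<epsilon>" using \<epsilon> by (simp add: pos_le_divide_eq)
  qed
  define s where "s = (1 - \<epsilon>1)\<^sup>2"
  have s: "3 / 4 \<le> s" "1 + \<epsilon> / 4 \<le> s * (1 + \<epsilon> / 2)"
  proof -
    have s2: "1 - 2 * \<epsilon>1 \<le> s" unfolding s_def by (simp add: power2_eq_square algebra_simps)
    show "3 / 4 \<le> s" using s2 \<epsilon>1(2) by linarith
    have "(1 - 2 * \<epsilon>1) * (1 + \<epsilon> / 2) \<le> s * (1 + \<epsilon> / 2)" using s2 \<epsilon> by (intro mult_right_mono) auto
    moreover have "1 + \<epsilon> / 4 \<le> (1 - 2 * \<epsilon>1) * (1 + \<epsilon> / 2)" using \<epsilon>1(3) by (simp add: algebra_simps)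
    ultimately show "1 + \<epsilon> / 4 \<le> s * (1 + \<epsilon> / 2)" by linarith
  qed
  define q0 :: real where "q0 = (1 / 16) ^ (32 * r)"
  have q0: "0 < q0" "q0 \<le> 1" by (auto simp: q0_def power_le_one)
  \<comment> \<open>As e - m is at least \<open>q0 * e\<close>, the ratio m / (e - m) is at most m /
    (q0 e), which is \<open>C * p\<close>.\<close>
  define C where "C = 1 / (q0 * q)"
  have C: "0 < C" using q0 q by (simp add: C_def)
  \<comment> \<open>Makes the correlation loss in \<open>low_gain\<close> equal to
    \<open>\<epsilon>1\<close>.\<close>
  define \<tau> where "\<tau> = \<epsilon>1 / (2 ^ r * ((real r + 2) * (2 * real r) ^ r))"
  have \<tau>: "0 < \<tau>" "2 ^ r * ((real r + 2) * (2 * real r) ^ r * \<tau>) \<le> \<epsilon>1"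
    using \<epsilon>1 r0 by (auto simp: \<tau>_def)
  obtain x0 where x0: "1 \<le> x0" "\<And>x. x0 \<le> x \<Longrightarrow> ln (C * exp 1 * x) \<le> sqrt x / 4"
  proof -
    have "eventually (\<lambda>x. ln (C * exp 1 * x) \<le> sqrt x / 4) at_top" using C by real_asymp
    then obtain X where "\<forall>x\<ge>X. ln (C * exp 1 * x) \<le> sqrt x / 4" unfolding eventually_at_top_linorder by blast
    then show ?thesis by (intro that[of "max X 1"]) auto
  qed
  \<comment> \<open>The first bound keeps the weight at a vertex below
    \<open>\<tau> * (n * p)\<close>; the second makes p n / a at least \<open>x0\<close> for the
    size a of every low star.\<close>
  define \<beta> where "\<beta> = min (\<tau>\<^sup>2 / 4) (1 / x0)"
  have \<beta>: "0 < \<beta>" "\<beta> \<le> \<tau>\<^sup>2 / 4" "\<beta> \<le> 1 / x0" "\<beta> \<le> 1"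
  proof -
    show "0 < \<beta>" "\<beta> \<le> \<tau>\<^sup>2 / 4" "\<beta> \<le> 1 / x0" using \<tau> x0 by (auto simp: \<beta>_def)
    moreover have "1 / x0 \<le> 1" using x0 by simp
    ultimately show "\<beta> \<le> 1" by linarith
  qed
  \<comment> \<open>In units of p n, the whole debt of a box: \<open>r * (z * n + u)\<close> for the
    stars and another \<open>r * z * n\<close> for the choice of the box, with
    \<open>z = C * p\<close> and \<open>u = p * n\<close>. The extra 1 in \<open>K0\<close> and
    \<open>\<rho>\<close> makes room for the sum of two exponentials.\<close>
  define Kc where "Kc = 2 * real r * C + real r"
  have Kc: "0 < Kc" using r0 C by (simp add: Kc_def add_pos_pos)
  define K0 where "K0 = 2 * (Kc + 1) / \<epsilon>1"
  have K0: "1 \<le> K0" "\<epsilon>1 * (1 / 2 * K0) = Kc + 1"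
  proof -
    have "\<epsilon>1 \<le> 1" by (rule order_trans[OF \<epsilon>1(2)]) simp
    also have "(1::real) \<le> 2 * (Kc + 1)" using Kc by simp
    finally have "\<epsilon>1 \<le> 2 * (Kc + 1)" .
    then show "1 \<le> K0" using \<epsilon>1 by (simp add: K0_def)
    show "\<epsilon>1 * (1 / 2 * K0) = Kc + 1" using \<epsilon>1 by (simp add: K0_def)
  qed
  define \<rho> where "\<rho> = exp (- (2 * (Kc + 1) / \<beta>))"
  have \<rho>: "0 < \<rho>" by (simp add: \<rho>_def)
  note hds = high_degree_sum[OF r \<rho>, where 'a = nat]
  then obtain \<sigma> where \<sigma>: "\<sigma> > 0" and hd: "\<forall>(P :: nat set set) n p d N y. finite P \<longrightarrow> card P = r \<longrightarrow> disjoint P \<longrightarrow>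
    (\<forall>V\<in>P. finite V \<and> n / (2 * real r) \<le> real (card V) \<and> real (card V) \<le> n) \<longrightarrow> 0 < n \<longrightarrow> 0 < p \<longrightarrow> p \<le> 1 \<longrightarrow> 1 \<le> d \<longrightarrow>
    (\<forall>j. 2 \<le> j \<longrightarrow> j \<le> r \<longrightarrow> 2 ^ Suc r * real N \<le> 1 / 2 * ((1 / 2 ^ r) * p ^ (j choose 2) / p ^ (r choose 2) * real d ^ j)) \<longrightarrow>
    (\<forall>j. 2 \<le> j \<longrightarrow> j \<le> r \<longrightarrow> 2 ^ Suc r * (real y * real N)
        \<le> \<sigma> * ((1 / 2 ^ r) * p ^ (j choose 2) / p ^ (r choose 2) * (n / (2 * real r)) ^ j)) \<longrightarrow>
    (\<exists>h. (\<forall>xs. set xs \<subseteq> PiE P (\<lambda>V. {A. A \<subseteq> V \<and> card A = d}) \<and> length xs = y \<longrightarrow>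
        rprob (cross P (\<Union>P)) (\<lambda>_. p) (\<lambda>R. \<forall>W\<in>set xs. \<forall>S\<in>transv P W. \<not> cross P S \<subseteq> R) \<le> exp (- h xs)) \<and>
      (\<forall>b. 0 \<le> b \<longrightarrow> (\<Sum>xs\<in>{xs. set xs \<subseteq> PiE P (\<lambda>V. {A. A \<subseteq> V \<and> card A = d}) \<and> length xs = y}. exp (- (b * h xs)))
        \<le> ((\<rho> ^ d + exp (- (b * (1 / 2 * (real N * p ^ (r choose 2)))))) * (n ^ d / fact d) ^ r) ^ y))"
    by (elim exE conjE) (rule that)
  \<comment> \<open>How far n^2 p^(r+2) must exceed 1 for \<open>N\<close> spread transversals to
    fit into a box; see \<open>own\<close>.\<close>
  define L where "L = max 1 (2 ^ (2 * r + 3) * K0 * (2 / \<beta>) ^ r)"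
  have L: "1 \<le> L" "2 ^ (2 * r + 3) * K0 * (2 / \<beta>) ^ r \<le> L" by (auto simp: L_def)
  define \<theta> where "\<theta> = min 1 (\<tau> / (4 * C))"
  have \<theta>: "0 < \<theta>" "\<theta> \<le> 1" "\<theta> * C \<le> \<tau> / 4"
  proof -
    show "0 < \<theta>" "\<theta> \<le> 1" using \<tau> C by (auto simp: \<theta>_def)
    have "\<theta> \<le> \<tau> / (4 * C)" by (simp add: \<theta>_def)
    then have "\<theta> * C \<le> \<tau> / (4 * C) * C" using C by (intro mult_right_mono) auto
    then show "\<theta> * C \<le> \<tau> / 4" using C by simp
  qed
  have l\<theta>: "0 \<le> ln (1 / \<theta>)" using \<theta> by simp
  define D where "D = 2 ^ (2 * r + 4) * K0 * (2 * real r) ^ r / (\<beta> * \<sigma>)"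
  have D: "0 < D" unfolding D_def using K0 \<beta> \<sigma> r0 by (intro divide_pos_pos mult_pos_pos) auto
  \<comment> \<open>The three bounds serve the loss of density in \<open>dens\<close>, the condition
    \<open>old\<close> on the saturation of the whole parts, and the entropy of the inner graphs in
    \<open>class1_count\<close>.\<close>
  define \<delta>0 where "\<delta>0 = min (\<eta> / (real r + 1)) (min (1 / D) (\<tau> / (8 * (ln (1 / \<theta>) + 1))))"
  have \<delta>0: "0 < \<delta>0" unfolding \<delta>0_def using \<eta> D \<tau> l\<theta> by (auto intro!: divide_pos_pos)
  define a where "a = 1 / real (r + 2)"
  define A where "A = 4 * (2 * real r) ^ (r - 1)"
  have C0: "1 \<le> C0" unfolding C0_def using r0 by (simp add: field_simps)
  define c0 where "c0 = min (\<epsilon> * C0 / 8) (1 / 2)"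
  have \<epsilon>C: "0 < \<epsilon> * C0" using \<epsilon> C0 by simp
  have c0: "0 < c0" "c0 < \<epsilon> * C0 / 4" "c0 \<le> 1" using \<epsilon>C by (auto simp: c0_def)
  have "0 < a" "0 < A" "0 < 1 / real k" using r0 k1 by (auto simp: a_def A_def)
  from eventually_small[OF \<tau>(1) \<beta>(1) C this(1) c0(1,2) this(2,3) \<eta>(1) r0(1), of "(L\<^sup>2) ^ (r - 1)"]
  obtain X where X: "2 \<le> X" "\<forall>x\<ge>X. (L\<^sup>2) ^ (r - 1) \<le> ln x ^ 2 \<and> 4 * ln x / \<tau> \<le> x powr a \<and> 1 \<le> \<beta> * x powr a \<and> 1 \<le> ln x \<and>
    (A * ln x) powr (1 / real k) * x powr (- (\<epsilon> * C0 / 4)) \<le> x powr (- c0) \<and> C * x powr (- c0) \<le> 1 / 2 \<and>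
    2 * (2 * C * x powr (- c0) + x\<^sup>2 * exp (- (1 / 2 * sqrt (x powr a)))) + x * exp (- (x powr a)) \<le> 1 \<and>
    1 / \<eta> * (exp (- (\<tau> / 4 * (x * x powr a))) + real r * (2 * (2 * (2 * C * x powr (- c0) + x\<^sup>2 * exp (- (1 / 2 * sqrt (x powr a)))) + x * exp (- (x powr a)))))
      \<le> x powr (- (c0 / 2))" by blast
  have main: "real (card (F_star n m r \<delta> \<eta> P)) \<le> real n powr (- (c0 / 2)) * real (e_part P choose m)"
    if nX: "X \<le> real n" and \<delta>: "0 < \<delta>" "\<delta> < \<delta>0" and m: "(1 + \<epsilon>) * m_r r n \<le> real m" and PB: "P \<in> balanced_partitions n r \<eta>"
      and mq: "real m < (1 - q0) * real (e_part P)" for n m \<delta> P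
  proof -
    let ?n = "real n"
    have vp: "vertex_partition n r P" using PB r by (simp add: vertex_partition_def balanced_partitions_def)
    interpret vertex_partition n r P by (rule vp)
    have n2: "2 \<le> ?n" "2 \<le> n" "0 < n" "1 \<le> ?n" using nX X(1) by auto
    have XL: "(L\<^sup>2) ^ (r - 1) \<le> ln ?n ^ 2" and X\<Lambda>: "4 * ln ?n / \<tau> \<le> ?n powr a" and X\<beta>: "1 \<le> \<beta> * ?n powr a"
      and Xln: "1 \<le> ln ?n" and XA: "(A * ln ?n) powr (1 / real k) * ?n powr (- (\<epsilon> * C0 / 4)) \<le> ?n powr (- c0)"
      and XC: "C * ?n powr (- c0) \<le> 1 / 2"
      and X1: "2 * (2 * C * ?n powr (- c0) + ?n\<^sup>2 * exp (- (1 / 2 * sqrt (?n powr a)))) + ?n * exp (- (?n powr a)) \<le> 1"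
      and Xf: "1 / \<eta> * (exp (- (\<tau> / 4 * (?n * ?n powr a))) + real r * (2 * (2 * (2 * C * ?n powr (- c0) + ?n\<^sup>2 * exp (- (1 / 2 * sqrt (?n powr a)))) + ?n * exp (- (?n powr a)))))
      \<le> ?n powr (- (c0 / 2))" using X(2) nX by auto
    define e where "e = real (e_part P)"
    have e0: "0 < e" using mq q0 by (metis e_def le_less_trans of_nat_0_le_iff zero_less_mult_pos diff_ge_0_iff_ge mult_eq_0_iff order_le_less less_irrefl of_nat_0)
    have e2: "e \<le> ?n ^ 2 / 2"
    proof -
      have "2 * real (card (partition_graph P)) \<le> ?n ^ 2" by (rule edges_le[OF finite_E]) (use E_edge in blast)
      then show ?thesis by (simp add: e_def e_part_def)
    qed
    have low: "(1 / real r - \<eta>) * ?n \<le> real (card V)" if "V \<in> P" for V using PB that by (simp add: balanced_partitions_def)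
    have rr: "1 / (2 * real r) \<le> 1 / real r - \<eta>" using \<eta>(2) r0 by (simp add: field_simps)
    have sz: "?n / (2 * real r) \<le> (1 / real r - \<eta>) * ?n" using mult_right_mono[OF rr, of ?n] by simp
    have size: "\<forall>V\<in>P. ?n / (2 * real r) \<le> real (card V)" using low sz by fastforce
    have szn: "\<forall>V\<in>P. finite V \<and> ?n / (2 * real r) \<le> real (card V) \<and> real (card V) \<le> ?n"
    proof
      fix V assume V: "V \<in> P"
      have "card V \<le> card {1..n}" by (rule card_mono[OF _ part_sub[OF V]]) simp
      then show "finite V \<and> ?n / (2 * real r) \<le> real (card V) \<and> real (card V) \<le> ?n" using size V finite_part by simp
    qed
    define p where "p = q * real m / e"
    have me': "real m < e"
    proof -
      have "(1 - q0) * e \<le> 1 * e" using q0 e0 by (intro mult_right_mono) auto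
      then show ?thesis using mq by (simp add: e_def)
    qed
    have me: "m < e_part P" using me' e_def by simp
    have p1: "p \<le> 1"
    proof -
      have "q * real m \<le> 1 * e" using q me' by (intro mult_mono) auto
      then show ?thesis unfolding p_def using e0 by (simp add: divide_le_eq)
    qed
    have DL: "(q * (1 + \<epsilon>)) ^ k * real r ^ (r - 1) * C0 * ln ?n \<le> ?n ^ (r - 1) * p ^ k"
      unfolding k_def C0_def by (rule density_lower[OF r n2(2) e0 _ _ \<epsilon> m p_def]) (use e_part_le q in \<open>auto simp: e_def\<close>)
    have p0: "0 < p"
    proof -
      have "0 < (q * (1 + \<epsilon>)) ^ k * real r ^ (r - 1) * C0 * ln ?n" using q \<epsilon> r0 C0 Xln by (intro mult_pos_pos zero_less_power) auto
      then have "0 < ?n ^ (r - 1) * p ^ k" using DL by linarith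
      moreover have "(0::real) ^ k = 0" using k1 by (intro zero_power) simp
      ultimately have "p \<noteq> 0" by (intro notI) simp
      moreover have "0 \<le> p" unfolding p_def using q e0 by simp
      ultimately show ?thesis by simp
    qed
    \<comment> \<open>The expected number of cliques over an inner edge if all parts had the
      smallest size allowed.\<close>
    define M0 where "M0 = ((1 / real r - \<eta>) * ?n) ^ (r - 1) * p ^ k"
    have M0low: "(1 + \<epsilon> / 2) * C0 * ln ?n \<le> M0"
    proof -
      have nn: "0 \<le> (1 / real r - \<eta>) ^ (r - 1)" using rr r0 by (intro zero_le_power) (smt (verit) divide_nonneg_nonneg)
      have "(1 / real r - \<eta>) ^ (r - 1) * ((q * (1 + \<epsilon>)) ^ k * real r ^ (r - 1) * C0 * ln ?n) \<le> (1 / real r - \<eta>) ^ (r - 1) * (?n ^ (r - 1) * p ^ k)"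
        using DL nn by (rule mult_left_mono)
      also have "\<dots> = M0" by (simp add: M0_def power_mult_distrib)
      also have "(1 / real r - \<eta>) ^ (r - 1) * ((q * (1 + \<epsilon>)) ^ k * real r ^ (r - 1) * C0 * ln ?n)
        = ((1 - real r * \<eta>) ^ (r - 1) * (q * (1 + \<epsilon>)) ^ k) * (C0 * ln ?n)"
      proof -
        have "(1 / real r - \<eta>) * real r = 1 - real r * \<eta>" using r0 by (simp add: algebra_simps)
        then have eq: "(1 - real r * \<eta>) ^ (r - 1) = (1 / real r - \<eta>) ^ (r - 1) * real r ^ (r - 1)" by (metis power_mult_distrib)
        show ?thesis unfolding eq by (simp only: mult_ac)
      qed
      finally have "((1 - real r * \<eta>) ^ (r - 1) * (q * (1 + \<epsilon>)) ^ k) * (C0 * ln ?n) \<le> M0" .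
      moreover have "(1 + \<epsilon> / 2) * (C0 * ln ?n) \<le> ((1 - real r * \<eta>) ^ (r - 1) * (q * (1 + \<epsilon>)) ^ k) * (C0 * ln ?n)"
        using \<eta>(3) C0 Xln unfolding q_def by (intro mult_right_mono) auto
      ultimately show ?thesis by (simp add: mult.assoc)
    qed
    have M0p: "?n ^ (r - 1) * p ^ k \<le> (2 * real r) ^ (r - 1) * M0"
    proof -
      have "?n ^ (r - 1) = (2 * real r) ^ (r - 1) * (?n / (2 * real r)) ^ (r - 1)" using r0 by (simp add: power_divide)
      also have "\<dots> \<le> (2 * real r) ^ (r - 1) * ((1 / real r - \<eta>) * ?n) ^ (r - 1)" using sz by (intro mult_left_mono power_mono) auto
      finally have "?n ^ (r - 1) * p ^ k \<le> (2 * real r) ^ (r - 1) * ((1 / real r - \<eta>) * ?n) ^ (r - 1) * p ^ k"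
        using p0 by (intro mult_right_mono) auto
      then show ?thesis by (simp add: M0_def mult.assoc)
    qed
    have lnY: "ln ?n \<le> ?n ^ (r - 1) * p ^ k"
    proof -
      have "M0 \<le> ?n ^ (r - 1) * p ^ k" unfolding M0_def
      proof (intro mult_right_mono power_mono)
        have "1 / real r \<le> 1" using r0 by simp
        then have "(1 / real r - \<eta>) * ?n \<le> 1 * ?n" using \<eta> by (intro mult_right_mono) auto
        then show "(1 / real r - \<eta>) * ?n \<le> ?n" by simp
        have "0 \<le> ?n / (2 * real r)" by simp
        then show "0 \<le> (1 / real r - \<eta>) * ?n" using sz by linarith
      qed (use p0 in auto)
      moreover have "ln ?n \<le> (1 + \<epsilon> / 2) * C0 * ln ?n"
      proof -
        have "1 * 1 \<le> (1 + \<epsilon> / 2) * C0" using \<epsilon> C0 by (intro mult_mono) auto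
        then show ?thesis using mult_right_mono[of 1 "(1 + \<epsilon> / 2) * C0" "ln ?n"] Xln by simp
      qed
      ultimately show ?thesis using M0low by linarith
    qed
    \<comment> \<open>The lower bound on n^(r-1) p^k is only logarithmic, but its square is the
      (r-1)-st power of n^2 p^(r+2), so for large n this base exceeds any prescribed
      constant.\<close>
    have Y: "L\<^sup>2 \<le> ?n\<^sup>2 * p ^ (r + 2)"
    proof (rule ccontr)
      assume "\<not> ?thesis"
      then have "(?n\<^sup>2 * p ^ (r + 2)) ^ (r - 1) < (L\<^sup>2) ^ (r - 1)" using p0 r by (intro power_strict_mono) auto
      also have "\<dots> \<le> ln ?n ^ 2" by (rule XL)
      also have "\<dots> \<le> (?n ^ (r - 1) * p ^ k)\<^sup>2" using lnY Xln by (intro power_mono) auto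
      also have "\<dots> = (?n\<^sup>2 * p ^ (r + 2)) ^ (r - 1)" using pw_square[of "Suc r" ?n p] r by (simp add: k_def numeral_2_eq_2)
      finally show False by simp
    qed
    note pwf = pw_facts[OF n2(4) p0 p1 L(1) Y, folded a_def]
    have r1: "1 \<le> r" using r by simp
    have pn: "?n powr a \<le> p * ?n" using pwf(3)[OF r1] .
    have \<beta>pn: "1 \<le> \<beta> * (p * ?n)" using X\<beta> mult_left_mono[OF pn, of \<beta>] \<beta> by linarith
    have pn1: "1 \<le> p * ?n"
    proof -
      have "\<beta> * (p * ?n) \<le> 1 * (p * ?n)" using \<beta> p0 by (intro mult_right_mono) auto
      then show ?thesis using \<beta>pn by linarith
    qed
    define d where "d = nat \<lfloor>\<beta> * (p * ?n)\<rfloor>"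
    have d: "real d \<le> \<beta> * (p * ?n)" "\<beta> * (p * ?n) / 2 \<le> real d" "1 \<le> d"
    proof -
      show "real d \<le> \<beta> * (p * ?n)" unfolding d_def using \<beta>pn by (simp add: of_nat_floor)
      show "\<beta> * (p * ?n) / 2 \<le> real d" unfolding d_def by (rule floor_half[OF \<beta>pn])
      show "1 \<le> d" unfolding d_def using \<beta>pn by (simp add: le_nat_iff le_floor_iff)
    qed
    have dn: "d \<le> n"
    proof -
      have "p * ?n \<le> 1 * ?n" using p1 by (intro mult_right_mono) auto
      moreover have "\<beta> * (p * ?n) \<le> 1 * (p * ?n)" using \<beta> p0 by (intro mult_right_mono) auto
      ultimately show ?thesis using d(1) by linarith
    qed
    define pC where "pC = p ^ (r choose 2)"
    have pC: "0 < pC" "pC \<le> 1" using p0 p1 by (auto simp: pC_def power_le_one)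
    \<comment> \<open>Among \<open>N\<close> transversals the expected number of cliques is about
      \<open>K0 * p * n\<close>, so a good box gains a prescribed multiple of p n.\<close>
    define N where "N = nat \<lceil>K0 * (p * ?n) / pC\<rceil>"
    have N: "K0 * (p * ?n) \<le> real N * pC" "real N * pC \<le> 2 * K0 * (p * ?n)"
    proof -
      have v1: "1 \<le> K0 * (p * ?n) / pC"
      proof -
        have "1 * 1 \<le> K0 * (p * ?n)" using K0 pn1 by (intro mult_mono) auto
        then show ?thesis using pC by (simp add: pos_le_divide_eq)
      qed
      have "K0 * (p * ?n) / pC \<le> real N" unfolding N_def by (rule real_nat_ceiling_ge)
      then show "K0 * (p * ?n) \<le> real N * pC" using pC by (simp add: pos_divide_le_eq)
      have "real N \<le> 2 * (K0 * (p * ?n) / pC)" unfolding N_def by (rule ceiling_double[OF v1])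
      then have "real N * pC \<le> 2 * (K0 * (p * ?n) / pC) * pC" using pC by (intro mult_right_mono) auto
      then show "real N * pC \<le> 2 * K0 * (p * ?n)" using pC by simp
    qed
    have m2: "real m \<le> 2 * (p * ?n ^ 2)"
    proof -
      have "real m = p * e / q" unfolding p_def using e0 q by simp
      also have "\<dots> \<le> p * e / (1 / 4)" using q p0 e0 by (intro divide_left_mono) auto
      also have "\<dots> \<le> p * (?n ^ 2 / 2) / (1 / 4)" using e2 p0 by (intro divide_right_mono mult_left_mono) auto
      finally show ?thesis by simp
    qed
    have own: "2 ^ Suc r * real N \<le> 1 / 2 * ((1 / 2 ^ r) * p ^ (j choose 2) / p ^ (r choose 2) * real d ^ j)" if j: "2 \<le> j" "j \<le> r" for j
    proof -
      let ?c = "j choose 2"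
      have Lj: "L \<le> ?n ^ (j - 1) * p ^ (?c + (j - 1))" using pwf(2)[OF r1 j] .
      have "(\<beta> / 2) ^ r * (p * ?n) ^ j \<le> (\<beta> / 2) ^ j * (p * ?n) ^ j"
        using \<beta> p0 j by (intro mult_right_mono power_decreasing) auto
      also have "\<dots> = (\<beta> * (p * ?n) / 2) ^ j" by (simp add: power_mult_distrib power_divide)
      also have "\<dots> \<le> real d ^ j" using d(2) \<beta> p0 by (intro power_mono) auto
      finally have dj: "(\<beta> / 2) ^ r * (p * ?n) ^ j \<le> real d ^ j" .
      have pj: "p ^ ?c * (p * ?n) ^ j = (p * ?n) * (?n ^ (j - 1) * p ^ (?c + (j - 1)))"
      proof -
        have "(p * ?n) ^ j = (p * ?n) * (p * ?n) ^ (j - 1)" using j by (cases j) auto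
        then show ?thesis by (simp add: power_mult_distrib power_add)
      qed
      have "2 ^ (2 * r + 3) * K0 * (p * ?n) = (\<beta> / 2) ^ r * ((2 ^ (2 * r + 3) * K0 * (2 / \<beta>) ^ r) * (p * ?n))"
      proof -
        have "(\<beta> / 2) ^ r * (2 / \<beta>) ^ r = 1" using \<beta> by (simp flip: power_mult_distrib)
        then have "(\<beta> / 2) ^ r * (2 / \<beta>) ^ r * (2 ^ (2 * r + 3) * K0 * (p * ?n)) = 2 ^ (2 * r + 3) * K0 * (p * ?n)" by simp
        then show ?thesis by (simp only: mult_ac)
      qed
      also have "\<dots> \<le> (\<beta> / 2) ^ r * ((p * ?n) * (?n ^ (j - 1) * p ^ (?c + (j - 1))))"
      proof (rule mult_left_mono)
        have "(2 ^ (2 * r + 3) * K0 * (2 / \<beta>) ^ r) * (p * ?n) \<le> (?n ^ (j - 1) * p ^ (?c + (j - 1))) * (p * ?n)"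
          using L(2) Lj p0 by (intro mult_right_mono) auto
        then show "(2 ^ (2 * r + 3) * K0 * (2 / \<beta>) ^ r) * (p * ?n) \<le> (p * ?n) * (?n ^ (j - 1) * p ^ (?c + (j - 1)))"
          by (simp only: mult.commute)
      qed (use \<beta> in simp)
      also have "\<dots> = p ^ ?c * ((\<beta> / 2) ^ r * (p * ?n) ^ j)" unfolding pj[symmetric] by simp
      also have "\<dots> \<le> p ^ ?c * real d ^ j" using dj p0 by (intro mult_left_mono) auto
      finally have key: "2 ^ (2 * r + 3) * K0 * (p * ?n) \<le> p ^ ?c * real d ^ j" .
      have "2 ^ Suc r * real N * (2 ^ Suc r * pC) = 2 ^ Suc r * 2 ^ Suc r * (real N * pC)" by simp
      also have "\<dots> \<le> 2 ^ Suc r * 2 ^ Suc r * (2 * K0 * (p * ?n))" using N(2) by (intro mult_left_mono) auto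
      also have "\<dots> = 2 ^ (2 * r + 3) * K0 * (p * ?n)" by (simp add: power_add power_mult power2_eq_square power_mult_distrib[symmetric])
      also have "\<dots> \<le> p ^ ?c * real d ^ j" by (rule key)
      finally have "2 ^ Suc r * real N \<le> p ^ ?c * real d ^ j / (2 ^ Suc r * pC)" using pC by (simp add: pos_le_divide_eq)
      then show ?thesis unfolding pC_def by (simp add: mult_ac)
    qed
    have old: "2 ^ Suc r * (real y * real N) \<le> \<sigma> * ((1 / 2 ^ r) * p ^ (j choose 2) / p ^ (r choose 2) * (?n / (2 * real r)) ^ j)"
      if j: "2 \<le> j" "j \<le> r" and y: "real y * real d \<le> \<delta> * real m" for j y
    proof -
      let ?c = "j choose 2"
      have one: "1 \<le> ?n ^ (j - 2) * p ^ (?c - 1)" using pwf(1)[OF r1 j] .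
      have nj: "?n ^ j * p ^ ?c = (?n ^ 2 * p) * (?n ^ (j - 2) * p ^ (?c - 1))"
      proof -
        have "1 \<le> ?c" using j by (simp add: Suc_leI)
        then have "p ^ ?c = p * p ^ (?c - 1)" by (cases ?c) auto
        moreover have "?n ^ j = ?n ^ 2 * ?n ^ (j - 2)" using j(1) by (metis le_add_diff_inverse power_add)
        ultimately show ?thesis by simp
      qed
      have njp: "?n ^ 2 * p \<le> ?n ^ j * p ^ ?c" unfolding nj using mult_left_mono[OF one, of "?n ^ 2 * p"] p0 by simp
      \<comment> \<open>There are at most \<open>4 * \<delta> * n / \<beta>\<close> boxes, because
        each comes with \<open>d\<close> of the at most \<open>\<delta> * m\<close> inner edges.
        Through this a small \<delta> keeps the whole family sparse in the parts.\<close>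
      have yn: "\<beta> * real y \<le> 4 * \<delta> * ?n"
      proof -
        have "real y * (\<beta> * (p * ?n) / 2) \<le> real y * real d" using d(2) by (intro mult_left_mono) auto
        also have "\<dots> \<le> \<delta> * (2 * (p * ?n ^ 2))" using y m2 \<delta> mult_left_mono[OF m2, of \<delta>] by linarith
        finally have "(\<beta> * real y) * (p * ?n) \<le> (4 * \<delta> * ?n) * (p * ?n)" by (simp add: power2_eq_square mult_ac)
        then show ?thesis using pn1 by (simp add: mult_le_cancel_right)
      qed
      have \<delta>D: "\<delta> * D \<le> 1"
      proof -
        have "\<delta> \<le> 1 / D" using \<delta>(2) by (simp add: \<delta>0_def)
        then show ?thesis using D by (simp add: pos_le_divide_eq)
      qed
      have "\<beta> * (2 ^ Suc r * (real y * real N) * (2 ^ r * pC)) = 2 ^ Suc r * 2 ^ r * ((\<beta> * real y) * (real N * pC))" by simp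
      also have "\<dots> \<le> 2 ^ Suc r * 2 ^ r * ((4 * \<delta> * ?n) * (2 * K0 * (p * ?n)))"
        by (rule mult_left_mono[OF mult_mono[OF yn N(2)]]) (use \<delta> pC in auto)
      also have "\<dots> = 2 ^ (2 * r + 4) * K0 * \<delta> * (?n ^ 2 * p)"
        by (simp add: power_add power_mult power2_eq_square power_mult_distrib[symmetric] mult_ac)
      also have "\<dots> \<le> 2 ^ (2 * r + 4) * K0 * \<delta> * (?n ^ j * p ^ ?c)" using njp K0 \<delta> by (intro mult_left_mono) auto
      also have "\<dots> = (\<delta> * D) * (\<beta> * (\<sigma> * (p ^ ?c * (?n ^ j / (2 * real r) ^ r))))"
        unfolding D_def using \<beta> \<sigma> r0 by (simp add: field_simps)
      also have "\<dots> \<le> 1 * (\<beta> * (\<sigma> * (p ^ ?c * (?n ^ j / (2 * real r) ^ r))))"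
        using \<delta>D \<beta> \<sigma> p0 by (intro mult_right_mono) auto
      also have "\<dots> \<le> \<beta> * (\<sigma> * (p ^ ?c * (?n / (2 * real r)) ^ j))"
      proof -
        have "(2 * real r) ^ j \<le> (2 * real r) ^ r" using j r0 by (intro power_increasing) auto
        then have "?n ^ j / (2 * real r) ^ r \<le> ?n ^ j / (2 * real r) ^ j" using r0 by (intro divide_left_mono) auto
        then have "?n ^ j / (2 * real r) ^ r \<le> (?n / (2 * real r)) ^ j" by (simp only: power_divide)
        then show ?thesis using \<beta> \<sigma> p0 unfolding mult_1 by (intro mult_left_mono) auto
      qed
      finally have "2 ^ Suc r * (real y * real N) * (2 ^ r * pC) \<le> \<sigma> * (p ^ ?c * (?n / (2 * real r)) ^ j)" using \<beta> by simp
      then have "2 ^ Suc r * (real y * real N) \<le> \<sigma> * (p ^ ?c * (?n / (2 * real r)) ^ j) / (2 ^ r * pC)" using pC by (simp add: pos_le_divide_eq)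
      then show ?thesis unfolding pC_def by (simp add: mult_ac)
    qed
    define \<Lambda> where "\<Lambda> = 4 * ln ?n / \<tau>"
    define M where "M = min M0 (4 * ln ?n)"
    define z where "z = C * p"
    define u where "u = p * ?n"
    define b0 where "b0 = (\<rho> ^ d + exp (- (\<epsilon>1 * (1 / 2 * (real N * p ^ (r choose 2)))))) * (?n ^ d / fact d) ^ r"
    define S where "S = 2 * (z * ?n * exp (- (s * M))) + ?n * exp (- (1 / 2 * sqrt (p * ?n)))"
    define good where "good = (\<lambda>y h. (\<forall>xs. set xs \<subseteq> PiE P (\<lambda>V. {A. A \<subseteq> V \<and> card A = d}) \<and> length xs = y \<longrightarrow>
        rprob (cross P (\<Union>P)) (\<lambda>_. p) (\<lambda>R. \<forall>W\<in>set xs. \<forall>S\<in>transv P W. \<not> cross P S \<subseteq> R) \<le> exp (- h xs)) \<and>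
      (\<forall>b. 0 \<le> b \<longrightarrow> (\<Sum>xs\<in>{xs. set xs \<subseteq> PiE P (\<lambda>V. {A. A \<subseteq> V \<and> card A = d}) \<and> length xs = y}. exp (- (b * h xs)))
        \<le> ((\<rho> ^ d + exp (- (b * (1 / 2 * (real N * p ^ (r choose 2)))))) * (?n ^ d / fact d) ^ r) ^ y))"
    have ex: "\<exists>h. good y h" if y: "real y * real d \<le> \<delta> * real m" for y
    proof -
      have n0': "0 < ?n" using n2 by simp
      show ?thesis unfolding good_def
        by (rule hd[rule_format, OF finite_P card_P disjoint_P _ n0' p0 p1 d(3)])
          (use szn own old[OF _ _ y] in \<open>simp_all\<close>)
    qed
    \<comment> \<open>\<open>high_degree_sum\<close> works for a fixed number of boxes, so an
      exponent is chosen for every length and \<open>h\<close> applies the one for the length of its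
      argument.\<close>
    define hf where "hf = (\<lambda>y. SOME h. good y h)"
    have hf: "good y (hf y)" if "real y * real d \<le> \<delta> * real m" for y
      unfolding hf_def using someI_ex[OF ex[OF that]] .
    define h where "h = (\<lambda>xs. hf (length xs) xs)"
    have h1: "rprob (cross P (\<Union>P)) (\<lambda>_. p) (\<lambda>R. \<forall>W\<in>set xs. \<forall>S\<in>transv P W. \<not> cross P S \<subseteq> R) \<le> exp (- h xs)"
      if "set xs \<subseteq> PiE P (\<lambda>V. {A. A \<subseteq> V \<and> card A = d})" "real (length xs) * real d \<le> \<delta> * real m" for xs
      using hf[OF that(2)] that(1) unfolding good_def h_def by blast
    have h2: "(\<Sum>xs\<in>{xs. set xs \<subseteq> PiE P (\<lambda>V. {A. A \<subseteq> V \<and> card A = d}) \<and> length xs = y}. exp (- (\<epsilon>1 * h xs))) \<le> b0 ^ y"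
      if y: "real y * real d \<le> \<delta> * real m" for y
    proof -
      have "(\<Sum>xs\<in>{xs. set xs \<subseteq> PiE P (\<lambda>V. {A. A \<subseteq> V \<and> card A = d}) \<and> length xs = y}. exp (- (\<epsilon>1 * hf y xs))) \<le> b0 ^ y"
        using hf[OF y] \<epsilon>1(1) unfolding good_def b0_def by simp
      also have "?this \<longleftrightarrow> ?thesis" unfolding h_def by (intro arg_cong[where f = "\<lambda>x. x \<le> b0 ^ y"] sum.cong) auto
      finally show ?thesis .
    qed
    have Zt: "p * ?n\<^sup>2 * exp (- (s * M)) \<le> ?n powr (- c0)"
      unfolding M_def by (rule expected_inner_edges[OF n2(1) Xln p0 p1 r kr C0_def \<epsilon> s M0low M0p A_def c0(3) XA])
    have \<zeta>n: "z * ?n * exp (- (s * M)) * ?n \<le> C * ?n powr (- c0)"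
      using mult_left_mono[OF Zt, of C] C by (simp add: z_def power2_eq_square mult_ac)
    have \<zeta>: "z * ?n * exp (- (s * M)) \<le> 1 / 2"
    proof -
      have "0 \<le> z * ?n * exp (- (s * M))" using C p0 by (simp add: z_def)
      then have "z * ?n * exp (- (s * M)) \<le> z * ?n * exp (- (s * M)) * ?n" using n2 by (simp add: mult_le_cancel_left1)
      then show ?thesis using \<zeta>n XC by linarith
    qed
    have z0: "0 < z" using C p0 by (simp add: z_def)
    have sr: "sparse_range n r P m d p \<eta> z \<tau> \<Lambda> \<epsilon>1 M \<delta> u \<theta> b0 S h"
    proof (intro sparse_range.intro sparse_range_axioms.intro vp)
      show "0 < n" "0 < p" "p \<le> 1" "0 < \<eta>" "m < e_part P" "0 < z" "0 < \<tau>" "0 < \<epsilon>1" "1 \<le> d" "0 < \<theta>" "\<theta> \<le> 1"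
        using n2 p0 p1 \<eta> me z0 \<tau> \<epsilon>1 d \<theta> by auto
      show "\<forall>V\<in>P. ?n / (2 * real r) \<le> real (card V)" by (rule size)
      show "\<eta> \<le> 1" "0 \<le> \<delta>" "\<epsilon>1 \<le> 1" "0 \<le> u" using \<eta>4 \<delta> \<epsilon>1 p0 by (auto simp: u_def)
      show "real m \<le> z * real (e_part P - m)"
      proof -
        have eq: "real (e_part P - m) = e - real m" using me by (simp add: e_def of_nat_diff)
        have "q0 * e \<le> e - real m" using mq by (simp add: e_def algebra_simps)
        then have "z * (q0 * e) \<le> z * (e - real m)" using z0 by (intro mult_left_mono) auto
        moreover have "z * (q0 * e) = real m" unfolding z_def C_def p_def using q0 q e0 by simp
        ultimately show ?thesis using eq by simp
      qed
      show "real (e_part P) * p \<le> (1 - \<eta>) * ((1 - (real r + 1) * \<delta>) * real m)"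
      proof -
        have "\<delta> \<le> \<eta> / (real r + 1)" using \<delta>(2) by (simp add: \<delta>0_def)
        then have "(real r + 1) * \<delta> \<le> \<eta>" using r0 by (simp add: pos_le_divide_eq mult.commute)
        then have "(1 - \<eta>) * ((1 - \<eta>) * real m) \<le> (1 - \<eta>) * ((1 - (real r + 1) * \<delta>) * real m)"
          using \<eta>4 by (intro mult_left_mono mult_right_mono) auto
        moreover have "real (e_part P) * p = (1 - \<eta>) * ((1 - \<eta>) * real m)"
          unfolding p_def e_def[symmetric] q_def using e0 by (simp add: power2_eq_square)
        ultimately show ?thesis by simp
      qed
      show "\<And>j. 2 \<le> j \<Longrightarrow> j \<le> r \<Longrightarrow> 1 \<le> ?n ^ (j - 2) * p ^ ((j choose 2) - 1)" by (rule pwf(1)[OF r1])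
      show "\<And>j. 3 \<le> j \<Longrightarrow> j \<le> r \<Longrightarrow> \<Lambda> \<le> ?n ^ (j - 2) * p ^ ((j choose 2) - 1)"
        unfolding \<Lambda>_def using X\<Lambda> pwf(4)[OF r1] by (meson order_trans)
      show "0 < \<Lambda>" "M \<le> \<tau> * \<Lambda>" using Xln \<tau> by (auto simp: \<Lambda>_def M_def)
      have M0n: "0 \<le> M0"
      proof -
        have "0 \<le> (1 + \<epsilon> / 2) * C0 * ln ?n" using \<epsilon> C0 Xln by simp
        then show ?thesis using M0low by linarith
      qed
      show "0 \<le> M" using M0n Xln by (simp add: M_def)
      show "\<forall>V\<in>P. M \<le> (\<Prod>W\<in>P - {V}. real (card W)) * p ^ ((Suc r choose 2) - 1)"
      proof
        fix V assume V: "V \<in> P"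
        have "0 \<le> (1 / real r - \<eta>) * ?n" using sz by (smt (verit) divide_nonneg_nonneg of_nat_0_le_iff)
        then have "(\<Prod>W\<in>P - {V}. (1 / real r - \<eta>) * ?n) \<le> (\<Prod>W\<in>P - {V}. real (card W))"
          using low by (intro prod_mono) auto
        moreover have "card (P - {V}) = r - 1" using V finite_P card_P by simp
        ultimately have "((1 / real r - \<eta>) * ?n) ^ (r - 1) \<le> (\<Prod>W\<in>P - {V}. real (card W))" by simp
        then have "M0 \<le> (\<Prod>W\<in>P - {V}. real (card W)) * p ^ k" unfolding M0_def using p0 by (intro mult_right_mono) auto
        then show "M \<le> (\<Prod>W\<in>P - {V}. real (card W)) * p ^ ((Suc r choose 2) - 1)" by (simp add: M_def k_def)
      qed
      show "2 ^ r * ((real r + 2) * (2 * real r) ^ r * \<tau>) \<le> \<epsilon>1" by (rule \<tau>(2))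
      show "2 * sqrt (real d) \<le> \<tau> * sqrt (p * ?n)"
      proof -
        have "\<beta> * (p * ?n) \<le> (\<tau>\<^sup>2 / 4) * (p * ?n)" using \<beta>(2) p0 by (intro mult_right_mono) auto
        then have "real d \<le> (\<tau>\<^sup>2 / 4) * (p * ?n)" using d(1) by linarith
        then have "sqrt (real d) \<le> sqrt ((\<tau>\<^sup>2 / 4) * (p * ?n))" by simp
        also have "\<dots> = \<tau> / 2 * sqrt (p * ?n)" using \<tau> by (simp add: real_sqrt_mult real_sqrt_divide)
        finally show ?thesis by simp
      qed
      show "\<And>xs. set xs \<subseteq> PiE P (\<lambda>V. {A. A \<subseteq> V \<and> card A = d}) \<Longrightarrow> real (length xs) * real d \<le> \<delta> * real m \<Longrightarrow>
        rprob (cross P (\<Union>P)) (\<lambda>_. p) (\<lambda>R. \<forall>W\<in>set xs. \<forall>S\<in>transv P W. \<not> cross P S \<subseteq> R) \<le> exp (- h xs)" by (rule h1)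
      show "\<And>y. real y * real d \<le> \<delta> * real m \<Longrightarrow>
        (\<Sum>xs\<in>{xs. set xs \<subseteq> PiE P (\<lambda>V. {A. A \<subseteq> V \<and> card A = d}) \<and> length xs = y}. exp (- (\<epsilon>1 * h xs))) \<le> b0 ^ y" by (rule h2)
      show "0 \<le> b0" unfolding b0_def using \<rho> by (intro mult_nonneg_nonneg add_nonneg_nonneg) auto
      show "b0 * z ^ (r * d) \<le> exp (- (real r * (z * ?n + u)))"
      proof -
        have e1: "\<rho> ^ d \<le> exp (- ((Kc + 1) * (p * ?n)))"
        proof -
          have "\<rho> ^ d = exp (- (2 * (Kc + 1) / \<beta> * real d))" unfolding \<rho>_def by (simp add: exp_of_nat_mult[symmetric] mult.commute)
          moreover have "(Kc + 1) * (p * ?n) \<le> 2 * (Kc + 1) / \<beta> * real d"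
          proof -
            have "2 * (Kc + 1) / \<beta> * (\<beta> * (p * ?n) / 2) \<le> 2 * (Kc + 1) / \<beta> * real d" using d(2) Kc \<beta> by (intro mult_left_mono) auto
            moreover have "2 * (Kc + 1) / \<beta> * (\<beta> * (p * ?n) / 2) = (Kc + 1) * (p * ?n)" using \<beta>(1) by simp
            ultimately show ?thesis by (simp only:)
          qed
          ultimately show ?thesis by simp
        qed
        have e2: "exp (- (\<epsilon>1 * (1 / 2 * (real N * p ^ (r choose 2))))) \<le> exp (- ((Kc + 1) * (p * ?n)))"
        proof -
          have "\<epsilon>1 * (1 / 2 * (K0 * (p * ?n))) \<le> \<epsilon>1 * (1 / 2 * (real N * pC))" using N(1) \<epsilon>1 by (intro mult_left_mono) auto
          moreover have "\<epsilon>1 * (1 / 2 * (K0 * (p * ?n))) = (Kc + 1) * (p * ?n)" unfolding K0(2)[symmetric] by simp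
          ultimately show ?thesis unfolding pC_def exp_le_cancel_iff by linarith
        qed
        have half: "exp (- ((Kc + 1) * (p * ?n))) \<le> exp (- (Kc * (p * ?n))) * (1 / 2)"
        proof -
          have "exp (- (p * ?n)) \<le> exp (- 1)" using pn1 by simp
          also have "\<dots> \<le> 1 / 2" using exp_ge_add_one_self[of 1] by (simp add: exp_minus field_simps)
          finally have "exp (- (Kc * (p * ?n))) * exp (- (p * ?n)) \<le> exp (- (Kc * (p * ?n))) * (1 / 2)" by (intro mult_left_mono) auto
          then show ?thesis by (simp add: exp_add[symmetric] algebra_simps)
        qed
        have zz: "(?n ^ d / fact d) ^ r * z ^ (r * d) \<le> exp (real r * (z * ?n))"
        proof -
          have "(?n ^ d / fact d) ^ r * z ^ (r * d) = ((z * ?n) ^ d / fact d) ^ r"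
          proof -
            have "z ^ (r * d) = (z ^ d) ^ r" by (simp add: power_mult[symmetric] mult.commute)
            then have "(?n ^ d / fact d) ^ r * z ^ (r * d) = (?n ^ d / fact d * z ^ d) ^ r" by (simp only: power_mult_distrib)
            then show ?thesis by (simp add: power_mult_distrib mult.commute)
          qed
          also have "\<dots> \<le> exp (z * ?n) ^ r" using z0 by (intro power_mono power_div_fact_le_exp) auto
          also have "\<dots> = exp (real r * (z * ?n))" by (simp add: exp_of_nat_mult)
          finally show ?thesis .
        qed
        have "b0 * z ^ (r * d) = (\<rho> ^ d + exp (- (\<epsilon>1 * (1 / 2 * (real N * p ^ (r choose 2)))))) * ((?n ^ d / fact d) ^ r * z ^ (r * d))"
          by (simp add: b0_def)
        also have "\<dots> \<le> exp (- (Kc * (p * ?n))) * exp (real r * (z * ?n))"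
        proof (rule mult_mono)
          show "\<rho> ^ d + exp (- (\<epsilon>1 * (1 / 2 * (real N * p ^ (r choose 2))))) \<le> exp (- (Kc * (p * ?n)))" using e1 e2 half by linarith
        qed (use zz z0 in auto)
        also have "\<dots> = exp (- (real r * (z * ?n + u)))"
        proof -
          have "- (Kc * (p * ?n)) + real r * (z * ?n) = - (real r * (z * ?n + u))" unfolding Kc_def z_def u_def by (simp add: algebra_simps)
          then show ?thesis by (simp only: exp_add[symmetric])
        qed
        finally show ?thesis .
      qed
      show "(\<Sum>B\<in>{B\<in>Pow {1..n}. card B \<le> d}. z ^ card B *
        exp (- ((1 - \<epsilon>1) ^ 2 * (real (card B) * min M (sqrt (p * ?n / real (card B))))))) \<le> 1 + S"
        unfolding S_def s_def[symmetric]
      proof (rule star_sum_bound[OF _ p0 z_def C s(1) dn _ \<zeta>])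
        show "1 \<le> n" using n2 by simp
        fix b assume b: "1 \<le> b" "b \<le> d"
        have "x0 * real b \<le> p * ?n"
        proof -
          have "real b \<le> (1 / x0) * (p * ?n)" using b(2) d(1) mult_right_mono[OF \<beta>(3), of "p * ?n"] p0 by simp
          then show ?thesis using x0(1) by (simp add: field_simps)
        qed
        then have "x0 \<le> p * ?n / real b" using b(1) by (simp add: pos_le_divide_eq)
        then show "ln (C * exp 1 * (p * ?n / real b)) \<le> sqrt (p * ?n / real b) / 4" by (rule x0(2))
      qed
    qed
    note bound = sparse_range.sparse_bound[OF sr, of \<eta>]
    have T1: "exp (- ((1 - \<epsilon>1) * (\<tau> * (?n ^ 2 * p))) + (\<delta> * real m * ln (1 / \<theta>) + \<theta> * z * ?n ^ 2)) \<le> exp (- (\<tau> / 4 * (?n * ?n powr a)))"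
    proof -
      let ?w = "\<tau> * (?n ^ 2 * p)"
      have w0: "0 \<le> ?w" using \<tau> p0 by simp
      have "\<theta> * z * ?n ^ 2 = (\<theta> * C) * (?n ^ 2 * p)" by (simp add: z_def)
      also have "\<dots> \<le> \<tau> / 4 * (?n ^ 2 * p)" using \<theta>(3) p0 by (intro mult_right_mono) auto
      finally have t1: "\<theta> * z * ?n ^ 2 \<le> ?w / 4" by simp
      have "\<delta> * real m * ln (1 / \<theta>) \<le> ?w / 4"
      proof -
        have "\<delta> \<le> \<tau> / (8 * (ln (1 / \<theta>) + 1))" using \<delta>(2) by (simp add: \<delta>0_def)
        then have d8: "\<delta> * (8 * (ln (1 / \<theta>) + 1)) \<le> \<tau>" using l\<theta> by (simp add: pos_le_divide_eq)
        have "\<delta> * ln (1 / \<theta>) * 8 \<le> \<tau>" using d8 \<delta> by (simp add: algebra_simps)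
        then have "\<delta> * ln (1 / \<theta>) * (2 * (p * ?n ^ 2)) \<le> \<tau> / 8 * (2 * (p * ?n ^ 2))" using p0 by (intro mult_right_mono) auto
        moreover have "\<delta> * ln (1 / \<theta>) * real m \<le> \<delta> * ln (1 / \<theta>) * (2 * (p * ?n ^ 2))" using m2 \<delta> l\<theta> by (intro mult_left_mono) auto
        ultimately show ?thesis by (simp add: mult_ac)
      qed
      moreover have "7 / 8 * ?w \<le> (1 - \<epsilon>1) * ?w" using \<epsilon>1 w0 by (intro mult_right_mono) auto
      moreover have "\<tau> / 4 * (?n * ?n powr a) \<le> ?w / 4"
      proof -
        have "?n * ?n powr a \<le> ?n * (p * ?n)" using pn by (intro mult_left_mono) auto
        then have "\<tau> / 4 * (?n * ?n powr a) \<le> \<tau> / 4 * (?n * (p * ?n))" by (rule mult_left_mono) (use \<tau> in simp)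
        then show ?thesis by (simp add: power2_eq_square mult_ac)
      qed
      ultimately show ?thesis unfolding exp_le_cancel_iff using t1 w0 by linarith
    qed
    define G where "G = 2 * (2 * C * ?n powr (- c0) + ?n\<^sup>2 * exp (- (1 / 2 * sqrt (?n powr a)))) + ?n * exp (- (?n powr a))"
    have T2: "((1 + S) * (1 + exp (- u))) ^ n - 1 \<le> 2 * G"
    proof -
      define w where "w = exp (- u)"
      have S0: "0 \<le> S" unfolding S_def using z0 by simp
      have w: "0 \<le> w" "w \<le> 1" using p0 by (auto simp: w_def u_def)
      have Sn: "?n * S \<le> 2 * C * ?n powr (- c0) + ?n\<^sup>2 * exp (- (1 / 2 * sqrt (?n powr a)))"
      proof -
        have "?n * S = 2 * (z * ?n * exp (- (s * M)) * ?n) + ?n\<^sup>2 * exp (- (1 / 2 * sqrt (p * ?n)))"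
          unfolding S_def by (simp add: power2_eq_square algebra_simps)
        moreover have "?n\<^sup>2 * exp (- (1 / 2 * sqrt (p * ?n))) \<le> ?n\<^sup>2 * exp (- (1 / 2 * sqrt (?n powr a)))" using pn by (intro mult_left_mono) auto
        ultimately show ?thesis using \<zeta>n by linarith
      qed
      have wn: "?n * w \<le> ?n * exp (- (?n powr a))" unfolding w_def u_def using pn by (intro mult_left_mono) auto
      have q1: "?n * (2 * S + w) \<le> G" using Sn wn unfolding G_def by (simp add: distrib_left)
      have "(1 + S) * (1 + w) \<le> 1 + (2 * S + w)" using mult_left_mono[OF w(2) S0] by (simp add: algebra_simps)
      then have "((1 + S) * (1 + w)) ^ n \<le> (1 + (2 * S + w)) ^ n" using S0 w by (intro power_mono) auto
      moreover have "(1 + (2 * S + w)) ^ n - 1 \<le> 2 * (?n * (2 * S + w))"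
        using one_plus_power_le[of "2 * S + w" n] q1 X1 S0 w unfolding G_def by linarith
      ultimately show ?thesis using q1 unfolding w_def by linarith
    qed
    have "\<eta> * real (card (F_star n m r \<delta> \<eta> P)) \<le> real (e_part P choose m) * (exp (- (\<tau> / 4 * (?n * ?n powr a))) + real r * (2 * G))"
      using bound by (rule order_trans) (intro mult_left_mono add_mono T1 T2, simp_all)
    then have "1 / \<eta> * (\<eta> * real (card (F_star n m r \<delta> \<eta> P))) \<le> 1 / \<eta> * (real (e_part P choose m) * (exp (- (\<tau> / 4 * (?n * ?n powr a))) + real r * (2 * G)))"
      using \<eta> by (intro mult_left_mono) auto
    then have "real (card (F_star n m r \<delta> \<eta> P)) \<le> real (e_part P choose m) * (1 / \<eta> * (exp (- (\<tau> / 4 * (?n * ?n powr a))) + real r * (2 * G)))"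
      using \<eta> by (simp add: mult_ac)
    also have "\<dots> \<le> real (e_part P choose m) * ?n powr (- (c0 / 2))" using Xf unfolding G_def by (intro mult_left_mono) auto
    finally show ?thesis by (simp add: mult.commute)
  qed
  show ?thesis
  proof (rule exI[of _ \<eta>], rule exI[of _ "c0 / 2"], rule exI[of _ \<delta>0], rule exI[of _ "nat \<lceil>X\<rceil>"], intro conjI allI impI)
    fix n m \<delta> P
    assume a: "nat \<lceil>X\<rceil> \<le> n" "0 < \<delta>" "\<delta> < \<delta>0" "(1 + \<epsilon>) * m_r r n \<le> real m" "P \<in> balanced_partitions n r \<eta>"
      "real m < (1 - (1 / 16) ^ (32 * r)) * real (e_part P)"
    have "X \<le> real n" using a(1) by linarith
    then show "real (card (F_star n m r \<delta> \<eta> P)) \<le> real n powr (- (c0 / 2)) * real (e_part P choose m)"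
      using main a(2-6) unfolding q0_def by blast
  qed (use \<eta> c0 \<delta>0 in auto)
qed

theorem theorem6p3:
  fixes r :: nat and \<epsilon> :: real
  assumes "r \<ge> 2" and "\<epsilon> > 0"
  shows "\<exists>\<gamma>::real. \<gamma> > 0 \<and> (\<exists>\<omega>::nat \<Rightarrow> real. filterlim \<omega> at_top sequentially \<and>
           (\<exists>\<delta>0::real. \<delta>0 > 0 \<and> (\<forall>\<delta>. 0 < \<delta> \<and> \<delta> < \<delta>0 \<longrightarrow>
              (\<forall>n m. real m \<ge> (1 + \<epsilon>) * m_r r n \<longrightarrow>
                 (\<forall>P\<in>balanced_partitions n r \<gamma>.
                    real (card (F_star n m r \<delta> \<gamma> P)) \<le> (1 / \<omega> n) * real (e_part P choose m))))))"
proof -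
  obtain \<gamma> c \<delta>0 and N0 :: nat where \<gamma>: "0 < \<gamma>" "\<gamma> \<le> 1 / (2 * real r)" and c: "0 < c" and \<delta>0: "0 < \<delta>0"
    and sparse: "\<And>n m \<delta> P. N0 \<le> n \<Longrightarrow> 0 < \<delta> \<Longrightarrow> \<delta> < \<delta>0 \<Longrightarrow> (1 + \<epsilon>) * m_r r n \<le> real m \<Longrightarrow> P \<in> balanced_partitions n r \<gamma> \<Longrightarrow>
      real m < (1 - (1 / 16) ^ (32 * r)) * real (e_part P) \<Longrightarrow>
      real (card (F_star n m r \<delta> \<gamma> P)) \<le> real n powr (- c) * real (e_part P choose m)"
    using sparse_case[OF assms] by blast
  have "eventually (\<lambda>n. real n * (1 / 4) ^ n \<le> 1) sequentially" by real_asymp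
  moreover have "eventually (\<lambda>n. 2 * (real n * (1 / 4) ^ n) \<le> real n powr (- c)) sequentially" using c by real_asymp
  ultimately have "eventually (\<lambda>n. real n * (1 / 4) ^ n \<le> 1 \<and> 2 * (real n * (1 / 4) ^ n) \<le> real n powr (- c)) sequentially"
    by eventually_elim simp
  then obtain N1 where N1: "\<And>n. N1 \<le> n \<Longrightarrow> real n * (1 / 4) ^ n \<le> 1 \<and> 2 * (real n * (1 / 4) ^ n) \<le> real n powr (- c)"
    unfolding eventually_sequentially by blast
  define N2 where "N2 = max (max N0 N1) 1"
  \<comment> \<open>The second bound is the one for the dense range. The third empties the family
    for \<open>n < N2\<close>: an inner edge requires \<delta> m to be at least 1, while m is at
    most n^2/2.\<close>
  define \<delta>1 where "\<delta>1 = min \<delta>0 (min (1 / (2 ^ 13 * real r ^ 2)) (1 / real N2 ^ 2))"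
  have r0: "0 < real r" using assms by simp
  have \<delta>1: "0 < \<delta>1" unfolding \<delta>1_def using \<delta>0 r0 by (auto simp: N2_def)
  have "real (card (F_star n m r \<delta> \<gamma> P)) \<le> (1 / real n powr c) * real (e_part P choose m)"
    if \<delta>: "0 < \<delta>" "\<delta> < \<delta>1" and m: "real m \<ge> (1 + \<epsilon>) * m_r r n" and PB: "P \<in> balanced_partitions n r \<gamma>" for \<delta> n m P
  proof (cases "n < N2")
    case True
    interpret vertex_partition n r P using PB assms by unfold_locales (auto simp: balanced_partitions_def)
    have "F_star n m r \<delta> \<gamma> P = {}"
    proof (rule ccontr)
      assume "F_star n m r \<delta> \<gamma> P \<noteq> {}"
      then obtain G where G: "G \<in> F_star n m r \<delta> \<gamma> P" by auto
      have "finite (inner_edges P G)" using finite_G[OF G] by (simp add: inner_edges_def)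
      then have "1 \<le> card (inner_edges P G)" using inner_pos[OF G] by (simp add: Suc_leI card_gt_0_iff)
      then have one: "1 \<le> \<delta> * real m" using inner_le[OF G] by linarith
      have "2 * real m \<le> real n ^ 2" using edges_le[OF finite_G[OF G]] G_edge[OF G] card_G[OF G] by blast
      also have "\<dots> \<le> real N2 ^ 2" using True by (intro power_mono) auto
      finally have "\<delta> * (2 * real m) \<le> \<delta> * real N2 ^ 2" using \<delta> by (intro mult_left_mono) auto
      moreover have "\<delta> * real N2 ^ 2 \<le> 1"
      proof -
        have "\<delta> \<le> 1 / real N2 ^ 2" using \<delta>(2) by (simp add: \<delta>1_def)
        moreover have "0 < real N2 ^ 2" by (simp add: N2_def)
        ultimately show ?thesis by (simp add: pos_le_divide_eq)
      qed
      ultimately show False using one by linarith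
    qed
    then show ?thesis by simp
  next
    case False
    then have n: "N0 \<le> n" "N1 \<le> n" "0 < n" by (auto simp: N2_def)
    have inv: "real n powr (- c) = 1 / real n powr c" by (simp add: powr_minus divide_inverse)
    show ?thesis
    proof (cases "real m < (1 - (1 / 16) ^ (32 * r)) * real (e_part P)")
      case True
      then show ?thesis using sparse[OF n(1) \<delta>(1) _ m PB] \<delta>(2) unfolding inv by (simp add: \<delta>1_def)
    next
      case False
      interpret vertex_partition n r P using PB assms by unfold_locales (auto simp: balanced_partitions_def)
      have size: "\<forall>V\<in>P. real n / (2 * real r) \<le> real (card V)"
      proof
        fix V assume V: "V \<in> P"
        have "1 / (2 * real r) \<le> 1 / real r - \<gamma>" using \<gamma>(2) r0 by (simp add: field_simps)
        then have "1 / (2 * real r) * real n \<le> (1 / real r - \<gamma>) * real n" by (intro mult_right_mono) auto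
        also have "\<dots> \<le> real (card V)" using PB V by (simp add: balanced_partitions_def)
        finally show "real n / (2 * real r) \<le> real (card V)" by simp
      qed
      have "real (card (F_star n m r \<delta> \<gamma> P)) \<le> ((1 + (1 / 4) ^ n) ^ n - 1) * real (e_part P choose m)"
        by (rule dense_bound[OF n(3) size]) (use False \<delta>(2) in \<open>auto simp: \<delta>1_def\<close>)
      also have "\<dots> \<le> real n powr (- c) * real (e_part P choose m)"
      proof (rule mult_right_mono)
        have "(1 + (1 / 4 :: real) ^ n) ^ n - 1 \<le> 2 * (real n * (1 / 4) ^ n)"
          by (rule one_plus_power_le) (use N1[OF n(2)] in auto)
        then show "(1 + (1 / 4) ^ n) ^ n - 1 \<le> real n powr (- c)" using N1[OF n(2)] by linarith
      qed simp
      finally show ?thesis unfolding inv .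
    qed
  qed
  moreover have "filterlim (\<lambda>n. real n powr c) at_top sequentially" using c by real_asymp
  ultimately show ?thesis using \<gamma>(1) \<delta>1
    by (intro exI[of _ \<gamma>] conjI exI[of _ "\<lambda>n. real n powr c"] exI[of _ \<delta>1]) auto
qed

end
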